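(* Let $\Bbbk$ be a field of characteristic zero, let $A$ be a noetherian Artin–Schelter (AS) regular domain over $\Bbbk$ generated in degree 1, let $G$ be a finite group coacting on $A$ inner faithfully as a dual reflection group, and let $H=\Bbbk^G$. Let $\{f_g\}_{g\in G}$, the mass element $m$, the covariant ring $A^{cov\,H}$ with graded Nakayama automorphism $\mu_{A^{cov\,H}}$, and the nonzero scalars $\beta(g)$ be as described in the context. (1) $f_m$ is a homogeneous normal element of $A$. (2) Let $\phi_m$ be the conjugation automorphism of $A$ defined by $a\mapsto f_m a f_m^{-1}$ for all $a\in A$. Then $\phi_m:f_g\mapsto\beta(g)f_{mgm^{-1}}$ for all $g\in G$. In other words, the graded Nakayama automorphism of the covariant ring $A^{cov\,H}$ is induced by the conjugation automorphism $\phi_m$. (3) Any $\mathbb{N}$-graded algebra automorphism of $A^{cov\,H}$ commutes with $\mu_{A^{cov\,H}}$. (4) The automorphism $\phi_m$ sends $A^H$ to $A^H$.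
   Context: All vector spaces and algebras are over $\Bbbk$. $A$ is connected graded if $A=\Bbbk\oplus A_1\oplus A_2\oplus\cdots$ with $A_iA_j\subseteq A_{i+j}$. A connected graded $A$ is AS Gorenstein if it has finite injective dimension $d$ on both sides, $\mathrm{Ext}^i_A({}_A\Bbbk,{}_AA)=\mathrm{Ext}^i_A(\Bbbk_A,A_A)=0$ for $i\ne d$, and $\mathrm{Ext}^d_A({}_A\Bbbk,{}_AA)\cong\mathrm{Ext}^d_A(\Bbbk_A,A_A)\cong\Bbbk(\mathfrak{l})$ for some integer $\mathfrak{l}$. It is AS regular if moreover it has finite global dimension and finite Gelfand–Kirillov dimension. $\Bbbk^G=\bigoplus_{g\in G}\Bbbk p_g$ is the Hopf algebra dual to $\Bbbk G$, with $p_gp_h=\delta_{g,h}p_g$, $1=\sum_gp_g$, $\Delta(p_g)=\sum_hp_h\otimes p_{h^{-1}g}$, $\epsilon(p_g)=\delta_{e,g}$, $e$ the unit of $G$. A homogeneous action of $\Bbbk^G$ on $A$ (equivalently a homogeneous $\Bbbk G$-coaction) is the same as a $G$-grading $A=\bigoplus_gA_g$ compatible with the $\mathbb{N}$-grading, with $A_g=p_g\cdot A$; the fixed subring is $A^{\Bbbk^G}=A_e$. It is inner faithful if no nonzero Hopf ideal of $\Bbbk^G$ annihilates $A$ (equivalently, $\{g:A_g\ne0\}$ generates $G$). $G$ coacts on $A$ as a dual reflection group if $\Bbbk^G$ acts homogeneously and inner faithfully on the noetherian AS regular domain $A$ generated in degree 1 and $A^{\Bbbk^G}$ is AS regular. Mass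 element $m$: with $d$ the injective dimension of $A$, the one-dimensional space $\mathrm{Ext}^d_A({}_A\Bbbk,A)$ (computed with $\mathbb{Z}\times G$-graded modules, a homomorphism $f:M\to N$ of left modules having $G$-degree $k$ if $f(M_h)\subseteq N_{hk}$ for all $h$) is spanned by a $G$-homogeneous element $u$; the homological codeterminant $D\in G$ satisfies $\deg_G(u)=D^{-1}$, and $m:=D^{-1}$. $\{f_g\mid g\in G\}\subseteq A$ is a set of homogeneous elements with $f_e=1$ and $A_g=f_gA^H=A^Hf_g$ for all $g$ (such elements exist in this setting). The covariant ring is $A^{cov\,H}=A/((A^H)_{\ge1})$, where $((A^H)_{\ge1})$ is the two-sided ideal generated by homogeneous elements of $A^H$ of positive degree; it is a Frobenius algebra with $\Bbbk$-basis the images $\overline{f}_g$ of the $f_g$. Here a finite-dimensional connected graded algebra $C$ is Frobenius if it has a nondegenerate associative bilinear form $\langle-,-\rangle$, graded of some degree; its unique graded Nakayama automorphism $\mu_C$ satisfies $\langle a,b\rangle=\langle\mu_C(b),a\rangle$ for all $a,b$. The nonzero scalars $\beta(g)$ are defined by $\mu_{A^{cov\,H}}(\overline{f}_g)=\beta(g)\overline{f}_{mgm^{-1}}$ for all $g\in G$ (the Nakayama automorphism of $A^{cov\,H}$ has this form). An element $x\in A$ is normal if $xA=Ax$; for a nonzero normal element $x$ of the domain $A$, $a\mapsto xax^{-1}$ denotes the automorphism sending $a$ to the unique $a'$ with $xa=a'x$. *)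

theory Defs
  imports "HOL-Algebra.Algebra" "HOL-Library.Extended_Real" "HOL-Library.Liminf_Limsup" Complex_Main
begin

section \<open>Algebras, modules and homomorphisms\<close>

definition char_zero :: "('k, 'z) ring_scheme \<Rightarrow> bool" where
  "char_zero K \<longleftrightarrow> (\<forall>n::nat. 0 < n \<longrightarrow> [n] \<cdot>\<^bsub>K\<^esub> \<one>\<^bsub>K\<^esub> \<noteq> \<zero>\<^bsub>K\<^esub>)"

text \<open>Associative unital, not necessarily commutative, algebras over a field (the library locale
  \<^locale>\<open>algebra\<close> is about commutative ones).\<close>

locale k_algebra = Module.module K A + K?: field K + A?: ring A
  for K :: "('k, 'y) ring_scheme" and A :: "('k, 'a, 'z) module_scheme" +
  assumes smult_mult_left: "\<lbrakk>c \<in> carrier K; x \<in> carrier A; y \<in> carrier A\<rbrakk>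
      \<Longrightarrow> (c \<odot>\<^bsub>A\<^esub> x) \<otimes>\<^bsub>A\<^esub> y = c \<odot>\<^bsub>A\<^esub> (x \<otimes>\<^bsub>A\<^esub> y)"
    and smult_mult_right: "\<lbrakk>c \<in> carrier K; x \<in> carrier A; y \<in> carrier A\<rbrakk>
      \<Longrightarrow> x \<otimes>\<^bsub>A\<^esub> (c \<odot>\<^bsub>A\<^esub> y) = c \<odot>\<^bsub>A\<^esub> (x \<otimes>\<^bsub>A\<^esub> y)"

text \<open>Modules over a noncommutative ring reuse the record \<open>module\<close>; its fields \<open>mult\<close> and \<open>one\<close> play
  no role for them. Right modules are left modules over the opposite ring. A submodule (in particular
  a left ideal, or a subspace) is \<^term>\<open>submodule W R M\<close>, a library notion that does not need
  commutativity.\<close>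

locale left_module = R?: ring R + M?: abelian_group M
  for R :: "('r, 'y) ring_scheme" and M :: "('r, 'm, 'z) module_scheme" +
  assumes lm_closed: "\<lbrakk>a \<in> carrier R; x \<in> carrier M\<rbrakk> \<Longrightarrow> a \<odot>\<^bsub>M\<^esub> x \<in> carrier M"
    and lm_add_left: "\<lbrakk>a \<in> carrier R; b \<in> carrier R; x \<in> carrier M\<rbrakk>
      \<Longrightarrow> (a \<oplus>\<^bsub>R\<^esub> b) \<odot>\<^bsub>M\<^esub> x = a \<odot>\<^bsub>M\<^esub> x \<oplus>\<^bsub>M\<^esub> b \<odot>\<^bsub>M\<^esub> x"
    and lm_add_right: "\<lbrakk>a \<in> carrier R; x \<in> carrier M; y \<in> carrier M\<rbrakk>
      \<Longrightarrow> a \<odot>\<^bsub>M\<^esub> (x \<oplus>\<^bsub>M\<^esub> y) = a \<odot>\<^bsub>M\<^esub> x \<oplus>\<^bsub>M\<^esub> a \<odot>\<^bsub>M\<^esub> y"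
    and lm_assoc: "\<lbrakk>a \<in> carrier R; b \<in> carrier R; x \<in> carrier M\<rbrakk>
      \<Longrightarrow> (a \<otimes>\<^bsub>R\<^esub> b) \<odot>\<^bsub>M\<^esub> x = a \<odot>\<^bsub>M\<^esub> (b \<odot>\<^bsub>M\<^esub> x)"
    and lm_one: "x \<in> carrier M \<Longrightarrow> \<one>\<^bsub>R\<^esub> \<odot>\<^bsub>M\<^esub> x = x"

definition opp :: "('a, 'z) ring_scheme \<Rightarrow> ('a, 'z) ring_scheme" where
  "opp A = A\<lparr>monoid.mult := (\<lambda>x y. y \<otimes>\<^bsub>A\<^esub> x)\<rparr>"

definition regular_module :: "('a, 'z) ring_scheme \<Rightarrow> ('a, 'a) module" where
  "regular_module A = \<lparr>carrier = carrier A, monoid.mult = monoid.mult A,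
     monoid.one = \<one>\<^bsub>A\<^esub>, ring.zero = \<zero>\<^bsub>A\<^esub>, ring.add = ring.add A,
     smult = monoid.mult A\<rparr>"

definition mod_hom :: "('r, 'y) ring_scheme \<Rightarrow> ('r, 'm, 'z) module_scheme
    \<Rightarrow> ('r, 'n, 'w) module_scheme \<Rightarrow> ('m \<Rightarrow> 'n) set" where
  "mod_hom R M N = {f \<in> carrier M \<rightarrow> carrier N.
     (\<forall>x\<in>carrier M. \<forall>y\<in>carrier M. f (x \<oplus>\<^bsub>M\<^esub> y) = f x \<oplus>\<^bsub>N\<^esub> f y) \<and>
     (\<forall>r\<in>carrier R. \<forall>x\<in>carrier M. f (r \<odot>\<^bsub>M\<^esub> x) = r \<odot>\<^bsub>N\<^esub> f x)}"

definition mod_isomorphic :: "('r, 'y) ring_scheme \<Rightarrow> ('r, 'm, 'z) module_scheme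
    \<Rightarrow> ('r, 'n, 'w) module_scheme \<Rightarrow> bool" where
  "mod_isomorphic R M N \<longleftrightarrow> (\<exists>f\<in>mod_hom R M N. bij_betw f (carrier M) (carrier N))"

text \<open>Quotient of a vector space by a subspace, or of an algebra by a two-sided ideal:
  \<open>FactRing\<close> with scalar multiplication added.\<close>

definition quotient :: "('k, 'a) module \<Rightarrow> 'a set \<Rightarrow> ('k, 'a set) module" where
  "quotient M W = \<lparr>carrier = carrier (M Quot W), monoid.mult = monoid.mult (M Quot W),
     monoid.one = \<one>\<^bsub>M Quot W\<^esub>, ring.zero = \<zero>\<^bsub>M Quot W\<^esub>, ring.add = ring.add (M Quot W),
     smult = (\<lambda>c U. \<Union>x\<in>U. W +>\<^bsub>M\<^esub> (c \<odot>\<^bsub>M\<^esub> x))\<rparr>"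

definition lin_span :: "('r, 'y) ring_scheme \<Rightarrow> ('r, 'm, 'z) module_scheme \<Rightarrow> 'm set \<Rightarrow> 'm set" where
  "lin_span R M S = \<Inter>{W. submodule W R M \<and> S \<subseteq> W}"

definition finite_dim :: "('k, 'y) ring_scheme \<Rightarrow> ('k, 'm, 'z) module_scheme \<Rightarrow> bool" where
  "finite_dim K M \<longleftrightarrow> (\<exists>S. finite S \<and> S \<subseteq> carrier M \<and> lin_span K M S = carrier M)"

definition dim_of :: "('k, 'y) ring_scheme \<Rightarrow> ('k, 'm, 'z) module_scheme \<Rightarrow> 'm set \<Rightarrow> nat" where
  "dim_of K M W = (LEAST n. \<exists>S\<subseteq>W. finite S \<and> card S = n \<and> lin_span K M S = W)"

definition is_domain :: "('a, 'z) ring_scheme \<Rightarrow> bool" where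
  "is_domain A \<longleftrightarrow> \<one>\<^bsub>A\<^esub> \<noteq> \<zero>\<^bsub>A\<^esub> \<and>
     (\<forall>x\<in>carrier A. \<forall>y\<in>carrier A. x \<otimes>\<^bsub>A\<^esub> y = \<zero>\<^bsub>A\<^esub> \<longrightarrow> x = \<zero>\<^bsub>A\<^esub> \<or> y = \<zero>\<^bsub>A\<^esub>)"

definition left_noetherian :: "('a, 'z) ring_scheme \<Rightarrow> bool" where
  "left_noetherian A \<longleftrightarrow> (\<forall>L. submodule L A (regular_module A) \<longrightarrow>
     (\<exists>S\<subseteq>L. finite S \<and> L = lin_span A (regular_module A) S))"

definition noetherian :: "('a, 'z) ring_scheme \<Rightarrow> bool" where
  "noetherian A \<longleftrightarrow> left_noetherian A \<and> left_noetherian (opp A)"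

section \<open>Gradings\<close>

definition direct_sum_decomp :: "('k, 'y) ring_scheme \<Rightarrow> ('k, 'm, 'z) module_scheme
    \<Rightarrow> ('i \<Rightarrow> 'm set) \<Rightarrow> bool" where
  "direct_sum_decomp K M V \<longleftrightarrow> (\<forall>i. submodule (V i) K M) \<and>
     (\<forall>x\<in>carrier M. \<exists>!c. (\<forall>i. c i \<in> V i) \<and> finite {i. c i \<noteq> \<zero>\<^bsub>M\<^esub>} \<and>
        x = (\<Oplus>\<^bsub>M\<^esub>i\<in>{i. c i \<noteq> \<zero>\<^bsub>M\<^esub>}. c i))"

definition component :: "('k, 'm, 'z) module_scheme \<Rightarrow> ('i \<Rightarrow> 'm set) \<Rightarrow> 'i \<Rightarrow> 'm \<Rightarrow> 'm" where
  "component M V i x = (THE c. (\<forall>i. c i \<in> V i) \<and> finite {i. c i \<noteq> \<zero>\<^bsub>M\<^esub>} \<and>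
        x = (\<Oplus>\<^bsub>M\<^esub>i\<in>{i. c i \<noteq> \<zero>\<^bsub>M\<^esub>}. c i)) i"

definition graded_algebra :: "('k, 'y) ring_scheme \<Rightarrow> ('k, 'a) module \<Rightarrow> (nat \<Rightarrow> 'a set) \<Rightarrow> bool" where
  "graded_algebra K A gr \<longleftrightarrow> k_algebra K A \<and> direct_sum_decomp K A gr \<and>
     (\<forall>i j. \<forall>x\<in>gr i. \<forall>y\<in>gr j. x \<otimes>\<^bsub>A\<^esub> y \<in> gr (i + j))"

definition connected_graded :: "('k, 'y) ring_scheme \<Rightarrow> ('k, 'a) module \<Rightarrow> (nat \<Rightarrow> 'a set) \<Rightarrow> bool" where
  "connected_graded K A gr \<longleftrightarrow> graded_algebra K A gr \<and> \<one>\<^bsub>A\<^esub> \<noteq> \<zero>\<^bsub>A\<^esub> \<and>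
     gr 0 = (\<lambda>c. c \<odot>\<^bsub>A\<^esub> \<one>\<^bsub>A\<^esub>) ` carrier K"

definition homogeneous :: "(nat \<Rightarrow> 'a set) \<Rightarrow> 'a \<Rightarrow> bool" where
  "homogeneous gr x \<longleftrightarrow> (\<exists>n. x \<in> gr n)"

definition generated_in_degree_1 ::
    "('k, 'y) ring_scheme \<Rightarrow> ('k, 'a) module \<Rightarrow> (nat \<Rightarrow> 'a set) \<Rightarrow> bool" where
  "generated_in_degree_1 K A gr \<longleftrightarrow>
     (\<forall>S. subring S A \<and> submodule S K A \<and> gr 1 \<subseteq> S \<longrightarrow> S = carrier A)"

definition algebra_auts :: "('k, 'y) ring_scheme \<Rightarrow> ('k, 'a) module \<Rightarrow> ('a \<Rightarrow> 'a) set" where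
  "algebra_auts K A = ring_iso A A \<inter> mod_hom K A A"

definition graded_auts ::
    "('k, 'y) ring_scheme \<Rightarrow> ('k, 'a) module \<Rightarrow> (nat \<Rightarrow> 'a set) \<Rightarrow> ('a \<Rightarrow> 'a) set" where
  "graded_auts K A gr = {s \<in> algebra_auts K A. \<forall>n. s ` gr n = gr n}"

section \<open>Homological dimensions and Gelfand--Kirillov dimension\<close>

text \<open>HOL cannot quantify over all modules at once. Projectivity, injectivity, resolutions and global
  dimension are taken in the category of modules whose carrier is a set of elements of type \<open>'a set\<close>,
  where \<open>'a\<close> is the type of elements of the ring. For infinite \<open>'a\<close> (which is the case for algebras
  over a field of characteristic 0) this represents all modules of cardinality at most
  \<open>2 ^ |'a|\<close>. It contains the regular module and all cyclic modules, which decide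
  injectivity (Baer) and the global dimension (Auslander), and it has enough projectives and enough
  injectives, so the resulting dimensions are the usual ones.\<close>

definition injective_module :: "('a, 'z) ring_scheme \<Rightarrow> ('a, 'a set) module \<Rightarrow> bool" where
  "injective_module A Q \<longleftrightarrow> left_module A Q \<and>
     (\<forall>(M :: ('a, 'a set) module) L f. left_module A M \<and> submodule L A M \<and>
        f \<in> mod_hom A (M\<lparr>carrier := L\<rparr>) Q \<longrightarrow> (\<exists>h\<in>mod_hom A M Q. \<forall>x\<in>L. h x = f x))"

definition projective_module :: "('a, 'z) ring_scheme \<Rightarrow> ('a, 'a set) module \<Rightarrow> bool" where
  "projective_module A P \<longleftrightarrow> left_module A P \<and>
     (\<forall>(M :: ('a, 'a set) module) (N :: ('a, 'a set) module) p f. left_module A M \<and> left_module A N \<and>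
        p \<in> mod_hom A M N \<and> p ` carrier M = carrier N \<and> f \<in> mod_hom A P N \<longrightarrow>
        (\<exists>h\<in>mod_hom A P M. \<forall>x\<in>carrier P. p (h x) = f x))"

text \<open>\<open>0 \<rightarrow> M \<rightarrow> Q 0 \<rightarrow> Q 1 \<rightarrow> \<dots>\<close>, respectively \<open>\<dots> \<rightarrow> P 1 \<rightarrow> P 0 \<rightarrow> M \<rightarrow> 0\<close>, with
  \<open>d i : Q i \<rightarrow> Q (i + 1)\<close>, respectively \<open>d i : P (i + 1) \<rightarrow> P i\<close>.\<close>

definition injective_resolution :: "('a, 'z) ring_scheme \<Rightarrow> ('a, 'm, 'w) module_scheme
    \<Rightarrow> (nat \<Rightarrow> ('a, 'a set) module) \<Rightarrow> ('m \<Rightarrow> 'a set) \<Rightarrow> (nat \<Rightarrow> 'a set \<Rightarrow> 'a set) \<Rightarrow> bool" where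
  "injective_resolution A M Q e d \<longleftrightarrow> (\<forall>i. injective_module A (Q i)) \<and>
     e \<in> mod_hom A M (Q 0) \<and> inj_on e (carrier M) \<and>
     (\<forall>i. d i \<in> mod_hom A (Q i) (Q (Suc i))) \<and>
     e ` carrier M = {x \<in> carrier (Q 0). d 0 x = \<zero>\<^bsub>Q 1\<^esub>} \<and>
     (\<forall>i. d i ` carrier (Q i) = {x \<in> carrier (Q (Suc i)). d (Suc i) x = \<zero>\<^bsub>Q (Suc (Suc i))\<^esub>})"

definition projective_resolution :: "('a, 'z) ring_scheme \<Rightarrow> ('a, 'm, 'w) module_scheme
    \<Rightarrow> (nat \<Rightarrow> ('a, 'a set) module) \<Rightarrow> ('a set \<Rightarrow> 'm) \<Rightarrow> (nat \<Rightarrow> 'a set \<Rightarrow> 'a set) \<Rightarrow> bool" where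
  "projective_resolution A M P e d \<longleftrightarrow> (\<forall>i. projective_module A (P i)) \<and>
     e \<in> mod_hom A (P 0) M \<and> e ` carrier (P 0) = carrier M \<and>
     (\<forall>i. d i \<in> mod_hom A (P (Suc i)) (P i)) \<and>
     d 0 ` carrier (P 1) = {x \<in> carrier (P 0). e x = \<zero>\<^bsub>M\<^esub>} \<and>
     (\<forall>i. d (Suc i) ` carrier (P (Suc (Suc i))) = {x \<in> carrier (P (Suc i)). d i x = \<zero>\<^bsub>P i\<^esub>})"

definition inj_dim_le :: "('a, 'z) ring_scheme \<Rightarrow> ('a, 'm, 'w) module_scheme \<Rightarrow> nat \<Rightarrow> bool" where
  "inj_dim_le A M n \<longleftrightarrow> (\<exists>Q e d. injective_resolution A M Q e d \<and>
     (\<forall>i>n. carrier (Q i) = {\<zero>\<^bsub>Q i\<^esub>}))"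

definition proj_dim_le :: "('a, 'z) ring_scheme \<Rightarrow> ('a, 'm, 'w) module_scheme \<Rightarrow> nat \<Rightarrow> bool" where
  "proj_dim_le A M n \<longleftrightarrow> (\<exists>P e d. projective_resolution A M P e d \<and>
     (\<forall>i>n. carrier (P i) = {\<zero>\<^bsub>P i\<^esub>}))"

definition has_inj_dim :: "('a, 'z) ring_scheme \<Rightarrow> ('a, 'm, 'w) module_scheme \<Rightarrow> nat \<Rightarrow> bool" where
  "has_inj_dim A M d \<longleftrightarrow> inj_dim_le A M d \<and> (\<forall>n<d. \<not> inj_dim_le A M n)"

definition finite_left_global_dim :: "('a, 'z) ring_scheme \<Rightarrow> bool" where
  "finite_left_global_dim A \<longleftrightarrow>
     (\<exists>n. \<forall>M :: ('a, 'a set) module. left_module A M \<longrightarrow> proj_dim_le A M n)"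

definition finite_global_dim :: "('a, 'z) ring_scheme \<Rightarrow> bool" where
  "finite_global_dim A \<longleftrightarrow> finite_left_global_dim A \<and> finite_left_global_dim (opp A)"

text \<open>\<open>dim (V\<^sup>0 + V\<^sup>1 + \<dots> + V\<^sup>n)\<close> for the subspace \<open>V\<close> spanned by \<open>S\<close>.\<close>

definition growth :: "('k, 'y) ring_scheme \<Rightarrow> ('k, 'a) module \<Rightarrow> 'a set \<Rightarrow> nat \<Rightarrow> nat" where
  "growth K A S n = dim_of K A (lin_span K A
     {foldr (monoid.mult A) xs \<one>\<^bsub>A\<^esub> | xs. set xs \<subseteq> S \<and> length xs \<le> n})"

definition GK_dim :: "('k, 'y) ring_scheme \<Rightarrow> ('k, 'a) module \<Rightarrow> ereal" where
  "GK_dim K A = (SUP S\<in>{S. finite S \<and> S \<subseteq> carrier A}.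
     limsup (\<lambda>n. ereal (log (real n) (real (growth K A S n)))))"

section \<open>Graded Ext\<close>

text \<open>\<open>Ext\<^sub>A(M, N)\<close> is computed by the bar resolution \<open>A \<otimes> A\<^sup>\<otimes>\<^sup>n \<otimes> M\<close> (tensors over the field
  \<open>K\<close>), a free resolution of the left \<open>A\<close>-module \<open>M\<close>. An \<open>A\<close>-linear map from its \<open>n\<close>-th term to \<open>N\<close>
  is the same as a \<open>K\<close>-multilinear map \<open>A\<^sup>n \<times> M \<rightarrow> N\<close>; these are the cochains below. \<open>K\<close> acts on
  modules through \<open>c \<mapsto> c 1\<^sub>A\<close>.

  Gradings are indexed by a group \<open>\<Gamma>\<close>, below \<open>\<int>\<close> or \<open>\<int> \<times> G\<close>. A homomorphism \<open>h : M \<rightarrow> N\<close> of left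
  modules has degree \<open>\<gamma>\<close> if \<open>h(M\<^sub>\<delta>) \<subseteq> N\<^bsub>\<delta>\<gamma>\<^esub>\<close>, so a cochain \<open>\<phi>\<close> has degree \<open>\<gamma>\<close> if
  \<open>\<phi>(a\<^sub>1, \<dots>, a\<^sub>n, x)\<close> has degree \<open>deg a\<^sub>1 \<cdots> deg a\<^sub>n deg x \<gamma>\<close>.\<close>

abbreviation (input) k_act ::
    "('k, 'a) module \<Rightarrow> ('a, 'n) module \<Rightarrow> 'k \<Rightarrow> 'n \<Rightarrow> 'n" where
  "k_act A N c y \<equiv> (c \<odot>\<^bsub>A\<^esub> \<one>\<^bsub>A\<^esub>) \<odot>\<^bsub>N\<^esub> y"

definition cochain_dom :: "('k, 'a) module \<Rightarrow> ('a, 'm) module \<Rightarrow> nat \<Rightarrow> ('a list \<times> 'm) set" where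
  "cochain_dom A M n = {as. length as = n \<and> set as \<subseteq> carrier A} \<times> carrier M"

definition multilinear_cochain :: "('k, 'y) ring_scheme \<Rightarrow> ('k, 'a) module \<Rightarrow> ('a, 'm) module
    \<Rightarrow> ('a, 'n) module \<Rightarrow> nat \<Rightarrow> ('a list \<times> 'm \<Rightarrow> 'n) \<Rightarrow> bool" where
  "multilinear_cochain K A M N n \<phi> \<longleftrightarrow> \<phi> \<in> cochain_dom A M n \<rightarrow>\<^sub>E carrier N \<and>
     (\<forall>(as, x)\<in>cochain_dom A M n.
       (\<forall>i<n. \<forall>b\<in>carrier A.
          \<phi> (as[i := as ! i \<oplus>\<^bsub>A\<^esub> b], x) = \<phi> (as, x) \<oplus>\<^bsub>N\<^esub> \<phi> (as[i := b], x)) \<and>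
       (\<forall>i<n. \<forall>c\<in>carrier K. \<phi> (as[i := c \<odot>\<^bsub>A\<^esub> as ! i], x) = k_act A N c (\<phi> (as, x))) \<and>
       (\<forall>y\<in>carrier M. \<phi> (as, x \<oplus>\<^bsub>M\<^esub> y) = \<phi> (as, x) \<oplus>\<^bsub>N\<^esub> \<phi> (as, y)) \<and>
       (\<forall>c\<in>carrier K. \<phi> (as, k_act A M c x) = k_act A N c (\<phi> (as, x))))"

definition cochain_degree :: "'d monoid \<Rightarrow> ('d \<Rightarrow> 'a set) \<Rightarrow> ('d \<Rightarrow> 'm set) \<Rightarrow> ('d \<Rightarrow> 'n set)
    \<Rightarrow> nat \<Rightarrow> 'd \<Rightarrow> ('a list \<times> 'm \<Rightarrow> 'n) \<Rightarrow> bool" where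
  "cochain_degree \<Gamma> grA grM grN n \<gamma> \<phi> \<longleftrightarrow>
     (\<forall>as \<gamma>s x \<delta>. length as = n \<and> set \<gamma>s \<subseteq> carrier \<Gamma> \<and> \<delta> \<in> carrier \<Gamma> \<and>
        list_all2 (\<lambda>a \<alpha>. a \<in> grA \<alpha>) as \<gamma>s \<and> x \<in> grM \<delta> \<longrightarrow>
        \<phi> (as, x) \<in> grN (foldr (monoid.mult \<Gamma>) \<gamma>s \<delta> \<otimes>\<^bsub>\<Gamma>\<^esub> \<gamma>))"

text \<open>The space of cochains of degree \<open>\<gamma>\<close>; \<open>mult\<close> and \<open>one\<close> are dummies.\<close>

definition cochains :: "('k, 'y) ring_scheme \<Rightarrow> 'd monoid \<Rightarrow> ('k, 'a) module \<Rightarrow> ('d \<Rightarrow> 'a set)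
    \<Rightarrow> ('a, 'm) module \<Rightarrow> ('d \<Rightarrow> 'm set) \<Rightarrow> ('a, 'n) module \<Rightarrow> ('d \<Rightarrow> 'n set)
    \<Rightarrow> nat \<Rightarrow> 'd \<Rightarrow> ('k, 'a list \<times> 'm \<Rightarrow> 'n) module" where
  "cochains K \<Gamma> A grA M grM N grN n \<gamma> =
     \<lparr>carrier = {\<phi>. multilinear_cochain K A M N n \<phi> \<and> cochain_degree \<Gamma> grA grM grN n \<gamma> \<phi>},
      monoid.mult = (\<lambda>\<phi> \<psi>. undefined), monoid.one = undefined,
      ring.zero = (\<lambda>p\<in>cochain_dom A M n. \<zero>\<^bsub>N\<^esub>),
      ring.add = (\<lambda>\<phi> \<psi>. \<lambda>p\<in>cochain_dom A M n. \<phi> p \<oplus>\<^bsub>N\<^esub> \<psi> p),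
      smult = (\<lambda>c \<phi>. \<lambda>p\<in>cochain_dom A M n. k_act A N c (\<phi> p))\<rparr>"

definition signed :: "('a, 'n) module \<Rightarrow> nat \<Rightarrow> 'n \<Rightarrow> 'n" where
  "signed N i y = (if even i then y else \<ominus>\<^bsub>N\<^esub> y)"

text \<open>\<open>(\<delta>\<phi>)(a\<^sub>0, \<dots>, a\<^sub>n, x) = a\<^sub>0 \<phi>(a\<^sub>1, \<dots>, a\<^sub>n, x)
  + \<Sum>\<^sub>i (-1)\<^sup>i\<^sup>+\<^sup>1 \<phi>(a\<^sub>0, \<dots>, a\<^sub>i a\<^sub>i\<^sub>+\<^sub>1, \<dots>, a\<^sub>n, x) + (-1)\<^sup>n\<^sup>+\<^sup>1 \<phi>(a\<^sub>0, \<dots>, a\<^sub>n\<^sub>-\<^sub>1, a\<^sub>n x)\<close>\<close>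

definition bar_diff :: "('k, 'a) module \<Rightarrow> ('a, 'm) module \<Rightarrow> ('a, 'n) module \<Rightarrow> nat
    \<Rightarrow> ('a list \<times> 'm \<Rightarrow> 'n) \<Rightarrow> 'a list \<times> 'm \<Rightarrow> 'n" where
  "bar_diff A M N n \<phi> = (\<lambda>(as, x)\<in>cochain_dom A M (Suc n).
     hd as \<odot>\<^bsub>N\<^esub> \<phi> (tl as, x)
     \<oplus>\<^bsub>N\<^esub> (\<Oplus>\<^bsub>N\<^esub>i\<in>{..<n}. signed N (Suc i)
            (\<phi> (take i as @ (as ! i \<otimes>\<^bsub>A\<^esub> as ! Suc i) # drop (Suc (Suc i)) as, x)))
     \<oplus>\<^bsub>N\<^esub> signed N (Suc n) (\<phi> (butlast as, last as \<odot>\<^bsub>M\<^esub> x)))"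

text \<open>The degree \<open>\<gamma>\<close> component of the graded vector space \<open>Ext\<^sup>n\<^sub>A(M, N)\<close>: cocycles modulo
  coboundaries.\<close>

definition Ext :: "('k, 'y) ring_scheme \<Rightarrow> 'd monoid \<Rightarrow> ('k, 'a) module \<Rightarrow> ('d \<Rightarrow> 'a set)
    \<Rightarrow> ('a, 'm) module \<Rightarrow> ('d \<Rightarrow> 'm set) \<Rightarrow> ('a, 'n) module \<Rightarrow> ('d \<Rightarrow> 'n set)
    \<Rightarrow> nat \<Rightarrow> 'd \<Rightarrow> ('k, ('a list \<times> 'm \<Rightarrow> 'n) set) module" where
  "Ext K \<Gamma> A grA M grM N grN n \<gamma> =
     (let C = (\<lambda>i. cochains K \<Gamma> A grA M grM N grN i \<gamma>);
          Z = {\<phi> \<in> carrier (C n). bar_diff A M N n \<phi> = \<zero>\<^bsub>C (Suc n)\<^esub>};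
          B = (case n of 0 \<Rightarrow> {\<zero>\<^bsub>C 0\<^esub>} | Suc i \<Rightarrow> bar_diff A M N i ` carrier (C i))
      in quotient ((C n)\<lparr>carrier := Z\<rparr>) B)"

text \<open>The trivial module \<open>K = A / A\<^sub>\<ge>\<^sub>1\<close> of a connected graded algebra, concentrated in the neutral
  degree.\<close>

definition augmentation ::
    "('k, 'y) ring_scheme \<Rightarrow> ('k, 'a) module \<Rightarrow> (nat \<Rightarrow> 'a set) \<Rightarrow> 'a \<Rightarrow> 'k" where
  "augmentation K A gr a = (THE c. c \<in> carrier K \<and> component A gr 0 a = c \<odot>\<^bsub>A\<^esub> \<one>\<^bsub>A\<^esub>)"

definition trivial_module ::
    "('k, 'y) ring_scheme \<Rightarrow> ('k, 'a) module \<Rightarrow> (nat \<Rightarrow> 'a set) \<Rightarrow> ('a, 'k) module" where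
  "trivial_module K A gr = \<lparr>carrier = carrier K, monoid.mult = monoid.mult K,
     monoid.one = \<one>\<^bsub>K\<^esub>, ring.zero = \<zero>\<^bsub>K\<^esub>,
     ring.add = ring.add K, smult = (\<lambda>a c. augmentation K A gr a \<otimes>\<^bsub>K\<^esub> c)\<rparr>"

definition trivial_grading :: "('k, 'y) ring_scheme \<Rightarrow> 'd monoid \<Rightarrow> 'd \<Rightarrow> 'k set" where
  "trivial_grading K \<Gamma> \<gamma> = (if \<gamma> = \<one>\<^bsub>\<Gamma>\<^esub> then carrier K else {\<zero>\<^bsub>K\<^esub>})"

text \<open>\<open>Ext\<^sup>n\<^sub>A(K, A)\<close> in degree \<open>\<gamma>\<close>, for a connected graded algebra whose \<open>\<nat>\<close>-grading \<open>gr\<close> is refined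
  to the \<open>\<Gamma>\<close>-grading \<open>grA\<close>.\<close>

definition Ext_triv_reg :: "('k, 'y) ring_scheme \<Rightarrow> 'd monoid \<Rightarrow> ('k, 'a) module \<Rightarrow> (nat \<Rightarrow> 'a set)
    \<Rightarrow> ('d \<Rightarrow> 'a set) \<Rightarrow> nat \<Rightarrow> 'd \<Rightarrow> ('k, ('a list \<times> 'k \<Rightarrow> 'a) set) module" where
  "Ext_triv_reg K \<Gamma> A gr grA n \<gamma> =
     Ext K \<Gamma> A grA (trivial_module K A gr) (trivial_grading K \<Gamma>) (regular_module A) grA n \<gamma>"

definition int_grading :: "('k, 'a) module \<Rightarrow> (nat \<Rightarrow> 'a set) \<Rightarrow> int \<Rightarrow> 'a set" where
  "int_grading A gr j = (if 0 \<le> j then gr (nat j) else {\<zero>\<^bsub>A\<^esub>})"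

section \<open>AS Gorenstein and AS regular algebras\<close>

text \<open>\<open>k(l)\<close> is \<open>K\<close> in degree \<open>-l\<close>. A one-dimensional graded module over a connected graded algebra is
  determined up to isomorphism by its degree, so \<open>Ext\<^sup>d \<cong> k(l)\<close> is expressed as an isomorphism of
  graded vector spaces.\<close>

definition one_sided_Gorenstein ::
    "('k, 'y) ring_scheme \<Rightarrow> ('k, 'a) module \<Rightarrow> (nat \<Rightarrow> 'a set) \<Rightarrow> nat \<Rightarrow> int \<Rightarrow> bool" where
  "one_sided_Gorenstein K A gr d l \<longleftrightarrow>
     has_inj_dim A (regular_module A) d \<and>
     (let E = Ext_triv_reg K integer_group A gr (int_grading A gr)
      in (\<forall>i j. i \<noteq> d \<longrightarrow> carrier (E i j) = {\<zero>\<^bsub>E i j\<^esub>}) \<and>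
         (\<forall>j. j \<noteq> - l \<longrightarrow> carrier (E d j) = {\<zero>\<^bsub>E d j\<^esub>}) \<and>
         mod_isomorphic K (E d (- l)) (regular_module K))"

definition AS_Gorenstein :: "('k, 'y) ring_scheme \<Rightarrow> ('k, 'a) module \<Rightarrow> (nat \<Rightarrow> 'a set) \<Rightarrow> bool" where
  "AS_Gorenstein K A gr \<longleftrightarrow> connected_graded K A gr \<and>
     (\<exists>d l. one_sided_Gorenstein K A gr d l \<and> one_sided_Gorenstein K (opp A) gr d l)"

definition AS_regular :: "('k, 'y) ring_scheme \<Rightarrow> ('k, 'a) module \<Rightarrow> (nat \<Rightarrow> 'a set) \<Rightarrow> bool" where
  "AS_regular K A gr \<longleftrightarrow> AS_Gorenstein K A gr \<and> finite_global_dim A \<and> GK_dim K A < \<infinity>"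

section \<open>Actions of the dual of a group algebra\<close>

text \<open>The dual Hopf algebra of \<open>K G\<close> as the algebra of functions \<open>G \<rightarrow> K\<close>. In terms of functions,
  \<open>\<Delta>(\<phi>)(x, y) = \<phi>(x y)\<close> (a function on \<open>G \<times> G\<close>), \<open>\<epsilon>(\<phi>) = \<phi>(e)\<close> and \<open>S(\<phi>)(x) = \<phi>(x\<^sup>-\<^sup>1)\<close>; on the
  basis \<open>p\<^sub>g\<close> this reads \<open>\<Delta>(p\<^sub>g) = \<Sum>\<^sub>h p\<^sub>h \<otimes> p\<close>\<open>\<^bsub>h\<^sup>-\<^sup>1g\<^esub>\<close>, \<open>\<epsilon>(p\<^sub>g) = \<delta>\<^bsub>e,g\<^esub>\<close>.\<close>

definition dual_alg :: "('k, 'y) ring_scheme \<Rightarrow> 'g monoid \<Rightarrow> ('k, 'g \<Rightarrow> 'k) module" where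
  "dual_alg K G = \<lparr>carrier = carrier G \<rightarrow>\<^sub>E carrier K,
     monoid.mult = (\<lambda>\<phi> \<psi>. \<lambda>x\<in>carrier G. \<phi> x \<otimes>\<^bsub>K\<^esub> \<psi> x),
     monoid.one = (\<lambda>x\<in>carrier G. \<one>\<^bsub>K\<^esub>),
     ring.zero = (\<lambda>x\<in>carrier G. \<zero>\<^bsub>K\<^esub>),
     ring.add = (\<lambda>\<phi> \<psi>. \<lambda>x\<in>carrier G. \<phi> x \<oplus>\<^bsub>K\<^esub> \<psi> x),
     smult = (\<lambda>c \<phi>. \<lambda>x\<in>carrier G. c \<otimes>\<^bsub>K\<^esub> \<phi> x)\<rparr>"

definition idem :: "('k, 'y) ring_scheme \<Rightarrow> 'g monoid \<Rightarrow> 'g \<Rightarrow> 'g \<Rightarrow> 'k" where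
  "idem K G g = (\<lambda>x\<in>carrier G. if x = g then \<one>\<^bsub>K\<^esub> else \<zero>\<^bsub>K\<^esub>)"

text \<open>For a subspace \<open>I\<close> of \<open>H = K\<^sup>G\<close>, the subspace \<open>I \<otimes> H\<close> of \<open>H \<otimes> H\<close> consists of the functions \<open>F\<close> on
  \<open>G \<times> G\<close> with \<open>F(-, y) \<in> I\<close> for all \<open>y\<close>; similarly for \<open>H \<otimes> I\<close>. The first condition after
  \<open>ideal\<close> is thus \<open>\<Delta>(I) \<subseteq> I \<otimes> H + H \<otimes> I\<close>.\<close>

definition hopf_ideal :: "('k, 'y) ring_scheme \<Rightarrow> 'g monoid \<Rightarrow> ('g \<Rightarrow> 'k) set \<Rightarrow> bool" where
  "hopf_ideal K G I \<longleftrightarrow> ideal I (dual_alg K G) \<and>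
     (\<forall>\<phi>\<in>I. \<exists>F F'. (\<forall>y\<in>carrier G. (\<lambda>x\<in>carrier G. F x y) \<in> I) \<and>
        (\<forall>x\<in>carrier G. (\<lambda>y\<in>carrier G. F' x y) \<in> I) \<and>
        (\<forall>x\<in>carrier G. \<forall>y\<in>carrier G. \<phi> (x \<otimes>\<^bsub>G\<^esub> y) = F x y \<oplus>\<^bsub>K\<^esub> F' x y)) \<and>
     (\<forall>\<phi>\<in>I. \<phi> \<one>\<^bsub>G\<^esub> = \<zero>\<^bsub>K\<^esub>) \<and>
     (\<forall>\<phi>\<in>I. (\<lambda>x\<in>carrier G. \<phi> (inv\<^bsub>G\<^esub> x)) \<in> I)"

text \<open>A Hopf action (module algebra structure) preserving the \<open>\<nat>\<close>-grading.\<close>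

definition homogeneous_action :: "('k, 'y) ring_scheme \<Rightarrow> 'g monoid \<Rightarrow> ('k, 'a) module
    \<Rightarrow> (nat \<Rightarrow> 'a set) \<Rightarrow> (('g \<Rightarrow> 'k) \<Rightarrow> 'a \<Rightarrow> 'a) \<Rightarrow> bool" where
  "homogeneous_action K G A gr \<rho> \<longleftrightarrow>
     (let H = dual_alg K G in
       (\<forall>\<phi>\<in>carrier H. \<rho> \<phi> \<in> mod_hom K A A) \<and>
       (\<forall>a\<in>carrier A. (\<lambda>\<phi>. \<rho> \<phi> a) \<in> mod_hom K H A) \<and>
       (\<forall>a\<in>carrier A. \<rho> \<one>\<^bsub>H\<^esub> a = a) \<and>
       (\<forall>\<phi>\<in>carrier H. \<forall>\<psi>\<in>carrier H. \<forall>a\<in>carrier A. \<rho> (\<phi> \<otimes>\<^bsub>H\<^esub> \<psi>) a = \<rho> \<phi> (\<rho> \<psi> a)) \<and>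
       (\<forall>g\<in>carrier G. \<forall>a\<in>carrier A. \<forall>b\<in>carrier A.
          \<rho> (idem K G g) (a \<otimes>\<^bsub>A\<^esub> b) =
          (\<Oplus>\<^bsub>A\<^esub>h\<in>carrier G. \<rho> (idem K G h) a \<otimes>\<^bsub>A\<^esub> \<rho> (idem K G (inv\<^bsub>G\<^esub> h \<otimes>\<^bsub>G\<^esub> g)) b)) \<and>
       (\<forall>\<phi>\<in>carrier H. \<rho> \<phi> \<one>\<^bsub>A\<^esub> = \<phi> \<one>\<^bsub>G\<^esub> \<odot>\<^bsub>A\<^esub> \<one>\<^bsub>A\<^esub>) \<and>
       (\<forall>\<phi>\<in>carrier H. \<forall>n. \<rho> \<phi> ` gr n \<subseteq> gr n))"

definition inner_faithful :: "('k, 'y) ring_scheme \<Rightarrow> 'g monoid \<Rightarrow> ('k, 'a) module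
    \<Rightarrow> (('g \<Rightarrow> 'k) \<Rightarrow> 'a \<Rightarrow> 'a) \<Rightarrow> bool" where
  "inner_faithful K G A \<rho> \<longleftrightarrow>
     (\<forall>I. hopf_ideal K G I \<and> (\<forall>\<phi>\<in>I. \<forall>a\<in>carrier A. \<rho> \<phi> a = \<zero>\<^bsub>A\<^esub>) \<longrightarrow> I = {\<zero>\<^bsub>dual_alg K G\<^esub>})"

definition G_component :: "('k, 'y) ring_scheme \<Rightarrow> 'g monoid \<Rightarrow> ('k, 'a) module
    \<Rightarrow> (('g \<Rightarrow> 'k) \<Rightarrow> 'a \<Rightarrow> 'a) \<Rightarrow> 'g \<Rightarrow> 'a set" where
  "G_component K G A \<rho> g = \<rho> (idem K G g) ` carrier A"

definition fixed_set :: "('k, 'y) ring_scheme \<Rightarrow> 'g monoid \<Rightarrow> ('k, 'a) module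
    \<Rightarrow> (('g \<Rightarrow> 'k) \<Rightarrow> 'a \<Rightarrow> 'a) \<Rightarrow> 'a set" where
  "fixed_set K G A \<rho> =
     {a \<in> carrier A. \<forall>\<phi>\<in>carrier (dual_alg K G). \<rho> \<phi> a = \<phi> \<one>\<^bsub>G\<^esub> \<odot>\<^bsub>A\<^esub> a}"

definition fixed_ring :: "('k, 'y) ring_scheme \<Rightarrow> 'g monoid \<Rightarrow> ('k, 'a) module
    \<Rightarrow> (('g \<Rightarrow> 'k) \<Rightarrow> 'a \<Rightarrow> 'a) \<Rightarrow> ('k, 'a) module" where
  "fixed_ring K G A \<rho> = A\<lparr>carrier := fixed_set K G A \<rho>\<rparr>"

definition dual_reflection_group :: "('k, 'y) ring_scheme \<Rightarrow> 'g monoid \<Rightarrow> ('k, 'a) module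
    \<Rightarrow> (nat \<Rightarrow> 'a set) \<Rightarrow> (('g \<Rightarrow> 'k) \<Rightarrow> 'a \<Rightarrow> 'a) \<Rightarrow> bool" where
  "dual_reflection_group K G A gr \<rho> \<longleftrightarrow>
     noetherian A \<and> AS_regular K A gr \<and> is_domain A \<and> generated_in_degree_1 K A gr \<and>
     homogeneous_action K G A gr \<rho> \<and> inner_faithful K G A \<rho> \<and>
     AS_regular K (fixed_ring K G A \<rho>) (\<lambda>n. gr n \<inter> fixed_set K G A \<rho>)"

text \<open>The one-dimensional space \<open>Ext\<^sup>d\<^sub>A(K, A)\<close> is concentrated in a single degree
  \<open>(j, D\<^sup>-\<^sup>1)\<close> of \<open>\<int> \<times> G\<close>.\<close>

definition homological_codeterminant :: "('k, 'y) ring_scheme \<Rightarrow> 'g monoid \<Rightarrow> ('k, 'a) module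
    \<Rightarrow> (nat \<Rightarrow> 'a set) \<Rightarrow> (('g \<Rightarrow> 'k) \<Rightarrow> 'a \<Rightarrow> 'a) \<Rightarrow> 'g \<Rightarrow> bool" where
  "homological_codeterminant K G A gr \<rho> D \<longleftrightarrow> D \<in> carrier G \<and>
     (\<exists>d j u. has_inj_dim A (regular_module A) d \<and>
       (let E = Ext_triv_reg K (integer_group \<times>\<times> G) A gr
                  (\<lambda>(i, g). int_grading A gr i \<inter> G_component K G A \<rho> g) d (j, inv\<^bsub>G\<^esub> D)
        in u \<in> carrier E \<and> u \<noteq> \<zero>\<^bsub>E\<^esub>))"

definition covariant_ideal :: "('k, 'y) ring_scheme \<Rightarrow> 'g monoid \<Rightarrow> ('k, 'a) module
    \<Rightarrow> (nat \<Rightarrow> 'a set) \<Rightarrow> (('g \<Rightarrow> 'k) \<Rightarrow> 'a \<Rightarrow> 'a) \<Rightarrow> 'a set" where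
  "covariant_ideal K G A gr \<rho> = Idl\<^bsub>A\<^esub> (\<Union>n\<in>{1..}. gr n \<inter> fixed_set K G A \<rho>)"

definition covariant_ring :: "('k, 'y) ring_scheme \<Rightarrow> 'g monoid \<Rightarrow> ('k, 'a) module
    \<Rightarrow> (nat \<Rightarrow> 'a set) \<Rightarrow> (('g \<Rightarrow> 'k) \<Rightarrow> 'a \<Rightarrow> 'a) \<Rightarrow> ('k, 'a set) module" where
  "covariant_ring K G A gr \<rho> = quotient A (covariant_ideal K G A gr \<rho>)"

definition to_covariant :: "('k, 'y) ring_scheme \<Rightarrow> 'g monoid \<Rightarrow> ('k, 'a) module
    \<Rightarrow> (nat \<Rightarrow> 'a set) \<Rightarrow> (('g \<Rightarrow> 'k) \<Rightarrow> 'a \<Rightarrow> 'a) \<Rightarrow> 'a \<Rightarrow> 'a set" where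
  "to_covariant K G A gr \<rho> a = covariant_ideal K G A gr \<rho> +>\<^bsub>A\<^esub> a"

definition covariant_grading :: "('k, 'y) ring_scheme \<Rightarrow> 'g monoid \<Rightarrow> ('k, 'a) module
    \<Rightarrow> (nat \<Rightarrow> 'a set) \<Rightarrow> (('g \<Rightarrow> 'k) \<Rightarrow> 'a \<Rightarrow> 'a) \<Rightarrow> nat \<Rightarrow> 'a set set" where
  "covariant_grading K G A gr \<rho> n = to_covariant K G A gr \<rho> ` gr n"

section \<open>Frobenius algebras, normal elements\<close>

definition frobenius_form :: "('k, 'y) ring_scheme \<Rightarrow> ('k, 'c) module \<Rightarrow> (nat \<Rightarrow> 'c set)
    \<Rightarrow> ('c \<Rightarrow> 'c \<Rightarrow> 'k) \<Rightarrow> bool" where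
  "frobenius_form K C gr B \<longleftrightarrow>
     (\<forall>a\<in>carrier C. B a \<in> mod_hom K C (regular_module K)) \<and>
     (\<forall>b\<in>carrier C. (\<lambda>a. B a b) \<in> mod_hom K C (regular_module K)) \<and>
     (\<forall>a\<in>carrier C. \<forall>b\<in>carrier C. \<forall>c\<in>carrier C. B (a \<otimes>\<^bsub>C\<^esub> b) c = B a (b \<otimes>\<^bsub>C\<^esub> c)) \<and>
     (\<forall>a\<in>carrier C. (\<forall>b\<in>carrier C. B a b = \<zero>\<^bsub>K\<^esub>) \<longrightarrow> a = \<zero>\<^bsub>C\<^esub>) \<and>
     (\<forall>b\<in>carrier C. (\<forall>a\<in>carrier C. B a b = \<zero>\<^bsub>K\<^esub>) \<longrightarrow> b = \<zero>\<^bsub>C\<^esub>) \<and>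
     (\<exists>l::int. \<forall>i j. int i + int j \<noteq> l \<longrightarrow> (\<forall>a\<in>gr i. \<forall>b\<in>gr j. B a b = \<zero>\<^bsub>K\<^esub>))"

definition graded_nakayama :: "('k, 'y) ring_scheme \<Rightarrow> ('k, 'c) module \<Rightarrow> (nat \<Rightarrow> 'c set)
    \<Rightarrow> ('c \<Rightarrow> 'c) \<Rightarrow> bool" where
  "graded_nakayama K C gr \<mu> \<longleftrightarrow> connected_graded K C gr \<and> finite_dim K C \<and>
     \<mu> \<in> graded_auts K C gr \<and>
     (\<exists>B. frobenius_form K C gr B \<and> (\<forall>a\<in>carrier C. \<forall>b\<in>carrier C. B a b = B (\<mu> b) a))"

definition normal_element :: "('a, 'z) ring_scheme \<Rightarrow> 'a \<Rightarrow> bool" where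
  "normal_element A x \<longleftrightarrow> x \<in> carrier A \<and>
     (\<lambda>a. x \<otimes>\<^bsub>A\<^esub> a) ` carrier A = (\<lambda>a. a \<otimes>\<^bsub>A\<^esub> x) ` carrier A"

text \<open>\<open>a \<mapsto> x a x\<^sup>-\<^sup>1\<close> for a nonzero normal element \<open>x\<close> of a domain.\<close>

definition conj_by :: "('a, 'z) ring_scheme \<Rightarrow> 'a \<Rightarrow> 'a \<Rightarrow> 'a" where
  "conj_by A x a = (THE a'. a' \<in> carrier A \<and> x \<otimes>\<^bsub>A\<^esub> a = a' \<otimes>\<^bsub>A\<^esub> x)"

end

theory Submission
  imports Defs
begin

text \<open>
  Write \<open>R = A\<^sup>H\<close> and let \<open>C\<close> be the covariant ring. As \<open>A\<^sub>g = f\<^sub>g R = R f\<^sub>g\<close> and \<open>A\<close> is a domain,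
  \<open>A\<close> is free over \<open>R\<close> on both sides with basis \<open>f\<close>, and \<open>f\<^sub>g f\<^sub>h\<close> is \<open>f\<close> of \<open>g h\<close> times an element
  of \<open>R\<close>. In \<open>C\<close> this element becomes a scalar. The Frobenius form of \<open>C\<close> is \<open>\<langle>a, b\<rangle> = F (a b)\<close> for a
  functional \<open>F\<close> living in a single degree, and nondegeneracy forces \<open>F\<close> to be nonzero on exactly one
  basis vector \<open>f\<^sub>t\<close>, which spans the socle of \<open>C\<close>. For every \<open>g\<close> the product of \<open>f\<^sub>g\<close> and \<open>f\<close> of \<open>g\<^sup>-\<^sup>1 t\<close> is then
  nonzero in \<open>C\<close>, which for degree reasons means that already in \<open>A\<close> it is a nonzero scalar multiple of
  \<open>f\<^sub>t\<close> (\<open>frobenius_functional_socle\<close>).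

  Once \<open>m = t\<close> is known, the rest is algebra. Writing \<open>f\<^sub>m\<close> as a multiple of \<open>f\<^sub>x f\<^sub>h\<close> with \<open>x = m h\<^sup>-\<^sup>1\<close> and
  as a multiple of \<open>f\<^sub>k f\<^sub>x\<close> with \<open>k = m h m\<^sup>-\<^sup>1\<close> gives that \<open>f\<^sub>m f\<^sub>h\<close> is a scalar times \<open>f\<^sub>k f\<^sub>m\<close>, so \<open>f\<^sub>m\<close> is
  normal, and the scalar is the quotient of two values of the form, hence equal to \<open>\<beta> h\<close>. A graded
  automorphism of \<open>C\<close> rescales the one-dimensional socle, so it preserves the form up to a scalar and
  commutes with the Nakayama automorphism.

  The homological point is \<open>m = t\<close> (\<open>Ext_degree_is_socle_degree\<close>). Let \<open>\<phi>\<close> be a cocycle of \<open>G\<close>-degree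
  \<open>g\<close> spanning \<open>Ext\<^sup>d\<^sub>A(K, A)\<close>. This space sits in one \<open>\<int>\<close>-degree, so for \<open>h \<noteq> e\<close> the cocycle \<open>\<phi> f\<^sub>h\<close>,
  whose \<open>\<int>\<close>-degree is larger, is a coboundary. If \<open>g \<noteq> t\<close>, take \<open>h = g\<^sup>-\<^sup>1 t\<close>. On \<open>R\<close> the values of \<open>\<phi>\<close> lie in
  \<open>R f\<^sub>g\<close>, and \<open>f\<^sub>g f\<^sub>h\<close> is a nonzero multiple of \<open>f\<^sub>t\<close>; dividing by \<open>f\<^sub>t\<close> and multiplying by \<open>f\<^sub>g\<close> shows that
  the restriction of \<open>\<phi>\<close> to \<open>R\<close> is itself a coboundary (\<open>bounds_if_product_bounds\<close>). But restriction
  \<open>Ext\<^sup>d\<^sub>A(K, A) \<rightarrow> Ext\<^sup>d\<^sub>R(K, A)\<close> is injective (\<open>restriction_injective\<close>), a contradiction.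

  Injectivity is a statement about \<open>Ext\<^sub>A(K, A) \<rightarrow> Ext\<^sub>A(C, A) = Ext\<^sub>R(K, A)\<close>: the kernel of the first map is
  a quotient of \<open>Ext\<close> one degree lower of the augmentation ideal of \<open>C\<close>, which vanishes because that
  ideal has a finite filtration with factors \<open>K\<close>, and the second map is an isomorphism because \<open>A\<close> is
  free over \<open>R\<close>. Both facts are proved here on bar cochains. Given a cocycle that vanishes on
  \<open>R\<close>, freeness makes it possible to enlarge, one argument at a time, the set where it vanishes, until
  only the last argument has to be in \<open>R\<close>; then the cocycle depends on the last argument through \<open>C\<close>, and
  its values at the \<open>f\<^sub>h\<close> are cocycles of one degree less, which are removed in the order of
  decreasing degree of \<open>f\<^sub>h\<close>.
\<close>

section \<open>Connected graded algebras\<close>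

locale conn_graded =
  fixes K :: "'k ring" and A :: "('k, 'a) module" (structure) and gr :: "nat \<Rightarrow> 'a set"
  assumes connected: "connected_graded K A gr"

sublocale conn_graded \<subseteq> k_algebra K A
  using connected by (simp add: connected_graded_def graded_algebra_def)

context conn_graded
begin

lemma decomposition: "direct_sum_decomp K A gr"
  using connected by (simp add: connected_graded_def graded_algebra_def)

lemma gr_mult: "x \<in> gr i \<Longrightarrow> y \<in> gr j \<Longrightarrow> x \<otimes> y \<in> gr (i + j)"
  using connected by (simp add: connected_graded_def graded_algebra_def)

lemma one_nonzero: "\<one> \<noteq> \<zero>"
  using connected by (simp add: connected_graded_def)

lemma gr_0: "gr 0 = (\<lambda>c. c \<odot> \<one>) ` carrier K"
  using connected by (simp add: connected_graded_def)

lemma gr_submodule: "submodule (gr i) K A"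
  using decomposition by (simp add: direct_sum_decomp_def)

lemma gr_closed: "x \<in> gr i \<Longrightarrow> x \<in> carrier A"
  using gr_submodule[of i] submoduleE(1) by blast

lemma gr_zero [simp]: "\<zero> \<in> gr i"
  using submodule.axioms(1)[OF gr_submodule, of i] subgroup.one_closed by fastforce

lemma gr_add: "x \<in> gr i \<Longrightarrow> y \<in> gr i \<Longrightarrow> x \<oplus> y \<in> gr i"
  using submodule.axioms(1)[OF gr_submodule, of i] subgroup.m_closed by fastforce

lemma gr_neg: "x \<in> gr i \<Longrightarrow> \<ominus> x \<in> gr i"
  using submodule.axioms(1)[OF gr_submodule, of i] subgroup.m_inv_closed
  by (fastforce simp: a_inv_def)

lemma gr_smult: "c \<in> carrier K \<Longrightarrow> x \<in> gr i \<Longrightarrow> c \<odot> x \<in> gr i"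
  using submodule.smult_closed[OF gr_submodule] .

lemma one_gr_0: "\<one> \<in> gr 0"
  unfolding gr_0 using A.one_closed by (metis R.one_closed image_eqI smult_one)

lemma scalar_eq: "c \<in> carrier K \<Longrightarrow> x \<in> carrier A \<Longrightarrow> c \<odot> x = (c \<odot> \<one>) \<otimes> x"
  by (simp add: smult_mult_left)

lemma gr_0_central: "z \<in> gr 0 \<Longrightarrow> x \<in> carrier A \<Longrightarrow> z \<otimes> x = x \<otimes> z"
  unfolding gr_0 by (auto simp: smult_mult_left smult_mult_right)

lemma gr_0_unit: "z \<in> gr 0 \<Longrightarrow> z \<noteq> \<zero> \<Longrightarrow> \<exists>w\<in>gr 0. w \<otimes> z = \<one> \<and> z \<otimes> w = \<one>"
proof -
  assume z: "z \<in> gr 0" "z \<noteq> \<zero>"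
  then obtain c where c: "c \<in> carrier K" "z = c \<odot> \<one>" unfolding gr_0 by auto
  have "c \<noteq> \<zero>\<^bsub>K\<^esub>" using c z by auto
  then have u: "c \<in> Units K" using c by (simp add: K.field_Units)
  have "(inv\<^bsub>K\<^esub> c) \<odot> \<one> \<in> gr 0" unfolding gr_0 using u by auto
  moreover have "((inv\<^bsub>K\<^esub> c) \<odot> \<one>) \<otimes> z = \<one>"
    using u c by (simp add: smult_mult_left smult_assoc1[symmetric])
  ultimately show ?thesis using gr_0_central z(1) gr_closed by metis
qed

lemma scalar_mult_nonzero: "c \<in> carrier K \<Longrightarrow> c \<noteq> \<zero>\<^bsub>K\<^esub> \<Longrightarrow> c \<odot> \<one> \<noteq> \<zero>"
proof
  assume c: "c \<in> carrier K" "c \<noteq> \<zero>\<^bsub>K\<^esub>" and 0: "c \<odot> \<one> = \<zero>"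
  then have "c \<in> Units K" by (simp add: K.field_Units)
  then have "inv\<^bsub>K\<^esub> c \<odot> (c \<odot> \<one>) = \<one>" "inv\<^bsub>K\<^esub> c \<in> carrier K"
    using c by (simp_all add: smult_assoc1[symmetric])
  then show False using 0 one_nonzero by simp
qed

abbreviation comp :: "nat \<Rightarrow> 'a \<Rightarrow> 'a" where "comp i x \<equiv> component A gr i x"

lemma comp_spec:
  assumes "x \<in> carrier A"
  shows "comp i x \<in> gr i" "finite {i. comp i x \<noteq> \<zero>}"
    "x = (\<Oplus>i\<in>{i. comp i x \<noteq> \<zero>}. comp i x)"
proof -
  let ?Q = "\<lambda>c. (\<forall>i. c i \<in> gr i) \<and> finite {i. c i \<noteq> \<zero>} \<and> x = (\<Oplus>i\<in>{i. c i \<noteq> \<zero>}. c i)"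
  have "\<exists>!c. ?Q c" using decomposition assms by (simp add: direct_sum_decomp_def)
  then have "?Q (THE c. ?Q c)" by (rule theI')
  then show "comp i x \<in> gr i" "finite {i. comp i x \<noteq> \<zero>}"
    "x = (\<Oplus>i\<in>{i. comp i x \<noteq> \<zero>}. comp i x)"
    unfolding component_def by auto
qed

lemma comp_closed [simp]: "x \<in> carrier A \<Longrightarrow> comp i x \<in> carrier A"
  using comp_spec(1) gr_closed by blast

lemma comp_unique:
  assumes "finite S" "\<And>i. c i \<in> gr i" "\<And>i. i \<notin> S \<Longrightarrow> c i = \<zero>" "x = (\<Oplus>i\<in>S. c i)"
  shows "comp i x = c i"
proof -
  let ?Q = "\<lambda>c. (\<forall>i. c i \<in> gr i) \<and> finite {i. c i \<noteq> \<zero>} \<and> x = (\<Oplus>i\<in>{i. c i \<noteq> \<zero>}. c i)"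
  have cl: "c \<in> T \<rightarrow> carrier A" for T using assms(2) gr_closed by blast
  have sub: "{i. c i \<noteq> \<zero>} \<subseteq> S" using assms(3) by auto
  have "x \<in> carrier A" using assms(4) cl by simp
  then have ex: "\<exists>!c. ?Q c" using decomposition by (simp add: direct_sum_decomp_def)
  have "(\<Oplus>i\<in>{i. c i \<noteq> \<zero>}. c i) = (\<Oplus>i\<in>S. c i)"
    by (rule M.add.finprod_mono_neutral_cong_left) (use assms(1) sub cl in auto)
  then have "?Q c" using assms sub finite_subset by auto
  then have "(THE c. ?Q c) = c" using ex by (rule the1_equality[rotated])
  then show ?thesis unfolding component_def by simp
qed

lemma comp_add:
  assumes x: "x \<in> carrier A" and y: "y \<in> carrier A"
  shows "comp i (x \<oplus> y) = comp i x \<oplus> comp i y"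
proof -
  let ?S = "\<lambda>x. {i. comp i x \<noteq> \<zero>}"
  let ?U = "?S x \<union> ?S y"
  have fin: "finite ?U" using comp_spec(2) x y by simp
  have ext: "z = (\<Oplus>i\<in>?U. comp i z)" if "z \<in> carrier A" "?S z \<subseteq> ?U" for z
    using comp_spec(3)[OF that(1)]
      M.add.finprod_mono_neutral_cong_left[OF fin that(2), of "\<lambda>i. comp i z" "\<lambda>i. comp i z"] that(1)
    by auto
  have "x \<oplus> y = (\<Oplus>i\<in>?U. comp i x) \<oplus> (\<Oplus>i\<in>?U. comp i y)"
    using ext[OF x] ext[OF y] by simp
  also have "\<dots> = (\<Oplus>i\<in>?U. comp i x \<oplus> comp i y)"
    using x y by (subst M.finsum_addf) auto
  finally have *: "x \<oplus> y = (\<Oplus>i\<in>?U. comp i x \<oplus> comp i y)" .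
  show ?thesis
    by (rule comp_unique[OF fin _ _ *]) (use x y comp_spec(1) gr_add in auto)
qed

lemma comp_homogeneous:
  assumes "x \<in> gr n" shows "comp i x = (if i = n then x else \<zero>)"
  by (rule comp_unique[of "{n}"]) (use assms gr_closed in auto)

text \<open>An induction rule in place of writing out sums of homogeneous components.\<close>

lemma homogeneous_induct [consumes 1, case_names homogeneous add]:
  assumes x: "x \<in> carrier A"
    and h: "\<And>i y. y \<in> gr i \<Longrightarrow> Q y"
    and a: "\<And>y z. y \<in> carrier A \<Longrightarrow> z \<in> carrier A \<Longrightarrow> Q y \<Longrightarrow> Q z \<Longrightarrow> Q (y \<oplus> z)"
  shows "Q x"
proof -
  have "Q (\<Oplus>i\<in>S. c i)" if "finite S" "\<And>i. c i \<in> gr i" for S c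
    using that
  proof (induction S rule: finite_induct)
    case empty then show ?case using h gr_zero by fastforce
  next
    case (insert i S)
    then have cl: "c \<in> T \<rightarrow> carrier A" for T using gr_closed by blast
    have ci: "c i \<in> carrier A" using insert.prems gr_closed by blast
    then have "Q (c i \<oplus> (\<Oplus>i\<in>S. c i))"
      using insert.IH insert.prems h cl gr_closed by (intro a M.finsum_closed) auto
    then show ?case using insert.hyps cl ci by simp
  qed
  from this[OF comp_spec(2)[OF x], of "\<lambda>i. comp i x"] show ?thesis
    using comp_spec(1,3)[OF x] by simp
qed

lemma comp_mult_left:
  assumes y: "y \<in> carrier A" and x: "x \<in> gr n"
  shows "comp i (x \<otimes> y) = (if n \<le> i then x \<otimes> comp (i - n) y else \<zero>)"
  using y
proof (induction rule: homogeneous_induct)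
  case (homogeneous k y)
  then have "x \<otimes> y \<in> gr (n + k)" using x gr_mult by blast
  then show ?case using homogeneous x gr_closed by (auto simp: comp_homogeneous)
next
  case (add y z)
  have "x \<in> carrier A" using x gr_closed by blast
  with add show ?case by (simp add: comp_add A.r_distr)
qed

lemma comp_mult_right:
  assumes y: "y \<in> carrier A" and x: "x \<in> gr n"
  shows "comp i (y \<otimes> x) = (if n \<le> i then comp (i - n) y \<otimes> x else \<zero>)"
  using y
proof (induction rule: homogeneous_induct)
  case (homogeneous k y)
  then have "y \<otimes> x \<in> gr (k + n)" using x gr_mult by blast
  then show ?case using homogeneous x gr_closed by (auto simp: comp_homogeneous)
next
  case (add y z)
  have "x \<in> carrier A" using x gr_closed by blast
  with add show ?case by (simp add: comp_add A.l_distr)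
qed

text \<open>The augmentation with values in \<open>gr 0 = K 1\<close> instead of \<open>K\<close>. Scalars are then central elements of
  \<open>A\<close>, and cochains with coefficients in the trivial module can be handled inside the ring \<open>A\<close>.\<close>

definition aug :: "'a \<Rightarrow> 'a" where "aug x = comp 0 x"

lemma aug_gr_0 [simp]: "x \<in> carrier A \<Longrightarrow> aug x \<in> gr 0"
  by (simp add: aug_def comp_spec)

lemma aug_closed [simp]: "x \<in> carrier A \<Longrightarrow> aug x \<in> carrier A"
  by (simp add: aug_def)

lemma aug_add: "x \<in> carrier A \<Longrightarrow> y \<in> carrier A \<Longrightarrow> aug (x \<oplus> y) = aug x \<oplus> aug y"
  by (simp add: aug_def comp_add)

lemma aug_homogeneous: "x \<in> gr n \<Longrightarrow> aug x = (if n = 0 then x else \<zero>)"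
  by (simp add: aug_def comp_homogeneous)

text \<open>By additivity both factors may be taken homogeneous, and only degree 0 contributes.\<close>

lemma aug_mult:
  assumes x: "x \<in> carrier A" and y: "y \<in> carrier A"
  shows "aug (x \<otimes> y) = aug x \<otimes> aug y"
  using x
proof (induction rule: homogeneous_induct)
  case (homogeneous k x)
  then show ?case using y gr_closed by (auto simp: aug_def comp_mult_left comp_homogeneous)
next
  case (add u v)
  then show ?case using y by (simp add: aug_add A.l_distr)
qed

lemma aug_zero [simp]: "aug \<zero> = \<zero>"
  using aug_homogeneous[OF gr_zero, of 0] by simp

lemma aug_one [simp]: "aug \<one> = \<one>"
  using aug_homogeneous[OF one_gr_0] by simp

lemma aug_neg: "x \<in> carrier A \<Longrightarrow> aug (\<ominus> x) = \<ominus> aug x"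
  using aug_add[of x "\<ominus> x"] by (metis M.a_inv_closed M.r_neg M.minus_equality M.a_comm aug_closed aug_zero)

lemma aug_central: "x \<in> carrier A \<Longrightarrow> y \<in> carrier A \<Longrightarrow> aug x \<otimes> y = y \<otimes> aug x"
  by (simp add: gr_0_central)

end

section \<open>The grading defined by an action of the dual of a group algebra\<close>

locale coaction = conn_graded K A gr + G?: group G
  for K :: "'k ring" and A :: "('k, 'a) module" (structure) and gr :: "nat \<Rightarrow> 'a set"
    and G :: "'g monoid" +
  fixes \<rho> :: "('g \<Rightarrow> 'k) \<Rightarrow> 'a \<Rightarrow> 'a"
  assumes finite_G: "finite (carrier G)"
    and action: "homogeneous_action K G A gr \<rho>"
begin

abbreviation H where "H \<equiv> dual_alg K G"

abbreviation G_mult (infixl "\<cdot>" 70) where "g \<cdot> h \<equiv> g \<otimes>\<^bsub>G\<^esub> h"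

abbreviation R :: "'a set" where "R \<equiv> fixed_set K G A \<rho>"

text \<open>The idempotent \<open>p\<^sub>g\<close> acts as the projection of \<open>A\<close> onto its component of degree \<open>g\<close>; the whole
  action is recovered from these projections.\<close>

definition proj :: "'g \<Rightarrow> 'a \<Rightarrow> 'a" where "proj g = \<rho> (idem K G g)"

abbreviation AG :: "'g \<Rightarrow> 'a set" where "AG g \<equiv> G_component K G A \<rho> g"

lemma H_carrier: "\<phi> \<in> carrier H \<longleftrightarrow> \<phi> \<in> carrier G \<rightarrow>\<^sub>E carrier K"
  by (simp add: dual_alg_def)

lemma idem_closed [simp]: "idem K G g \<in> carrier H"
  by (auto simp: H_carrier idem_def)

lemma action_hom: "\<phi> \<in> carrier H \<Longrightarrow> \<rho> \<phi> \<in> mod_hom K A A"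
  and action_lin: "a \<in> carrier A \<Longrightarrow> (\<lambda>\<phi>. \<rho> \<phi> a) \<in> mod_hom K H A"
  and action_one: "a \<in> carrier A \<Longrightarrow> \<rho> \<one>\<^bsub>H\<^esub> a = a"
  and action_mult: "\<phi> \<in> carrier H \<Longrightarrow> \<psi> \<in> carrier H \<Longrightarrow> a \<in> carrier A \<Longrightarrow>
     \<rho> (\<phi> \<otimes>\<^bsub>H\<^esub> \<psi>) a = \<rho> \<phi> (\<rho> \<psi> a)"
  and action_unit: "\<phi> \<in> carrier H \<Longrightarrow> \<rho> \<phi> \<one> = \<phi> \<one>\<^bsub>G\<^esub> \<odot> \<one>"
  and action_gr: "\<phi> \<in> carrier H \<Longrightarrow> x \<in> gr n \<Longrightarrow> \<rho> \<phi> x \<in> gr n"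
  using action unfolding homogeneous_action_def Let_def image_subset_iff by (elim conjE, simp)+

lemma proj_mult: "g \<in> carrier G \<Longrightarrow> a \<in> carrier A \<Longrightarrow> b \<in> carrier A \<Longrightarrow>
   proj g (a \<otimes> b) = (\<Oplus>h\<in>carrier G. proj h a \<otimes> proj (inv\<^bsub>G\<^esub> h \<cdot> g) b)"
  using action unfolding homogeneous_action_def Let_def proj_def by blast

lemma proj_closed [simp]: "a \<in> carrier A \<Longrightarrow> proj g a \<in> carrier A"
  using action_hom[OF idem_closed, of g] unfolding mod_hom_def proj_def by auto

lemma proj_add: "a \<in> carrier A \<Longrightarrow> b \<in> carrier A \<Longrightarrow> proj g (a \<oplus> b) = proj g a \<oplus> proj g b"
  using action_hom[OF idem_closed, of g] unfolding mod_hom_def proj_def by auto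

lemma proj_smult: "c \<in> carrier K \<Longrightarrow> a \<in> carrier A \<Longrightarrow> proj g (c \<odot> a) = c \<odot> proj g a"
  using action_hom[OF idem_closed, of g] unfolding mod_hom_def proj_def by auto

lemma proj_gr: "x \<in> gr n \<Longrightarrow> proj g x \<in> gr n"
  by (simp add: proj_def action_gr)

lemma proj_zero [simp]: "proj g \<zero> = \<zero>"
  using proj_add[of \<zero> \<zero> g] by (metis M.add.l_cancel_one M.l_zero M.zero_closed proj_closed)

lemma proj_neg: "x \<in> carrier A \<Longrightarrow> proj g (\<ominus> x) = \<ominus> proj g x"
  using proj_add[of x "\<ominus> x"] by (metis M.a_inv_closed M.r_neg M.minus_equality M.a_comm proj_closed proj_zero)

lemma proj_minus: "x \<in> carrier A \<Longrightarrow> y \<in> carrier A \<Longrightarrow> proj g (x \<ominus> y) = proj g x \<ominus> proj g y"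
  by (simp add: a_minus_def proj_add proj_neg)

lemma action_H_add: "a \<in> carrier A \<Longrightarrow> \<phi> \<in> carrier H \<Longrightarrow> \<psi> \<in> carrier H \<Longrightarrow>
    \<rho> (\<phi> \<oplus>\<^bsub>H\<^esub> \<psi>) a = \<rho> \<phi> a \<oplus> \<rho> \<psi> a"
  and action_H_smult: "a \<in> carrier A \<Longrightarrow> c \<in> carrier K \<Longrightarrow> \<phi> \<in> carrier H \<Longrightarrow>
    \<rho> (c \<odot>\<^bsub>H\<^esub> \<phi>) a = c \<odot> \<rho> \<phi> a"
  and action_closed: "a \<in> carrier A \<Longrightarrow> \<phi> \<in> carrier H \<Longrightarrow> \<rho> \<phi> a \<in> carrier A"
  using action_lin[of a] unfolding mod_hom_def by blast+

lemma zero_H: "\<zero>\<^bsub>H\<^esub> \<in> carrier H" "a \<in> carrier A \<Longrightarrow> \<rho> \<zero>\<^bsub>H\<^esub> a = \<zero>"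
proof -
  show z: "\<zero>\<^bsub>H\<^esub> \<in> carrier H" by (auto simp: dual_alg_def)
  assume a: "a \<in> carrier A"
  have "\<zero>\<^bsub>H\<^esub> \<oplus>\<^bsub>H\<^esub> \<zero>\<^bsub>H\<^esub> = \<zero>\<^bsub>H\<^esub>" by (auto simp: dual_alg_def)
  then have "\<rho> \<zero>\<^bsub>H\<^esub> a = \<rho> \<zero>\<^bsub>H\<^esub> a \<oplus> \<rho> \<zero>\<^bsub>H\<^esub> a" "\<rho> \<zero>\<^bsub>H\<^esub> a \<in> carrier A"
    using action_H_add[OF a z z] action_closed[OF a z] by simp_all
  then show "\<rho> \<zero>\<^bsub>H\<^esub> a = \<zero>" by simp
qed

lemma proj_proj:
  assumes "g \<in> carrier G" "h \<in> carrier G" "a \<in> carrier A"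
  shows "proj g (proj h a) = (if g = h then proj g a else \<zero>)"
proof -
  have "idem K G g \<otimes>\<^bsub>H\<^esub> idem K G h = (if g = h then idem K G g else \<zero>\<^bsub>H\<^esub>)"
    by (auto simp: dual_alg_def idem_def)
  then show ?thesis
    using action_mult[of "idem K G g" "idem K G h" a] assms zero_H(2)
    by (auto simp: proj_def)
qed

text \<open>The sums of the \<open>p\<^sub>g\<close> over subsets of \<open>G\<close> are the indicator functions, and the one of \<open>G\<close> is the
  unit of \<open>K\<^sup>G\<close>.\<close>

lemma sum_proj:
  assumes a: "a \<in> carrier A" shows "(\<Oplus>g\<in>carrier G. proj g a) = a"
proof -
  define ind where "ind S = (\<lambda>x\<in>carrier G. if x \<in> S then \<one>\<^bsub>K\<^esub> else \<zero>\<^bsub>K\<^esub>)" for S :: "'g set"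
  have indH: "ind S \<in> carrier H" for S by (auto simp: H_carrier ind_def)
  have "(\<Oplus>g\<in>S. proj g a) = \<rho> (ind S) a" if "finite S" for S
    using that
  proof (induction S rule: finite_induct)
    case empty
    have "ind {} = \<zero>\<^bsub>H\<^esub>" by (auto simp: ind_def dual_alg_def)
    then show ?case using zero_H(2)[OF a] by simp
  next
    case (insert g S)
    have "ind (insert g S) = idem K G g \<oplus>\<^bsub>H\<^esub> ind S"
      using insert.hyps by (auto simp: ind_def dual_alg_def idem_def)
    moreover have "\<rho> (idem K G g \<oplus>\<^bsub>H\<^esub> ind S) a = \<rho> (idem K G g) a \<oplus> \<rho> (ind S) a"
      using action_H_add[OF a idem_closed indH] .
    ultimately show ?case using insert a by (simp add: proj_def[symmetric])
  qed
  moreover have "ind (carrier G) = \<one>\<^bsub>H\<^esub>" by (auto simp: ind_def dual_alg_def)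
  ultimately show ?thesis using finite_G action_one[OF a] by simp
qed

text \<open>Additive properties pass from the \<open>G\<close>-homogeneous parts of \<open>x\<close> to \<open>x\<close>.\<close>

lemma proj_induct [consumes 1, case_names proj add zero]:
  assumes x: "x \<in> carrier A" and p: "\<And>g. g \<in> carrier G \<Longrightarrow> Q (proj g x)"
    and add: "\<And>y z. y \<in> carrier A \<Longrightarrow> z \<in> carrier A \<Longrightarrow> Q y \<Longrightarrow> Q z \<Longrightarrow> Q (y \<oplus> z)"
    and zero: "Q \<zero>"
  shows "Q x"
proof -
  have "Q (\<Oplus>g\<in>S. proj g x)" if "finite S" "S \<subseteq> carrier G" for S
    using that
  proof (induction S rule: finite_induct)
    case (insert g S)
    have "(\<lambda>g. proj g x) \<in> S \<rightarrow> carrier A" using x by simp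
    then show ?case using insert x p by (simp add: add)
  qed (simp add: zero)
  from this[OF finite_G subset_refl] show ?thesis using sum_proj[OF x] by simp
qed

lemma AG_iff: "g \<in> carrier G \<Longrightarrow> x \<in> AG g \<longleftrightarrow> x \<in> carrier A \<and> proj g x = x"
proof
  assume g: "g \<in> carrier G" and "x \<in> AG g"
  then obtain y where "y \<in> carrier A" "x = proj g y"
    unfolding G_component_def proj_def[symmetric] by auto
  then show "x \<in> carrier A \<and> proj g x = x" using proj_proj[OF g g] by simp
next
  assume "x \<in> carrier A \<and> proj g x = x"
  then show "x \<in> AG g" unfolding G_component_def proj_def[symmetric] by (metis image_eqI)
qed

lemma AG_closed: "x \<in> AG g \<Longrightarrow> x \<in> carrier A"
  unfolding G_component_def proj_def[symmetric] by auto

lemma proj_AG [simp]: "a \<in> carrier A \<Longrightarrow> proj g a \<in> AG g"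
  unfolding G_component_def proj_def[symmetric] by auto

lemma proj_of_AG: "g \<in> carrier G \<Longrightarrow> h \<in> carrier G \<Longrightarrow> x \<in> AG h \<Longrightarrow>
    proj g x = (if g = h then x else \<zero>)"
  using proj_proj[of g h x] AG_iff[of h x] by auto

text \<open>An element of degree \<open>e\<close> is fixed because \<open>\<phi> p\<^sub>e = \<phi>(e) p\<^sub>e\<close> for every \<open>\<phi>\<close>.\<close>

lemma R_eq: "R = AG \<one>\<^bsub>G\<^esub>"
proof (intro Set.equalityI subsetI)
  fix a assume "a \<in> R"
  then have a: "a \<in> carrier A" and "proj \<one>\<^bsub>G\<^esub> a = idem K G \<one>\<^bsub>G\<^esub> \<one>\<^bsub>G\<^esub> \<odot> a"
    unfolding fixed_set_def proj_def by auto
  then have "proj \<one>\<^bsub>G\<^esub> a = a" by (simp add: idem_def)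
  then show "a \<in> AG \<one>\<^bsub>G\<^esub>" using a AG_iff by auto
next
  fix a assume "a \<in> AG \<one>\<^bsub>G\<^esub>"
  then have a: "a \<in> carrier A" and p: "proj \<one>\<^bsub>G\<^esub> a = a" using AG_iff[of "\<one>\<^bsub>G\<^esub>"] by auto
  have "\<rho> \<phi> a = \<phi> \<one>\<^bsub>G\<^esub> \<odot> a" if \<phi>: "\<phi> \<in> carrier H" for \<phi>
  proof -
    have c: "\<phi> \<one>\<^bsub>G\<^esub> \<in> carrier K" using \<phi> by (auto simp: H_carrier)
    have "\<phi> \<otimes>\<^bsub>H\<^esub> idem K G \<one>\<^bsub>G\<^esub> = \<phi> \<one>\<^bsub>G\<^esub> \<odot>\<^bsub>H\<^esub> idem K G \<one>\<^bsub>G\<^esub>"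
      using \<phi> c by (intro ext) (auto simp: dual_alg_def idem_def PiE_iff)
    moreover have "\<rho> (\<phi> \<one>\<^bsub>G\<^esub> \<odot>\<^bsub>H\<^esub> idem K G \<one>\<^bsub>G\<^esub>) a = \<phi> \<one>\<^bsub>G\<^esub> \<odot> \<rho> (idem K G \<one>\<^bsub>G\<^esub>) a"
      using action_H_smult[OF a c idem_closed] .
    ultimately show ?thesis using action_mult[OF \<phi> idem_closed a, of "\<one>\<^bsub>G\<^esub>"] p by (simp add: proj_def)
  qed
  then show "a \<in> R" using a by (simp add: fixed_set_def)
qed

text \<open>The coproduct of \<open>p\<^sub>u\<close> gives a sum over \<open>G\<close>, of which only the summand \<open>h = g\<close> sees \<open>x\<close>.\<close>

lemma proj_mult_left:
  assumes g: "g \<in> carrier G" and u: "u \<in> carrier G" and x: "x \<in> AG g" and b: "b \<in> carrier A"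
  shows "proj u (x \<otimes> b) = x \<otimes> proj (inv\<^bsub>G\<^esub> g \<cdot> u) b"
proof -
  have xc: "x \<in> carrier A" using x AG_closed by blast
  have "proj u (x \<otimes> b) = (\<Oplus>h\<in>carrier G. proj h x \<otimes> proj (inv\<^bsub>G\<^esub> h \<cdot> u) b)"
    using proj_mult[OF u xc b] .
  also have "\<dots> = (\<Oplus>h\<in>carrier G. if g = h then x \<otimes> proj (inv\<^bsub>G\<^esub> h \<cdot> u) b else \<zero>)"
    by (rule M.add.finprod_cong') (use g x xc b proj_of_AG[OF _ g x] in \<open>auto\<close>)
  also have "\<dots> = x \<otimes> proj (inv\<^bsub>G\<^esub> g \<cdot> u) b"
    by (rule M.add.finprod_singleton) (use g finite_G xc b in auto)
  finally show ?thesis .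
qed

lemma proj_mult_right:
  assumes g: "g \<in> carrier G" and u: "u \<in> carrier G" and x: "x \<in> AG g" and b: "b \<in> carrier A"
  shows "proj u (b \<otimes> x) = proj (u \<cdot> inv\<^bsub>G\<^esub> g) b \<otimes> x"
proof -
  have xc: "x \<in> carrier A" using x AG_closed by blast
  have eq: "inv\<^bsub>G\<^esub> h \<cdot> u = g \<longleftrightarrow> u \<cdot> inv\<^bsub>G\<^esub> g = h" if "h \<in> carrier G" for h
    using that g u G.inv_solve_left' G.inv_solve_right' by auto
  have "proj u (b \<otimes> x) = (\<Oplus>h\<in>carrier G. proj h b \<otimes> proj (inv\<^bsub>G\<^esub> h \<cdot> u) x)"
    using proj_mult[OF u b xc] .
  also have "\<dots> = (\<Oplus>h\<in>carrier G. if u \<cdot> inv\<^bsub>G\<^esub> g = h then proj h b \<otimes> x else \<zero>)"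
    by (rule M.add.finprod_cong') (use g u x xc b proj_of_AG[OF _ g x] eq in \<open>auto\<close>)
  also have "\<dots> = proj (u \<cdot> inv\<^bsub>G\<^esub> g) b \<otimes> x"
    by (rule M.add.finprod_singleton) (use g u finite_G xc b in auto)
  finally show ?thesis .
qed

lemma AG_mult:
  assumes "g \<in> carrier G" "h \<in> carrier G" "x \<in> AG g" "y \<in> AG h"
  shows "x \<otimes> y \<in> AG (g \<cdot> h)"
proof -
  have c: "x \<in> carrier A" "y \<in> carrier A" using assms AG_closed by auto
  have "proj (g \<cdot> h) (x \<otimes> y) = x \<otimes> proj h y"
    using proj_mult_left[of g "g \<cdot> h" x y] assms c by (simp add: G.m_assoc[symmetric])
  then show ?thesis using assms c AG_iff by auto
qed

lemma one_R: "\<one> \<in> R"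
  unfolding R_eq using AG_iff[of "\<one>\<^bsub>G\<^esub>" \<one>] action_unit[OF idem_closed, of "\<one>\<^bsub>G\<^esub>"]
  by (simp add: proj_def idem_def)

lemma R_closed: "r \<in> R \<Longrightarrow> r \<in> carrier A" by (simp add: fixed_set_def)

lemma AG_add: "g \<in> carrier G \<Longrightarrow> x \<in> AG g \<Longrightarrow> y \<in> AG g \<Longrightarrow> x \<oplus> y \<in> AG g"
  using AG_iff proj_add by auto

lemma AG_zero [simp]: "g \<in> carrier G \<Longrightarrow> \<zero> \<in> AG g"
  using AG_iff by auto

lemma R_mult: "r \<in> R \<Longrightarrow> s \<in> R \<Longrightarrow> r \<otimes> s \<in> R"
  unfolding R_eq using AG_mult[of "\<one>\<^bsub>G\<^esub>" "\<one>\<^bsub>G\<^esub>"] by simp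

lemma R_add: "r \<in> R \<Longrightarrow> s \<in> R \<Longrightarrow> r \<oplus> s \<in> R"
  unfolding R_eq using AG_add by simp

lemma AG_gr_0: "z \<in> gr 0 \<Longrightarrow> z \<in> R"
  unfolding gr_0 using one_R proj_smult[of _ \<one> "\<one>\<^bsub>G\<^esub>"] AG_iff[of "\<one>\<^bsub>G\<^esub>"] unfolding R_eq by auto

lemma proj_comp:
  assumes a: "a \<in> carrier A" shows "proj g (comp n a) = comp n (proj g a)"
  using a
proof (induction rule: homogeneous_induct)
  case (homogeneous k x)
  then show ?case using proj_gr[OF homogeneous, of g] by (auto simp: comp_homogeneous)
next
  case (add y z) then show ?case by (simp add: comp_add proj_add)
qed

lemma AG_comp: "g \<in> carrier G \<Longrightarrow> x \<in> AG g \<Longrightarrow> comp n x \<in> AG g"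
  using AG_iff proj_comp by auto

end

section \<open>The basis of \<open>A\<close> over the fixed ring\<close>

lemma (in cring) dual_alg_ring: "ring (dual_alg R (G :: 'g monoid))"
proof (rule ringI)
  let ?H = "dual_alg R G"
  show "abelian_group ?H"
  proof (rule abelian_groupI)
    fix x assume x: "x \<in> carrier ?H"
    show "\<exists>y\<in>carrier ?H. y \<oplus>\<^bsub>?H\<^esub> x = \<zero>\<^bsub>?H\<^esub>"
      by (rule bexI[of _ "\<lambda>g\<in>carrier G. \<ominus>\<^bsub>R\<^esub> x g"])
        (use x in \<open>auto simp: dual_alg_def PiE_def Pi_def l_neg intro!: ext\<close>)
  qed (auto simp: dual_alg_def PiE_iff extensional_def a_ac intro!: ext)
  show "monoid ?H"
    by (rule monoidI) (auto simp: dual_alg_def PiE_iff extensional_def m_assoc intro!: ext)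
qed (auto simp: dual_alg_def PiE_iff extensional_def l_distr r_distr intro!: ext)

locale covariant_basis = coaction K A gr G \<rho>
  for K :: "'k ring" and A :: "('k, 'a) module" (structure) and gr :: "nat \<Rightarrow> 'a set"
    and G :: "'g monoid" and \<rho> :: "('g \<Rightarrow> 'k) \<Rightarrow> 'a \<Rightarrow> 'a" +
  fixes f :: "'g \<Rightarrow> 'a"
  assumes domain: "is_domain A" and faithful: "inner_faithful K G A \<rho>"
    and f_homogeneous: "g \<in> carrier G \<Longrightarrow> homogeneous gr (f g)"
    and f_one: "f \<one>\<^bsub>G\<^esub> = \<one>"
    and AG_left: "g \<in> carrier G \<Longrightarrow> AG g = (\<lambda>a. f g \<otimes> a) ` R"
    and AG_right: "g \<in> carrier G \<Longrightarrow> AG g = (\<lambda>a. a \<otimes> f g) ` R"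
begin

lemma integral_A: "x \<in> carrier A \<Longrightarrow> y \<in> carrier A \<Longrightarrow> x \<otimes> y = \<zero> \<Longrightarrow> x = \<zero> \<or> y = \<zero>"
  using domain by (simp add: is_domain_def)

lemma cancel_left:
  assumes "x \<in> carrier A" "a \<in> carrier A" "b \<in> carrier A" "x \<noteq> \<zero>" "x \<otimes> a = x \<otimes> b"
  shows "a = b"
proof -
  have "x \<otimes> (a \<ominus> b) = \<zero>" using assms by (simp add: a_minus_def A.r_distr A.r_minus M.r_neg)
  then have "a \<ominus> b = \<zero>" using integral_A[of x "a \<ominus> b"] assms by auto
  then show ?thesis using assms A.r_right_minus_eq by auto
qed

lemma cancel_right:
  assumes "x \<in> carrier A" "a \<in> carrier A" "b \<in> carrier A" "x \<noteq> \<zero>" "a \<otimes> x = b \<otimes> x"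
  shows "a = b"
proof -
  have "(a \<ominus> b) \<otimes> x = \<zero>" using assms by (simp add: a_minus_def A.l_distr A.l_minus M.r_neg)
  then have "a \<ominus> b = \<zero>" using integral_A[of "a \<ominus> b" x] assms by auto
  then show ?thesis using assms A.r_right_minus_eq by auto
qed

lemma f_AG: "g \<in> carrier G \<Longrightarrow> f g \<in> AG g"
  using AG_left[of g] one_R f_homogeneous[of g] gr_closed
  by (fastforce simp: homogeneous_def image_iff)

lemma f_closed [simp]: "g \<in> carrier G \<Longrightarrow> f g \<in> carrier A"
  using f_AG AG_closed by blast

text \<open>The degrees \<open>g\<close> with \<open>A\<^sub>g \<noteq> 0\<close> are closed under multiplication because \<open>A\<close> is a domain, so they form
  a subgroup \<open>S\<close> of the finite group \<open>G\<close>. The functions that vanish on \<open>S\<close> form a Hopf ideal which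
  annihilates \<open>A\<close>, and inner faithfulness forces this ideal to be zero.\<close>

lemma AG_nonzero:
  assumes g: "g \<in> carrier G" shows "AG g \<noteq> {\<zero>}"
proof
  assume AGg: "AG g = {\<zero>}"
  define S where "S = {g \<in> carrier G. AG g \<noteq> {\<zero>}}"
  have S_ex: "x \<in> S \<longleftrightarrow> x \<in> carrier G \<and> (\<exists>a\<in>AG x. a \<noteq> \<zero>)" for x
    unfolding S_def using AG_zero[of x] by blast
  have S_one: "\<one>\<^bsub>G\<^esub> \<in> S" unfolding S_ex using one_R one_nonzero R_eq by auto
  have S_mult: "x \<cdot> y \<in> S" if "x \<in> S" "y \<in> S" for x y
    using that unfolding S_ex using AG_mult integral_A AG_closed by (metis G.m_closed)
  have S_sub: "S \<subseteq> carrier G" by (auto simp: S_def)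
  then have S_fin: "finite S" using finite_G finite_subset by blast
  have S_inv: "inv\<^bsub>G\<^esub> x \<in> S" if x: "x \<in> S" for x
  proof -
    \<comment> \<open>a finite subset closed under multiplication: translation by \<open>x\<close> permutes it\<close>
    have "inj_on (\<lambda>y. x \<cdot> y) S" using x S_sub by (intro inj_onI) (metis G.l_cancel subset_iff)
    moreover have "(\<lambda>y. x \<cdot> y) ` S \<subseteq> S" using x S_mult by auto
    ultimately have "(\<lambda>y. x \<cdot> y) ` S = S" using S_fin endo_inj_surj by blast
    then obtain y where "y \<in> S" "x \<cdot> y = \<one>\<^bsub>G\<^esub>" using S_one by (metis imageE)
    then show ?thesis using x S_sub by (metis G.inv_equality G.inv_inv G.inv_closed G.inv_comm subset_iff)
  qed
  define I where "I = {\<phi> \<in> carrier H. \<forall>x\<in>S. \<phi> x = \<zero>\<^bsub>K\<^esub>}"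
  interpret H: ring H by (rule R.dual_alg_ring)
  have Iideal: "ideal I H"
  proof (rule idealI)
    show "ring H" by (rule H.ring_axioms)
    show "subgroup I (add_monoid H)"
    proof (rule H.add.subgroupI)
      show "I \<subseteq> carrier H" by (auto simp: I_def)
      have "\<zero>\<^bsub>H\<^esub> \<in> I" using S_sub by (auto simp: I_def dual_alg_def)
      then show "I \<noteq> {}" by auto
    next
      fix a assume a: "a \<in> I"
      let ?b = "\<lambda>x\<in>carrier G. \<ominus>\<^bsub>K\<^esub> a x"
      have ac: "a \<in> carrier H" using a by (simp add: I_def)
      have b: "?b \<in> carrier H" using ac by (auto simp: dual_alg_def)
      have "?b \<oplus>\<^bsub>H\<^esub> a = \<zero>\<^bsub>H\<^esub>" using ac by (auto simp: dual_alg_def PiE_def Pi_def R.l_neg intro!: ext)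
      then have "\<ominus>\<^bsub>H\<^esub> a = ?b" using H.minus_equality b ac by blast
      then show "\<ominus>\<^bsub>H\<^esub> a \<in> I" using a b S_sub by (auto simp: I_def)
    next
      fix a b assume "a \<in> I" "b \<in> I"
      then show "a \<oplus>\<^bsub>H\<^esub> b \<in> I" using S_sub by (auto simp: I_def dual_alg_def)
    qed
  qed (use S_sub in \<open>auto simp: I_def dual_alg_def PiE_iff\<close>)
  \<comment> \<open>for the coproduct, split \<open>\<phi> (x y)\<close> according to whether \<open>x\<close> lies in the subgroup \<open>S\<close>\<close>
  have "hopf_ideal K G I"
    unfolding hopf_ideal_def
  proof (intro conjI ballI)
    fix \<phi> assume \<phi>: "\<phi> \<in> I"
    then have \<phi>K: "\<And>x. x \<in> carrier G \<Longrightarrow> \<phi> x \<in> carrier K" by (auto simp: I_def dual_alg_def)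
    have \<phi>0: "\<And>x. x \<in> S \<Longrightarrow> \<phi> x = \<zero>\<^bsub>K\<^esub>" using \<phi> by (auto simp: I_def)
    show "\<exists>F F'. (\<forall>y\<in>carrier G. (\<lambda>x\<in>carrier G. F x y) \<in> I) \<and>
        (\<forall>x\<in>carrier G. (\<lambda>y\<in>carrier G. F' x y) \<in> I) \<and>
        (\<forall>x\<in>carrier G. \<forall>y\<in>carrier G. \<phi> (x \<cdot> y) = F x y \<oplus>\<^bsub>K\<^esub> F' x y)"
      by (rule exI[of _ "\<lambda>x y. if x \<in> S then \<zero>\<^bsub>K\<^esub> else \<phi> (x \<cdot> y)"],
          rule exI[of _ "\<lambda>x y. if x \<in> S then \<phi> (x \<cdot> y) else \<zero>\<^bsub>K\<^esub>"])
        (use \<phi>K \<phi>0 S_mult S_sub in \<open>auto simp: I_def dual_alg_def\<close>)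
    show "\<phi> \<one>\<^bsub>G\<^esub> = \<zero>\<^bsub>K\<^esub>" using \<phi>0 S_one by auto
    show "(\<lambda>x\<in>carrier G. \<phi> (inv\<^bsub>G\<^esub> x)) \<in> I"
      using \<phi>K \<phi>0 S_inv S_sub by (auto simp: I_def dual_alg_def)
  qed (rule Iideal)
  moreover have "\<rho> \<phi> a = \<zero>" if \<phi>: "\<phi> \<in> I" and a: "a \<in> carrier A" for \<phi> a
  proof -
    have \<phi>H: "\<phi> \<in> carrier H" using \<phi> by (simp add: I_def)
    have "proj h (\<rho> \<phi> a) = \<zero>" if h: "h \<in> carrier G" for h
    proof (cases "h \<in> S")
      case False
      then have "AG h = {\<zero>}" using h by (auto simp: S_def)
      then show ?thesis using proj_AG[OF action_closed[OF a \<phi>H], of h] by auto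
    next
      case True
      have "\<phi> \<in> carrier G \<rightarrow>\<^sub>E carrier K" "\<phi> h = \<zero>\<^bsub>K\<^esub>" using \<phi> True by (auto simp: I_def dual_alg_def)
      then have "idem K G h \<otimes>\<^bsub>H\<^esub> \<phi> = \<zero>\<^bsub>H\<^esub>"
        by (intro ext) (auto simp: dual_alg_def idem_def PiE_iff)
      then show ?thesis
        using action_mult[OF idem_closed \<phi>H a, of h] zero_H(2)[OF a] by (simp add: proj_def)
    qed
    then show ?thesis
      using sum_proj[OF action_closed[OF a \<phi>H]] by (metis M.add.finprod_one_eqI)
  qed
  ultimately have "I = {\<zero>\<^bsub>H\<^esub>}" using faithful unfolding inner_faithful_def by blast
  moreover have "idem K G g \<in> I"
  proof -
    have "g \<notin> S" using AGg by (simp add: S_def)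
    then show ?thesis using S_sub by (auto simp: I_def idem_def dual_alg_def)
  qed
  ultimately have "idem K G g g = \<zero>\<^bsub>H\<^esub> g" by auto
  then show False using g by (auto simp: idem_def dual_alg_def)
qed

lemma f_nonzero: "g \<in> carrier G \<Longrightarrow> f g \<noteq> \<zero>"
proof
  assume g: "g \<in> carrier G" and "f g = \<zero>"
  then have "AG g \<subseteq> {\<zero>}" using AG_left R_closed by auto
  then show False using AG_nonzero[OF g] AG_zero[OF g] by auto
qed

definition dg :: "'g \<Rightarrow> nat" where "dg g = (SOME n. f g \<in> gr n)"

lemma f_gr: "g \<in> carrier G \<Longrightarrow> f g \<in> gr (dg g)"
  unfolding dg_def using f_homogeneous[of g] someI_ex[of "\<lambda>n. f g \<in> gr n"]
  by (simp add: homogeneous_def)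

lemma gr_unique: "x \<in> gr i \<Longrightarrow> x \<in> gr j \<Longrightarrow> x \<noteq> \<zero> \<Longrightarrow> i = j"
  using comp_homogeneous[of x i i] comp_homogeneous[of x j i] by (auto split: if_splits)

lemma dg_zero: "g \<in> carrier G \<Longrightarrow> dg g = 0 \<longleftrightarrow> g = \<one>\<^bsub>G\<^esub>"
proof
  assume g: "g \<in> carrier G" and "dg g = 0"
  then have "f g \<in> R" using f_gr[OF g] AG_gr_0 by simp
  then have "proj g (f g) = (if g = \<one>\<^bsub>G\<^esub> then f g else \<zero>)"
    unfolding R_eq using proj_of_AG[OF g] by blast
  moreover have "proj g (f g) = f g" using AG_iff[OF g] f_AG[OF g] by simp
  ultimately show "g = \<one>\<^bsub>G\<^esub>" using f_nonzero[OF g] by (auto split: if_splits)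
next
  assume "g \<in> carrier G" "g = \<one>\<^bsub>G\<^esub>"
  then show "dg g = 0" using gr_unique[OF _ one_gr_0 one_nonzero] f_gr[of g] f_one by auto
qed

text \<open>The coordinates of the free right \<open>R\<close>-module \<open>A\<close> with respect to the basis \<open>f\<close>.\<close>

definition coord :: "'g \<Rightarrow> 'a \<Rightarrow> 'a" where
  "coord g a = (THE r. r \<in> R \<and> proj g a = f g \<otimes> r)"

lemma coord_unique:
  assumes "g \<in> carrier G" "r \<in> R" "proj g a = f g \<otimes> r"
  shows "coord g a = r"
  unfolding coord_def
proof (rule the_equality)
  show "r \<in> R \<and> proj g a = f g \<otimes> r" using assms by simp
  fix s assume s: "s \<in> R \<and> proj g a = f g \<otimes> s"
  show "s = r"
    by (rule cancel_left[OF f_closed _ _ f_nonzero])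
      (use assms s R_closed in simp_all)
qed

lemma coord:
  assumes g: "g \<in> carrier G" and a: "a \<in> carrier A"
  shows "coord g a \<in> R" "f g \<otimes> coord g a = proj g a"
proof -
  obtain r where "r \<in> R" "proj g a = f g \<otimes> r" using proj_AG[OF a, of g] AG_left[OF g] by auto
  then show "coord g a \<in> R" "f g \<otimes> coord g a = proj g a" using coord_unique[OF g] by auto
qed

lemma coord_closed [simp]: "g \<in> carrier G \<Longrightarrow> a \<in> carrier A \<Longrightarrow> coord g a \<in> carrier A"
  using coord R_closed by blast

lemma sum_coord: "a \<in> carrier A \<Longrightarrow> (\<Oplus>g\<in>carrier G. f g \<otimes> coord g a) = a"
proof -
  assume a: "a \<in> carrier A"
  have "(\<Oplus>g\<in>carrier G. f g \<otimes> coord g a) = (\<Oplus>g\<in>carrier G. proj g a)"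
    by (rule M.add.finprod_cong') (use a coord in auto)
  then show ?thesis using sum_proj[OF a] by simp
qed

lemma coord_add:
  assumes "g \<in> carrier G" "a \<in> carrier A" "b \<in> carrier A"
  shows "coord g (a \<oplus> b) = coord g a \<oplus> coord g b"
  by (rule coord_unique) (use assms coord proj_add in \<open>auto simp: A.r_distr intro: R_add\<close>)

lemma coord_mult_right:
  assumes g: "g \<in> carrier G" and a: "a \<in> carrier A" and r: "r \<in> R"
  shows "coord g (a \<otimes> r) = coord g a \<otimes> r"
proof (rule coord_unique[OF g])
  show "coord g a \<otimes> r \<in> R" using coord[OF g a] r R_mult by blast
  have "proj g (a \<otimes> r) = proj g a \<otimes> r"
    using proj_mult_right[of "\<one>\<^bsub>G\<^esub>" g r a] g a r R_eq by simp
  then show "proj g (a \<otimes> r) = f g \<otimes> (coord g a \<otimes> r)"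
    using coord[OF g a] R_closed[OF r] R_closed[OF coord(1)[OF g a]] g by (simp flip: A.m_assoc)
qed

lemma coord_f:
  assumes g: "g \<in> carrier G" and h: "h \<in> carrier G" and r: "r \<in> R"
  shows "coord g (f h \<otimes> r) = (if g = h then r else \<zero>)"
proof (rule coord_unique[OF g])
  show "(if g = h then r else \<zero>) \<in> R" using r unfolding R_eq by auto
  have "f h \<otimes> r \<in> AG h" using AG_left[OF h] r by auto
  then show "proj g (f h \<otimes> r) = f g \<otimes> (if g = h then r else \<zero>)"
    using proj_of_AG[OF g h] g by auto
qed

lemma coord_R: "g \<in> carrier G \<Longrightarrow> r \<in> R \<Longrightarrow> coord g r = (if g = \<one>\<^bsub>G\<^esub> then r else \<zero>)"
  using coord_f[of g "\<one>\<^bsub>G\<^esub>" r] R_closed[of r] by (simp add: f_one)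

lemma coord_central:
  assumes "g \<in> carrier G" "a \<in> carrier A" "z \<in> gr 0"
  shows "coord g (z \<otimes> a) = z \<otimes> coord g a"
  using coord_mult_right[of g a z] assms AG_gr_0 gr_0_central coord_closed by metis

text \<open>\<open>f g\<close> is homogeneous and \<open>A\<close> is a domain, so all components of the coordinate but one are zero.\<close>

lemma coord_gr:
  assumes g: "g \<in> carrier G" and a: "a \<in> gr i"
  shows "coord g a \<in> (if dg g \<le> i then gr (i - dg g) else {\<zero>})"
proof -
  have ac: "a \<in> carrier A" using a gr_closed by blast
  have "comp i (f g \<otimes> coord g a) = f g \<otimes> coord g a"
    using proj_gr[OF a, of g] coord[OF g ac] by (simp add: comp_homogeneous)
  then have "f g \<otimes> coord g a = f g \<otimes> (if dg g \<le> i then comp (i - dg g) (coord g a) else \<zero>)"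
    using comp_mult_left[OF coord_closed[OF g ac] f_gr[OF g], of i] g by (auto split: if_splits)
  then have "coord g a = (if dg g \<le> i then comp (i - dg g) (coord g a) else \<zero>)"
    using cancel_left[OF f_closed[OF g] coord_closed[OF g ac] _ f_nonzero[OF g]] ac g by auto
  then show ?thesis using comp_spec(1)[OF coord_closed[OF g ac], of "i - dg g"] by (metis singletonI)
qed

text \<open>Reducing the coordinates modulo the augmentation ideal of \<open>R\<close> gives the coordinates in the
  covariant ring with respect to the images of the \<open>f g\<close> (see \<open>I_iff\<close>).\<close>

definition lam :: "'g \<Rightarrow> 'a \<Rightarrow> 'a" where "lam g a = aug (coord g a)"

lemma lam_gr_0: "g \<in> carrier G \<Longrightarrow> a \<in> carrier A \<Longrightarrow> lam g a \<in> gr 0"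
  by (simp add: lam_def)

lemma lam_closed [simp]: "g \<in> carrier G \<Longrightarrow> a \<in> carrier A \<Longrightarrow> lam g a \<in> carrier A"
  by (simp add: lam_def)

lemma lam_add: "g \<in> carrier G \<Longrightarrow> a \<in> carrier A \<Longrightarrow> b \<in> carrier A \<Longrightarrow>
    lam g (a \<oplus> b) = lam g a \<oplus> lam g b"
  by (simp add: lam_def coord_add aug_add)

lemma lam_mult_right: "g \<in> carrier G \<Longrightarrow> a \<in> carrier A \<Longrightarrow> r \<in> R \<Longrightarrow>
    lam g (a \<otimes> r) = lam g a \<otimes> aug r"
  by (simp add: lam_def coord_mult_right aug_mult R_closed)

lemma lam_central: "g \<in> carrier G \<Longrightarrow> a \<in> carrier A \<Longrightarrow> z \<in> gr 0 \<Longrightarrow> lam g (z \<otimes> a) = z \<otimes> lam g a"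
  by (simp add: lam_def coord_central aug_mult gr_closed aug_homogeneous)

lemma lam_f: "g \<in> carrier G \<Longrightarrow> h \<in> carrier G \<Longrightarrow> lam g (f h) = (if g = h then \<one> else \<zero>)"
  using coord_f[of g h \<one>] one_R by (auto simp: lam_def)

lemma lam_R: "g \<in> carrier G \<Longrightarrow> r \<in> R \<Longrightarrow> lam g r = (if g = \<one>\<^bsub>G\<^esub> then aug r else \<zero>)"
  by (simp add: lam_def coord_R)

lemma lam_homogeneous:
  assumes "g \<in> carrier G" "a \<in> gr i" "i \<noteq> dg g" shows "lam g a = \<zero>"
  using coord_gr[OF assms(1,2)] assms(3) by (auto simp: lam_def aug_homogeneous split: if_splits)

text \<open>The part of \<open>x\<close> of positive degree moves \<open>f h\<close> into degrees above that of \<open>f g\<close>, where \<open>lam g\<close> is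
  zero. This is the triangularity of the action of \<open>A\<close> on the covariant ring.\<close>

lemma lam_mult_f:
  assumes g: "g \<in> carrier G" and h: "h \<in> carrier G" and le: "dg g \<le> dg h" and x: "x \<in> carrier A"
  shows "lam g (x \<otimes> f h) = aug x \<otimes> lam g (f h)"
  using x
proof (induction rule: homogeneous_induct)
  case (homogeneous i x)
  show ?case
  proof (cases "i = 0")
    case True
    then show ?thesis using homogeneous g h lam_central by (simp add: aug_homogeneous)
  next
    case False
    have "x \<otimes> f h \<in> gr (i + dg h)" using homogeneous f_gr[OF h] gr_mult by blast
    then show ?thesis using False homogeneous g h le lam_homogeneous by (auto simp: aug_homogeneous)
  qed
next
  case (add y z)
  then show ?case using g h by (simp add: A.l_distr lam_add aug_add)
qed

text \<open>Compare the components of degree \<open>n\<close>, the lowest ones, of both sides.\<close>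

lemma aug_conjugate:
  assumes "x \<in> gr n" "x \<noteq> \<zero>" "a \<in> carrier A" "b \<in> carrier A" "x \<otimes> a = b \<otimes> x"
  shows "aug a = aug b"
proof -
  have xc: "x \<in> carrier A" using assms gr_closed by blast
  have "comp n (x \<otimes> a) = x \<otimes> aug a" "comp n (b \<otimes> x) = aug b \<otimes> x"
    using comp_mult_left[OF assms(3,1), of n] comp_mult_right[OF assms(4,1), of n]
    by (simp_all add: aug_def)
  then have "aug a \<otimes> x = aug b \<otimes> x" using assms xc aug_central[of a x] by simp
  then show ?thesis using cancel_right[OF xc] assms by auto
qed

abbreviation I :: "'a set" where "I \<equiv> covariant_ideal K G A gr \<rho>"

text \<open>For multiplication from the right, coordinates are moved past \<open>f h\<close> using \<open>R f\<^sub>h = f\<^sub>h R\<close>,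
  which by \<open>aug_conjugate\<close> does not change their augmentation.\<close>

lemma lam_ideal: "ideal {a \<in> carrier A. \<forall>g\<in>carrier G. lam g a = \<zero>} A" (is "ideal ?J A")
proof (rule idealI)
  show "ring A" by (rule A.ring_axioms)
  have neg: "lam g (\<ominus> a) = \<ominus> lam g a" if "g \<in> carrier G" "a \<in> carrier A" for g a
    using lam_central[OF that gr_neg[OF one_gr_0]] that by (simp add: A.l_minus)
  show "subgroup ?J (add_monoid A)"
  proof (rule M.add.subgroupI)
    show "?J \<noteq> {}" using lam_R[OF _ AG_gr_0[OF gr_zero]] by (auto intro!: exI[of _ \<zero>])
  qed (auto simp: neg lam_add)
next
  fix a x assume a: "a \<in> ?J" and x: "x \<in> carrier A"
  then have ac: "a \<in> carrier A" and a0: "\<And>g. g \<in> carrier G \<Longrightarrow> aug (coord g a) = \<zero>"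
    by (auto simp: lam_def)
  have lam0: "lam k \<zero> = \<zero>" if "k \<in> carrier G" for k
    using that lam_R[OF _ AG_gr_0[OF gr_zero]] by auto
  have sum0: "lam k (\<Oplus>h\<in>S. u h) = \<zero>"
    if "finite S" "k \<in> carrier G" "\<And>h. h \<in> S \<Longrightarrow> u h \<in> carrier A" "\<And>h. h \<in> S \<Longrightarrow> lam k (u h) = \<zero>"
    for S u k
    using that
  proof (induction S rule: finite_induct)
    case (insert s S)
    then have "u \<in> S \<rightarrow> carrier A" by auto
    with insert show ?case by (simp add: lam_add)
  qed (simp add: lam0)
  have "x \<otimes> a = (\<Oplus>h\<in>carrier G. x \<otimes> (f h \<otimes> coord h a))"
    using sum_coord[OF ac] A.finsum_rdistr[OF finite_G x, of "\<lambda>h. f h \<otimes> coord h a"] ac by auto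
  moreover have "lam k (x \<otimes> (f h \<otimes> coord h a)) = \<zero>" if k: "k \<in> carrier G" and h: "h \<in> carrier G" for k h
  proof -
    have "x \<otimes> (f h \<otimes> coord h a) = (x \<otimes> f h) \<otimes> coord h a" using x h ac by (simp add: A.m_assoc)
    then show ?thesis using lam_mult_right[OF k, of "x \<otimes> f h" "coord h a"] a0[OF h] coord[OF h ac] x h k by simp
  qed
  ultimately have "lam k (x \<otimes> a) = \<zero>" if "k \<in> carrier G" for k
    using sum0[OF finite_G that, of "\<lambda>h. x \<otimes> (f h \<otimes> coord h a)"] that x ac by simp
  then show "x \<otimes> a \<in> ?J" using x ac by simp
  have "a \<otimes> x = (\<Oplus>h\<in>carrier G. a \<otimes> (f h \<otimes> coord h x))"
    using sum_coord[OF x] A.finsum_rdistr[OF finite_G ac, of "\<lambda>h. f h \<otimes> coord h x"] x by auto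
  moreover have "lam k (a \<otimes> (f h \<otimes> coord h x)) = \<zero>" if k: "k \<in> carrier G" and h: "h \<in> carrier G" for k h
  proof -
    have "lam k (a \<otimes> f h) = \<zero>"
    proof -
      have "a \<otimes> f h = (\<Oplus>l\<in>carrier G. (f l \<otimes> coord l a) \<otimes> f h)"
        using sum_coord[OF ac] A.finsum_ldistr[OF finite_G f_closed[OF h], of "\<lambda>h. f h \<otimes> coord h a"] ac by auto
      moreover have "lam k ((f l \<otimes> coord l a) \<otimes> f h) = \<zero>" if l: "l \<in> carrier G" for l
      proof -
        have "coord l a \<otimes> f h \<in> AG h" using coord[OF l ac] AG_right[OF h] by auto
        \<comment> \<open>move the coordinate past \<open>f h\<close>\<close>
        then obtain r where r: "r \<in> R" "coord l a \<otimes> f h = f h \<otimes> r" using AG_left[OF h] by auto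
        then have "aug r = \<zero>"
          using aug_conjugate[OF f_gr[OF h] f_nonzero[OF h], of r "coord l a"] R_closed l ac a0 by simp
        moreover have "(f l \<otimes> coord l a) \<otimes> f h = (f l \<otimes> f h) \<otimes> r"
          using r l h ac R_closed by (simp add: A.m_assoc)
        ultimately show ?thesis using lam_mult_right[OF k, of "f l \<otimes> f h" r] r l h k by simp
      qed
      ultimately show ?thesis
        using sum0[OF finite_G k, of "\<lambda>l. (f l \<otimes> coord l a) \<otimes> f h"] h ac by simp
    qed
    moreover have "a \<otimes> (f h \<otimes> coord h x) = (a \<otimes> f h) \<otimes> coord h x" using x h ac by (simp add: A.m_assoc)
    ultimately show ?thesis using lam_mult_right[OF k, of "a \<otimes> f h" "coord h x"] coord[OF h x] ac h x by simp
  qed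
  ultimately have "lam k (a \<otimes> x) = \<zero>" if "k \<in> carrier G" for k
    using sum0[OF finite_G that, of "\<lambda>h. a \<otimes> (f h \<otimes> coord h x)"] that x ac by simp
  then show "a \<otimes> x \<in> ?J" using x ac by simp
qed

lemma R_comp: "r \<in> R \<Longrightarrow> comp n r \<in> R" unfolding R_eq by (simp add: AG_comp)

lemma gens_sub: "(\<Union>n\<in>{1..}. gr n \<inter> R) \<subseteq> carrier A" using R_closed by auto

lemma I_ideal: "ideal I A"
  unfolding covariant_ideal_def by (rule A.genideal_ideal[OF gens_sub])

lemma I_closed: "a \<in> I \<Longrightarrow> a \<in> carrier A"
  by (rule ideal.Icarr[OF I_ideal])

lemma I_zero: "\<zero> \<in> I"
  by (rule additive_subgroup.zero_closed[OF ideal.axioms(1)[OF I_ideal]])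

lemma I_add: "a \<in> I \<Longrightarrow> b \<in> I \<Longrightarrow> a \<oplus> b \<in> I"
  by (rule additive_subgroup.a_closed[OF ideal.axioms(1)[OF I_ideal]])

lemma I_finsum: "finite S \<Longrightarrow> (\<And>s. s \<in> S \<Longrightarrow> u s \<in> I) \<Longrightarrow> (\<Oplus>s\<in>S. u s) \<in> I"
proof (induction S rule: finite_induct)
  case (insert x F)
  then have "u \<in> F \<rightarrow> carrier A" "u x \<in> carrier A" using I_closed by auto
  with insert show ?case by (simp add: I_add)
qed (simp add: I_zero)

lemma R_aug_I:
  assumes r: "r \<in> R" and 0: "aug r = \<zero>" shows "r \<in> I"
proof -
  have rc: "r \<in> carrier A" using r R_closed by blast
  have "comp n r \<in> I" for n
  proof (cases "n = 0")
    case True then show ?thesis using 0 I_zero by (simp add: aug_def)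
  next
    case False
    then have "comp n r \<in> (\<Union>n\<in>{1..}. gr n \<inter> R)"
      using comp_spec(1)[OF rc] R_comp[OF r] by (intro UN_I[of n]) auto
    then show ?thesis unfolding covariant_ideal_def using A.genideal_self[OF gens_sub] by blast
  qed
  then show ?thesis using comp_spec(2,3)[OF rc] I_finsum by metis
qed

text \<open>The ideal generated by the positive part of \<open>R\<close> is \<open>A R\<^sub>+\<close>, the sum of the \<open>f\<^sub>g R\<^sub>+\<close>; hence the images of the
  \<open>f g\<close> form a basis of the covariant ring.\<close>

lemma I_iff: "a \<in> I \<longleftrightarrow> a \<in> carrier A \<and> (\<forall>g\<in>carrier G. lam g a = \<zero>)"
proof
  have "I \<subseteq> {a \<in> carrier A. \<forall>g\<in>carrier G. lam g a = \<zero>}"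
    unfolding covariant_ideal_def
  proof (rule A.genideal_minimal[OF lam_ideal])
    show "(\<Union>n\<in>{1..}. gr n \<inter> R) \<subseteq> {a \<in> carrier A. \<forall>g\<in>carrier G. lam g a = \<zero>}"
      using R_closed lam_R by (auto simp: aug_homogeneous)
  qed
  then show "a \<in> I \<Longrightarrow> a \<in> carrier A \<and> (\<forall>g\<in>carrier G. lam g a = \<zero>)" by blast
next
  assume a: "a \<in> carrier A \<and> (\<forall>g\<in>carrier G. lam g a = \<zero>)"
  then have "f g \<otimes> coord g a \<in> I" if g: "g \<in> carrier G" for g
    using ideal.I_l_closed[OF I_ideal R_aug_I[OF coord(1)] f_closed] g by (auto simp: lam_def)
  then show "a \<in> I" using sum_coord[of a] I_finsum[OF finite_G, of "\<lambda>g. f g \<otimes> coord g a"] a by auto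
qed

end

section \<open>The socle of the covariant ring\<close>

context covariant_basis
begin

text \<open>A graded Frobenius form on the covariant ring is determined by \<open>F = \<langle>1, -\<rangle>\<close>, since
  \<open>\<langle>a, b\<rangle> = F (a b)\<close>. These are the properties of \<open>F\<close>, pulled back to \<open>A\<close>.\<close>

definition frobenius_functional :: "('a \<Rightarrow> 'k) \<Rightarrow> nat \<Rightarrow> bool" where
  "frobenius_functional F l \<longleftrightarrow> F \<in> carrier A \<rightarrow> carrier K \<and>
     (\<forall>x\<in>carrier A. \<forall>y\<in>carrier A. F (x \<oplus> y) = F x \<oplus>\<^bsub>K\<^esub> F y) \<and>
     (\<forall>c\<in>carrier K. \<forall>x\<in>carrier A. F (c \<odot> x) = c \<otimes>\<^bsub>K\<^esub> F x) \<and>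
     (\<forall>x\<in>I. F x = \<zero>\<^bsub>K\<^esub>) \<and> (\<forall>i. i \<noteq> l \<longrightarrow> (\<forall>x\<in>gr i. F x = \<zero>\<^bsub>K\<^esub>)) \<and>
     (\<forall>x\<in>carrier A. (\<forall>y\<in>carrier A. F (x \<otimes> y) = \<zero>\<^bsub>K\<^esub>) \<longrightarrow> x \<in> I)"

text \<open>In the covariant ring \<open>f t\<close> is a multiple of every \<open>f g\<close>, so it spans the socle. The equation holds in
  \<open>A\<close> itself, not only modulo the ideal, and this is what makes it useful.\<close>

definition socle_degree :: "'g \<Rightarrow> bool" where
  "socle_degree t \<longleftrightarrow> t \<in> carrier G \<and> (\<forall>g\<in>carrier G. \<exists>z\<in>gr 0.
      z \<noteq> \<zero> \<and> f g \<otimes> f (inv\<^bsub>G\<^esub> g \<cdot> t) = z \<otimes> f t)"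

lemma f_not_I: "g \<in> carrier G \<Longrightarrow> f g \<notin> I"
  using lam_f[of g g] one_nonzero I_iff by fastforce

text \<open>Every \<open>f g\<close> is nonzero in the covariant ring, so by nondegeneracy \<open>F (f\<^sub>g f\<^sub>h r) \<noteq> 0\<close> for some \<open>h\<close> and \<open>r \<in> R\<close>. Then the
  element \<open>s\<close> of \<open>R\<close> with \<open>f\<^sub>g f\<^sub>h = f\<^sub>g\<^sub>h s\<close> is homogeneous with nonzero augmentation, that is, a nonzero scalar,
  and \<open>F\<close> is nonzero on the basis element of degree \<open>g h\<close>. There is only one such basis element: if there
  were two, both in degree \<open>l\<close>, some combination \<open>x\<close> of them would satisfy \<open>F (x y) = 0\<close> for all \<open>y\<close>.\<close>

lemma frobenius_functional_socle:
  assumes F: "frobenius_functional F l"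
  obtains t where "socle_degree t" "F (f t) \<noteq> \<zero>\<^bsub>K\<^esub>" "dg t = l"
    "\<And>g. g \<in> carrier G \<Longrightarrow> g \<noteq> t \<Longrightarrow> dg g \<noteq> l"
proof -
  have Fc: "\<And>x. x \<in> carrier A \<Longrightarrow> F x \<in> carrier K"
    and Fadd: "\<And>x y. x \<in> carrier A \<Longrightarrow> y \<in> carrier A \<Longrightarrow> F (x \<oplus> y) = F x \<oplus>\<^bsub>K\<^esub> F y"
    and Fsm: "\<And>c x. c \<in> carrier K \<Longrightarrow> x \<in> carrier A \<Longrightarrow> F (c \<odot> x) = c \<otimes>\<^bsub>K\<^esub> F x"
    and FI: "\<And>x. x \<in> I \<Longrightarrow> F x = \<zero>\<^bsub>K\<^esub>" and Fgr: "\<And>i x. i \<noteq> l \<Longrightarrow> x \<in> gr i \<Longrightarrow> F x = \<zero>\<^bsub>K\<^esub>"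
    and Fnd: "\<And>x. x \<in> carrier A \<Longrightarrow> (\<And>y. y \<in> carrier A \<Longrightarrow> F (x \<otimes> y) = \<zero>\<^bsub>K\<^esub>) \<Longrightarrow> x \<in> I"
    using F unfolding frobenius_functional_def by (auto simp: Pi_iff)
  have F0: "F \<zero> = \<zero>\<^bsub>K\<^esub>" using FI I_zero by blast
  have Fsum: "\<exists>s\<in>S. F (u s) \<noteq> \<zero>\<^bsub>K\<^esub>"
    if "finite S" "\<And>s. s \<in> S \<Longrightarrow> u s \<in> carrier A" "F (\<Oplus>s\<in>S. u s) \<noteq> \<zero>\<^bsub>K\<^esub>" for S :: "'g set" and u
    using that
  proof (induction S rule: finite_induct)
    case (insert s S)
    then have "u \<in> S \<rightarrow> carrier A" "u s \<in> carrier A" by auto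
    with insert have "F (u s) \<oplus>\<^bsub>K\<^esub> F (\<Oplus>s\<in>S. u s) \<noteq> \<zero>\<^bsub>K\<^esub>" by (simp add: Fadd)
    then have "F (u s) \<noteq> \<zero>\<^bsub>K\<^esub> \<or> F (\<Oplus>s\<in>S. u s) \<noteq> \<zero>\<^bsub>K\<^esub>" by auto
    then show ?case using insert by auto
  qed (simp add: F0)
  \<comment> \<open>\<open>F (f g \<otimes> r)\<close> depends on the augmentation of \<open>r\<close> only\<close>
  have Ff: "F (f g) \<noteq> \<zero>\<^bsub>K\<^esub> \<and> aug r \<noteq> \<zero>"
    if g: "g \<in> carrier G" and r: "r \<in> R" and nz: "F (f g \<otimes> r) \<noteq> \<zero>\<^bsub>K\<^esub>" for g r
  proof -
    have rc: "r \<in> carrier A" using r R_closed by blast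
    obtain c where c: "c \<in> carrier K" "aug r = c \<odot> \<one>" using aug_gr_0[OF rc] unfolding gr_0 by auto
    have ar: "aug r \<in> R" using AG_gr_0 aug_gr_0[OF rc] by blast
    have "r \<ominus> aug r \<in> R" using r ar proj_minus[of r "aug r" "\<one>\<^bsub>G\<^esub>"] AG_iff[of "\<one>\<^bsub>G\<^esub>"] unfolding R_eq by auto
    moreover have "aug (r \<ominus> aug r) = \<zero>"
      using rc aug_add[of r "\<ominus> aug r"] by (simp add: a_minus_def aug_neg aug_homogeneous[OF aug_gr_0] M.r_neg)
    ultimately have "f g \<otimes> (r \<ominus> aug r) \<in> I"
      using ideal.I_l_closed[OF I_ideal R_aug_I f_closed[OF g]] by blast
    moreover have "f g \<otimes> r = f g \<otimes> (r \<ominus> aug r) \<oplus> c \<odot> f g"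
    proof -
      have "r = (r \<ominus> aug r) \<oplus> aug r" using rc by (simp add: a_minus_def M.a_assoc M.l_neg)
      then have "f g \<otimes> r = f g \<otimes> ((r \<ominus> aug r) \<oplus> aug r)" by simp
      also have "\<dots> = f g \<otimes> (r \<ominus> aug r) \<oplus> f g \<otimes> aug r" using rc g by (simp add: A.r_distr)
      also have "f g \<otimes> aug r = c \<odot> f g" using c g by (simp add: smult_mult_right)
      finally show ?thesis .
    qed
    ultimately have "F (f g \<otimes> r) = c \<otimes>\<^bsub>K\<^esub> F (f g)"
      using FI I_closed Fadd Fsm c g Fc by simp
    then have "c \<noteq> \<zero>\<^bsub>K\<^esub>" "F (f g) \<noteq> \<zero>\<^bsub>K\<^esub>" using nz c(1) Fc g by auto
    then show ?thesis using scalar_mult_nonzero c by simp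
  qed
  \<comment> \<open>the products that survive in the covariant ring\<close>
  have prod: "\<exists>h\<in>carrier G. F (f (g \<cdot> h)) \<noteq> \<zero>\<^bsub>K\<^esub> \<and>
      (\<exists>z\<in>gr 0. z \<noteq> \<zero> \<and> f g \<otimes> f h = z \<otimes> f (g \<cdot> h))"
    if g: "g \<in> carrier G" for g
  proof -
    obtain b where b: "b \<in> carrier A" "F (f g \<otimes> b) \<noteq> \<zero>\<^bsub>K\<^esub>" using Fnd[of "f g"] f_not_I g by auto
    have "f g \<otimes> b = (\<Oplus>h\<in>carrier G. f g \<otimes> (f h \<otimes> coord h b))"
      using sum_coord[OF b(1)] A.finsum_rdistr[OF finite_G f_closed[OF g], of "\<lambda>h. f h \<otimes> coord h b"] b by auto
    then obtain h where h: "h \<in> carrier G" "F (f g \<otimes> (f h \<otimes> coord h b)) \<noteq> \<zero>\<^bsub>K\<^esub>"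
      using Fsum[OF finite_G, of "\<lambda>h. f g \<otimes> (f h \<otimes> coord h b)"] b g by auto
    let ?k = "g \<cdot> h"
    have k: "?k \<in> carrier G" using g h by simp
    have fgh: "f g \<otimes> f h \<in> AG ?k" using AG_mult f_AG g h by blast
    then obtain s where s: "s \<in> R" "f g \<otimes> f h = f ?k \<otimes> s" using AG_left[OF k] by auto
    have sc: "s \<in> carrier A" using s R_closed by blast
    have rb: "coord h b \<in> R" using coord h b by blast
    have "F (f ?k \<otimes> (s \<otimes> coord h b)) \<noteq> \<zero>\<^bsub>K\<^esub>"
      using h s g b sc k by (simp flip: A.m_assoc)
    then have nz: "F (f ?k) \<noteq> \<zero>\<^bsub>K\<^esub>" "aug (s \<otimes> coord h b) \<noteq> \<zero>" using Ff[OF k R_mult[OF s(1) rb]] by auto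
    then have as: "aug s \<noteq> \<zero>" using aug_mult sc b h by auto
    have "s = coord ?k (f g \<otimes> f h)" using coord_f[OF k k s(1)] s(2) by simp
    moreover have "f g \<otimes> f h \<in> gr (dg g + dg h)" using gr_mult f_gr g h by blast
    ultimately obtain i where i: "s \<in> gr i" using coord_gr[OF k] gr_zero by (metis singletonD)
    then have "s \<in> gr 0" using as aug_homogeneous[of s i] by (auto split: if_splits)
    moreover have "s \<noteq> \<zero>" using as by auto
    ultimately show ?thesis using h nz s gr_0_central[of s "f ?k"] k
      by (intro bexI[of _ h] conjI bexI[of _ s]) simp_all
  qed
  obtain h where h: "h \<in> carrier G" "F (f (\<one>\<^bsub>G\<^esub> \<cdot> h)) \<noteq> \<zero>\<^bsub>K\<^esub>" using prod[of "\<one>\<^bsub>G\<^esub>"] by auto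
  define t where "t = h"
  have t: "t \<in> carrier G" and Ft: "F (f t) \<noteq> \<zero>\<^bsub>K\<^esub>" using h by (auto simp: t_def)
  have dgF: "dg g = l" if "g \<in> carrier G" "F (f g) \<noteq> \<zero>\<^bsub>K\<^esub>" for g
    using that Fgr f_gr by blast
  have uniq: "g = t" if g: "g \<in> carrier G" and Fg: "F (f g) \<noteq> \<zero>\<^bsub>K\<^esub>" for g
  proof (rule ccontr)
    assume ne: "g \<noteq> t"
    let ?x = "F (f t) \<odot> f g \<oplus> (\<ominus>\<^bsub>K\<^esub> F (f g)) \<odot> f t"
    have Fgt: "F (f t) \<in> carrier K" "F (f g) \<in> carrier K" using Fc g t by auto
    have xc: "?x \<in> carrier A" using g t Fgt by simp
    have xl: "?x \<in> gr l"
      using gr_add gr_smult Fgt f_gr[OF g] f_gr[OF t] dgF[OF g Fg] dgF[OF t Ft] by simp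
    have Fx: "F ?x = \<zero>\<^bsub>K\<^esub>" using g t Fgt by (simp add: Fadd Fsm R.l_minus R.r_minus R.m_comm R.r_neg)
    have "F (?x \<otimes> y) = \<zero>\<^bsub>K\<^esub>" if y: "y \<in> carrier A" for y
      using y
    proof (induction rule: homogeneous_induct)
      case (homogeneous i y)
      show ?case
      proof (cases "i = 0")
        case True
        then have "y \<in> gr 0" using homogeneous by simp
        then obtain c where "c \<in> carrier K" "y = c \<odot> \<one>" unfolding gr_0 by auto
        then show ?thesis using Fsm Fx xc by (simp add: smult_mult_right del: M.add.m_closed)
      next
        case False
        have "?x \<otimes> y \<in> gr (l + i)" using gr_mult xl homogeneous by blast
        then show ?thesis using Fgr[of "l + i"] False by simp
      qed
    next
      case (add y z)
      have "?x \<otimes> (y \<oplus> z) = ?x \<otimes> y \<oplus> ?x \<otimes> z" using A.r_distr add xc by simp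
      moreover have "?x \<otimes> y \<in> carrier A" "?x \<otimes> z \<in> carrier A" using add xc by simp_all
      ultimately show ?case using Fadd add.IH by simp
    qed
    then have "?x \<in> I" using Fnd[OF xc] by blast
    then have "lam g ?x = \<zero>" using g I_iff by blast
    moreover have "lam g ?x = F (f t) \<odot> \<one>"
    proof -
      have sm: "lam g (c \<odot> y) = c \<odot> lam g y" if "c \<in> carrier K" "y \<in> carrier A" for c y
        using lam_central[OF g that(2), of "c \<odot> \<one>"] that g scalar_eq[symmetric] unfolding gr_0 by simp
      show ?thesis using sm g t Fgt ne by (simp add: lam_add lam_f smult_r_null)
    qed
    ultimately show False using scalar_mult_nonzero Fgt Ft by simp
  qed
  have soc: "socle_degree t"
    unfolding socle_degree_def
  proof (intro conjI ballI t)
    fix g assume g: "g \<in> carrier G"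
    obtain h z where h: "h \<in> carrier G" "F (f (g \<cdot> h)) \<noteq> \<zero>\<^bsub>K\<^esub>"
      and z: "z \<in> gr 0" "z \<noteq> \<zero>" "f g \<otimes> f h = z \<otimes> f (g \<cdot> h)" using prod[OF g] by blast
    then have gh: "g \<cdot> h = t" using uniq g by simp
    then have "h = inv\<^bsub>G\<^esub> g \<cdot> t" using g h G.inv_solve_left t by metis
    then show "\<exists>z\<in>gr 0. z \<noteq> \<zero> \<and> f g \<otimes> f (inv\<^bsub>G\<^esub> g \<cdot> t) = z \<otimes> f t"
      using z gh by auto
  qed
  have "g = t" if g: "g \<in> carrier G" and l: "dg g = l" for g
  proof -
    let ?h = "inv\<^bsub>G\<^esub> g \<cdot> t"
    obtain z where z: "z \<in> gr 0" "z \<noteq> \<zero>" "f g \<otimes> f ?h = z \<otimes> f t" using soc g unfolding socle_degree_def by blast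
    have h: "?h \<in> carrier G" using g t by simp
    have "f g \<otimes> f ?h \<in> gr (dg g + dg ?h)" using gr_mult f_gr g h by blast
    moreover have "f g \<otimes> f ?h \<in> gr (0 + dg t)" using z gr_mult f_gr t by metis
    moreover have "f g \<otimes> f ?h \<noteq> \<zero>" 
      using integral_A[OF f_closed[OF g] f_closed[OF h]] f_nonzero[OF g] f_nonzero[OF h] by argo
    ultimately have "dg ?h = 0" using gr_unique l dgF[OF t Ft] by fastforce
    then have "?h = \<one>\<^bsub>G\<^esub>" using dg_zero h by blast
    moreover have "g \<cdot> ?h = t" using g t by (simp flip: G.m_assoc)
    ultimately show ?thesis using g by simp
  qed
  then show ?thesis using that[OF soc Ft dgF[OF t Ft]] by blast
qed

end

section \<open>Conjugation by the socle element\<close>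

context covariant_basis
begin

abbreviation "C \<equiv> covariant_ring K G A gr \<rho>"
abbreviation "to \<equiv> to_covariant K G A gr \<rho>"
abbreviation "grC \<equiv> covariant_grading K G A gr \<rho>"

lemma to_hom: "to \<in> ring_hom A (A Quot I)"
  unfolding to_covariant_def[abs_def] by (rule ideal.rcos_ring_hom[OF I_ideal])

lemma C_carrier: "carrier C = to ` carrier A"
  unfolding covariant_ring_def quotient_def to_covariant_def[abs_def]
  by (auto simp: FactRing_def A_RCOSETS_def')

lemma to_closed [simp]: "a \<in> carrier A \<Longrightarrow> to a \<in> carrier C"
  by (simp add: C_carrier)

lemma to_mult: "a \<in> carrier A \<Longrightarrow> b \<in> carrier A \<Longrightarrow> to a \<otimes>\<^bsub>C\<^esub> to b = to (a \<otimes> b)"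
  using ring_hom_mult[OF to_hom] by (simp add: covariant_ring_def quotient_def)

lemma to_add: "a \<in> carrier A \<Longrightarrow> b \<in> carrier A \<Longrightarrow> to a \<oplus>\<^bsub>C\<^esub> to b = to (a \<oplus> b)"
  using ring_hom_add[OF to_hom] by (simp add: covariant_ring_def quotient_def)

lemma to_one: "\<one>\<^bsub>C\<^esub> = to \<one>"
  using ring_hom_one[OF to_hom] by (simp add: covariant_ring_def quotient_def)

lemma to_eq: "a \<in> carrier A \<Longrightarrow> b \<in> carrier A \<Longrightarrow> to a = to b \<longleftrightarrow> a \<ominus> b \<in> I"
  unfolding to_covariant_def using A.quotient_eq_iff_same_a_r_cos[OF I_ideal] by auto

lemma zero_C: "\<zero>\<^bsub>C\<^esub> = to \<zero>"
  using ring_hom_zero[OF to_hom A.ring_axioms ideal.quotient_is_ring[OF I_ideal]]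
  by (simp add: covariant_ring_def quotient_def)

lemma to_zero_iff: "a \<in> carrier A \<Longrightarrow> to a = \<zero>\<^bsub>C\<^esub> \<longleftrightarrow> a \<in> I"
  using to_eq[of a \<zero>] zero_C by (simp add: a_minus_def)

lemma I_smult: "c \<in> carrier K \<Longrightarrow> x \<in> I \<Longrightarrow> c \<odot> x \<in> I"
  using ideal.I_l_closed[OF I_ideal, of x "c \<odot> \<one>"] scalar_eq[of c x] I_closed[of x] by simp

lemma to_smult:
  assumes c: "c \<in> carrier K" and a: "a \<in> carrier A"
  shows "c \<odot>\<^bsub>C\<^esub> to a = to (c \<odot> a)"
proof -
  have eq: "I +> (c \<odot> x) = to (c \<odot> a)" if x: "x \<in> to a" for x
  proof -
    obtain i where i: "i \<in> I" "x = i \<oplus> a"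
      using x unfolding to_covariant_def by (auto simp: a_r_coset_def')
    then have ic: "i \<in> carrier A" using I_closed by blast
    have "c \<odot> x \<ominus> c \<odot> a = c \<odot> i"
      using i ic a c by (simp add: smult_r_distr a_minus_def M.a_assoc M.r_neg)
    then have "c \<odot> x \<ominus> c \<odot> a \<in> I" using I_smult c i by simp
    then have "to (c \<odot> x) = to (c \<odot> a)" using to_eq c a i ic by simp
    then show ?thesis by (simp add: to_covariant_def)
  qed
  have "a \<in> to a" unfolding to_covariant_def using I_zero a by (force simp: a_r_coset_def')
  moreover have "c \<odot>\<^bsub>C\<^esub> to a = (\<Union>x\<in>to a. I +> (c \<odot> x))"
    by (simp add: covariant_ring_def quotient_def)
  ultimately show ?thesis using eq by blast
qed

lemma aug_scalar: "a \<in> carrier A \<Longrightarrow> \<exists>c\<in>carrier K. aug a = c \<odot> \<one>"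
  using aug_gr_0 unfolding gr_0 by blast

lemma to_R: "r \<in> R \<Longrightarrow> to r = to (aug r)"
proof -
  assume r: "r \<in> R"
  have rc: "r \<in> carrier A" using r R_closed by blast
  have ar: "aug r \<in> R" using AG_gr_0 aug_gr_0[OF rc] by blast
  have "r \<ominus> aug r \<in> R"
    using r ar proj_minus[of r "aug r" "\<one>\<^bsub>G\<^esub>"] AG_iff[of "\<one>\<^bsub>G\<^esub>"] unfolding R_eq by auto
  moreover have "aug (r \<ominus> aug r) = \<zero>"
    using rc aug_add[of r "\<ominus> aug r"]
    by (simp add: a_minus_def aug_neg aug_homogeneous[OF aug_gr_0] M.r_neg)
  ultimately show ?thesis using to_eq rc R_aug_I by simp
qed

lemma conj_by_unique:
  assumes "x \<in> carrier A" "x \<noteq> \<zero>" "b \<in> carrier A" "x \<otimes> a = b \<otimes> x"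
  shows "conj_by A x a = b"
  unfolding conj_by_def
  by (rule the_equality) (use assms cancel_right[OF assms(1) _ _ assms(2)] in auto)

lemma conj_by:
  assumes x: "normal_element A x" "x \<noteq> \<zero>" and a: "a \<in> carrier A"
  shows "conj_by A x a \<in> carrier A" "x \<otimes> a = conj_by A x a \<otimes> x"
proof -
  have xc: "x \<in> carrier A" using x(1) by (simp add: normal_element_def)
  have "x \<otimes> a \<in> (\<lambda>a. a \<otimes> x) ` carrier A" using x(1) a unfolding normal_element_def by blast
  then obtain b where "b \<in> carrier A" "x \<otimes> a = b \<otimes> x" by auto
  then show "conj_by A x a \<in> carrier A" "x \<otimes> a = conj_by A x a \<otimes> x"
    using conj_by_unique[OF xc x(2)] by auto
qed

lemma conj_by_automorphism:
  assumes x: "normal_element A x" "x \<noteq> \<zero>"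
  shows "conj_by A x \<in> algebra_auts K A"
proof -
  have xc: "x \<in> carrier A" using x(1) by (simp add: normal_element_def)
  note c = conj_by[OF x]
  have add: "conj_by A x (a \<oplus> b) = conj_by A x a \<oplus> conj_by A x b"
    if "a \<in> carrier A" "b \<in> carrier A" for a b
    by (rule conj_by_unique[OF xc x(2)]) (use that c xc in \<open>simp_all add: A.r_distr A.l_distr\<close>)
  have mult: "conj_by A x (a \<otimes> b) = conj_by A x a \<otimes> conj_by A x b"
    if ab: "a \<in> carrier A" "b \<in> carrier A" for a b
  proof (rule conj_by_unique[OF xc x(2)])
    have "x \<otimes> (a \<otimes> b) = (conj_by A x a \<otimes> x) \<otimes> b" using ab c xc by (simp flip: A.m_assoc)
    also have "\<dots> = conj_by A x a \<otimes> (conj_by A x b \<otimes> x)" using ab c xc by (simp add: A.m_assoc)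
    finally show "x \<otimes> (a \<otimes> b) = conj_by A x a \<otimes> conj_by A x b \<otimes> x" using ab c xc by (simp add: A.m_assoc)
  qed (use ab c in simp)
  have one: "conj_by A x \<one> = \<one>" by (rule conj_by_unique[OF xc x(2)]) (use xc in auto)
  have sm: "conj_by A x (k \<odot> a) = k \<odot> conj_by A x a" if "k \<in> carrier K" "a \<in> carrier A" for k a
    by (rule conj_by_unique[OF xc x(2)])
      (use that c xc in \<open>simp_all add: smult_mult_right smult_mult_left\<close>)
  have "inj_on (conj_by A x) (carrier A)"
    by (rule inj_onI) (metis c(2) cancel_left[OF xc _ _ x(2)])
  moreover have "b \<in> conj_by A x ` carrier A" if b: "b \<in> carrier A" for b
  proof -
    have "b \<otimes> x \<in> (\<lambda>a. x \<otimes> a) ` carrier A" using x(1) b unfolding normal_element_def by blast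
    then obtain a where "a \<in> carrier A" "x \<otimes> a = b \<otimes> x" by auto
    then show ?thesis using conj_by_unique[OF xc x(2) b] by (metis image_eqI)
  qed
  ultimately have "bij_betw (conj_by A x) (carrier A) (carrier A)"
    using c(1) by (auto simp: bij_betw_def)
  then show ?thesis
    unfolding algebra_auts_def ring_iso_def ring_hom_def mod_hom_def
    using add mult one sm c(1) by auto
qed

text \<open>Put \<open>k = m h m\<^sup>-\<^sup>1\<close> and \<open>x = m h\<^sup>-\<^sup>1\<close>, so that \<open>k x = m = x h\<close>. Up to nonzero scalars,
  \<open>f\<^sub>m f\<^sub>h = f\<^sub>k f\<^sub>x f\<^sub>h = f\<^sub>k f\<^sub>m\<close>. Together with \<open>f\<^sub>m R = R f\<^sub>m\<close> this makes \<open>f m\<close> normal.\<close>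

theorem socle_element_normal:
  assumes m: "socle_degree m" shows "normal_element A (f m)"
    and "h \<in> carrier G \<Longrightarrow> \<exists>z\<in>gr 0. f m \<otimes> f h = z \<otimes> f (m \<cdot> h \<cdot> inv\<^bsub>G\<^esub> m) \<otimes> f m"
proof -
  have mG: "m \<in> carrier G" using m by (simp add: socle_degree_def)
  have div: "\<exists>z\<in>gr 0. z \<noteq> \<zero> \<and> f g \<otimes> f h = z \<otimes> f m" if "g \<in> carrier G" "h \<in> carrier G" "g \<cdot> h = m" for g h
  proof -
    have "h = inv\<^bsub>G\<^esub> g \<cdot> m" using that mG G.inv_solve_left by metis
    then show ?thesis using m that unfolding socle_degree_def by blast
  qed
  have move: "\<exists>z\<in>gr 0. z \<noteq> \<zero> \<and> f m \<otimes> f h = z \<otimes> f (m \<cdot> h \<cdot> inv\<^bsub>G\<^esub> m) \<otimes> f m"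
    if h: "h \<in> carrier G" for h
  proof -
    let ?g = "m \<cdot> h \<cdot> inv\<^bsub>G\<^esub> m" and ?x = "m \<cdot> inv\<^bsub>G\<^esub> h"
    have G: "?g \<in> carrier G" "?x \<in> carrier G" using h mG by auto
    have "?g \<cdot> ?x = m" "?x \<cdot> h = m"
      using h mG by (simp_all add: G.m_assoc) (simp add: G.m_assoc[symmetric])
    then obtain z w where z: "z \<in> gr 0" "z \<noteq> \<zero>" "f ?g \<otimes> f ?x = z \<otimes> f m"
      and w: "w \<in> gr 0" "w \<noteq> \<zero>" "f ?x \<otimes> f h = w \<otimes> f m" using div G h by metis
    obtain v where v: "v \<in> gr 0" "v \<otimes> z = \<one>" using gr_0_unit[OF z(1,2)] by blast
    have c: "v \<in> carrier A" "z \<in> carrier A" "w \<in> carrier A" using v z w gr_closed by auto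
    have "f m \<otimes> f h = v \<otimes> ((z \<otimes> f m) \<otimes> f h)" using v c mG h by (simp flip: A.m_assoc)
    also have "\<dots> = v \<otimes> (f ?g \<otimes> (f ?x \<otimes> f h))" using z(3) G h by (simp flip: z(3) add: A.m_assoc)
    also have "\<dots> = v \<otimes> ((f ?g \<otimes> w) \<otimes> f m)" using w(3) G h mG c by (simp add: A.m_assoc)
    also have "f ?g \<otimes> w = w \<otimes> f ?g" using gr_0_central[OF w(1)] G by simp
    finally have "f m \<otimes> f h = (v \<otimes> w) \<otimes> f ?g \<otimes> f m" using c G mG by (simp add: A.m_assoc)
    moreover have "v \<otimes> w \<in> gr 0" using gr_mult[OF v(1) w(1)] by simp
    moreover have "v \<otimes> w \<noteq> \<zero>" using integral_A c v w one_nonzero by (metis A.l_null)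
    ultimately show ?thesis by blast
  qed
  then show "h \<in> carrier G \<Longrightarrow> \<exists>z\<in>gr 0. f m \<otimes> f h = z \<otimes> f (m \<cdot> h \<cdot> inv\<^bsub>G\<^esub> m) \<otimes> f m"
    by blast
  have LR: "f m \<otimes> (f h \<otimes> r) \<in> (\<lambda>a. a \<otimes> f m) ` carrier A" if h: "h \<in> carrier G" and r: "r \<in> R" for h r
  proof -
    obtain z where z: "z \<in> gr 0" "f m \<otimes> f h = z \<otimes> f (m \<cdot> h \<cdot> inv\<^bsub>G\<^esub> m) \<otimes> f m" using move[OF h] by blast
    have "f m \<otimes> r \<in> AG m" using AG_left[OF mG] r by blast
    then obtain s where s: "s \<in> R" "f m \<otimes> r = s \<otimes> f m" using AG_right[OF mG] by auto
    have c: "z \<in> carrier A" "s \<in> carrier A" "r \<in> carrier A" using z s r gr_closed R_closed by auto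
    have g: "f (m \<cdot> h \<cdot> inv\<^bsub>G\<^esub> m) \<in> carrier A" using mG h by simp
    have "f m \<otimes> (f h \<otimes> r) = z \<otimes> f (m \<cdot> h \<cdot> inv\<^bsub>G\<^esub> m) \<otimes> (f m \<otimes> r)"
      using z(2) c h mG g by (simp flip: A.m_assoc)
    also have "\<dots> = (z \<otimes> f (m \<cdot> h \<cdot> inv\<^bsub>G\<^esub> m) \<otimes> s) \<otimes> f m"
      using s c mG h g by (simp add: A.m_assoc)
    finally show ?thesis using c g by (metis A.m_closed image_eqI)
  qed
  have RL: "(r \<otimes> f h) \<otimes> f m \<in> (\<lambda>a. f m \<otimes> a) ` carrier A" if h: "h \<in> carrier G" and r: "r \<in> R" for h r
  proof -
    let ?k = "inv\<^bsub>G\<^esub> m \<cdot> h \<cdot> m"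
    have k: "?k \<in> carrier G" "m \<cdot> ?k \<cdot> inv\<^bsub>G\<^esub> m = h"
      using mG h by (simp_all add: G.m_assoc) (simp flip: G.m_assoc)
    then obtain z where z: "z \<in> gr 0" "z \<noteq> \<zero>" "f m \<otimes> f ?k = z \<otimes> f h \<otimes> f m" using move[OF k(1)] by auto
    obtain v where v: "v \<in> gr 0" "v \<otimes> z = \<one>" using gr_0_unit[OF z(1,2)] by blast
    have "r \<otimes> f m \<in> AG m" using AG_right[OF mG] r by blast
    then obtain s where s: "s \<in> R" "r \<otimes> f m = f m \<otimes> s" using AG_left[OF mG] by auto
    have c: "z \<in> carrier A" "v \<in> carrier A" "s \<in> carrier A" "r \<in> carrier A"
      using z v s r gr_closed R_closed by auto
    have "f h \<otimes> f m = v \<otimes> (z \<otimes> f h \<otimes> f m)" using v c h mG by (simp flip: A.m_assoc)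
    then have "(r \<otimes> f h) \<otimes> f m = r \<otimes> (v \<otimes> (f m \<otimes> f ?k))" using z(3) c h mG by (simp add: A.m_assoc)
    also have "\<dots> = v \<otimes> ((r \<otimes> f m) \<otimes> f ?k)"
      using gr_0_central[OF v(1) c(4)] c mG k by (metis A.m_assoc A.m_closed f_closed)
    also have "\<dots> = (v \<otimes> f m) \<otimes> (s \<otimes> f ?k)" using s c mG k(1) by (simp add: A.m_assoc)
    also have "\<dots> = f m \<otimes> (v \<otimes> (s \<otimes> f ?k))"
      using gr_0_central[OF v(1), of "f m"] c mG k(1) by (simp add: A.m_assoc)
    finally show ?thesis using c k(1) by (metis A.m_closed f_closed image_eqI)
  qed
  have sub1: "f m \<otimes> a \<in> (\<lambda>a. a \<otimes> f m) ` carrier A" if a: "a \<in> carrier A" for a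
    using a
  proof (induction rule: proj_induct)
    case (proj h)
    then show ?case using LR[OF proj coord(1)[OF proj a]] coord(2)[OF proj a] by simp
  next
    case (add y z)
    then obtain y' z' where "y' \<in> carrier A" "z' \<in> carrier A" "f m \<otimes> y = y' \<otimes> f m" "f m \<otimes> z = z' \<otimes> f m" by auto
    then have "f m \<otimes> (y \<oplus> z) = (y' \<oplus> z') \<otimes> f m" using add mG by (simp add: A.r_distr A.l_distr)
    then show ?case using \<open>y' \<in> carrier A\<close> \<open>z' \<in> carrier A\<close> by blast
  qed (use mG in \<open>auto intro!: image_eqI[of _ _ \<zero>]\<close>)
  have sub2: "a \<otimes> f m \<in> (\<lambda>a. f m \<otimes> a) ` carrier A" if a: "a \<in> carrier A" for a
    using a
  proof (induction rule: proj_induct)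
    case (proj h)
    obtain r where "r \<in> R" "proj h a = r \<otimes> f h" using proj_AG[OF a, of h] AG_right[OF proj] by auto
    then show ?case using RL[OF proj] by simp
  next
    case (add y z)
    then obtain y' z' where "y' \<in> carrier A" "z' \<in> carrier A" "y \<otimes> f m = f m \<otimes> y'" "z \<otimes> f m = f m \<otimes> z'" by auto
    then have "(y \<oplus> z) \<otimes> f m = f m \<otimes> (y' \<oplus> z')" using add mG by (simp add: A.r_distr A.l_distr)
    then show ?case using \<open>y' \<in> carrier A\<close> \<open>z' \<in> carrier A\<close> by blast
  qed (use mG in \<open>auto intro!: image_eqI[of _ _ \<zero>]\<close>)
  show "normal_element A (f m)" unfolding normal_element_def using sub1 sub2 mG by auto
qed

lemma socle_element_conj:
  assumes m: "socle_degree m"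
  shows "conj_by A (f m) ` R = R"
    and "a \<in> carrier A \<Longrightarrow> aug (conj_by A (f m) a) = aug a"
proof -
  have mG: "m \<in> carrier G" using m by (simp add: socle_degree_def)
  note x = socle_element_normal(1)[OF m] f_nonzero[OF mG]
  note u = conj_by_unique[OF f_closed[OF mG] x(2)]
  show "conj_by A (f m) ` R = R"
  proof (intro Set.equalityI subsetI)
    fix y assume "y \<in> conj_by A (f m) ` R"
    then obtain r where r: "r \<in> R" "y = conj_by A (f m) r" by auto
    have "f m \<otimes> r \<in> AG m" using AG_left[OF mG] r by blast
    then obtain s where s: "s \<in> R" "f m \<otimes> r = s \<otimes> f m" using AG_right[OF mG] by auto
    then show "y \<in> R" using u[OF R_closed[OF s(1)] s(2)] r by simp
  next
    fix s assume s: "s \<in> R"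
    have "s \<otimes> f m \<in> AG m" using AG_right[OF mG] s by blast
    then obtain r where r: "r \<in> R" "s \<otimes> f m = f m \<otimes> r" using AG_left[OF mG] by auto
    then show "s \<in> conj_by A (f m) ` R" using u[OF R_closed[OF s] r(2)[symmetric]] by (metis image_eqI)
  qed
  show "a \<in> carrier A \<Longrightarrow> aug (conj_by A (f m) a) = aug a"
    using aug_conjugate[OF f_gr[OF mG] x(2)] conj_by[OF x] by metis
qed

text \<open>Associativity gives \<open>B(a, b) = B(1, a b)\<close>, and \<open>1\<close> has degree 0.\<close>

lemma frobenius_form_functional:
  assumes B: "frobenius_form K C grC B"
  obtains l where "frobenius_functional (\<lambda>a. B (to \<one>) (to a)) l"
    "\<And>a b. a \<in> carrier A \<Longrightarrow> b \<in> carrier A \<Longrightarrow> B (to a) (to b) = B (to \<one>) (to (a \<otimes> b))"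
proof -
  have Bhom: "\<And>c. c \<in> carrier C \<Longrightarrow> B c \<in> mod_hom K C (regular_module K)"
    and Bassoc: "\<And>a b c. a \<in> carrier C \<Longrightarrow> b \<in> carrier C \<Longrightarrow> c \<in> carrier C \<Longrightarrow>
        B (a \<otimes>\<^bsub>C\<^esub> b) c = B a (b \<otimes>\<^bsub>C\<^esub> c)"
    and Bnd: "\<And>a. a \<in> carrier C \<Longrightarrow> (\<And>b. b \<in> carrier C \<Longrightarrow> B a b = \<zero>\<^bsub>K\<^esub>) \<Longrightarrow> a = \<zero>\<^bsub>C\<^esub>"
    using B unfolding frobenius_form_def by auto
  obtain l where l: "\<And>i j a b. int i + int j \<noteq> l \<Longrightarrow> a \<in> grC i \<Longrightarrow> b \<in> grC j \<Longrightarrow> B a b = \<zero>\<^bsub>K\<^esub>"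
    using B unfolding frobenius_form_def by metis
  have mult: "B (to a) (to b) = B (to \<one>) (to (a \<otimes> b))" if "a \<in> carrier A" "b \<in> carrier A" for a b
    using Bassoc[of "to \<one>" "to a" "to b"] that by (simp add: to_mult)
  let ?F = "\<lambda>a. B (to \<one>) (to a)"
  have lin: "?F x \<in> carrier K" "?F (x \<oplus> y) = ?F x \<oplus>\<^bsub>K\<^esub> ?F y" "c \<in> carrier K \<Longrightarrow> ?F (c \<odot> x) = c \<otimes>\<^bsub>K\<^esub> ?F x"
    if "x \<in> carrier A" "y \<in> carrier A" for x y c
    using Bhom[of "to \<one>"] that
    by (auto simp: mod_hom_def regular_module_def to_add[symmetric] to_smult[symmetric] Pi_iff)
  have F0: "?F \<zero> = \<zero>\<^bsub>K\<^esub>"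
    using lin(1)[of \<zero> \<zero>] lin(3)[of \<zero> \<zero> "\<zero>\<^bsub>K\<^esub>"] by simp
  have nd: "x \<in> I" if x: "x \<in> carrier A" and 0: "\<forall>y\<in>carrier A. ?F (x \<otimes> y) = \<zero>\<^bsub>K\<^esub>" for x
  proof -
    have "B (to x) b = \<zero>\<^bsub>K\<^esub>" if "b \<in> carrier C" for b
      using that 0 mult[OF x] unfolding C_carrier by auto
    then show ?thesis using Bnd[of "to x"] to_zero_iff x by simp
  qed
  have gr1: "to \<one> \<in> grC 0" and grx: "x \<in> gr i \<Longrightarrow> to x \<in> grC i" for x i
    using one_gr_0 by (auto simp: covariant_grading_def)
  have Fgr: "?F x = \<zero>\<^bsub>K\<^esub>" if "i \<noteq> nat l" "x \<in> gr i" for i x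
  proof -
    have "int 0 + int i \<noteq> l \<or> l < 0" using that(1) by auto
    moreover have "int 0 + int i \<noteq> l" if "l < 0" using that by auto
    ultimately show ?thesis using l[OF _ gr1 grx[OF that(2)]] by blast
  qed
  have FI: "?F x = \<zero>\<^bsub>K\<^esub>" if "x \<in> I" for x
    using to_zero_iff[OF I_closed[OF that]] that F0 zero_C by simp
  have "frobenius_functional ?F (nat l)"
    unfolding frobenius_functional_def using lin nd Fgr FI by auto
  then show ?thesis using that mult by blast
qed

text \<open>The part of the covariant ring in the degree of the socle is one-dimensional.\<close>

lemma lam_gr_socle:
  assumes "socle_degree m" "\<And>g. g \<in> carrier G \<Longrightarrow> g \<noteq> m \<Longrightarrow> dg g \<noteq> dg m" "a \<in> gr (dg m)"
  shows "to a = to (lam m a \<otimes> f m)"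
proof -
  have mG: "m \<in> carrier G" using assms(1) by (simp add: socle_degree_def)
  have ac: "a \<in> carrier A" using assms(3) gr_closed by blast
  have neg: "lam g (\<ominus> b) = \<ominus> lam g b" if "g \<in> carrier G" "b \<in> carrier A" for g b
    using lam_central[OF that gr_neg[OF one_gr_0]] that by (simp add: A.l_minus)
  have "lam g (a \<ominus> lam m a \<otimes> f m) = \<zero>" if g: "g \<in> carrier G" for g
  proof -
    have "lam g (a \<ominus> lam m a \<otimes> f m) = lam g a \<ominus> lam m a \<otimes> lam g (f m)"
      using lam_central[OF g f_closed[OF mG] lam_gr_0[OF mG ac]] g mG ac
      by (simp add: a_minus_def lam_add neg)
    then show ?thesis
      using lam_homogeneous[OF g assms(3)] assms(2)[OF g] g mG ac lam_f[OF g mG]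
      by (cases "g = m") (auto simp: a_minus_def M.r_neg)
  qed
  then have "a \<ominus> lam m a \<otimes> f m \<in> I" using ac mG by (simp add: I_iff)
  then show ?thesis using to_eq ac mG by simp
qed

text \<open>With \<open>k = m h m\<^sup>-\<^sup>1\<close> and \<open>x = m h\<^sup>-\<^sup>1\<close>, the definition of \<open>\<mu>\<close> says \<open>F (f\<^sub>x f\<^sub>h) = \<beta>(h) F (f\<^sub>k f\<^sub>x)\<close>, and
  both arguments are multiples of \<open>f m\<close>; so \<open>\<beta>(h)\<close> is the scalar in the commutation rule for \<open>f m\<close> and
  \<open>f h\<close>. On \<open>R\<close> both \<open>\<mu>\<close> and the conjugation reduce to the augmentation. A graded automorphism \<open>\<sigma>\<close> acts on
  the socle by a scalar \<open>s\<close>, hence \<open>F (\<sigma> c) = s F c\<close>, and comparing \<open>\<langle>\<sigma>(\<mu> c), -\<rangle>\<close> with \<open>\<langle>\<mu>(\<sigma> c), -\<rangle>\<close> gives the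
  last claim.\<close>

theorem socle_conjugation_nakayama:
  fixes \<mu> \<sigma> :: "'a set \<Rightarrow> 'a set"
  assumes m: "socle_degree m"
    and \<mu>: "\<mu> \<in> graded_auts K C grC"
    and B: "frobenius_form K C grC B"
    and F: "frobenius_functional (\<lambda>a. B (to \<one>) (to a)) l"
    and Fm: "B (to \<one>) (to (f m)) \<noteq> \<zero>\<^bsub>K\<^esub>" and dgm: "dg m = l"
    and uniq: "\<And>g. g \<in> carrier G \<Longrightarrow> g \<noteq> m \<Longrightarrow> dg g \<noteq> l"
    and B_mult: "\<And>a b. a \<in> carrier A \<Longrightarrow> b \<in> carrier A \<Longrightarrow> B (to a) (to b) = B (to \<one>) (to (a \<otimes> b))"
    and nak: "\<And>a b. a \<in> carrier C \<Longrightarrow> b \<in> carrier C \<Longrightarrow> B a b = B (\<mu> b) a"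
    and \<beta>: "\<And>g. g \<in> carrier G \<Longrightarrow> \<beta> g \<in> carrier K"
    and \<mu>\<beta>: "\<And>g. g \<in> carrier G \<Longrightarrow>
           \<mu> (to (f g)) = \<beta> g \<odot>\<^bsub>C\<^esub> to (f (m \<cdot> g \<cdot> inv\<^bsub>G\<^esub> m))"
  shows "g \<in> carrier G \<Longrightarrow> conj_by A (f m) (f g) = \<beta> g \<odot> f (m \<cdot> g \<cdot> inv\<^bsub>G\<^esub> m)"
    and "a \<in> carrier A \<Longrightarrow> \<mu> (to a) = to (conj_by A (f m) a)"
    and "\<sigma> \<in> graded_auts K C grC \<Longrightarrow> c \<in> carrier C \<Longrightarrow> \<sigma> (\<mu> c) = \<mu> (\<sigma> c)"
proof -
  have mG: "m \<in> carrier G" using m by (simp add: socle_degree_def)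
  note x = socle_element_normal(1)[OF m] f_nonzero[OF mG]
  let ?F = "\<lambda>a. B (to \<one>) (to a)"
  have Fc: "\<And>x. x \<in> carrier A \<Longrightarrow> ?F x \<in> carrier K"
    and Fsm: "\<And>c x. c \<in> carrier K \<Longrightarrow> x \<in> carrier A \<Longrightarrow> ?F (c \<odot> x) = c \<otimes>\<^bsub>K\<^esub> ?F x"
    and Fadd: "\<And>x y. x \<in> carrier A \<Longrightarrow> y \<in> carrier A \<Longrightarrow> ?F (x \<oplus> y) = ?F x \<oplus>\<^bsub>K\<^esub> ?F y"
    and Fgr: "\<And>i x. i \<noteq> l \<Longrightarrow> x \<in> gr i \<Longrightarrow> ?F x = \<zero>\<^bsub>K\<^esub>"
    and Fnd: "\<And>x. x \<in> carrier A \<Longrightarrow> (\<And>y. y \<in> carrier A \<Longrightarrow> ?F (x \<otimes> y) = \<zero>\<^bsub>K\<^esub>) \<Longrightarrow> x \<in> I"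
    using F unfolding frobenius_functional_def by (auto simp: Pi_iff)
  have scal: "z = w" if zw: "z \<in> gr 0" "w \<in> gr 0" "?F (z \<otimes> f m) = ?F (w \<otimes> f m)" for z w
  proof -
    obtain a b where ab: "a \<in> carrier K" "z = a \<odot> \<one>" "b \<in> carrier K" "w = b \<odot> \<one>"
      using zw(1,2) unfolding gr_0 by blast
    then have "a \<otimes>\<^bsub>K\<^esub> ?F (f m) = b \<otimes>\<^bsub>K\<^esub> ?F (f m)"
      using zw(3) Fsm mG by (simp add: scalar_eq[symmetric])
    then have "a = b" using K.m_rcancel[of "?F (f m)" a b] ab Fc[OF f_closed[OF mG]] Fm by simp
    then show ?thesis using ab by simp
  qed
  have \<mu>C: "\<mu> \<in> ring_hom C C" "\<mu> \<in> mod_hom K C C" "\<And>c. c \<in> carrier C \<Longrightarrow> \<mu> c \<in> carrier C"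
    using \<mu> unfolding graded_auts_def algebra_auts_def ring_iso_def by (auto simp: ring_hom_def)
  have conj_f: "conj_by A (f m) (f h) = \<beta> h \<odot> f (m \<cdot> h \<cdot> inv\<^bsub>G\<^esub> m)" if h: "h \<in> carrier G" for h
  proof (rule conj_by_unique[OF f_closed[OF mG] x(2)])
    let ?g = "m \<cdot> h \<cdot> inv\<^bsub>G\<^esub> m" and ?x = "m \<cdot> inv\<^bsub>G\<^esub> h"
    have G: "?g \<in> carrier G" "?x \<in> carrier G" using h mG by auto
    have gx: "inv\<^bsub>G\<^esub> ?g \<cdot> m = ?x" and xh: "inv\<^bsub>G\<^esub> ?x \<cdot> m = h"
      using h mG by (simp_all add: G.m_assoc G.inv_mult_group)
    obtain z where z: "z \<in> gr 0" "z \<noteq> \<zero>" "f ?g \<otimes> f ?x = z \<otimes> f m"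
      using m[unfolded socle_degree_def, THEN conjunct2, rule_format, OF G(1)] gx by auto
    obtain w where w: "w \<in> gr 0" "f ?x \<otimes> f h = w \<otimes> f m"
      using m[unfolded socle_degree_def, THEN conjunct2, rule_format, OF G(2)] xh by auto
    have c: "z \<in> carrier A" "w \<in> carrier A" using z w gr_closed by auto
    have b: "\<beta> h \<in> carrier K" using \<beta> h by blast
    have "?F (w \<otimes> f m) = B (to (f ?x)) (to (f h))" using B_mult[OF f_closed[OF G(2)] f_closed[OF h]] w by simp
    also have "\<dots> = B (\<beta> h \<odot>\<^bsub>C\<^esub> to (f ?g)) (to (f ?x))" using nak \<mu>\<beta>[OF h] G h by simp
    also have "\<dots> = ?F (\<beta> h \<odot> f ?g \<otimes> f ?x)" using b G B_mult[of "\<beta> h \<odot> f ?g" "f ?x"] by (simp add: to_smult)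
    also have "\<beta> h \<odot> f ?g \<otimes> f ?x = (\<beta> h \<odot> z) \<otimes> f m"
      using z(3) b G c mG by (simp add: smult_mult_left)
    finally have wz: "w = \<beta> h \<odot> z" using scal[OF w(1) gr_smult[OF b z(1)]] by blast
    have "z \<otimes> (f m \<otimes> f h) = f ?g \<otimes> (f ?x \<otimes> f h)"
      using z(3) c mG G h by (simp flip: A.m_assoc)
    also have "\<dots> = (f ?g \<otimes> w) \<otimes> f m" using w c mG G by (simp add: A.m_assoc)
    also have "f ?g \<otimes> w = z \<otimes> (\<beta> h \<odot> f ?g)"
      using gr_0_central[OF w(1), of "f ?g"] G wz b c by (simp add: smult_mult_left smult_mult_right)
    finally have "z \<otimes> (f m \<otimes> f h) = z \<otimes> (\<beta> h \<odot> f ?g \<otimes> f m)"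
      using c mG G b by (simp add: A.m_assoc)
    then show "f m \<otimes> f h = \<beta> h \<odot> f ?g \<otimes> f m"
      using cancel_left[OF c(1) _ _ z(2)] mG G h b by simp
    show "\<beta> h \<odot> f ?g \<in> carrier A" using b G by simp
  qed
  then show "g \<in> carrier G \<Longrightarrow> conj_by A (f m) (f g) = \<beta> g \<odot> f (m \<cdot> g \<cdot> inv\<^bsub>G\<^esub> m)" .
  have cj: "conj_by A (f m) \<in> ring_hom A A" "\<And>a. a \<in> carrier A \<Longrightarrow> conj_by A (f m) a \<in> carrier A"
    using conj_by_automorphism[OF x] conj_by[OF x]
    unfolding algebra_auts_def ring_iso_def by auto
  have \<mu>add: "\<mu> (to (a \<oplus> b)) = \<mu> (to a) \<oplus>\<^bsub>C\<^esub> \<mu> (to b)"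
    if "a \<in> carrier A" "b \<in> carrier A" for a b
    using ring_hom_add[OF \<mu>C(1), of "to a" "to b"] that by (simp add: to_add)
  have piece: "\<mu> (to (f h \<otimes> r)) = to (conj_by A (f m) (f h \<otimes> r))"
    if h: "h \<in> carrier G" and r: "r \<in> R" for h r
  proof -
    have rc: "r \<in> carrier A" using r R_closed by blast
    have cr: "conj_by A (f m) r \<in> R" using socle_element_conj(1)[OF m] r by blast
    obtain c where k: "c \<in> carrier K" "aug r = c \<odot> \<one>" using aug_scalar[OF rc] by blast
    have "\<mu> (to r) = \<mu> (c \<odot>\<^bsub>C\<^esub> \<one>\<^bsub>C\<^esub>)" using to_R[OF r] k by (simp add: to_smult to_one)
    also have "\<dots> = c \<odot>\<^bsub>C\<^esub> \<mu> \<one>\<^bsub>C\<^esub>"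
      using \<mu>C(2) k(1) to_closed[OF A.one_closed] unfolding mod_hom_def to_one by blast
    also have "\<dots> = to (aug r)" using ring_hom_one[OF \<mu>C(1)] k by (simp add: to_smult to_one)
    finally have 1: "\<mu> (to r) = to (conj_by A (f m) r)"
      using to_R[OF cr] socle_element_conj(2)[OF m rc] by simp
    have 2: "\<mu> (to (f h)) = to (conj_by A (f m) (f h))"
      using \<mu>\<beta>[OF h] conj_f[OF h] \<beta>[OF h] h mG by (simp add: to_smult)
    have "\<mu> (to (f h \<otimes> r)) = \<mu> (to (f h)) \<otimes>\<^bsub>C\<^esub> \<mu> (to r)"
      using ring_hom_mult[OF \<mu>C(1), of "to (f h)" "to r"] h rc by (simp add: to_mult)
    then show ?thesis using 1 2 h rc cj ring_hom_mult[OF cj(1) f_closed[OF h] rc]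
      by (simp add: to_mult)
  qed
  have \<mu>to: "\<mu> (to a) = to (conj_by A (f m) a)" if a: "a \<in> carrier A" for a
    using a
  proof (induction rule: proj_induct)
    case (proj h)
    then show ?case using piece[OF proj coord(1)[OF proj a]] coord(2)[OF proj a] by simp
  next
    case (add y z)
    then show ?case using ring_hom_add[OF cj(1)] cj(2) \<mu>add by (simp add: to_add)
  next
    case zero
    show ?case using piece[OF G.one_closed AG_gr_0[OF gr_zero]] by (simp add: f_one)
  qed
  then show "a \<in> carrier A \<Longrightarrow> \<mu> (to a) = to (conj_by A (f m) a)" .
  assume \<sigma>: "\<sigma> \<in> graded_auts K C grC" and c: "c \<in> carrier C"
  have \<sigma>C: "\<sigma> \<in> ring_hom C C" "\<sigma> \<in> mod_hom K C C" "\<And>c. c \<in> carrier C \<Longrightarrow> \<sigma> c \<in> carrier C"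
    "\<sigma> ` carrier C = carrier C" "\<And>n. \<sigma> ` grC n = grC n"
    using \<sigma> unfolding graded_auts_def algebra_auts_def ring_iso_def
    by (auto simp: ring_hom_def bij_betw_def)
  \<comment> \<open>the socle is one-dimensional, so \<open>\<sigma>\<close> rescales the form by a constant\<close>
  let ?L = "B (to \<one>)"
  have Lhom: "?L \<in> mod_hom K C (regular_module K)" using B unfolding frobenius_form_def by auto
  obtain s where s: "s \<in> carrier K" "s \<otimes>\<^bsub>K\<^esub> ?F (f m) = ?L (\<sigma> (to (f m)))"
  proof -
    let ?y = "?L (\<sigma> (to (f m)))"
    have "?y \<in> carrier K" using Lhom \<sigma>C(3)[OF to_closed[OF f_closed[OF mG]]]
      unfolding mod_hom_def regular_module_def by auto
    moreover have "?F (f m) \<in> Units K" using Fm Fc[OF f_closed[OF mG]] by (simp add: K.field_Units)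
    ultimately show ?thesis 
      using that[of "?y \<otimes>\<^bsub>K\<^esub> inv\<^bsub>K\<^esub> ?F (f m)"] Fc[OF f_closed[OF mG]]
      by (simp add: R.m_assoc)
  qed
  have L\<sigma>: "?L (\<sigma> (to a)) = s \<otimes>\<^bsub>K\<^esub> ?L (to a)" if a: "a \<in> carrier A" for a
    using a
  proof (induction rule: homogeneous_induct)
    case (homogeneous i a)
    have ac: "a \<in> carrier A" using homogeneous gr_closed by blast
    show ?case
    proof (cases "i = l")
      case False
      have "\<sigma> (to a) \<in> grC i" using \<sigma>C(5)[of i] homogeneous by (auto simp: covariant_grading_def)
      then obtain b where "b \<in> gr i" "\<sigma> (to a) = to b" by (auto simp: covariant_grading_def)
      then show ?thesis using Fgr[OF False] homogeneous s by simp
    next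
      case True
      obtain k where k: "k \<in> carrier K" "lam m a = k \<odot> \<one>" using lam_gr_0[OF mG ac] unfolding gr_0 by blast
      have "to a = to (lam m a \<otimes> f m)" using lam_gr_socle[OF m, of a] uniq dgm homogeneous True by metis
      then have ta: "to a = k \<odot>\<^bsub>C\<^esub> to (f m)" using k mG by (simp add: to_smult scalar_eq[symmetric])
      have "\<sigma> (to a) = k \<odot>\<^bsub>C\<^esub> \<sigma> (to (f m))"
        using \<sigma>C(2) k(1) to_closed[OF f_closed[OF mG]] unfolding mod_hom_def ta by blast
      then have "?L (\<sigma> (to a)) = k \<otimes>\<^bsub>K\<^esub> ?L (\<sigma> (to (f m)))"
        using Lhom k(1) \<sigma>C(3)[OF to_closed[OF f_closed[OF mG]]]
        unfolding mod_hom_def regular_module_def by auto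
      also have "\<dots> = s \<otimes>\<^bsub>K\<^esub> (k \<otimes>\<^bsub>K\<^esub> ?F (f m))"
        using s k(1) Fc[OF f_closed[OF mG]] by (simp flip: s(2) add: R.m_lcomm)
      also have "k \<otimes>\<^bsub>K\<^esub> ?F (f m) = ?L (to a)" using k mG Fsm ta by (simp add: to_smult)
      finally show ?thesis .
    qed
  next
    case (add y z)
    have "\<sigma> (to (y \<oplus> z)) = \<sigma> (to y) \<oplus>\<^bsub>C\<^esub> \<sigma> (to z)"
      using ring_hom_add[OF \<sigma>C(1), of "to y" "to z"] add by (simp add: to_add)
    moreover have "?L (\<sigma> (to y) \<oplus>\<^bsub>C\<^esub> \<sigma> (to z)) = ?L (\<sigma> (to y)) \<oplus>\<^bsub>K\<^esub> ?L (\<sigma> (to z))"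
      using Lhom \<sigma>C(3)[OF to_closed[OF add(1)]] \<sigma>C(3)[OF to_closed[OF add(2)]]
      unfolding mod_hom_def regular_module_def by auto
    ultimately show ?case using add Fadd Fc s(1) by (simp add: R.r_distr)
  qed
  obtain b where b: "b \<in> carrier A" "c = to b" using c C_carrier by auto
  obtain u where u: "u \<in> carrier A" "\<mu> (\<sigma> c) = to u"
    using \<mu>C(3)[OF \<sigma>C(3)[OF c]] C_carrier by auto
  obtain v where v: "v \<in> carrier A" "\<sigma> (\<mu> c) = to v"
    using \<sigma>C(3)[OF \<mu>C(3)[OF c]] C_carrier by auto
  obtain w where w: "w \<in> carrier A" "\<mu> c = to w" using \<mu>C(3)[OF c] C_carrier by auto
  have "?F ((v \<ominus> u) \<otimes> y) = \<zero>\<^bsub>K\<^esub>" if y: "y \<in> carrier A" for y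
  proof -
    have "to y \<in> \<sigma> ` carrier C" using \<sigma>C(4) to_closed[OF y] by simp
    then obtain a where a: "a \<in> carrier A" "to y = \<sigma> (to a)" using C_carrier by auto
    obtain b' where b': "b' \<in> carrier A" "\<sigma> c = to b'" using \<sigma>C(3)[OF c] C_carrier by auto
    have hom: "\<sigma> (to p \<otimes>\<^bsub>C\<^esub> to q) = \<sigma> (to p) \<otimes>\<^bsub>C\<^esub> \<sigma> (to q)" if "p \<in> carrier A" "q \<in> carrier A" for p q
      using ring_hom_mult[OF \<sigma>C(1)] that by simp
    have "?F (u \<otimes> y) = B (\<mu> (\<sigma> c)) (to y)" using u B_mult[OF u(1) y] by simp
    also have "\<dots> = B (to y) (\<sigma> c)" using nak[of "to y" "\<sigma> c"] y \<sigma>C(3)[OF c] by simp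
    also have "\<dots> = ?L (\<sigma> (to a) \<otimes>\<^bsub>C\<^esub> \<sigma> c)" using B_mult[OF y b'(1)] b' y a(2)[symmetric] by (simp add: to_mult)
    also have "\<dots> = ?L (\<sigma> (to (a \<otimes> b)))" using hom[OF a(1) b(1)] b a by (simp add: to_mult)
    also have "\<dots> = s \<otimes>\<^bsub>K\<^esub> B (to a) c" using L\<sigma> a b B_mult[OF a(1) b(1)] by simp
    also have "\<dots> = s \<otimes>\<^bsub>K\<^esub> B (to w) (to a)" using nak[of "to a" c] a c w by simp
    also have "\<dots> = ?L (\<sigma> (to (w \<otimes> a)))" using L\<sigma> a w B_mult[OF w(1) a(1)] by simp
    also have "\<dots> = ?L (\<sigma> (to w) \<otimes>\<^bsub>C\<^esub> \<sigma> (to a))" using hom[OF w(1) a(1)] a w by (simp add: to_mult)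
    also have "\<dots> = ?F (v \<otimes> y)" using v w y a(2)[symmetric] by (simp add: to_mult)
    finally have eq: "?F (u \<otimes> y) = ?F (v \<otimes> y)" .
    have "v \<otimes> y = (v \<ominus> u) \<otimes> y \<oplus> u \<otimes> y"
      using u v y by (simp add: a_minus_def A.l_distr A.l_minus M.a_assoc M.l_neg)
    then have "?F (v \<otimes> y) = ?F ((v \<ominus> u) \<otimes> y) \<oplus>\<^bsub>K\<^esub> ?F (u \<otimes> y)" using Fadd u v y by simp
    moreover have "?F (v \<otimes> y) \<in> carrier K" "?F ((v \<ominus> u) \<otimes> y) \<in> carrier K" using Fc u v y by simp_all
    ultimately show ?thesis using eq by (metis R.add.r_cancel_one')
  qed
  then have "v \<ominus> u \<in> I" using Fnd u v by simp
  then show "\<sigma> (\<mu> c) = \<mu> (\<sigma> c)" using to_eq u v by simp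
qed

end

section \<open>Bar cochains as functions on lists\<close>

context conn_graded
begin

abbreviation lists :: "nat \<Rightarrow> 'a list set" where
  "lists n \<equiv> {l. length l = n \<and> set l \<subseteq> carrier A}"

text \<open>A cochain with coefficients in the trivial module is represented by its values at \<open>1 \<in> K\<close>, a function
  of the list of arguments. The recursion peels off the first argument and computes
  \<open>\<chi>(a\<^sub>1 a\<^sub>2, a\<^sub>3, \<dots>) - \<chi>(a\<^sub>1, a\<^sub>2 a\<^sub>3, \<dots>) + \<dots>\<close>; the first argument plays no special role
  in these terms, so inductions run smoothly with it frozen. The differential is \<open>a\<^sub>1 \<chi>(a\<^sub>2, \<dots>)\<close> minus this sum.\<close>

fun bdy :: "('a list \<Rightarrow> 'a) \<Rightarrow> 'a list \<Rightarrow> 'a" where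
  "bdy \<chi> [] = \<zero>"
| "bdy \<chi> [a] = aug a \<otimes> \<chi> []"
| "bdy \<chi> (a # b # l) = \<chi> ((a \<otimes> b) # l) \<ominus> bdy (\<lambda>l. \<chi> (a # l)) (b # l)"

definition dif :: "('a list \<Rightarrow> 'a) \<Rightarrow> 'a list \<Rightarrow> 'a" where
  "dif \<chi> l = hd l \<otimes> \<chi> (tl l) \<ominus> bdy \<chi> l"

text \<open>Multilinearity over \<open>K\<close>; scalars are elements of \<open>gr 0\<close>.\<close>

fun multi :: "nat \<Rightarrow> ('a list \<Rightarrow> 'a) \<Rightarrow> bool" where
  "multi 0 \<chi> \<longleftrightarrow> \<chi> [] \<in> carrier A"
| "multi (Suc n) \<chi> \<longleftrightarrow> (\<forall>a\<in>carrier A. multi n (\<lambda>l. \<chi> (a # l))) \<and>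
     (\<forall>l\<in>lists n. (\<forall>a\<in>carrier A. \<forall>b\<in>carrier A. \<chi> ((a \<oplus> b) # l) = \<chi> (a # l) \<oplus> \<chi> (b # l)) \<and>
        (\<forall>z\<in>gr 0. \<forall>a\<in>carrier A. \<chi> ((z \<otimes> a) # l) = z \<otimes> \<chi> (a # l)))"

text \<open>Freezing an argument of degree \<open>i\<close> raises the degree of the cochain by \<open>i\<close>. Degrees are integers since
  cochains may lower the degree.\<close>

fun gdeg :: "nat \<Rightarrow> int \<Rightarrow> ('a list \<Rightarrow> 'a) \<Rightarrow> bool" where
  "gdeg 0 j \<chi> \<longleftrightarrow> \<chi> [] \<in> int_grading A gr j"
| "gdeg (Suc n) j \<chi> \<longleftrightarrow> (\<forall>i. \<forall>a\<in>gr i. gdeg n (j + int i) (\<lambda>l. \<chi> (a # l)))"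

lemma lists_Suc: "l \<in> lists (Suc n) \<longleftrightarrow> (\<exists>a\<in>carrier A. \<exists>l'\<in>lists n. l = a # l')"
  by (cases l) auto

lemma multi_closed: "multi n \<chi> \<Longrightarrow> l \<in> lists n \<Longrightarrow> \<chi> l \<in> carrier A"
proof (induction n arbitrary: \<chi> l)
  case (Suc n)
  then obtain a l' where "a \<in> carrier A" "l' \<in> lists n" "l = a # l'" by (auto simp: lists_Suc simp del: mem_Collect_eq)
  then show ?case using Suc.IH[of "\<lambda>l. \<chi> (a # l)" l'] Suc.prems by auto
qed auto

lemma multi_Cons: "multi (Suc n) \<chi> \<Longrightarrow> a \<in> carrier A \<Longrightarrow> multi n (\<lambda>l. \<chi> (a # l))"
  by simp

lemma multi_add: "multi (Suc n) \<chi> \<Longrightarrow> a \<in> carrier A \<Longrightarrow> b \<in> carrier A \<Longrightarrow> l \<in> lists n \<Longrightarrow>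
    \<chi> ((a \<oplus> b) # l) = \<chi> (a # l) \<oplus> \<chi> (b # l)"
  by simp

lemma multi_scal: "multi (Suc n) \<chi> \<Longrightarrow> z \<in> gr 0 \<Longrightarrow> a \<in> carrier A \<Longrightarrow> l \<in> lists n \<Longrightarrow>
    \<chi> ((z \<otimes> a) # l) = z \<otimes> \<chi> (a # l)"
  by simp

lemma multi_SucI:
  assumes "\<And>a. a \<in> carrier A \<Longrightarrow> multi n (\<lambda>l. \<chi> (a # l))"
    and "\<And>a b l. a \<in> carrier A \<Longrightarrow> b \<in> carrier A \<Longrightarrow> l \<in> lists n \<Longrightarrow>
      \<chi> ((a \<oplus> b) # l) = \<chi> (a # l) \<oplus> \<chi> (b # l)"
    and "\<And>z a l. z \<in> gr 0 \<Longrightarrow> a \<in> carrier A \<Longrightarrow> l \<in> lists n \<Longrightarrow>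
      \<chi> ((z \<otimes> a) # l) = z \<otimes> \<chi> (a # l)"
  shows "multi (Suc n) \<chi>"
  using assms by simp

declare multi.simps(2) [simp del]

lemma multi_zero_head:
  assumes "multi (Suc n) \<chi>" "l \<in> lists n" shows "\<chi> (\<zero> # l) = \<zero>"
proof -
  have "\<chi> ((\<zero> \<otimes> \<zero>) # l) = \<zero> \<otimes> \<chi> (\<zero> # l)"
    by (rule multi_scal[OF assms(1) gr_zero M.zero_closed assms(2)])
  moreover have "\<chi> (\<zero> # l) \<in> carrier A" using multi_closed[OF assms(1)] assms(2) by auto
  ultimately show ?thesis by simp
qed

lemma multi_finsum:
  assumes "multi (Suc n) \<chi>" "l \<in> lists n" "finite S" "u \<in> S \<rightarrow> carrier A"
  shows "\<chi> ((\<Oplus>s\<in>S. u s) # l) = (\<Oplus>s\<in>S. \<chi> (u s # l))"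
  using assms(3,4)
proof (induction S rule: finite_induct)
  case empty then show ?case using multi_zero_head[OF assms(1,2)] by simp
next
  case (insert s S)
  then have u: "u s \<in> carrier A" "u \<in> S \<rightarrow> carrier A" by auto
  have c: "a \<in> carrier A \<Longrightarrow> \<chi> (a # l) \<in> carrier A" for a
    using multi_closed[OF assms(1)] assms(2) by auto
  then have "(\<lambda>s. \<chi> (u s # l)) \<in> S \<rightarrow> carrier A" using u by auto
  then show ?case using insert u c multi_add[OF assms(1) u(1) _ assms(2)] by simp
qed

lemma multi_cong:
  "(\<And>l. l \<in> lists n \<Longrightarrow> \<chi> l = \<chi>' l) \<Longrightarrow> multi n \<chi> \<Longrightarrow> multi n \<chi>'"
proof (induction n arbitrary: \<chi> \<chi>')
  case (Suc n)
  show ?case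
  proof (rule multi_SucI)
    fix a assume a: "a \<in> carrier A"
    show "multi n (\<lambda>l. \<chi>' (a # l))"
      by (rule Suc.IH[of "\<lambda>l. \<chi> (a # l)"]) (use Suc.prems a multi_Cons in auto)
  next
    fix a b l assume h: "a \<in> carrier A" "b \<in> carrier A" "l \<in> lists n"
    then show "\<chi>' ((a \<oplus> b) # l) = \<chi>' (a # l) \<oplus> \<chi>' (b # l)"
      using Suc.prems(1)[of "(a \<oplus> b) # l"] Suc.prems(1)[of "a # l"] Suc.prems(1)[of "b # l"]
        multi_add[OF Suc.prems(2) h] by simp
  next
    fix z a l assume h: "z \<in> gr 0" "a \<in> carrier A" "l \<in> lists n"
    then show "\<chi>' ((z \<otimes> a) # l) = z \<otimes> \<chi>' (a # l)"
      using Suc.prems(1)[of "(z \<otimes> a) # l"] Suc.prems(1)[of "a # l"]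
        multi_scal[OF Suc.prems(2) h] gr_closed[of z] by simp
  qed
qed simp

text \<open>The \<open>K\<close>-linear maps; they may be applied to the values of a cochain.\<close>

definition lin :: "('a \<Rightarrow> 'a) \<Rightarrow> bool" where
  "lin \<kappa> \<longleftrightarrow> \<kappa> \<in> carrier A \<rightarrow> carrier A \<and>
     (\<forall>x\<in>carrier A. \<forall>y\<in>carrier A. \<kappa> (x \<oplus> y) = \<kappa> x \<oplus> \<kappa> y) \<and>
     (\<forall>z\<in>gr 0. \<forall>x\<in>carrier A. \<kappa> (z \<otimes> x) = z \<otimes> \<kappa> x)"

lemma linD:
  assumes "lin \<kappa>"
  shows "x \<in> carrier A \<Longrightarrow> \<kappa> x \<in> carrier A"
    and "x \<in> carrier A \<Longrightarrow> y \<in> carrier A \<Longrightarrow> \<kappa> (x \<oplus> y) = \<kappa> x \<oplus> \<kappa> y"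
    and "z \<in> gr 0 \<Longrightarrow> x \<in> carrier A \<Longrightarrow> \<kappa> (z \<otimes> x) = z \<otimes> \<kappa> x"
  using assms by (auto simp: lin_def)

lemma lin_neg: "lin \<kappa> \<Longrightarrow> x \<in> carrier A \<Longrightarrow> \<kappa> (\<ominus> x) = \<ominus> \<kappa> x"
  using linD(3)[of \<kappa> "\<ominus> \<one>" x] linD(1)[of \<kappa> x] gr_neg[OF one_gr_0] by (simp add: A.l_minus)

lemma lin_minus: "lin \<kappa> \<Longrightarrow> x \<in> carrier A \<Longrightarrow> y \<in> carrier A \<Longrightarrow> \<kappa> (x \<ominus> y) = \<kappa> x \<ominus> \<kappa> y"
  by (simp add: a_minus_def linD lin_neg)

lemma lin_mult_right: "x \<in> carrier A \<Longrightarrow> lin (\<lambda>y. y \<otimes> x)"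
  using gr_closed by (auto simp: lin_def A.l_distr A.m_assoc)

lemma lin_mult_left: "x \<in> carrier A \<Longrightarrow> lin (\<lambda>y. x \<otimes> y)"
proof -
  assume x: "x \<in> carrier A"
  have "x \<otimes> (z \<otimes> y) = z \<otimes> (x \<otimes> y)" if "z \<in> gr 0" "y \<in> carrier A" for z y
    using gr_0_central[OF that(1) x] x that(2) gr_closed[OF that(1)] by (metis A.m_assoc)
  then show ?thesis using x by (auto simp: lin_def A.r_distr)
qed

lemma lin_uminus: "lin (\<lambda>y. \<ominus> y)"
  using gr_closed by (auto simp: lin_def M.minus_add A.r_minus)

lemma multi_map: "lin \<kappa> \<Longrightarrow> multi n \<chi> \<Longrightarrow> multi n (\<lambda>l. \<kappa> (\<chi> l))"
proof (induction n arbitrary: \<chi>)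
  case (Suc n)
  have c: "a \<in> carrier A \<Longrightarrow> l \<in> lists n \<Longrightarrow> \<chi> (a # l) \<in> carrier A" for a l
    using multi_closed[OF Suc.prems(2)] by auto
  show ?case
  proof (rule multi_SucI)
    fix a assume "a \<in> carrier A"
    then show "multi n (\<lambda>l. \<kappa> (\<chi> (a # l)))"
      using Suc.IH[OF Suc.prems(1), of "\<lambda>l. \<chi> (a # l)"] multi_Cons[OF Suc.prems(2)] by blast
  next
    fix a b l assume "a \<in> carrier A" "b \<in> carrier A" "l \<in> lists n"
    then show "\<kappa> (\<chi> ((a \<oplus> b) # l)) = \<kappa> (\<chi> (a # l)) \<oplus> \<kappa> (\<chi> (b # l))"
      using multi_add[OF Suc.prems(2), of a b l] linD(2)[OF Suc.prems(1) c c, of a l b l] by simp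
  next
    fix z a l assume "z \<in> gr 0" "a \<in> carrier A" "l \<in> lists n"
    then show "\<kappa> (\<chi> ((z \<otimes> a) # l)) = z \<otimes> \<kappa> (\<chi> (a # l))"
      using multi_scal[OF Suc.prems(2), of z a l] linD(3)[OF Suc.prems(1) _ c, of z a l] by simp
  qed
qed (simp add: linD)

lemma multi_plus: "multi n \<chi> \<Longrightarrow> multi n \<psi> \<Longrightarrow> multi n (\<lambda>l. \<chi> l \<oplus> \<psi> l)"
proof (induction n arbitrary: \<chi> \<psi>)
  case (Suc n)
  have c: "a \<in> carrier A \<Longrightarrow> l \<in> lists n \<Longrightarrow> \<chi> (a # l) \<in> carrier A"
    "a \<in> carrier A \<Longrightarrow> l \<in> lists n \<Longrightarrow> \<psi> (a # l) \<in> carrier A" for a l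
    using multi_closed[OF Suc.prems(1)] multi_closed[OF Suc.prems(2)] by auto
  show ?case
  proof (rule multi_SucI)
    fix a assume "a \<in> carrier A"
    then show "multi n (\<lambda>l. \<chi> (a # l) \<oplus> \<psi> (a # l))"
      using Suc.IH[of "\<lambda>l. \<chi> (a # l)" "\<lambda>l. \<psi> (a # l)"] multi_Cons Suc.prems by blast
  next
    fix a b l assume h: "a \<in> carrier A" "b \<in> carrier A" "l \<in> lists n"
    then show "\<chi> ((a \<oplus> b) # l) \<oplus> \<psi> ((a \<oplus> b) # l) = (\<chi> (a # l) \<oplus> \<psi> (a # l)) \<oplus> (\<chi> (b # l) \<oplus> \<psi> (b # l))"
      using multi_add[OF Suc.prems(1) h] multi_add[OF Suc.prems(2) h] c by (simp add: M.a_ac)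
  next
    fix z a l assume h: "z \<in> gr 0" "a \<in> carrier A" "l \<in> lists n"
    then show "\<chi> ((z \<otimes> a) # l) \<oplus> \<psi> ((z \<otimes> a) # l) = z \<otimes> (\<chi> (a # l) \<oplus> \<psi> (a # l))"
      using multi_scal[OF Suc.prems(1) h] multi_scal[OF Suc.prems(2) h] c gr_closed[of z]
      by (simp add: A.r_distr)
  qed
qed simp

lemma multi_neg: "multi n \<chi> \<Longrightarrow> multi n (\<lambda>l. \<ominus> \<chi> l)"
  using multi_map[OF lin_uminus] .

lemma multi_minus: "multi n \<chi> \<Longrightarrow> multi n \<psi> \<Longrightarrow> multi n (\<lambda>l. \<chi> l \<ominus> \<psi> l)"
  unfolding a_minus_def using multi_plus multi_neg by blast

lemma multi_zero: "multi n (\<lambda>l. \<zero>)"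
proof (induction n)
  case (Suc n) then show ?case using gr_closed by (intro multi_SucI) auto
qed simp

lemma multi_sum:
  "finite S \<Longrightarrow> (\<And>s. s \<in> S \<Longrightarrow> multi n (\<chi> s)) \<Longrightarrow> multi n (\<lambda>l. \<Oplus>s\<in>S. \<chi> s l)"
proof (induction S rule: finite_induct)
  case (insert s S)
  have "multi n (\<lambda>l. \<chi> s l \<oplus> (\<Oplus>s\<in>S. \<chi> s l))" using insert multi_plus by auto
  then show ?case
  proof (rule multi_cong[rotated])
    fix l assume l: "l \<in> lists n"
    have "(\<lambda>s. \<chi> s l) \<in> S \<rightarrow> carrier A" "\<chi> s l \<in> carrier A" using insert.prems multi_closed l by blast+
    then show "\<chi> s l \<oplus> (\<Oplus>s\<in>S. \<chi> s l) = (\<Oplus>s\<in>insert s S. \<chi> s l)" using insert.hyps by simp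
  qed
qed (simp add: multi_zero)

subsection \<open>The differential\<close>

definition closed_on :: "nat \<Rightarrow> ('a list \<Rightarrow> 'a) \<Rightarrow> bool" where "closed_on n \<chi> \<longleftrightarrow> (\<forall>l\<in>lists n. \<chi> l \<in> carrier A)"

lemma multi_closed_on: "multi n \<chi> \<Longrightarrow> closed_on n \<chi>" using multi_closed by (auto simp: closed_on_def)

lemma closed_onD: "closed_on n \<chi> \<Longrightarrow> length l = n \<Longrightarrow> set l \<subseteq> carrier A \<Longrightarrow> \<chi> l \<in> carrier A"
  by (auto simp: closed_on_def)

lemma closed_on_Cons: "closed_on (Suc n) \<chi> \<Longrightarrow> a \<in> carrier A \<Longrightarrow> closed_on n (\<lambda>l. \<chi> (a # l))"
  by (auto simp: closed_on_def)

lemma bdy_cong: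
  "(\<And>l. l \<in> lists n \<Longrightarrow> \<chi> l = \<chi>' l) \<Longrightarrow> l \<in> lists (Suc n) \<Longrightarrow> bdy \<chi> l = bdy \<chi>' l"
proof (induction n arbitrary: \<chi> \<chi>' l)
  case 0 then show ?case by (auto simp: length_Suc_conv)
next
  case (Suc n)
  then obtain a b l' where l: "l = a # b # l'" "a \<in> carrier A" "b \<in> carrier A" "l' \<in> lists n"
    by (auto simp: length_Suc_conv)
  have "bdy (\<lambda>l. \<chi> (a # l)) (b # l') = bdy (\<lambda>l. \<chi>' (a # l)) (b # l')"
    using Suc.IH[of "\<lambda>l. \<chi> (a # l)" "\<lambda>l. \<chi>' (a # l)" "b # l'"] Suc.prems(1) l by auto
  then show ?case using l Suc.prems(1)[of "(a \<otimes> b) # l'"] by simp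
qed

lemma bdy_closed: "closed_on n \<chi> \<Longrightarrow> length l = Suc n \<Longrightarrow> set l \<subseteq> carrier A \<Longrightarrow> bdy \<chi> l \<in> carrier A"
proof (induction n arbitrary: \<chi> l)
  case 0 then show ?case by (auto simp: length_Suc_conv closed_on_def)
next
  case (Suc n)
  then obtain a b l' where l: "l = a # b # l'" "a \<in> carrier A" "b \<in> carrier A" "l' \<in> lists n"
    by (auto simp: length_Suc_conv)
  then show ?case using Suc.IH[OF closed_on_Cons[OF Suc.prems(1) l(2)], of "b # l'"] closed_onD[OF Suc.prems(1), of "(a \<otimes> b) # l'"] by simp
qed

lemma bdy_map: "lin \<kappa> \<Longrightarrow> closed_on n \<chi> \<Longrightarrow> length l = Suc n \<Longrightarrow> set l \<subseteq> carrier A \<Longrightarrow>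
    bdy (\<lambda>l. \<kappa> (\<chi> l)) l = \<kappa> (bdy \<chi> l)"
proof (induction n arbitrary: \<chi> l)
  case 0 then show ?case by (auto simp: length_Suc_conv closed_on_def linD)
next
  case (Suc n)
  then obtain a b l' where l: "l = a # b # l'" "a \<in> carrier A" "b \<in> carrier A" "l' \<in> lists n"
    by (auto simp: length_Suc_conv)
  note ca = closed_on_Cons[OF Suc.prems(2) l(2)]
  show ?case using l Suc.IH[OF Suc.prems(1) ca, of "b # l'"] closed_onD[OF Suc.prems(2), of "(a \<otimes> b) # l'"]
      bdy_closed[OF ca, of "b # l'"] Suc.prems(1) by (simp add: lin_minus)
qed

lemma bdy_plus: "closed_on n \<chi> \<Longrightarrow> closed_on n \<psi> \<Longrightarrow> length l = Suc n \<Longrightarrow> set l \<subseteq> carrier A \<Longrightarrow>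
    bdy (\<lambda>l. \<chi> l \<oplus> \<psi> l) l = bdy \<chi> l \<oplus> bdy \<psi> l"
proof (induction n arbitrary: \<chi> \<psi> l)
  case 0 then show ?case by (auto simp: length_Suc_conv closed_on_def A.r_distr)
next
  case (Suc n)
  then obtain a b l' where l: "l = a # b # l'" "a \<in> carrier A" "b \<in> carrier A" "l' \<in> lists n"
    by (auto simp: length_Suc_conv)
  note ca = closed_on_Cons[OF Suc.prems(1) l(2)] closed_on_Cons[OF Suc.prems(2) l(2)]
  show ?case using l Suc.IH[OF ca, of "b # l'"] closed_onD[OF Suc.prems(1), of "(a \<otimes> b) # l'"]
      closed_onD[OF Suc.prems(2), of "(a \<otimes> b) # l'"]
      bdy_closed[OF ca(1), of "b # l'"] bdy_closed[OF ca(2), of "b # l'"]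
    by (simp add: a_minus_def M.minus_add M.a_ac)
qed

lemma bdy_zero: "length l = Suc n \<Longrightarrow> set l \<subseteq> carrier A \<Longrightarrow> bdy (\<lambda>l. \<zero>) l = \<zero>"
proof (induction n arbitrary: l)
  case 0 then show ?case by (auto simp: length_Suc_conv)
next
  case (Suc n)
  then obtain a b l' where l: "l = a # b # l'" "a \<in> carrier A" "b \<in> carrier A" "l' \<in> lists n"
    by (auto simp: length_Suc_conv)
  then show ?case using Suc.IH[of "b # l'"] by (simp add: a_minus_def)
qed

lemma bdy_sum: "finite S \<Longrightarrow> (\<And>s. s \<in> S \<Longrightarrow> closed_on n (\<chi> s)) \<Longrightarrow> length l = Suc n \<Longrightarrow> set l \<subseteq> carrier A \<Longrightarrow>
    bdy (\<lambda>l. \<Oplus>s\<in>S. \<chi> s l) l = (\<Oplus>s\<in>S. bdy (\<chi> s) l)"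
proof (induction S rule: finite_induct)
  case empty then show ?case by (simp add: bdy_zero)
next
  case (insert s S)
  have c: "(\<lambda>s. \<chi> s l) \<in> S \<rightarrow> carrier A" "\<chi> s l \<in> carrier A" if "l \<in> lists n" for l
    using insert.prems(1) that by (auto simp: closed_on_def)
  have cS: "closed_on n (\<lambda>l. \<Oplus>s\<in>S. \<chi> s l)" using c by (auto simp: closed_on_def)
  have "bdy (\<lambda>l. \<Oplus>s\<in>insert s S. \<chi> s l) l = bdy (\<lambda>l. \<chi> s l \<oplus> (\<Oplus>s\<in>S. \<chi> s l)) l"
    by (rule bdy_cong[of n]) (use c insert in auto)
  also have "\<dots> = bdy (\<chi> s) l \<oplus> bdy (\<lambda>l. \<Oplus>s\<in>S. \<chi> s l) l"
    using bdy_plus[OF _ cS] insert.prems by simp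
  also have "\<dots> = (\<Oplus>s\<in>insert s S. bdy (\<chi> s) l)"
  proof -
    have "(\<lambda>s. bdy (\<chi> s) l) \<in> S \<rightarrow> carrier A" "bdy (\<chi> s) l \<in> carrier A"
      using insert.prems bdy_closed by blast+
    then show ?thesis using insert by simp
  qed
  finally show ?case .
qed

lemma dif_Cons [simp]: "dif \<chi> (a # l) = a \<otimes> \<chi> l \<ominus> bdy \<chi> (a # l)"
  by (simp add: dif_def)

lemma dif_closed: "closed_on n \<chi> \<Longrightarrow> l \<in> lists (Suc n) \<Longrightarrow> dif \<chi> l \<in> carrier A"
  using bdy_closed[of n \<chi> l] closed_onD[of n \<chi> "tl l"] by (cases l) auto

lemma dif_cong: "(\<And>l. l \<in> lists n \<Longrightarrow> \<chi> l = \<chi>' l) \<Longrightarrow> l \<in> lists (Suc n) \<Longrightarrow> dif \<chi> l = dif \<chi>' l"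
  using bdy_cong[of n \<chi> \<chi>' l] by (cases l) auto

lemma dif_plus: "closed_on n \<chi> \<Longrightarrow> closed_on n \<psi> \<Longrightarrow> l \<in> lists (Suc n) \<Longrightarrow>
    dif (\<lambda>l. \<chi> l \<oplus> \<psi> l) l = dif \<chi> l \<oplus> dif \<psi> l"
  using bdy_plus[of n \<chi> \<psi> l] bdy_closed[of n _ l] closed_onD[of n _ "tl l"]
  by (cases l) (auto simp: A.r_distr a_minus_def M.minus_add M.a_ac)

lemma dif_neg: "closed_on n \<chi> \<Longrightarrow> l \<in> lists (Suc n) \<Longrightarrow> dif (\<lambda>l. \<ominus> \<chi> l) l = \<ominus> dif \<chi> l"
  using bdy_map[OF lin_uminus, of n \<chi> l] bdy_closed[of n _ l] closed_onD[of n _ "tl l"]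
  by (cases l) (auto simp: A.r_minus a_minus_def M.minus_add)

lemma closed_on_neg: "closed_on n \<chi> \<Longrightarrow> closed_on n (\<lambda>l. \<ominus> \<chi> l)" by (auto simp: closed_on_def)

lemma dif_minus: "closed_on n \<chi> \<Longrightarrow> closed_on n \<psi> \<Longrightarrow> l \<in> lists (Suc n) \<Longrightarrow>
    dif (\<lambda>l. \<chi> l \<ominus> \<psi> l) l = dif \<chi> l \<ominus> dif \<psi> l"
  using dif_plus[of n \<chi> "\<lambda>l. \<ominus> \<psi> l" l] closed_on_neg[of n \<psi>] dif_neg[of n \<psi> l]
  by (simp add: a_minus_def)

text \<open>The map has to commute with the first argument of the given list only, because it may be linear over \<open>R\<close>
  instead of \<open>A\<close>.\<close>

lemma dif_map: "lin \<kappa> \<Longrightarrow> closed_on n \<chi> \<Longrightarrow> l \<in> lists (Suc n) \<Longrightarrow>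
   \<kappa> (hd l \<otimes> \<chi> (tl l)) = hd l \<otimes> \<kappa> (\<chi> (tl l)) \<Longrightarrow> dif (\<lambda>l. \<kappa> (\<chi> l)) l = \<kappa> (dif \<chi> l)"
  using bdy_map[of \<kappa> n \<chi> l] bdy_closed[of n _ l] closed_onD[of n _ "tl l"]
  by (cases l) (auto simp: lin_minus)

lemma multi_bdy: "multi n \<chi> \<Longrightarrow> multi (Suc n) (bdy \<chi>)"
proof (induction n arbitrary: \<chi>)
  case 0
  then show ?case by (auto intro!: multi_SucI simp: aug_add A.l_distr aug_mult aug_homogeneous A.m_assoc gr_closed)
next
  case (Suc n)
  have c: "closed_on (Suc n) \<chi>" using multi_closed_on Suc.prems .
  show ?case
  proof (rule multi_SucI)
    fix a assume a: "a \<in> carrier A"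
    have IH: "multi (Suc n) (bdy (\<lambda>l. \<chi> (a # l)))" using Suc.IH multi_Cons[OF Suc.prems a] by blast
    have "multi (Suc n) (\<lambda>l. \<chi> ((a \<otimes> hd l) # tl l))"
    proof (rule multi_SucI)
      fix b assume "b \<in> carrier A"
      then show "multi n (\<lambda>l. \<chi> ((a \<otimes> hd (b # l)) # tl (b # l)))" using a multi_Cons[OF Suc.prems] by simp
    next
      fix b b' l assume "b \<in> carrier A" "b' \<in> carrier A" "l \<in> lists n"
      then show "\<chi> ((a \<otimes> hd ((b \<oplus> b') # l)) # tl ((b \<oplus> b') # l)) =
          \<chi> ((a \<otimes> hd (b # l)) # tl (b # l)) \<oplus> \<chi> ((a \<otimes> hd (b' # l)) # tl (b' # l))"
        using a multi_add[OF Suc.prems, of "a \<otimes> b" "a \<otimes> b'" l] by (simp add: A.r_distr)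
    next
      fix z b l assume h: "z \<in> gr 0" "b \<in> carrier A" "l \<in> lists n"
      have "a \<otimes> (z \<otimes> b) = z \<otimes> (a \<otimes> b)" using linD(3)[OF lin_mult_left[OF a] h(1,2)] .
      then show "\<chi> ((a \<otimes> hd ((z \<otimes> b) # l)) # tl ((z \<otimes> b) # l)) = z \<otimes> \<chi> ((a \<otimes> hd (b # l)) # tl (b # l))"
        using a h multi_scal[OF Suc.prems h(1), of "a \<otimes> b" l] by simp
    qed
    from multi_minus[OF this IH] show "multi (Suc n) (\<lambda>l. bdy \<chi> (a # l))"
      by (rule multi_cong[rotated]) (auto simp: length_Suc_conv)
  next
    fix a a' l assume h: "a \<in> carrier A" "a' \<in> carrier A" "l \<in> lists (Suc n)"
    then obtain b l' where l: "l = b # l'" "b \<in> carrier A" "l' \<in> lists n" by (auto simp: length_Suc_conv)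
    have "bdy (\<lambda>l. \<chi> ((a \<oplus> a') # l)) l = bdy (\<lambda>l. \<chi> (a # l) \<oplus> \<chi> (a' # l)) l"
      by (rule bdy_cong[of n]) (use h multi_add[OF Suc.prems] in auto)
    also have "\<dots> = bdy (\<lambda>l. \<chi> (a # l)) l \<oplus> bdy (\<lambda>l. \<chi> (a' # l)) l"
      using bdy_plus[OF closed_on_Cons[OF c] closed_on_Cons[OF c]] h by blast
    finally show "bdy \<chi> ((a \<oplus> a') # l) = bdy \<chi> (a # l) \<oplus> bdy \<chi> (a' # l)"
      using l h multi_add[OF Suc.prems, of "a \<otimes> b" "a' \<otimes> b" l'] closed_onD[OF c, of "(a \<otimes> b) # l'"]
        closed_onD[OF c, of "(a' \<otimes> b) # l'"] bdy_closed[OF closed_on_Cons[OF c], of a l] bdy_closed[OF closed_on_Cons[OF c], of a' l]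
      by (simp add: A.l_distr a_minus_def M.minus_add M.a_ac)
  next
    fix z a l assume h: "z \<in> gr 0" "a \<in> carrier A" "l \<in> lists (Suc n)"
    then obtain b l' where l: "l = b # l'" "b \<in> carrier A" "l' \<in> lists n" by (auto simp: length_Suc_conv)
    have z: "z \<in> carrier A" using h gr_closed by blast
    have "bdy (\<lambda>l. \<chi> ((z \<otimes> a) # l)) l = bdy (\<lambda>l. z \<otimes> \<chi> (a # l)) l"
      by (rule bdy_cong[of n]) (use h multi_scal[OF Suc.prems] in auto)
    also have "\<dots> = z \<otimes> bdy (\<lambda>l. \<chi> (a # l)) l"
      using bdy_map[OF lin_mult_left[OF z] closed_on_Cons[OF c]] h by blast
    finally show "bdy \<chi> ((z \<otimes> a) # l) = z \<otimes> bdy \<chi> (a # l)"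
      using l h z multi_scal[OF Suc.prems h(1), of "a \<otimes> b" l'] closed_onD[OF c, of "(a \<otimes> b) # l'"]
        bdy_closed[OF closed_on_Cons[OF c], of a l]
      by (simp add: A.m_assoc a_minus_def A.r_distr A.r_minus)
  qed
qed

lemma multi_dif: assumes "multi n \<chi>" shows "multi (Suc n) (dif \<chi>)"
proof -
  have "multi (Suc n) (\<lambda>l. hd l \<otimes> \<chi> (tl l))"
  proof (rule multi_SucI)
    fix a assume "a \<in> carrier A"
    then show "multi n (\<lambda>l. hd (a # l) \<otimes> \<chi> (tl (a # l)))" using multi_map[OF lin_mult_left assms] by simp
  qed (use assms multi_closed gr_closed in \<open>auto simp: A.l_distr A.m_assoc\<close>)
  from multi_minus[OF this multi_bdy[OF assms]] show ?thesis by (simp add: dif_def[abs_def])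
qed

lemma bdy_shift: "bdy (\<lambda>l. \<chi> ((a \<otimes> hd l) # tl l)) (b # c # l) = bdy \<chi> ((a \<otimes> b) # c # l)"
  if "a \<in> carrier A" "b \<in> carrier A" "c \<in> carrier A"
  using that by (simp add: A.m_assoc)

text \<open>Freezing the first argument \<open>a\<close> of \<open>bdy \<chi>\<close> leaves the cochain \<open>l \<mapsto> \<chi>(a b, \<dots>)\<close> minus \<open>bdy\<close> of the frozen
  \<open>\<chi>\<close>; the first contributes what cancels the leading term, and the second vanishes by induction.\<close>

lemma bdy_bdy: "multi n \<chi> \<Longrightarrow> length l = n \<Longrightarrow> set l \<subseteq> carrier A \<Longrightarrow> a \<in> carrier A \<Longrightarrow> b \<in> carrier A \<Longrightarrow>
    bdy (bdy \<chi>) (a # b # l) = \<zero>"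
proof (induction n arbitrary: \<chi> a b l)
  case 0
  then have "aug b \<otimes> (aug a \<otimes> \<chi> []) = aug a \<otimes> (aug b \<otimes> \<chi> [])"
    using linD(3)[OF lin_mult_left[of "aug b"], of "aug a" "\<chi> []"] by simp
  with 0 show ?case by (simp add: aug_mult A.m_assoc A.r_right_minus_eq)
next
  case (Suc n)
  then obtain c l' where l: "l = c # l'" "c \<in> carrier A" "l' \<in> lists n" by (auto simp: length_Suc_conv)
  let ?\<chi>a = "\<lambda>l. \<chi> (a # l)" and ?m = "\<lambda>l. \<chi> ((a \<otimes> hd l) # tl l)"
  have ca: "multi n ?\<chi>a" using multi_Cons Suc.prems by blast
  have clb: "closed_on (Suc n) (bdy ?\<chi>a)" using multi_closed_on[OF multi_bdy[OF ca]] .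
  have clm: "closed_on (Suc n) ?m"
    using multi_closed_on[OF Suc.prems(1)] Suc.prems(4) by (auto simp: closed_on_def length_Suc_conv)
  have "bdy (\<lambda>l. bdy \<chi> (a # l)) (b # l) = bdy (\<lambda>l. ?m l \<oplus> \<ominus> bdy ?\<chi>a l) (b # l)"
    by (rule bdy_cong[of "Suc n"]) (use Suc.prems in \<open>auto simp: length_Suc_conv a_minus_def\<close>)
  also have "\<dots> = bdy ?m (b # l) \<oplus> bdy (\<lambda>l. \<ominus> bdy ?\<chi>a l) (b # l)"
    using bdy_plus[OF clm closed_on_neg[OF clb], of "b # l"] Suc.prems by simp
  also have "bdy (\<lambda>l. \<ominus> bdy ?\<chi>a l) (b # l) = \<ominus> bdy (bdy ?\<chi>a) (b # l)"
    using bdy_map[OF lin_uminus clb, of "b # l"] Suc.prems by simp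
  also have "bdy (bdy ?\<chi>a) (b # l) = \<zero>" using Suc.IH[OF ca, of l' b c] l Suc.prems by simp
  also have "bdy ?m (b # l) = bdy \<chi> ((a \<otimes> b) # l)" using bdy_shift l Suc.prems by simp
  finally have "bdy (\<lambda>l. bdy \<chi> (a # l)) (b # l) = bdy \<chi> ((a \<otimes> b) # l)"
    using bdy_closed[OF multi_closed_on[OF Suc.prems(1)], of "(a \<otimes> b) # l"] Suc.prems by simp
  then show ?case using bdy_closed[OF multi_closed_on[OF Suc.prems(1)], of "(a \<otimes> b) # l"] Suc.prems
    by simp
qed

lemma dif_dif:
  assumes "multi n \<chi>" "l \<in> lists (Suc (Suc n))" shows "dif (dif \<chi>) l = \<zero>"
proof -
  obtain a b l' where l: "l = a # b # l'" "a \<in> carrier A" "b \<in> carrier A" "l' \<in> lists n"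
    using assms(2) by (auto simp: length_Suc_conv)
  let ?h = "\<lambda>l. hd l \<otimes> \<chi> (tl l)"
  have c: "closed_on n \<chi>" using multi_closed_on assms(1) .
  have cb: "closed_on (Suc n) (bdy \<chi>)" using multi_closed_on[OF multi_bdy[OF assms(1)]] .
  have ch: "closed_on (Suc n) ?h" using c by (auto simp: closed_on_def length_Suc_conv)
  have x: "bdy \<chi> (b # l') \<in> carrier A" "\<chi> l' \<in> carrier A" "bdy (\<lambda>l. a \<otimes> \<chi> l) (b # l') = a \<otimes> bdy \<chi> (b # l')"
    using bdy_closed[OF c, of "b # l'"] closed_onD[OF c, of l'] bdy_map[OF lin_mult_left[OF l(2)] c, of "b # l'"] l by auto
  have "bdy (dif \<chi>) l = bdy (\<lambda>l. ?h l \<oplus> \<ominus> bdy \<chi> l) l" by (simp add: dif_def[abs_def] a_minus_def)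
  also have "\<dots> = bdy ?h l \<oplus> bdy (\<lambda>l. \<ominus> bdy \<chi> l) l"
    using bdy_plus[OF ch closed_on_neg[OF cb], of l] assms(2) by simp
  also have "bdy (\<lambda>l. \<ominus> bdy \<chi> l) l = \<ominus> bdy (bdy \<chi>) l" using bdy_map[OF lin_uminus cb, of l] assms(2) by simp
  also have "bdy (bdy \<chi>) l = \<zero>" using bdy_bdy[OF assms(1)] l by simp
  also have "bdy ?h l = (a \<otimes> b) \<otimes> \<chi> l' \<ominus> a \<otimes> bdy \<chi> (b # l')" using l x by simp
  finally have "bdy (dif \<chi>) l = a \<otimes> (b \<otimes> \<chi> l' \<ominus> bdy \<chi> (b # l'))"
    using l x by (simp add: a_minus_def A.r_distr A.r_minus A.m_assoc)
  then show ?thesis using l x by (simp add: A.r_right_minus_eq)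
qed

end

section \<open>Degrees of cochains and the last argument\<close>

context conn_graded
begin

abbreviation IG :: "int \<Rightarrow> 'a set" where "IG j \<equiv> int_grading A gr j"

lemma IG_closed: "x \<in> IG j \<Longrightarrow> x \<in> carrier A"
  using gr_closed by (auto simp: int_grading_def split: if_splits)

lemma IG_zero [simp]: "\<zero> \<in> IG j" by (simp add: int_grading_def)

lemma IG_add: "x \<in> IG j \<Longrightarrow> y \<in> IG j \<Longrightarrow> x \<oplus> y \<in> IG j"
  using gr_add by (auto simp: int_grading_def split: if_splits)

lemma IG_neg: "x \<in> IG j \<Longrightarrow> \<ominus> x \<in> IG j"
  using gr_neg by (auto simp: int_grading_def split: if_splits)

lemma IG_nat: "IG (int i) = gr i" by (simp add: int_grading_def)

lemma IG_mult: "a \<in> gr i \<Longrightarrow> y \<in> IG j \<Longrightarrow> a \<otimes> y \<in> IG (j + int i)"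
  using gr_mult[of a i y "nat j"] gr_closed[of a i]
  by (auto simp: int_grading_def nat_add_distrib add.commute split: if_splits)

lemma IG_mult_right: "a \<in> gr i \<Longrightarrow> y \<in> IG j \<Longrightarrow> y \<otimes> a \<in> IG (j + int i)"
  using gr_mult[of y "nat j" a i] gr_closed[of a i]
  by (auto simp: int_grading_def nat_add_distrib split: if_splits)

lemma IG_sum: "finite S \<Longrightarrow> (\<And>s. s \<in> S \<Longrightarrow> u s \<in> IG j) \<Longrightarrow> (\<Oplus>s\<in>S. u s) \<in> IG j"
proof (induction S rule: finite_induct)
  case (insert x F)
  then have "u \<in> F \<rightarrow> carrier A" "u x \<in> carrier A" using IG_closed by auto
  with insert show ?case by (simp add: IG_add)
qed simp

lemma gdeg_cong:
  "(\<And>l. l \<in> lists n \<Longrightarrow> \<chi> l = \<chi>' l) \<Longrightarrow> gdeg n j \<chi> \<Longrightarrow> gdeg n j \<chi>'"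
proof (induction n arbitrary: \<chi> \<chi>' j)
  case (Suc n)
  show ?case unfolding gdeg.simps
  proof (intro allI ballI)
    fix i a assume a: "a \<in> gr i"
    show "gdeg n (j + int i) (\<lambda>l. \<chi>' (a # l))"
      by (rule Suc.IH[of "\<lambda>l. \<chi> (a # l)"]) (use Suc.prems a gr_closed in auto)
  qed
qed simp

lemma gdeg_map: "(\<And>i y. y \<in> IG i \<Longrightarrow> \<kappa> y \<in> IG (i + s)) \<Longrightarrow> gdeg n j \<chi> \<Longrightarrow> gdeg n (j + s) (\<lambda>l. \<kappa> (\<chi> l))"
proof (induction n arbitrary: \<chi> j)
  case (Suc n)
  have "gdeg n (j + s + int i) (\<lambda>l. \<kappa> (\<chi> (a # l)))" if "a \<in> gr i" for a i
    using Suc.IH[OF Suc.prems(1), of "j + int i" "\<lambda>l. \<chi> (a # l)"] Suc.prems(2) that by (simp add: ac_simps)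
  then show ?case by simp
qed simp

lemma gdeg_plus: "gdeg n j \<chi> \<Longrightarrow> gdeg n j \<psi> \<Longrightarrow> gdeg n j (\<lambda>l. \<chi> l \<oplus> \<psi> l)"
  by (induction n arbitrary: \<chi> \<psi> j) (auto simp: IG_add)

lemma gdeg_neg: "gdeg n j \<chi> \<Longrightarrow> gdeg n j (\<lambda>l. \<ominus> \<chi> l)"
  by (induction n arbitrary: \<chi> j) (auto simp: IG_neg)

lemma gdeg_minus: "gdeg n j \<chi> \<Longrightarrow> gdeg n j \<psi> \<Longrightarrow> gdeg n j (\<lambda>l. \<chi> l \<ominus> \<psi> l)"
  unfolding a_minus_def using gdeg_plus gdeg_neg by blast

lemma gdeg_zero: "gdeg n j (\<lambda>l. \<zero>)"
  by (induction n arbitrary: j) auto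

lemma gdeg_sum:
  "finite S \<Longrightarrow> (\<And>s. s \<in> S \<Longrightarrow> gdeg n j (\<chi> s)) \<Longrightarrow> gdeg n j (\<lambda>l. \<Oplus>s\<in>S. \<chi> s l)"
proof (induction n arbitrary: j \<chi>)
  case 0 then show ?case using IG_sum[OF 0(1), of "\<lambda>s. \<chi> s []"] by simp
next
  case (Suc n)
  then show ?case by simp
qed

lemma gdeg_bdy: "gdeg n j \<chi> \<Longrightarrow> gdeg (Suc n) j (bdy \<chi>)"
proof (induction n arbitrary: \<chi> j)
  case 0
  have "aug a \<otimes> \<chi> [] \<in> IG (j + int i)" if "a \<in> gr i" for a i
    using IG_mult[OF that, of "\<chi> []" j] 0 that IG_closed[of "\<chi> []"] by (auto simp: aug_homogeneous)
  then show ?case by simp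
next
  case (Suc n)
  show ?case unfolding gdeg.simps(2)[of "Suc n" j "bdy \<chi>"]
  proof (intro allI ballI)
    fix i a assume a: "a \<in> gr i"
    have ac: "a \<in> carrier A" using a gr_closed by blast
    have 1: "gdeg (Suc n) (j + int i) (\<lambda>l. \<chi> ((a \<otimes> hd l) # tl l))"
      unfolding gdeg.simps
    proof (intro allI ballI)
      fix k b assume "b \<in> gr k"
      then have "a \<otimes> b \<in> gr (i + k)" using a gr_mult by blast
      then have "gdeg n (j + int (i + k)) (\<lambda>l. \<chi> ((a \<otimes> b) # l))" using Suc.prems unfolding gdeg.simps by blast
      then show "gdeg n (j + int i + int k) (\<lambda>l. \<chi> ((a \<otimes> hd (b # l)) # tl (b # l)))" by (simp add: ac_simps)
    qed
    have "gdeg n (j + int i) (\<lambda>l. \<chi> (a # l))" using a Suc.prems by simp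
    from gdeg_minus[OF 1 Suc.IH[OF this]]
    show "gdeg (Suc n) (j + int i) (\<lambda>l. bdy \<chi> (a # l))"
      by (rule gdeg_cong[rotated]) (auto simp: length_Suc_conv)
  qed
qed

lemma gdeg_dif: assumes "gdeg n j \<chi>" shows "gdeg (Suc n) j (dif \<chi>)"
proof -
  have "gdeg (Suc n) j (\<lambda>l. hd l \<otimes> \<chi> (tl l))"
    using assms gdeg_map[of "\<lambda>y. _ \<otimes> y"] IG_mult by simp
  from gdeg_minus[OF this gdeg_bdy[OF assms]] show ?thesis by (simp add: dif_def[abs_def])
qed

lemma gdeg_snoc: "gdeg (Suc n) j \<chi> \<Longrightarrow> b \<in> gr i \<Longrightarrow> gdeg n (j + int i) (\<lambda>l. \<chi> (l @ [b]))"
proof (induction n arbitrary: \<chi> j)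
  case (Suc n)
  have "gdeg n (j + int k + int i) (\<lambda>l. \<chi> (a # l @ [b]))" if "a \<in> gr k" for a k
    using Suc.IH[of "j + int k" "\<lambda>l. \<chi> (a # l)"] Suc.prems that unfolding gdeg.simps(2)[of "Suc n"] by blast
  then show ?case by (simp add: ac_simps)
qed simp

lemma multi_snoc: "multi (Suc n) \<chi> \<Longrightarrow> b \<in> carrier A \<Longrightarrow> multi n (\<lambda>l. \<chi> (l @ [b]))"
proof (induction n arbitrary: \<chi>)
  case 0 then show ?case using multi_closed[of 1 \<chi> "[b]"] by simp
next
  case (Suc n)
  show ?case
  proof (rule multi_SucI)
    fix a assume "a \<in> carrier A"
    then show "multi n (\<lambda>l. \<chi> ((a # l) @ [b]))"
      using Suc.IH[of "\<lambda>l. \<chi> (a # l)"] multi_Cons[OF Suc.prems(1)] Suc.prems(2) by simp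
  next
    fix a a' l assume "a \<in> carrier A" "a' \<in> carrier A" "l \<in> lists n"
    then show "\<chi> (((a \<oplus> a') # l) @ [b]) = \<chi> ((a # l) @ [b]) \<oplus> \<chi> ((a' # l) @ [b])"
      using multi_add[OF Suc.prems(1), of a a' "l @ [b]"] Suc.prems(2) by simp
  next
    fix z a l assume "z \<in> gr 0" "a \<in> carrier A" "l \<in> lists n"
    then show "\<chi> (((z \<otimes> a) # l) @ [b]) = z \<otimes> \<chi> ((a # l) @ [b])"
      using multi_scal[OF Suc.prems(1), of z a "l @ [b]"] Suc.prems(2) by simp
  qed
qed

lemma multi_last: "multi (Suc n) \<chi> \<Longrightarrow> l \<in> lists n \<Longrightarrow> multi 1 (\<lambda>k. \<chi> (l @ k))"
proof (induction n arbitrary: \<chi> l)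
  case 0
  then have "l = []" by simp
  then show ?case using 0 by (simp add: multi.simps(2))
next
  case (Suc n)
  then obtain a l' where l: "l = a # l'" "a \<in> carrier A" "l' \<in> lists n" by (auto simp: length_Suc_conv)
  then show ?case using Suc.IH[OF multi_Cons[OF Suc.prems(1) l(2)] l(3)] by simp
qed

lemma multi_last_sum: "multi (Suc n) \<chi> \<Longrightarrow> l \<in> lists n \<Longrightarrow> finite S \<Longrightarrow> u \<in> S \<rightarrow> carrier A \<Longrightarrow>
    \<chi> (l @ [\<Oplus>s\<in>S. u s]) = (\<Oplus>s\<in>S. \<chi> (l @ [u s]))"
  using multi_finsum[of 0 "\<lambda>k. \<chi> (l @ k)" "[]" S u] multi_last[of n \<chi> l] by simp

text \<open>Multiplying a cochain by a linear functional of an additional last argument.\<close>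

lemma multi_tensor:
  "multi n \<psi> \<Longrightarrow> lin \<nu> \<Longrightarrow> multi (Suc n) (\<lambda>l. \<psi> (butlast l) \<otimes> \<nu> (last l))"
proof (induction n arbitrary: \<psi>)
  case 0
  have "\<psi> [] \<otimes> \<nu> (z \<otimes> a) = z \<otimes> (\<psi> [] \<otimes> \<nu> a)" if "z \<in> gr 0" "a \<in> carrier A" for z a
    using 0 that linD(3)[OF 0(2)] linD(1)[OF 0(2)] linD(3)[OF lin_mult_left, of "\<psi> []" z "\<nu> a"] by simp
  then show ?case using 0 linD(1,2)[OF 0(2)] by (auto intro!: multi_SucI simp: A.r_distr)
next
  case (Suc n)
  show ?case
  proof (rule multi_SucI)
    fix a assume "a \<in> carrier A"
    then have "multi (Suc n) (\<lambda>l. \<psi> (a # butlast l) \<otimes> \<nu> (last l))"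
      using Suc.IH[OF _ Suc.prems(2), of "\<lambda>l. \<psi> (a # l)"] multi_Cons[OF Suc.prems(1)] by blast
    then show "multi (Suc n) (\<lambda>l. \<psi> (butlast (a # l)) \<otimes> \<nu> (last (a # l)))"
      by (rule multi_cong[rotated]) auto
  next
    fix a b l assume h: "a \<in> carrier A" "b \<in> carrier A" "l \<in> lists (Suc n)"
    then have "butlast l \<in> lists n" "last l \<in> carrier A" "l \<noteq> []"
      by (auto dest: in_set_butlastD simp: subset_iff) (metis last_in_set length_0_conv nat.distinct(1))
    then show "\<psi> (butlast ((a \<oplus> b) # l)) \<otimes> \<nu> (last ((a \<oplus> b) # l)) =
        \<psi> (butlast (a # l)) \<otimes> \<nu> (last (a # l)) \<oplus> \<psi> (butlast (b # l)) \<otimes> \<nu> (last (b # l))"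
      using multi_add[OF Suc.prems(1) h(1,2), of "butlast l"] multi_closed[OF Suc.prems(1), of "_ # butlast l"]
        h linD(1)[OF Suc.prems(2)] by (simp add: A.l_distr)
  next
    fix z a l assume h: "z \<in> gr 0" "a \<in> carrier A" "l \<in> lists (Suc n)"
    then have "butlast l \<in> lists n" "last l \<in> carrier A" "l \<noteq> []"
      by (auto dest: in_set_butlastD simp: subset_iff) (metis last_in_set length_0_conv nat.distinct(1))
    then show "\<psi> (butlast ((z \<otimes> a) # l)) \<otimes> \<nu> (last ((z \<otimes> a) # l)) =
        z \<otimes> (\<psi> (butlast (a # l)) \<otimes> \<nu> (last (a # l)))"
      using multi_scal[OF Suc.prems(1) h(1,2), of "butlast l"] multi_closed[OF Suc.prems(1), of "_ # butlast l"]
        h linD(1)[OF Suc.prems(2)] gr_closed[OF h(1)] by (simp add: A.m_assoc)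
  qed
qed

lemma gdeg_tensor:
  "gdeg n (j + int s) \<psi> \<Longrightarrow> multi n \<psi> \<Longrightarrow> (\<And>i a. a \<in> gr i \<Longrightarrow> \<nu> a \<in> gr 0) \<Longrightarrow>
    (\<And>i a. a \<in> gr i \<Longrightarrow> i \<noteq> s \<Longrightarrow> \<nu> a = \<zero>) \<Longrightarrow>
    gdeg (Suc n) j (\<lambda>l. \<psi> (butlast l) \<otimes> \<nu> (last l))"
proof (induction n arbitrary: \<psi> j)
  case 0
  have "\<psi> [] \<otimes> \<nu> a \<in> IG (j + int i)" if a: "a \<in> gr i" for i a
  proof (cases "i = s")
    case True
    then show ?thesis using 0(1) IG_mult_right[OF 0(3)[OF a], of "\<psi> []" "j + int s"] by simp
  next
    case False
    then show ?thesis using 0(2,4) a by simp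
  qed
  then show ?case by simp
next
  case (Suc n)
  show ?case unfolding gdeg.simps(2)[of "Suc n"]
  proof (intro allI ballI)
    fix i a assume a: "a \<in> gr i"
    have "gdeg n (j + int i + int s) (\<lambda>l. \<psi> (a # l))" using Suc.prems(1) a by (auto simp: ac_simps)
    then have "gdeg (Suc n) (j + int i) (\<lambda>l. \<psi> (a # butlast l) \<otimes> \<nu> (last l))"
      using Suc.IH[of "j + int i" "\<lambda>l. \<psi> (a # l)"] multi_Cons[OF Suc.prems(2) gr_closed[OF a]] Suc.prems(3,4) by blast
    then show "gdeg (Suc n) (j + int i) (\<lambda>l. \<psi> (butlast (a # l)) \<otimes> \<nu> (last (a # l)))"
      by (rule gdeg_cong[rotated]) auto
  qed
qed

definition sgn :: "nat \<Rightarrow> 'a \<Rightarrow> 'a" where "sgn n y = (if even n then y else \<ominus> y)"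

lemma sgn_closed [simp]: "y \<in> carrier A \<Longrightarrow> sgn n y \<in> carrier A"
  by (simp add: sgn_def)

lemma sgn_Suc: "y \<in> carrier A \<Longrightarrow> sgn (Suc n) y = \<ominus> sgn n y"
  by (simp add: sgn_def)

lemma sgn_zero [simp]: "sgn n \<zero> = \<zero>"
  by (simp add: sgn_def)

lemma sgn_zero_iff: "y \<in> carrier A \<Longrightarrow> sgn n y = \<zero> \<longleftrightarrow> y = \<zero>"
  by (auto simp: sgn_def)

text \<open>Freezing the last argument \<open>b\<close> gives a cochain in one variable less. The two differentials differ by a term
  which measures how far \<open>\<chi>\<close>, as a function of its last argument, is from being a map of \<open>A\<close>-modules into
  functions on which \<open>A\<close> acts by the augmentation.\<close>

lemma bdy_snoc:
  "closed_on (Suc (length xs)) \<chi> \<Longrightarrow> set xs \<subseteq> carrier A \<Longrightarrow> a \<in> carrier A \<Longrightarrow> b \<in> carrier A \<Longrightarrow>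
   bdy \<chi> (xs @ [a, b]) = bdy (\<lambda>l. \<chi> (l @ [b])) (xs @ [a]) \<oplus>
     sgn (length xs) (\<chi> (xs @ [a \<otimes> b]) \<ominus> aug a \<otimes> \<chi> (xs @ [b]) \<ominus> aug b \<otimes> \<chi> (xs @ [a]))"
proof (induction xs arbitrary: \<chi>)
  case Nil
  have "\<chi> [a \<otimes> b] \<in> carrier A" "\<chi> [a] \<in> carrier A" "\<chi> [b] \<in> carrier A"
    using Nil by (auto simp: closed_on_def)
  then show ?case using Nil by (simp add: sgn_def a_minus_def M.a_ac M.r_neg2 M.r_neg1)
next
  case (Cons x xs)
  let ?\<chi>x = "\<lambda>l. \<chi> (x # l)"
  have x: "x \<in> carrier A" "set xs \<subseteq> carrier A" using Cons.prems by auto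
  have cx: "closed_on (Suc (length xs)) ?\<chi>x" using closed_on_Cons Cons.prems(1) x(1) by simp
  note c = closed_onD[OF cx]
  obtain y ys zs where ys: "xs @ [a, b] = y # ys @ [b]" "xs @ [a] = y # ys" "y \<in> carrier A" "set ys \<subseteq> carrier A"
    "length ys = length xs"
    using x(2) Cons.prems(3) by (cases xs) auto
  let ?t = "\<chi> ((x # xs) @ [a \<otimes> b]) \<ominus> aug a \<otimes> \<chi> ((x # xs) @ [b]) \<ominus> aug b \<otimes> \<chi> ((x # xs) @ [a])"
  have t: "?t \<in> carrier A" using c[of "xs @ [a \<otimes> b]"] c[of "xs @ [a]"] c[of "xs @ [b]"] x Cons.prems by simp
  have B: "bdy (\<lambda>l. ?\<chi>x (l @ [b])) (xs @ [a]) \<in> carrier A"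
    by (rule bdy_closed[of "length xs"]) (use cx x Cons.prems in \<open>auto simp: closed_on_def\<close>)
  have X: "\<chi> ((x \<otimes> y) # ys @ [b]) \<in> carrier A"
    using closed_onD[OF Cons.prems(1), of "(x \<otimes> y) # ys @ [b]"] x ys Cons.prems by simp
  have "bdy \<chi> ((x # xs) @ [a, b]) = \<chi> ((x \<otimes> y) # ys @ [b]) \<ominus> bdy ?\<chi>x (xs @ [a, b])"
    by (simp only: append_Cons ys(1) bdy.simps)
  also have "bdy ?\<chi>x (xs @ [a, b]) = bdy (\<lambda>l. ?\<chi>x (l @ [b])) (xs @ [a]) \<oplus> sgn (length xs) ?t"
    using Cons.IH[OF cx x(2) Cons.prems(3,4)] by simp
  also have "\<chi> ((x \<otimes> y) # ys @ [b]) \<ominus> (bdy (\<lambda>l. ?\<chi>x (l @ [b])) (xs @ [a]) \<oplus> sgn (length xs) ?t)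
     = (\<chi> ((x \<otimes> y) # ys @ [b]) \<ominus> bdy (\<lambda>l. ?\<chi>x (l @ [b])) (xs @ [a])) \<oplus> sgn (length (x # xs)) ?t"
    using B X t by (simp add: sgn_Suc a_minus_def M.minus_add M.a_ac)
  also have "\<chi> ((x \<otimes> y) # ys @ [b]) \<ominus> bdy (\<lambda>l. ?\<chi>x (l @ [b])) (xs @ [a]) = bdy (\<lambda>l. \<chi> (l @ [b])) ((x # xs) @ [a])"
    using ys(2) by simp
  finally show ?case .
qed

lemma dif_snoc:
  assumes "closed_on (Suc (length xs)) \<chi>" "set xs \<subseteq> carrier A" "a \<in> carrier A" "b \<in> carrier A"
  shows "dif \<chi> (xs @ [a, b]) = dif (\<lambda>l. \<chi> (l @ [b])) (xs @ [a]) \<ominus>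
     sgn (length xs) (\<chi> (xs @ [a \<otimes> b]) \<ominus> aug a \<otimes> \<chi> (xs @ [b]) \<ominus> aug b \<otimes> \<chi> (xs @ [a]))"
proof -
  let ?t = "\<chi> (xs @ [a \<otimes> b]) \<ominus> aug a \<otimes> \<chi> (xs @ [b]) \<ominus> aug b \<otimes> \<chi> (xs @ [a])"
  have t: "?t \<in> carrier A" using closed_onD[OF assms(1), of "xs @ [a \<otimes> b]"] closed_onD[OF assms(1), of "xs @ [a]"]
      closed_onD[OF assms(1), of "xs @ [b]"] assms by simp
  have B: "bdy (\<lambda>l. \<chi> (l @ [b])) (xs @ [a]) \<in> carrier A"
    by (rule bdy_closed[of "length xs"]) (use assms in \<open>auto simp: closed_on_def\<close>)
  obtain y ys where ys: "xs @ [a, b] = y # ys @ [b]" "xs @ [a] = y # ys" "y \<in> carrier A" "set ys \<subseteq> carrier A"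
    "length ys = length xs"
    using assms(2,3) by (cases xs) auto
  have Y: "\<chi> (ys @ [b]) \<in> carrier A" using closed_onD[OF assms(1), of "ys @ [b]"] ys assms by simp
  show ?thesis
    unfolding dif_def bdy_snoc[OF assms] unfolding ys(1) ys(2) list.sel
    using ys(3) Y B t unfolding ys(2) by (simp add: a_minus_def M.minus_add M.a_ac)
qed

end

section \<open>Restriction to the fixed ring is injective on Ext\<close>

context conn_graded
begin

definition cocycle :: "nat \<Rightarrow> int \<Rightarrow> ('a list \<Rightarrow> 'a) \<Rightarrow> bool" where
  "cocycle n j \<chi> \<longleftrightarrow> multi n \<chi> \<and> gdeg n j \<chi> \<and> (\<forall>l\<in>lists (Suc n). dif \<chi> l = \<zero>)"

text \<open>There are no cochains below degree 0, so in degree 0 only zero bounds.\<close>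

definition bounds :: "nat \<Rightarrow> int \<Rightarrow> ('a list \<Rightarrow> 'a) \<Rightarrow> bool" where
  "bounds n j \<chi> \<longleftrightarrow> (case n of 0 \<Rightarrow> \<chi> [] = \<zero> | Suc N \<Rightarrow>
     \<exists>\<psi>. multi N \<psi> \<and> gdeg N j \<psi> \<and> (\<forall>l\<in>lists n. \<chi> l = dif \<psi> l))"

definition acyclic_in :: "nat \<Rightarrow> bool" where
  "acyclic_in n \<longleftrightarrow> (\<forall>j \<chi>. cocycle n j \<chi> \<longrightarrow> bounds n j \<chi>)"

lemma boundsI: "multi N \<psi> \<Longrightarrow> gdeg N j \<psi> \<Longrightarrow> (\<And>l. l \<in> lists (Suc N) \<Longrightarrow> \<chi> l = dif \<psi> l) \<Longrightarrow> bounds (Suc N) j \<chi>"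
  unfolding bounds_def by auto

lemma cocycle_minus_dif:
  assumes "cocycle (Suc N) j \<chi>" "multi N \<psi>" "gdeg N j \<psi>"
  shows "cocycle (Suc N) j (\<lambda>l. \<chi> l \<ominus> dif \<psi> l)"
proof -
  have c: "closed_on (Suc N) \<chi>" "closed_on (Suc N) (dif \<psi>)"
    using assms multi_closed_on multi_dif unfolding cocycle_def by blast+
  have "dif (\<lambda>l. \<chi> l \<ominus> dif \<psi> l) l = \<zero>" if "l \<in> lists (Suc (Suc N))" for l
    using dif_minus[OF c that] dif_dif[OF assms(2) that] assms(1) that
    unfolding cocycle_def by (auto simp: a_minus_def)
  then show ?thesis
    using assms multi_minus[OF _ multi_dif] gdeg_minus[OF _ gdeg_dif] unfolding cocycle_def by blast
qed

lemma bounds_minus_dif: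
  assumes "cocycle (Suc N) j \<chi>" "multi N \<psi>" "gdeg N j \<psi>" "bounds (Suc N) j (\<lambda>l. \<chi> l \<ominus> dif \<psi> l)"
  shows "bounds (Suc N) j \<chi>"
proof -
  obtain \<theta> where \<theta>: "multi N \<theta>" "gdeg N j \<theta>" "\<And>l. l \<in> lists (Suc N) \<Longrightarrow> \<chi> l \<ominus> dif \<psi> l = dif \<theta> l"
    using assms(4) unfolding bounds_def by auto
  show ?thesis
  proof (rule boundsI[OF multi_plus[OF \<theta>(1) assms(2)] gdeg_plus[OF \<theta>(2) assms(3)]])
    fix l assume l: "l \<in> lists (Suc N)"
    have c: "\<chi> l \<in> carrier A" "dif \<psi> l \<in> carrier A"
      using assms(1) multi_closed[OF _ l] dif_closed[OF multi_closed_on[OF assms(2)] l] unfolding cocycle_def by auto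
    have "dif (\<lambda>l. \<theta> l \<oplus> \<psi> l) l = (\<chi> l \<ominus> dif \<psi> l) \<oplus> dif \<psi> l"
      using dif_plus[OF multi_closed_on[OF \<theta>(1)] multi_closed_on[OF assms(2)] l] \<theta>(3)[OF l] by simp
    then show "\<chi> l = dif (\<lambda>l. \<theta> l \<oplus> \<psi> l) l" using c by (simp add: a_minus_def M.a_assoc M.l_neg)
  qed
qed

lemma dif_zero: "l \<in> lists (Suc n) \<Longrightarrow> dif (\<lambda>l. \<zero>) l = \<zero>"
  using bdy_zero[of l n] by (cases l) (auto simp: a_minus_def)

lemma bounds_zero: "(\<And>l. l \<in> lists n \<Longrightarrow> \<chi> l = \<zero>) \<Longrightarrow> bounds n j \<chi>"
proof (cases n)
  case 0
  assume "\<And>l. l \<in> lists n \<Longrightarrow> \<chi> l = \<zero>"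
  then show ?thesis using 0 by (simp add: bounds_def)
next
  case (Suc N)
  assume "\<And>l. l \<in> lists n \<Longrightarrow> \<chi> l = \<zero>"
  then show ?thesis using Suc boundsI[OF multi_zero gdeg_zero, of N \<chi> j] dif_zero by simp
qed

lemma multi_sgn: "multi n \<psi> \<Longrightarrow> multi n (\<lambda>l. sgn p (\<psi> l))"
  by (cases "even p") (simp_all add: sgn_def multi_neg)

lemma gdeg_sgn: "gdeg n j \<psi> \<Longrightarrow> gdeg n j (\<lambda>l. sgn p (\<psi> l))"
  by (cases "even p") (simp_all add: sgn_def gdeg_neg)

lemma dif_sgn: "closed_on n \<psi> \<Longrightarrow> l \<in> lists (Suc n) \<Longrightarrow> dif (\<lambda>l. sgn p (\<psi> l)) l = sgn p (dif \<psi> l)"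
  using dif_neg by (simp add: sgn_def)

lemma sgn_sgn: "y \<in> carrier A \<Longrightarrow> sgn p (sgn p y) = y"
  by (simp add: sgn_def)

lemma multi_zero_entry: "multi n \<chi> \<Longrightarrow> l \<in> lists n \<Longrightarrow> \<zero> \<in> set l \<Longrightarrow> \<chi> l = \<zero>"
proof (induction n arbitrary: \<chi> l)
  case (Suc n)
  then obtain a l' where l: "l = a # l'" "a \<in> carrier A" "l' \<in> lists n" by (auto simp: length_Suc_conv)
  show ?case
  proof (cases "a = \<zero>")
    case True then show ?thesis using multi_zero_head[OF Suc.prems(1) l(3)] l by simp
  next
    case False then show ?thesis using Suc.IH[OF multi_Cons[OF Suc.prems(1) l(2)] l(3)] l Suc.prems by simp
  qed
qed simp

lemma finsum_minus: "finite S \<Longrightarrow> u \<in> S \<rightarrow> carrier A \<Longrightarrow> v \<in> S \<rightarrow> carrier A \<Longrightarrow>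
    (\<Oplus>s\<in>S. u s \<ominus> v s) = (\<Oplus>s\<in>S. u s) \<ominus> (\<Oplus>s\<in>S. v s)"
proof (induction S rule: finite_induct)
  case (insert x F)
  then have c: "u x \<in> carrier A" "v x \<in> carrier A" "u \<in> F \<rightarrow> carrier A" "v \<in> F \<rightarrow> carrier A" by auto
  then have "(\<lambda>s. u s \<ominus> v s) \<in> F \<rightarrow> carrier A" by auto
  then show ?case using insert c by (simp add: a_minus_def M.minus_add M.a_ac)
qed (simp add: a_minus_def)

end

context covariant_basis
begin

text \<open>A contracting homotopy coming from the freeness of \<open>A\<close> as a right \<open>R\<close>-module: with the first \<open>p\<close>
  arguments frozen, the next argument \<open>a\<close> is replaced by the pairs \<open>(f h, r\<^sub>h)\<close> for \<open>a = \<Sum> f\<^sub>h r\<^sub>h\<close>.\<close>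

fun push :: "nat \<Rightarrow> ('a list \<Rightarrow> 'a) \<Rightarrow> 'a list \<Rightarrow> 'a" where
  "push 0 \<chi> l = (\<Oplus>h\<in>carrier G. \<chi> (f h # coord h (hd l) # tl l))"
| "push (Suc p) \<chi> l = push p (\<lambda>k. \<chi> (hd l # k)) (tl l)"

definition vanish :: "nat \<Rightarrow> nat \<Rightarrow> ('a list \<Rightarrow> 'a) \<Rightarrow> bool" where
  "vanish p q \<chi> \<longleftrightarrow> (\<forall>xs\<in>lists p. \<forall>ys. length ys = q \<and> set ys \<subseteq> R \<longrightarrow> \<chi> (xs @ ys) = \<zero>)"

lemma vanishD: "vanish p q \<chi> \<Longrightarrow> length xs = p \<Longrightarrow> set xs \<subseteq> carrier A \<Longrightarrow> length ys = q \<Longrightarrow> set ys \<subseteq> R \<Longrightarrow>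
    \<chi> (xs @ ys) = \<zero>"
  unfolding vanish_def by blast

lemma R_sub: "set ys \<subseteq> R \<Longrightarrow> set ys \<subseteq> carrier A" using R_closed by blast

lemma push_append: "length xs = p \<Longrightarrow>
    push p \<chi> (xs @ a # l) = (\<Oplus>h\<in>carrier G. \<chi> (xs @ f h # coord h a # l))"
  by (induction p arbitrary: \<chi> xs) (auto simp: length_Suc_conv)

lemma split_at: "p < n \<Longrightarrow> l \<in> lists n \<Longrightarrow> \<exists>xs a ys. l = xs @ a # ys \<and> length xs = p \<and> set xs \<subseteq> carrier A \<and>
    a \<in> carrier A \<and> set ys \<subseteq> carrier A \<and> length ys = n - Suc p"
proof -
  assume "p < n" "l \<in> lists n"
  then have "l = take p l @ l ! p # drop (Suc p) l" "l ! p \<in> carrier A"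
    by (auto simp: id_take_nth_drop dest: nth_mem)
  then show ?thesis using \<open>p < n\<close> \<open>l \<in> lists n\<close>
    by (intro exI[of _ "take p l"] exI[of _ "l ! p"] exI[of _ "drop (Suc p) l"])
      (auto dest: in_set_takeD in_set_dropD)
qed

lemma multi_push: "multi (Suc n) \<chi> \<Longrightarrow> p < n \<Longrightarrow> multi n (push p \<chi>)"
proof (induction p arbitrary: n \<chi>)
  case 0
  then obtain m where n: "n = Suc m" by (cases n) auto
  have "multi n (\<lambda>l. \<chi> (f h # coord h (hd l) # tl l))" if h: "h \<in> carrier G" for h
  proof -
    have mh: "multi (Suc m) (\<lambda>l. \<chi> (f h # l))" using multi_Cons[OF 0(1)] h n by simp
    show ?thesis unfolding n
      by (rule multi_SucI)
        (use multi_Cons[OF mh] multi_add[OF mh] multi_scal[OF mh] h in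
          \<open>auto simp: coord_add coord_central\<close>)
  qed
  then show ?case using multi_sum[OF finite_G, of n "\<lambda>h l. \<chi> (f h # coord h (hd l) # tl l)"] by simp
next
  case (Suc p)
  then obtain m where n: "n = Suc m" "p < m" by (cases n) auto
  have ml: "\<And>a. a \<in> carrier A \<Longrightarrow> multi (Suc m) (\<lambda>l. \<chi> (a # l))" using multi_Cons Suc.prems(1) n by simp
  show ?case unfolding n(1)
  proof (rule multi_SucI)
    fix a assume "a \<in> carrier A"
    then show "multi m (\<lambda>l. push (Suc p) \<chi> (a # l))" using Suc.IH[OF ml n(2)] by simp
  next
    fix a b l assume h: "a \<in> carrier A" "b \<in> carrier A" "l \<in> lists m"
    then obtain xs c ys where l: "l = xs @ c # ys" "length xs = p" "set xs \<subseteq> carrier A" "c \<in> carrier A"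
      "set ys \<subseteq> carrier A" "length ys = m - Suc p" using split_at[OF n(2) h(3)] by blast
    have k: "xs @ f g # coord g c # ys \<in> lists (Suc m)" if "g \<in> carrier G" for g using l n that by simp
    have "(\<lambda>g. \<chi> (x # xs @ f g # coord g c # ys)) \<in> carrier G \<rightarrow> carrier A" if "x \<in> carrier A" for x
      using multi_closed[OF ml[OF that] k] by auto
    then have "(\<Oplus>g\<in>carrier G. \<chi> (a # xs @ f g # coord g c # ys) \<oplus> \<chi> (b # xs @ f g # coord g c # ys)) =
        push p (\<lambda>k. \<chi> (a # k)) l \<oplus> push p (\<lambda>k. \<chi> (b # k)) l"
      using h l by (simp add: push_append M.finsum_addf)
    moreover have "push p (\<lambda>k. \<chi> ((a \<oplus> b) # k)) l =
        (\<Oplus>g\<in>carrier G. \<chi> (a # xs @ f g # coord g c # ys) \<oplus> \<chi> (b # xs @ f g # coord g c # ys))"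
      unfolding l(1) push_append[OF l(2)]
      by (rule M.add.finprod_cong')
        (use multi_add[OF Suc.prems(1)[unfolded n(1)] h(1,2) k] multi_closed[OF ml k] h in auto)
    ultimately show "push (Suc p) \<chi> ((a \<oplus> b) # l) = push (Suc p) \<chi> (a # l) \<oplus> push (Suc p) \<chi> (b # l)" by simp
  next
    fix z a l assume h: "z \<in> gr 0" "a \<in> carrier A" "l \<in> lists m"
    then obtain xs c ys where l: "l = xs @ c # ys" "length xs = p" "set xs \<subseteq> carrier A" "c \<in> carrier A"
      "set ys \<subseteq> carrier A" "length ys = m - Suc p" using split_at[OF n(2) h(3)] by blast
    have z: "z \<in> carrier A" using h gr_closed by blast
    have k: "xs @ f g # coord g c # ys \<in> lists (Suc m)" if "g \<in> carrier G" for g using l n that by simp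
    have "(\<lambda>g. \<chi> (a # xs @ f g # coord g c # ys)) \<in> carrier G \<rightarrow> carrier A"
      using multi_closed[OF ml[OF h(2)] k] by auto
    then have "(\<Oplus>g\<in>carrier G. z \<otimes> \<chi> (a # xs @ f g # coord g c # ys)) = z \<otimes> push p (\<lambda>k. \<chi> (a # k)) l"
      using z l by (simp add: push_append A.finsum_rdistr finite_G)
    moreover have "push p (\<lambda>k. \<chi> ((z \<otimes> a) # k)) l = (\<Oplus>g\<in>carrier G. z \<otimes> \<chi> (a # xs @ f g # coord g c # ys))"
      unfolding l(1) push_append[OF l(2)]
      by (rule M.add.finprod_cong')
        (use multi_scal[OF Suc.prems(1)[unfolded n(1)] h(1,2) k] multi_closed[OF ml k] h z in auto)
    ultimately show "push (Suc p) \<chi> ((z \<otimes> a) # l) = z \<otimes> push (Suc p) \<chi> (a # l)" by simp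
  qed
qed

lemma gdeg_push: "multi (Suc n) \<chi> \<Longrightarrow> gdeg (Suc n) j \<chi> \<Longrightarrow> p < n \<Longrightarrow> gdeg n j (push p \<chi>)"
proof (induction p arbitrary: n \<chi> j)
  case 0
  then obtain m where n: "n = Suc m" by (cases n) auto
  have "gdeg m (j + int i) (\<lambda>l. \<chi> (f h # coord h a # l))" if h: "h \<in> carrier G" and a: "a \<in> gr i" for h a i
  proof -
    have g1: "gdeg (Suc m) (j + int (dg h)) (\<lambda>l. \<chi> (f h # l))" using 0(2) f_gr[OF h] n by simp
    show ?thesis
    proof (cases "dg h \<le> i")
      case True
      then have "coord h a \<in> gr (i - dg h)" using coord_gr[OF h a] by simp
      then have "gdeg m (j + int (dg h) + int (i - dg h)) (\<lambda>l. \<chi> (f h # coord h a # l))"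
        using g1 by simp
      then show ?thesis using True by (simp add: of_nat_diff)
    next
      case False
      then have 1: "coord h a = \<zero>" using coord_gr[OF h a] by simp
      show ?thesis
        by (rule gdeg_cong[OF _ gdeg_zero])
          (use multi_zero_entry[OF 0(1)] 1 h n in auto)
    qed
  qed
  then show ?case unfolding n by (auto intro!: gdeg_sum[OF finite_G])
next
  case (Suc p)
  then obtain m where n: "n = Suc m" "p < m" by (cases n) auto
  show ?case unfolding n(1) gdeg.simps
  proof (intro allI ballI)
    fix i a assume a: "a \<in> gr i"
    have "multi (Suc m) (\<lambda>l. \<chi> (a # l))" using multi_Cons Suc.prems(1) n gr_closed[OF a] by simp
    moreover have "gdeg (Suc m) (j + int i) (\<lambda>l. \<chi> (a # l))"
      using Suc.prems(2) a unfolding n(1) gdeg.simps(2)[of "Suc m"] by blast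
    ultimately show "gdeg m (j + int i) (\<lambda>l. push (Suc p) \<chi> (a # l))" using Suc.IH n(2) by simp
  qed
qed

text \<open>An argument in \<open>R\<close> has the single coordinate \<open>r\<^sub>e\<close>, so \<open>push\<close> inserts \<open>f e = 1 \<in> R\<close> in front of it.\<close>

lemma push_R:
  assumes "multi (p + Suc (Suc s)) \<chi>" "vanish p (Suc (Suc s)) \<chi>"
    and "length xs = p" "set xs \<subseteq> carrier A" "y \<in> R" "set ys \<subseteq> R" "length ys = s"
  shows "push p \<chi> (xs @ y # ys) = \<zero>"
proof -
  have "\<chi> (xs @ f h # coord h y # ys) = \<zero>" if h: "h \<in> carrier G" for h
  proof (cases "h = \<one>\<^bsub>G\<^esub>")
    case True
    then show ?thesis
      using vanishD[OF assms(2-4), of "\<one> # y # ys"] assms one_R coord_R[OF h assms(5)] by (simp add: f_one)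
  next
    case False
    then show ?thesis
      using multi_zero_entry[OF assms(1), of "xs @ f h # coord h y # ys"] assms h R_sub[OF assms(6)]
        coord_R[OF h assms(5)] by simp
  qed
  then show ?thesis unfolding push_append[OF assms(3)] by (simp add: M.add.finprod_one_eqI)
qed

text \<open>Merging \<open>f h\<close> with \<open>r\<^sub>h\<close> gives back \<open>\<chi>\<close>, and merging \<open>r\<^sub>h\<close> with the argument that follows it, an element of \<open>R\<close>,
  is compatible with \<open>push\<close>; these terms are the case \<open>p = 0\<close>. The terms in which two of the first
  arguments merge have too many arguments in \<open>R\<close> and vanish, so each frozen argument only changes the sign.\<close>

lemma bdy_push:
  "multi (p + Suc (Suc s)) \<chi> \<Longrightarrow> vanish p (Suc (Suc s)) \<chi> \<Longrightarrow> length xs = p \<Longrightarrow> set xs \<subseteq> carrier A \<Longrightarrow>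
   a \<in> carrier A \<Longrightarrow> length ys = Suc s \<Longrightarrow> set ys \<subseteq> R \<Longrightarrow>
   bdy (push p \<chi>) (xs @ a # ys) \<oplus> (\<Oplus>h\<in>carrier G. bdy \<chi> (xs @ f h # coord h a # ys)) = sgn p (\<chi> (xs @ a # ys))"
proof (induction p arbitrary: \<chi> xs)
  case 0
  then obtain y ys' where ys: "ys = y # ys'" "y \<in> R" "set ys' \<subseteq> R" "length ys' = s" by (auto simp: length_Suc_conv)
  have yc: "y \<in> carrier A" "set ys' \<subseteq> carrier A" using ys R_closed R_sub by auto
  have m: "multi (Suc (Suc s)) \<chi>" using 0(1) by simp
  let ?P = "\<lambda>h. \<chi> ((f h \<otimes> coord h a) # ys)" and ?Q = "\<lambda>h. \<chi> (f h # (coord h a \<otimes> y) # ys')"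
    and ?W = "\<lambda>h. bdy (\<lambda>l. \<chi> (f h # coord h a # l)) ys"
  have cW: "closed_on s (\<lambda>l. \<chi> (f h # coord h a # l))" if "h \<in> carrier G" for h
    using multi_closed_on[OF m] that 0(5) by (auto simp: closed_on_def)
  have c: "?P \<in> carrier G \<rightarrow> carrier A" "?Q \<in> carrier G \<rightarrow> carrier A" "?W \<in> carrier G \<rightarrow> carrier A"
    using multi_closed[OF m] bdy_closed[OF cW] 0(5) ys yc by auto
  have S: "(\<Oplus>h\<in>carrier G. ?P h) \<in> carrier A" "(\<Oplus>h\<in>carrier G. ?Q h) \<in> carrier A" "(\<Oplus>h\<in>carrier G. ?W h) \<in> carrier A"
    using c by simp_all
  have "(\<Oplus>h\<in>carrier G. \<chi> (f h # coord h (a \<otimes> y) # ys')) = (\<Oplus>h\<in>carrier G. ?Q h)"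
    by (rule M.add.finprod_cong') (use c coord_mult_right[OF _ 0(5) ys(2)] in auto)
  moreover have "bdy (\<lambda>l. \<Oplus>h\<in>carrier G. \<chi> (f h # coord h a # l)) ys = (\<Oplus>h\<in>carrier G. ?W h)"
    by (rule bdy_sum[OF finite_G, of s]) (use cW ys yc in auto)
  ultimately have 1: "bdy (push 0 \<chi>) (a # ys) = (\<Oplus>h\<in>carrier G. ?Q h) \<ominus> (\<Oplus>h\<in>carrier G. ?W h)"
    using ys by simp
  have c': "?P h \<in> carrier A" "?Q h \<in> carrier A" "?W h \<in> carrier A" if "h \<in> carrier G" for h
    using c that by auto
  have "(\<Oplus>h\<in>carrier G. bdy \<chi> (f h # coord h a # ys)) = (\<Oplus>h\<in>carrier G. ?P h \<ominus> (?Q h \<ominus> ?W h))"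
    by (rule M.add.finprod_cong') (use c' ys in auto)
  also have "\<dots> = (\<Oplus>h\<in>carrier G. ?P h) \<ominus> ((\<Oplus>h\<in>carrier G. ?Q h) \<ominus> (\<Oplus>h\<in>carrier G. ?W h))"
  proof -
    have "(\<lambda>h. ?Q h \<ominus> ?W h) \<in> carrier G \<rightarrow> carrier A" using c by auto
    then show ?thesis using c finsum_minus[OF finite_G] by simp
  qed
  finally have 2: "(\<Oplus>h\<in>carrier G. bdy \<chi> (f h # coord h a # ys)) =
      (\<Oplus>h\<in>carrier G. ?P h) \<ominus> ((\<Oplus>h\<in>carrier G. ?Q h) \<ominus> (\<Oplus>h\<in>carrier G. ?W h))" .
  have "(\<Oplus>h\<in>carrier G. ?P h) = \<chi> (a # ys)"
    using multi_finsum[OF m, of ys "carrier G" "\<lambda>h. f h \<otimes> coord h a"] finite_G sum_coord[OF 0(5)] 0(5) ys yc by auto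
  moreover have "x \<oplus> (p \<ominus> x) = p" if "x \<in> carrier A" "p \<in> carrier A" for x p
    using that by (simp add: a_minus_def M.a_ac M.r_neg)
  moreover have "xs = []" using 0(3) by simp
  ultimately show ?case
    using S unfolding \<open>xs = []\<close> append_Nil 2 unfolding 1 by (simp add: sgn_def)
next
  case (Suc p)
  then obtain b xs' where xs: "xs = b # xs'" "b \<in> carrier A" "set xs' \<subseteq> carrier A" "length xs' = p"
    by (auto simp: length_Suc_conv)
  obtain y ys' where ys: "ys = y # ys'" "y \<in> R" "set ys' \<subseteq> R" "length ys' = s"
    using Suc.prems by (auto simp: length_Suc_conv)
  have ysc: "set ys \<subseteq> carrier A" using R_sub Suc.prems by blast
  let ?\<chi>b = "\<lambda>l. \<chi> (b # l)"
  have mb: "multi (p + Suc (Suc s)) ?\<chi>b" using multi_Cons[of "p + Suc (Suc s)" \<chi> b] Suc.prems(1) xs(2) by simp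
  have vb: "vanish p (Suc (Suc s)) ?\<chi>b"
    unfolding vanish_def using vanishD[OF Suc.prems(2), of "b # _"] xs(2) by auto
  note IH = Suc.IH[OF mb vb xs(4,3) Suc.prems(5-7)]
  obtain b' k where k: "xs' @ [a] = b' # k" "b' \<in> carrier A" "set k \<subseteq> carrier A" "length k = p"
    using xs Suc.prems(5) by (cases xs') auto
  have eq: "xs' @ a # ys = b' # k @ ys" using k(1) by (metis append.assoc append_Cons append_Nil)
  have "bdy (push (Suc p) \<chi>) (xs @ a # ys) = push (Suc p) \<chi> ((b \<otimes> b') # k @ ys) \<ominus> bdy (push p ?\<chi>b) (xs' @ a # ys)"
    unfolding xs(1) append_Cons eq by simp
  also have "push (Suc p) \<chi> ((b \<otimes> b') # k @ ys) = \<zero>"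
    using push_R[OF Suc.prems(1,2), of "(b \<otimes> b') # k" y ys'] k xs ys by simp
  finally have 1: "bdy (push (Suc p) \<chi>) (xs @ a # ys) = \<ominus> bdy (push p ?\<chi>b) (xs' @ a # ys)"
    using bdy_closed[OF multi_closed_on[OF multi_push[of "p + Suc s" ?\<chi>b p]], of "xs' @ a # ys"]
      mb xs Suc.prems ysc by (simp add: a_minus_def del: push.simps)
  have 2: "bdy \<chi> (xs @ f h # coord h a # ys) = \<ominus> bdy ?\<chi>b (xs' @ f h # coord h a # ys)"
    if h: "h \<in> carrier G" for h
  proof -
    have cR: "coord h a \<in> R" using coord h Suc.prems by blast
    obtain b' k where k: "xs' @ [f h] = b' # k" "b' \<in> carrier A" "set k \<subseteq> carrier A" "length k = p"
      using xs h by (cases xs') auto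
    have eq: "xs' @ f h # coord h a # ys = b' # k @ coord h a # ys"
      using k(1) by (metis append.assoc append_Cons append_Nil)
    have "bdy \<chi> (xs @ f h # coord h a # ys) = \<chi> ((b \<otimes> b') # k @ coord h a # ys) \<ominus> bdy ?\<chi>b (xs' @ f h # coord h a # ys)"
      unfolding xs(1) append_Cons eq by simp
    also have "\<chi> ((b \<otimes> b') # k @ coord h a # ys) = \<zero>"
      using vanishD[OF Suc.prems(2), of "(b \<otimes> b') # k" "coord h a # ys"] k xs cR Suc.prems by simp
    finally show ?thesis
      using bdy_closed[OF multi_closed_on[OF mb], of "xs' @ f h # coord h a # ys"] xs Suc.prems ysc h by (simp add: a_minus_def)
  qed
  have cb: "(\<lambda>h. bdy ?\<chi>b (xs' @ f h # coord h a # ys)) \<in> carrier G \<rightarrow> carrier A"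
    using bdy_closed[OF multi_closed_on[OF mb]] xs Suc.prems ysc by auto
  have "(\<Oplus>h\<in>carrier G. bdy \<chi> (xs @ f h # coord h a # ys)) =
      (\<Oplus>h\<in>carrier G. \<zero> \<ominus> bdy ?\<chi>b (xs' @ f h # coord h a # ys))"
    by (rule M.add.finprod_cong')
      (use cb 2 funcset_mem[OF cb] in \<open>auto simp: a_minus_def\<close>)
  also have "\<dots> = \<ominus> (\<Oplus>h\<in>carrier G. bdy ?\<chi>b (xs' @ f h # coord h a # ys))"
    using finsum_minus[OF finite_G _ cb, of "\<lambda>_. \<zero>"] cb by (simp add: a_minus_def)
  finally have 3: "(\<Oplus>h\<in>carrier G. bdy \<chi> (xs @ f h # coord h a # ys)) =
     \<ominus> (\<Oplus>h\<in>carrier G. bdy ?\<chi>b (xs' @ f h # coord h a # ys))" .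
  have B: "bdy (push p ?\<chi>b) (xs' @ a # ys) \<in> carrier A"
    using bdy_closed[OF multi_closed_on[OF multi_push[of "p + Suc s" ?\<chi>b p]], of "xs' @ a # ys"]
      mb xs Suc.prems ysc by simp
  have X: "\<chi> (xs @ a # ys) \<in> carrier A"
    using multi_closed[OF mb, of "xs' @ a # ys"] xs Suc.prems ysc by simp
  have "bdy (push (Suc p) \<chi>) (xs @ a # ys) \<oplus> (\<Oplus>h\<in>carrier G. bdy \<chi> (xs @ f h # coord h a # ys)) =
     \<ominus> (bdy (push p ?\<chi>b) (xs' @ a # ys) \<oplus> (\<Oplus>h\<in>carrier G. bdy ?\<chi>b (xs' @ f h # coord h a # ys)))"
    unfolding 1 3 using B cb by (simp add: M.minus_add)
  also have "\<dots> = sgn (Suc p) (\<chi> (xs @ a # ys))" using IH X xs(1) by (simp add: sgn_Suc)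
  finally show ?case .
qed

text \<open>The first term of the differential vanishes on both sides for the same reason, too many arguments in \<open>R\<close>.\<close>

lemma dif_push:
  assumes m: "multi (p + Suc (Suc s)) \<chi>" and v: "vanish p (Suc (Suc s)) \<chi>"
    and coc: "\<And>l. l \<in> lists (Suc (p + Suc (Suc s))) \<Longrightarrow> dif \<chi> l = \<zero>"
    and xs: "length xs = p" "set xs \<subseteq> carrier A" and a: "a \<in> carrier A" and ys: "length ys = Suc s" "set ys \<subseteq> R"
  shows "dif (push p \<chi>) (xs @ a # ys) = sgn (Suc p) (\<chi> (xs @ a # ys))"
proof -
  obtain y ys' where y: "ys = y # ys'" "y \<in> R" "set ys' \<subseteq> R" "length ys' = s"
    using ys by (auto simp: length_Suc_conv)
  have ysc: "set ys \<subseteq> carrier A" using R_sub ys by blast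
  have tl: "tl (xs @ c # l) = tl (xs @ [c]) @ l" "hd (xs @ c # l) = hd (xs @ [c])" "length (tl (xs @ [c])) = p"
     "c \<in> carrier A \<Longrightarrow> set (tl (xs @ [c])) \<subseteq> carrier A" "c \<in> carrier A \<Longrightarrow> hd (xs @ [c]) \<in> carrier A" for c l
    using xs by (cases xs; auto)+
  have "push p \<chi> (tl (xs @ a # ys)) = \<zero>"
    unfolding tl(1)[of a ys] unfolding y(1) using push_R[OF m v tl(3) tl(4)[OF a] y(2-4)] .
  then have 1: "dif (push p \<chi>) (xs @ a # ys) = \<ominus> bdy (push p \<chi>) (xs @ a # ys)"
    using tl(5)[OF a] bdy_closed[OF multi_closed_on[OF multi_push[of "p + Suc s" \<chi> p]], of "xs @ a # ys"] m xs a ys ysc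
    unfolding dif_def tl(2)[of a ys] by (simp add: a_minus_def)
  have "bdy \<chi> (xs @ f h # coord h a # ys) = \<zero>" if h: "h \<in> carrier G" for h
  proof -
    have "\<chi> (tl (xs @ f h # coord h a # ys)) = \<zero>"
      unfolding tl(1)[of "f h" "coord h a # ys"] using vanishD[OF v tl(3) tl(4), of "f h" "coord h a # ys"] coord(1)[OF h a] h ys by simp
    moreover have "bdy \<chi> (xs @ f h # coord h a # ys) \<in> carrier A"
      using bdy_closed[OF multi_closed_on[OF m], of "xs @ f h # coord h a # ys"] xs a h ys ysc by simp
    moreover have "dif \<chi> (xs @ f h # coord h a # ys) = \<zero>" using coc xs a h ys ysc by simp
    ultimately have "\<ominus> bdy \<chi> (xs @ f h # coord h a # ys) = \<zero>"
      using tl(5)[OF f_closed[OF h]] unfolding dif_def tl(2)[of "f h" "coord h a # ys"] by (simp add: a_minus_def)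
    then show ?thesis using \<open>bdy \<chi> (xs @ f h # coord h a # ys) \<in> carrier A\<close> by simp
  qed
  then have "(\<Oplus>h\<in>carrier G. bdy \<chi> (xs @ f h # coord h a # ys)) = \<zero>" by (simp add: M.add.finprod_one_eqI)
  then have "bdy (push p \<chi>) (xs @ a # ys) = sgn p (\<chi> (xs @ a # ys))"
    using bdy_push[OF m v xs a ys] bdy_closed[OF multi_closed_on[OF multi_push[of "p + Suc s" \<chi> p]], of "xs @ a # ys"] m xs a ys ysc
    by simp
  then show ?thesis using 1 multi_closed[OF m, of "xs @ a # ys"] xs a ys ysc by (simp add: sgn_Suc)
qed

text \<open>Subtracting the coboundary of \<open>push\<close> enlarges the set on which the cocycle vanishes from
  \<open>A\<^sup>p \<times> R\<^sup>s\<^sup>+\<^sup>1\<close> to \<open>A\<^sup>p\<^sup>+\<^sup>1 \<times> R\<^sup>s\<close>, as long as \<open>s > 0\<close>. Iterating, only the last argument has to lie in \<open>R\<close>.\<close>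

lemma bounds_if_vanish:
  assumes target: "\<And>\<chi>. cocycle (Suc N) j \<chi> \<Longrightarrow> vanish N 1 \<chi> \<Longrightarrow> bounds (Suc N) j \<chi>"
  shows "cocycle (Suc N) j \<chi> \<Longrightarrow> vanish 0 (Suc N) \<chi> \<Longrightarrow> bounds (Suc N) j \<chi>"
proof -
  have "cocycle (Suc N) j \<chi> \<Longrightarrow> vanish p (Suc s) \<chi> \<Longrightarrow> p + s = N \<Longrightarrow> bounds (Suc N) j \<chi>" for p s \<chi>
  proof (induction s arbitrary: p \<chi>)
    case 0 then show ?case using target by simp
  next
    case (Suc s)
    have N: "Suc N = p + Suc (Suc s)" "N = p + Suc s" using Suc.prems(3) by auto
    have m: "multi (p + Suc (Suc s)) \<chi>" and g: "gdeg (Suc N) j \<chi>"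
      and c: "\<And>l. l \<in> lists (Suc (p + Suc (Suc s))) \<Longrightarrow> dif \<chi> l = \<zero>"
      using Suc.prems(1) N(1) unfolding cocycle_def by auto
    let ?\<psi> = "\<lambda>l. sgn (Suc p) (push p \<chi> l)"
    have mp: "multi N (push p \<chi>)" using multi_push[of N \<chi> p] m N by simp
    have mpsi: "multi N ?\<psi>" and gpsi: "gdeg N j ?\<psi>"
      using multi_sgn[OF mp] gdeg_sgn[OF gdeg_push[OF _ g]] m N by simp_all
    let ?\<chi>' = "\<lambda>l. \<chi> l \<ominus> dif ?\<psi> l"
    have "?\<chi>' (xs @ ys) = \<zero>" if xs: "xs \<in> lists (Suc p)" and ys: "length ys = Suc s" "set ys \<subseteq> R" for xs ys
    proof -
      obtain xs' a where x: "xs = xs' @ [a]" "length xs' = p" "set xs' \<subseteq> carrier A" "a \<in> carrier A"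
        using xs by (cases xs rule: rev_cases) auto
      have ysc: "set ys \<subseteq> carrier A" using R_sub ys by blast
      have l: "xs' @ a # ys \<in> lists (Suc N)" using x ys ysc N by simp
      have X: "\<chi> (xs' @ a # ys) \<in> carrier A" using multi_closed[OF m] l N by simp
      have "dif ?\<psi> (xs' @ a # ys) = sgn (Suc p) (sgn (Suc p) (\<chi> (xs' @ a # ys)))"
        using dif_sgn[OF multi_closed_on[OF mp] l] dif_push[OF m Suc.prems(2) c x(2-4) ys] by simp
      then show ?thesis using x(1) X by (simp add: sgn_sgn A.r_right_minus_eq)
    qed
    then have "vanish (Suc p) (Suc s) ?\<chi>'" unfolding vanish_def by blast
    then have "bounds (Suc N) j ?\<chi>'"
      using Suc.IH[OF cocycle_minus_dif[OF Suc.prems(1) mpsi gpsi]] Suc.prems(3) by simp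
    then show ?case using bounds_minus_dif[OF Suc.prems(1) mpsi gpsi] by blast
  qed
  then show "cocycle (Suc N) j \<chi> \<Longrightarrow> vanish 0 (Suc N) \<chi> \<Longrightarrow> bounds (Suc N) j \<chi>" by simp
qed

text \<open>Freezing a last argument in \<open>R\<close> gives zero, so by \<open>dif_snoc\<close> the correction term vanishes.\<close>

lemma last_arg_mult_R:
  assumes coc: "cocycle (Suc N) j \<chi>" and v: "vanish N 1 \<chi>"
    and xs: "xs \<in> lists N" and a: "a \<in> carrier A" and r: "r \<in> R"
  shows "\<chi> (xs @ [a \<otimes> r]) = aug r \<otimes> \<chi> (xs @ [a])"
proof -
  have m: "multi (Suc N) \<chi>" using coc by (simp add: cocycle_def)
  have rc: "r \<in> carrier A" using r R_closed by blast
  have v0: "\<chi> (l @ [r]) = \<zero>" if "l \<in> lists N" for l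
    using vanishD[OF v, of l "[r]"] that r by simp
  have c: "\<chi> (xs @ [a]) \<in> carrier A" "\<chi> (xs @ [a \<otimes> r]) \<in> carrier A"
    using multi_closed[OF m] xs a rc by auto
  have "dif (\<lambda>l. \<chi> (l @ [r])) (xs @ [a]) = dif (\<lambda>l. \<zero>) (xs @ [a])"
    by (rule dif_cong[of N]) (use v0 xs a in auto)
  also have "\<dots> = \<zero>" using dif_zero[of "xs @ [a]" N] xs a by simp
  finally have "dif (\<lambda>l. \<chi> (l @ [r])) (xs @ [a]) = \<zero>" .
  moreover have "dif \<chi> (xs @ [a, r]) = \<zero>" using coc xs a rc by (simp add: cocycle_def)
  ultimately have "\<zero> \<ominus> sgn (length xs) (\<chi> (xs @ [a \<otimes> r]) \<ominus> aug a \<otimes> \<zero> \<ominus> aug r \<otimes> \<chi> (xs @ [a])) = \<zero>"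
    using dif_snoc[of xs \<chi> a r] multi_closed_on[OF m] v0[OF xs] xs a rc by simp
  then have "sgn (length xs) (\<chi> (xs @ [a \<otimes> r]) \<ominus> aug r \<otimes> \<chi> (xs @ [a])) = \<zero>"
    using c a rc by (simp add: a_minus_def)
  then show ?thesis using c a rc by (simp add: sgn_zero_iff A.r_right_minus_eq)
qed

text \<open>As a function of its last argument, the cocycle factors through the covariant ring.\<close>

lemma last_arg_lam:
  assumes coc: "cocycle (Suc N) j \<chi>" and v: "vanish N 1 \<chi>"
    and xs: "xs \<in> lists N" and a: "a \<in> carrier A"
  shows "\<chi> (xs @ [a]) = (\<Oplus>h\<in>carrier G. lam h a \<otimes> \<chi> (xs @ [f h]))"
proof -
  have m: "multi (Suc N) \<chi>" using coc by (simp add: cocycle_def)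
  have "\<chi> (xs @ [\<Oplus>h\<in>carrier G. f h \<otimes> coord h a]) = (\<Oplus>h\<in>carrier G. \<chi> (xs @ [f h \<otimes> coord h a]))"
    by (rule multi_last_sum[OF m xs finite_G]) (use a in auto)
  also have "\<dots> = (\<Oplus>h\<in>carrier G. lam h a \<otimes> \<chi> (xs @ [f h]))"
    by (rule M.add.finprod_cong')
      (use last_arg_mult_R[OF coc v xs] coord(1) a multi_closed[OF m, of "xs @ [f _]"] xs in \<open>auto simp: lam_def\<close>)
  finally show ?thesis using sum_coord[OF a] by simp
qed

text \<open>For \<open>a\<close> of positive degree, \<open>a f\<^sub>h\<close> is in the covariant ring a combination of basis elements of larger degree,
  where \<open>\<chi>\<close> vanishes. So freezing \<open>f h\<close> as last argument gives a cocycle on the trivial module.\<close>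

lemma last_arg_cocycle:
  assumes coc: "cocycle (Suc N) j \<chi>" and v: "vanish N 1 \<chi>"
    and h: "h \<in> carrier G" "h \<noteq> \<one>\<^bsub>G\<^esub>"
    and U: "\<And>k xs. k \<in> carrier G \<Longrightarrow> dg h < dg k \<Longrightarrow> xs \<in> lists N \<Longrightarrow> \<chi> (xs @ [f k]) = \<zero>"
  shows "cocycle N (j + int (dg h)) (\<lambda>l. \<chi> (l @ [f h]))"
proof -
  have m: "multi (Suc N) \<chi>" using coc by (simp add: cocycle_def)
  have "dif (\<lambda>l. \<chi> (l @ [f h])) l = \<zero>" if l: "l \<in> lists (Suc N)" for l
  proof -
    obtain xs a where x: "l = xs @ [a]" "xs \<in> lists N" "a \<in> carrier A"
      using l by (cases l rule: rev_cases) auto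
    have c: "\<chi> (xs @ [b]) \<in> carrier A" if "b \<in> carrier A" for b
      using multi_closed[OF m] x(2) that by simp
    have "\<chi> (xs @ [a \<otimes> f h]) = (\<Oplus>k\<in>carrier G. lam k (a \<otimes> f h) \<otimes> \<chi> (xs @ [f k]))"
      using last_arg_lam[OF coc v x(2)] x(3) h by simp
    also have "\<dots> = (\<Oplus>k\<in>carrier G. if h = k then aug a \<otimes> \<chi> (xs @ [f k]) else \<zero>)"
    proof (rule M.add.finprod_cong')
      fix k assume k: "k \<in> carrier G"
      show "lam k (a \<otimes> f h) \<otimes> \<chi> (xs @ [f k]) = (if h = k then aug a \<otimes> \<chi> (xs @ [f k]) else \<zero>)"
      proof (cases "dg h < dg k")
        case True
        then show ?thesis using U[OF k True x(2)] x(3) h k by auto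
      next
        case False
        then have "lam k (a \<otimes> f h) = aug a \<otimes> lam k (f h)" using lam_mult_f[OF k h(1) _ x(3)] by simp
        then show ?thesis using lam_f[OF k h(1)] x(3) c k by auto
      qed
    qed (use c x in auto)
    also have "\<dots> = aug a \<otimes> \<chi> (xs @ [f h])"
      by (rule M.add.finprod_singleton) (use h finite_G c x in auto)
    finally have e: "\<chi> (xs @ [a \<otimes> f h]) = aug a \<otimes> \<chi> (xs @ [f h])" .
    have "aug (f h) = \<zero>" using aug_homogeneous[OF f_gr[OF h(1)]] dg_zero[OF h(1)] h(2) by simp
    then have "dif \<chi> (xs @ [a, f h]) = dif (\<lambda>l. \<chi> (l @ [f h])) (xs @ [a]) \<ominus> \<zero>"
      using dif_snoc[of xs \<chi> a "f h"] multi_closed_on[OF m] x h e c by (simp add: a_minus_def M.r_neg)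
    moreover have "dif \<chi> (xs @ [a, f h]) = \<zero>" using coc x h by (simp add: cocycle_def)
    moreover have "dif (\<lambda>l. \<chi> (l @ [f h])) (xs @ [a]) \<in> carrier A"
      using dif_closed[OF multi_closed_on[OF multi_snoc[OF m]], of "f h" "xs @ [a]"] x h by simp
    ultimately show ?thesis using x(1) by (simp add: a_minus_def)
  qed
  then show ?thesis
    using coc multi_snoc[OF m f_closed[OF h(1)]] gdeg_snoc[OF _ f_gr[OF h(1)]] unfolding cocycle_def by blast
qed

lemma lam_lin: "h \<in> carrier G \<Longrightarrow> lin (lam h)"
  unfolding lin_def by (auto simp: lam_add lam_central)

text \<open>If \<open>lam h\<close> behaves like a derivation along the augmentation at \<open>b\<close>, the correction term of \<open>dif_snoc\<close> vanishes.
  This covers \<open>b \<in> R\<close> as well as \<open>b = f k\<close> in degrees not below that of \<open>f h\<close>.\<close>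

lemma dif_tensor_lam:
  assumes h: "h \<in> carrier G" and \<psi>: "multi M \<psi>" and b: "b \<in> carrier A" and xs: "xs \<in> lists M" and a: "a \<in> carrier A"
    and split: "lam h (a \<otimes> b) = aug a \<otimes> lam h b \<oplus> aug b \<otimes> lam h a"
  shows "dif (\<lambda>l. \<psi> (butlast l) \<otimes> lam h (last l)) (xs @ [a, b]) = dif \<psi> (xs @ [a]) \<otimes> lam h b"
proof -
  let ?\<Psi> = "\<lambda>l. \<psi> (butlast l) \<otimes> lam h (last l)"
  have m: "multi (Suc M) ?\<Psi>" by (rule multi_tensor[OF \<psi> lam_lin[OF h]])
  have p: "\<psi> xs \<in> carrier A" using multi_closed[OF \<psi> xs] .
  have comm: "aug c \<otimes> (\<psi> xs \<otimes> lam h d) = \<psi> xs \<otimes> (aug c \<otimes> lam h d)" if "c \<in> carrier A" "d \<in> carrier A" for c d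
    using linD(3)[OF lin_mult_left[OF p], of "aug c" "lam h d"] that h by simp
  have lc: "lam h a \<in> carrier A" "lam h b \<in> carrier A" using h a b by auto
  have "?\<Psi> (xs @ [a \<otimes> b]) \<ominus> aug a \<otimes> ?\<Psi> (xs @ [b]) \<ominus> aug b \<otimes> ?\<Psi> (xs @ [a]) = \<zero>"
    using split comm a b p lc
    by (simp add: A.r_distr a_minus_def M.a_assoc flip: M.minus_add) (simp add: M.r_neg flip: M.a_assoc)
  then have "dif ?\<Psi> (xs @ [a, b]) = dif (\<lambda>l. ?\<Psi> (l @ [b])) (xs @ [a]) \<ominus> \<zero>"
    using dif_snoc[of xs ?\<Psi> a b] multi_closed_on[OF m] xs a b by simp
  also have "dif (\<lambda>l. ?\<Psi> (l @ [b])) (xs @ [a]) = dif (\<lambda>l. \<psi> l \<otimes> lam h b) (xs @ [a])" by simp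
  also have "\<dots> = dif \<psi> (xs @ [a]) \<otimes> lam h b"
  proof (rule dif_map[OF lin_mult_right[OF lc(2)] multi_closed_on[OF \<psi>]])
    show "xs @ [a] \<in> lists (Suc M)" using xs a by simp
    have "tl (xs @ [a]) \<in> lists M" "hd (xs @ [a]) \<in> carrier A" using xs a by (cases xs; auto)+
    then show "hd (xs @ [a]) \<otimes> \<psi> (tl (xs @ [a])) \<otimes> lam h b = hd (xs @ [a]) \<otimes> (\<psi> (tl (xs @ [a])) \<otimes> lam h b)"
      using lc multi_closed[OF \<psi>] by (simp add: A.m_assoc)
  qed
  finally show ?thesis
    using dif_closed[OF multi_closed_on[OF \<psi>], of "xs @ [a]"] xs a lc by (simp add: a_minus_def)
qed

text \<open>The set \<open>U\<close> consists of the \<open>h\<close> for which the values of the cocycle at the last argument \<open>f h\<close> have been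
  made zero; it is closed under passing to larger degrees. For \<open>h\<close> of largest degree outside \<open>U\<close> these values
  are a cocycle of one degree less, hence the coboundary of some \<open>\<psi>\<close>, and the coboundary of
  \<open>\<psi>(a\<^sub>1, \<dots>) lam h (a\<^sub>n)\<close> removes them without disturbing \<open>U\<close>.\<close>

lemma bounds_if_last_vanish:
  assumes ac: "acyclic_in N"
  shows "cocycle (Suc N) j \<chi> \<Longrightarrow> vanish N 1 \<chi> \<Longrightarrow> bounds (Suc N) j \<chi>"
proof -
  have "cocycle (Suc N) j \<chi> \<Longrightarrow> vanish N 1 \<chi> \<Longrightarrow> U \<subseteq> carrier G \<Longrightarrow>
     (\<And>h k. h \<in> U \<Longrightarrow> k \<in> carrier G \<Longrightarrow> dg h < dg k \<Longrightarrow> k \<in> U) \<Longrightarrow>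
     (\<And>h xs. h \<in> U \<Longrightarrow> xs \<in> lists N \<Longrightarrow> \<chi> (xs @ [f h]) = \<zero>) \<Longrightarrow> card (carrier G - U) = c \<Longrightarrow>
     bounds (Suc N) j \<chi>" for U \<chi> c
  proof (induction c arbitrary: U \<chi>)
    case 0
    then have U: "U = carrier G" using finite_G by auto
    show ?case
    proof (rule bounds_zero)
      fix l assume "l \<in> lists (Suc N)"
      then obtain xs a where x: "l = xs @ [a]" "xs \<in> lists N" "a \<in> carrier A"
        by (cases l rule: rev_cases) auto
      show "\<chi> l = \<zero>" unfolding x(1) last_arg_lam[OF 0(1,2) x(2,3)]
        by (rule M.add.finprod_one_eqI) (use 0(5) U x in auto)
    qed
  next
    case (Suc c)
    have fin: "finite (carrier G - U)" and ne: "carrier G - U \<noteq> {}"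
      using finite_G Suc.prems(6) by (blast, metis card.empty nat.distinct(1))
    have "Max (dg ` (carrier G - U)) \<in> dg ` (carrier G - U)" using fin ne by simp
    then obtain h where h: "h \<in> carrier G" "h \<notin> U" "dg h = Max (dg ` (carrier G - U))" by auto
    have hmax: "dg k \<le> dg h" if "k \<in> carrier G" "k \<notin> U" for k
      using that fin h(3) by simp
    have Ule: "dg h \<le> dg k" if "k \<in> U" for k
      using Suc.prems(4)[OF that h(1)] h(2) by (meson not_le)
    let ?U = "insert h U"
    have U1: "?U \<subseteq> carrier G" using Suc.prems(3) h by simp
    have U2: "k \<in> ?U" if "h' \<in> ?U" "k \<in> carrier G" "dg h' < dg k" for h' k
      using that Suc.prems(4) hmax by (metis insert_iff not_le)
    have "carrier G - ?U = (carrier G - U) - {h}" by auto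
    then have U3: "card (carrier G - ?U) = c" using Suc.prems(6) h fin by simp
    note step = Suc.IH[OF _ _ U1 U2 _ U3]
    have vU: "\<chi> (xs @ [f k]) = \<zero>" if "k \<in> carrier G" "dg h < dg k" "xs \<in> lists N" for k xs
      using Suc.prems(5) hmax that by (meson not_le)
    show ?case
    \<comment> \<open>\<open>f e = 1\<close> lies in \<open>R\<close>, where the cocycle vanishes already\<close>
    proof (cases "h = \<one>\<^bsub>G\<^esub>")
      case True
      have "\<chi> (xs @ [f h]) = \<zero>" if "xs \<in> lists N" for xs
        using vanishD[OF Suc.prems(2), of xs "[\<one>]"] that one_R True f_one by simp
      then show ?thesis by (intro step Suc.prems(1,2)) (use Suc.prems(5) in auto)
    next
      case False
      have bd: "bounds N (j + int (dg h)) (\<lambda>l. \<chi> (l @ [f h]))"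
        using ac last_arg_cocycle[OF Suc.prems(1,2) h(1) False vU] unfolding acyclic_in_def by blast
      show ?thesis
      proof (cases N)
        case 0
        then have "\<chi> (xs @ [f h]) = \<zero>" if "xs \<in> lists N" for xs using bd that by (simp add: bounds_def)
        then show ?thesis by (intro step Suc.prems(1,2)) (use Suc.prems(5) in auto)
      next
        case N: (Suc M)
        then obtain \<psi> where \<psi>: "multi M \<psi>" "gdeg M (j + int (dg h)) \<psi>"
          "\<And>l. l \<in> lists N \<Longrightarrow> \<chi> (l @ [f h]) = dif \<psi> l" using bd unfolding bounds_def by auto
        let ?\<Psi> = "\<lambda>l. \<psi> (butlast l) \<otimes> lam h (last l)"
        have m: "multi N ?\<Psi>" unfolding N by (rule multi_tensor[OF \<psi>(1) lam_lin[OF h(1)]])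
        have g: "gdeg N j ?\<Psi>" unfolding N
          by (rule gdeg_tensor[OF \<psi>(2,1)]) (use lam_gr_0 lam_homogeneous h(1) gr_closed in auto)
        let ?\<chi>' = "\<lambda>l. \<chi> l \<ominus> dif ?\<Psi> l"
        have key: "?\<chi>' (l @ [b]) = \<chi> (l @ [b]) \<ominus> \<chi> (l @ [f h]) \<otimes> lam h b"
          if l: "l \<in> lists N" and b: "b \<in> carrier A"
            and sp: "\<And>a. a \<in> carrier A \<Longrightarrow> lam h (a \<otimes> b) = aug a \<otimes> lam h b \<oplus> aug b \<otimes> lam h a" for l b
        proof -
          obtain xs a where x: "l = xs @ [a]" "xs \<in> lists M" "a \<in> carrier A"
            using l N by (cases l rule: rev_cases) auto
          show ?thesis
            using dif_tensor_lam[OF h(1) \<psi>(1) b x(2,3) sp[OF x(3)]] \<psi>(3)[OF l] x(1) by simp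
        qed
        have cx: "\<chi> (l @ [b]) \<in> carrier A" if "l \<in> lists N" "b \<in> carrier A" for l b
          using multi_closed[of "Suc N" \<chi>] Suc.prems(1) that unfolding cocycle_def by auto
        have van: "?\<chi>' (l @ [r]) = \<zero>" if l: "l \<in> lists N" and r: "r \<in> R" for l r
        proof -
          have "lam h r = \<zero>" using lam_R[OF h(1) r] False by simp
          moreover have "lam h (a \<otimes> r) = aug r \<otimes> lam h a" if "a \<in> carrier A" for a
            using lam_mult_right[OF h(1) that r] aug_central[of r "lam h a"] R_closed[OF r] h(1) that by simp
          moreover have "\<chi> (l @ [r]) = \<zero>" using vanishD[OF Suc.prems(2), of l "[r]"] l r by simp
          ultimately show ?thesis using key[OF l R_closed[OF r]] R_closed[OF r] cx[OF l] h(1) by (simp add: a_minus_def)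
        qed
        then have van': "vanish N 1 ?\<chi>'" unfolding vanish_def by (auto simp: length_Suc_conv)
        have "?\<chi>' (xs @ [f k]) = \<zero>" if k: "k \<in> ?U" and xs: "xs \<in> lists N" for k xs
        proof (cases "k = \<one>\<^bsub>G\<^esub>")
          case True then show ?thesis using van[OF xs one_R] f_one by simp
        next
          case k1: False
          have kG: "k \<in> carrier G" using k U1 by auto
          have le: "dg h \<le> dg k" using k Ule by auto
          have a0: "aug (f k) = \<zero>" using aug_homogeneous[OF f_gr[OF kG]] dg_zero[OF kG] k1 by simp
          have "lam h (a \<otimes> f k) = aug a \<otimes> lam h (f k) \<oplus> aug (f k) \<otimes> lam h a" if "a \<in> carrier A" for a
            using lam_mult_f[OF h(1) kG le that] a0 that h(1) kG by simp
          then have e: "?\<chi>' (xs @ [f k]) = \<chi> (xs @ [f k]) \<ominus> \<chi> (xs @ [f h]) \<otimes> lam h (f k)"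
            using key[OF xs f_closed[OF kG]] by blast
          show ?thesis
          proof (cases "k = h")
            case True
            then show ?thesis unfolding e using lam_f[OF h(1) h(1)] cx[OF xs f_closed[OF h(1)]] by (simp add: A.r_right_minus_eq)
          next
            case False
            then have "k \<in> U" using k by simp
            then show ?thesis unfolding e using Suc.prems(5)[OF _ xs] lam_f[OF h(1) kG] False
                cx[OF xs f_closed[OF h(1)]] by (simp add: a_minus_def)
          qed
        qed
        then have "bounds (Suc N) j ?\<chi>'"
          by (intro step cocycle_minus_dif[OF Suc.prems(1) m g] van')
        then show ?thesis by (rule bounds_minus_dif[OF Suc.prems(1) m g])
      qed
    qed
  qed
  from this[of \<chi> "{}"] show "cocycle (Suc N) j \<chi> \<Longrightarrow> vanish N 1 \<chi> \<Longrightarrow> bounds (Suc N) j \<chi>" by blast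
qed

text \<open>If the restriction of a cocycle to \<open>R\<close> is the coboundary of a cochain that extends to \<open>A\<close>, subtracting the
  coboundary of the extension makes the cocycle vanish on \<open>R\<close>; so this is the case to be considered.\<close>

theorem restriction_injective:
  assumes "acyclic_in N" "cocycle (Suc N) j \<chi>" "vanish 0 (Suc N) \<chi>"
  shows "bounds (Suc N) j \<chi>"
  using bounds_if_vanish[OF bounds_if_last_vanish[OF assms(1)] assms(2,3)] .

text \<open>The coordinates of \<open>A\<close> as a free left \<open>R\<close>-module.\<close>

definition rcoord :: "'g \<Rightarrow> 'a \<Rightarrow> 'a" where
  "rcoord g a = (THE r. r \<in> R \<and> proj g a = r \<otimes> f g)"

lemma rcoord_unique:
  assumes g: "g \<in> carrier G" and "r \<in> R" "proj g a = r \<otimes> f g"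
  shows "rcoord g a = r"
  unfolding rcoord_def
proof (rule the_equality)
  show "r \<in> R \<and> proj g a = r \<otimes> f g" using assms by simp
  fix s assume s: "s \<in> R \<and> proj g a = s \<otimes> f g"
  show "s = r"
    by (rule cancel_right[OF f_closed[OF g] _ _ f_nonzero[OF g]])
      (use assms s R_closed in simp_all)
qed

lemma rcoord:
  assumes g: "g \<in> carrier G" and a: "a \<in> carrier A"
  shows "rcoord g a \<in> R" "rcoord g a \<otimes> f g = proj g a"
proof -
  obtain r where "r \<in> R" "proj g a = r \<otimes> f g" using proj_AG[OF a, of g] AG_right[OF g] by auto
  then show "rcoord g a \<in> R" "rcoord g a \<otimes> f g = proj g a" using rcoord_unique[OF g] by auto
qed

lemma rcoord_closed [simp]: "g \<in> carrier G \<Longrightarrow> a \<in> carrier A \<Longrightarrow> rcoord g a \<in> carrier A"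
  using rcoord R_closed by blast

lemma rcoord_add:
  assumes "g \<in> carrier G" "a \<in> carrier A" "b \<in> carrier A"
  shows "rcoord g (a \<oplus> b) = rcoord g a \<oplus> rcoord g b"
  by (rule rcoord_unique) (use assms rcoord proj_add in \<open>auto simp: A.l_distr intro: R_add\<close>)

lemma rcoord_mult_left:
  assumes g: "g \<in> carrier G" and a: "a \<in> carrier A" and r: "r \<in> R"
  shows "rcoord g (r \<otimes> a) = r \<otimes> rcoord g a"
proof (rule rcoord_unique[OF g])
  show "r \<otimes> rcoord g a \<in> R" using rcoord[OF g a] r R_mult by blast
  have "proj g (r \<otimes> a) = r \<otimes> proj g a"
    using proj_mult_left[of "\<one>\<^bsub>G\<^esub>" g r a] g a r R_eq by simp
  then show "proj g (r \<otimes> a) = r \<otimes> rcoord g a \<otimes> f g"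
    using rcoord[OF g a] R_closed[OF r] R_closed[OF rcoord(1)[OF g a]] g by (simp add: A.m_assoc)
qed

lemma rcoord_gr:
  assumes g: "g \<in> carrier G" and a: "a \<in> gr i"
  shows "rcoord g a \<in> IG (int i - int (dg g))"
proof -
  have ac: "a \<in> carrier A" using a gr_closed by blast
  have "comp i (rcoord g a \<otimes> f g) = rcoord g a \<otimes> f g"
    using proj_gr[OF a, of g] rcoord[OF g ac] by (simp add: comp_homogeneous)
  then have "rcoord g a \<otimes> f g = (if dg g \<le> i then comp (i - dg g) (rcoord g a) else \<zero>) \<otimes> f g"
    using comp_mult_right[OF rcoord_closed[OF g ac] f_gr[OF g], of i] g by (auto split: if_splits)
  then have "rcoord g a = (if dg g \<le> i then comp (i - dg g) (rcoord g a) else \<zero>)"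
    using cancel_right[OF f_closed[OF g] rcoord_closed[OF g ac] _ f_nonzero[OF g]] ac g by auto
  moreover have "comp (i - dg g) (rcoord g a) \<in> gr (i - dg g)" by (rule comp_spec(1)[OF rcoord_closed[OF g ac]])
  moreover have "dg g \<le> i \<Longrightarrow> int i - int (dg g) = int (i - dg g)" by simp
  ultimately show ?thesis using IG_nat IG_zero by metis
qed

text \<open>Let \<open>\<kappa>\<close> project to the component of degree \<open>g h\<close>, divide on the right by \<open>z\<close> and the basis element of degree
  \<open>g h\<close>, and multiply by \<open>f g\<close>. It is linear over \<open>R\<close> from the left, so on \<open>R\<close> it commutes with the differential; and it
  maps \<open>\<chi> f\<^sub>h\<close> to \<open>\<chi>\<close> there. Thus \<open>\<chi>\<close> is a coboundary on \<open>R\<close>, and \<open>restriction_injective\<close> applies.\<close>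

theorem bounds_if_product_bounds:
  assumes ac: "n = 0 \<or> acyclic_in (n - 1)" and coc: "cocycle n j \<chi>"
    and g: "g \<in> carrier G" and h: "h \<in> carrier G" and z: "z \<in> gr 0" "z \<noteq> \<zero>" "f g \<otimes> f h = z \<otimes> f (g \<cdot> h)"
    and val: "\<And>l. length l = n \<Longrightarrow> set l \<subseteq> R \<Longrightarrow> \<chi> l \<in> AG g"
    and bd: "bounds n (j + int (dg h)) (\<lambda>l. \<chi> l \<otimes> f h)"
  shows "bounds n j \<chi>"
proof (cases n)
  case 0
  then have "\<chi> [] \<otimes> f h = \<zero>" "\<chi> [] \<in> carrier A" using bd coc by (auto simp: bounds_def cocycle_def)
  then have "\<chi> [] = \<zero>" using integral_A[OF _ f_closed[OF h]] f_nonzero[OF h] by blast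
  then show ?thesis using 0 by (simp add: bounds_def)
next
  case (Suc N)
  let ?k = "g \<cdot> h"
  have k: "?k \<in> carrier G" using g h by simp
  obtain \<psi> where \<psi>: "multi N \<psi>" "gdeg N (j + int (dg h)) \<psi>" "\<And>l. l \<in> lists (Suc N) \<Longrightarrow> \<chi> l \<otimes> f h = dif \<psi> l"
    using bd Suc unfolding bounds_def by auto
  obtain v where v: "v \<in> gr 0" "z \<otimes> v = \<one>" using gr_0_unit[OF z(1,2)] by blast
  have c: "v \<in> carrier A" "z \<in> carrier A" using v z gr_closed by auto
  have deg: "dg g + dg h = dg ?k"
  proof -
    have "f g \<otimes> f h \<in> gr (dg g + dg h)" "f g \<otimes> f h \<in> gr (0 + dg ?k)"
      using gr_mult[OF f_gr[OF g] f_gr[OF h]] gr_mult[OF z(1) f_gr[OF k]] unfolding z(3) by simp_all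
    moreover have "f g \<otimes> f h \<noteq> \<zero>"
      using integral_A[OF f_closed[OF g] f_closed[OF h]] f_nonzero[OF g] f_nonzero[OF h] by argo
    ultimately show ?thesis using gr_unique by fastforce
  qed
  define \<kappa> where "\<kappa> y = rcoord ?k y \<otimes> (v \<otimes> f g)" for y
  have lk: "lin \<kappa>"
  proof -
    have "rcoord ?k (w \<otimes> y) = w \<otimes> rcoord ?k y" if "w \<in> gr 0" "y \<in> carrier A" for w y
      using rcoord_mult_left[OF k that(2) AG_gr_0[OF that(1)]] .
    then show ?thesis unfolding lin_def \<kappa>_def using c g k gr_closed
      by (auto simp: rcoord_add A.l_distr A.m_assoc simp del: G.m_closed)
  qed
  have kdeg: "\<kappa> y \<in> IG (i + (- int (dg h)))" if y: "y \<in> IG i" for y i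
  proof (cases "0 \<le> i")
    case True
    then have "y \<in> gr (nat i)" using y by (simp add: int_grading_def)
    then have 1: "rcoord ?k y \<in> IG (i - int (dg ?k))" using rcoord_gr[OF k, of y "nat i"] True by simp
    have "v \<otimes> f g \<in> gr (0 + dg g)" using gr_mult[OF v(1) f_gr[OF g]] .
    then have "\<kappa> y \<in> IG (i - int (dg ?k) + int (0 + dg g))" unfolding \<kappa>_def using IG_mult_right[OF _ 1] by blast
    moreover have "i - int (dg ?k) + int (0 + dg g) = i + (- int (dg h))" using deg by linarith
    ultimately show ?thesis by (simp only:)
  next
    case False
    then have "y = \<zero>" using y by (simp add: int_grading_def)
    then show ?thesis using linD(3)[OF lk gr_zero, of \<zero>] linD(1)[OF lk, of \<zero>] by simp
  qed
  let ?\<psi> = "\<lambda>l. \<kappa> (\<psi> l)"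
  have m: "multi N ?\<psi>" by (rule multi_map[OF lk \<psi>(1)])
  have gd: "gdeg N j ?\<psi>" using gdeg_map[OF kdeg \<psi>(2)] by simp
  have R: "dif ?\<psi> l = \<chi> l" if l: "length l = Suc N" "set l \<subseteq> R" for l
  proof -
    have lA: "l \<in> lists (Suc N)" using l R_sub by blast
    obtain r l' where r: "l = r # l'" "r \<in> R" "l' \<in> lists N" using l R_sub[of "tl l"] by (cases l) auto
    have "rcoord ?k (r \<otimes> \<psi> l') = r \<otimes> rcoord ?k (\<psi> l')"
      by (rule rcoord_mult_left[OF k multi_closed[OF \<psi>(1) r(3)] r(2)])
    then have "dif ?\<psi> l = \<kappa> (dif \<psi> l)"
      using r c g R_closed[OF r(2)] rcoord_closed[OF k multi_closed[OF \<psi>(1) r(3)]]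
      by (intro dif_map[OF lk multi_closed_on[OF \<psi>(1)] lA]) (simp add: \<kappa>_def A.m_assoc)
    also have "\<dots> = \<kappa> (\<chi> l \<otimes> f h)" using \<psi>(3)[OF lA] by simp
    also have "\<dots> = \<chi> l"
    proof -
      have "\<chi> l \<in> AG g" using val l Suc by simp
      then obtain s where s: "s \<in> R" "\<chi> l = s \<otimes> f g" using AG_right[OF g] by auto
      have sc: "s \<in> carrier A" using s R_closed by blast
      have sz: "s \<otimes> z \<in> R" using R_mult[OF s(1) AG_gr_0[OF z(1)]] .
      have e: "\<chi> l \<otimes> f h = (s \<otimes> z) \<otimes> f ?k" using s z(3) sc c g h k by (simp add: A.m_assoc)
      have "(s \<otimes> z) \<otimes> f ?k \<in> AG ?k" using AG_right[OF k] sz by blast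
      then have "proj ?k ((s \<otimes> z) \<otimes> f ?k) = (s \<otimes> z) \<otimes> f ?k" using AG_iff[OF k] by blast
      then have "rcoord ?k (\<chi> l \<otimes> f h) = s \<otimes> z" unfolding e by (rule rcoord_unique[OF k sz])
      then have "\<kappa> (\<chi> l \<otimes> f h) = s \<otimes> ((z \<otimes> v) \<otimes> f g)" using sc c g by (simp add: \<kappa>_def A.m_assoc)
      then show ?thesis using v(2) s(2) g by simp
    qed
    finally show ?thesis .
  qed
  let ?\<chi>' = "\<lambda>l. \<chi> l \<ominus> dif ?\<psi> l"
  have coc': "cocycle (Suc N) j \<chi>" using coc Suc by simp
  have "vanish 0 (Suc N) ?\<chi>'"
    unfolding vanish_def
  proof (intro ballI allI impI)
    fix xs ys assume xs: "xs \<in> lists 0" and ys: "length ys = Suc N \<and> set ys \<subseteq> R"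
    have "\<chi> ys \<in> carrier A" using coc' multi_closed[of "Suc N" \<chi> ys] ys R_sub unfolding cocycle_def by blast
    then show "?\<chi>' (xs @ ys) = \<zero>" using xs R[of ys] ys by (simp add: A.r_right_minus_eq)
  qed
  then have "bounds (Suc N) j ?\<chi>'"
    using restriction_injective[OF _ cocycle_minus_dif[OF coc' m gd]] ac Suc by simp
  then show ?thesis using bounds_minus_dif[OF coc' m gd] Suc by simp
qed

end

section \<open>Ext in terms of cochains on lists\<close>

context conn_graded
begin

abbreviation Triv where "Triv \<equiv> trivial_module K A gr"
abbreviation Reg where "Reg \<equiv> regular_module A"

lemma augmentation_eq: "a \<in> carrier A \<Longrightarrow> augmentation K A gr a \<in> carrier K \<and> aug a = augmentation K A gr a \<odot> \<one>"
proof -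
  assume a: "a \<in> carrier A"
  obtain c where c: "c \<in> carrier K" "aug a = c \<odot> \<one>" using aug_gr_0[OF a] unfolding gr_0 by blast
  have uniq: "c' = c" if "c' \<in> carrier K" "c \<odot> \<one> = c' \<odot> \<one>" for c'
  proof (rule ccontr)
    assume "c' \<noteq> c"
    then have "c \<ominus>\<^bsub>K\<^esub> c' \<noteq> \<zero>\<^bsub>K\<^esub>" using c(1) that(1) by simp
    moreover have "(c \<ominus>\<^bsub>K\<^esub> c') \<odot> \<one> = \<zero>"
      using c(1) that by (simp add: a_minus_def smult_l_distr smult_l_minus M.r_neg)
    ultimately show False using scalar_mult_nonzero c(1) that(1) by blast
  qed
  have "augmentation K A gr a = c"
    unfolding augmentation_def aug_def[symmetric]
    by (rule the_equality) (use c uniq in \<open>simp, metis\<close>)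
  then show ?thesis using c by simp
qed

lemma augmentation_scalar: "c \<in> carrier K \<Longrightarrow> augmentation K A gr (c \<odot> \<one>) = c"
proof -
  assume c: "c \<in> carrier K"
  have "c \<odot> \<one> \<in> gr 0" unfolding gr_0 using c by blast
  then have "aug (c \<odot> \<one>) = c \<odot> \<one>" by (simp add: aug_homogeneous)
  then have e: "augmentation K A gr (c \<odot> \<one>) \<odot> \<one> = c \<odot> \<one>" "augmentation K A gr (c \<odot> \<one>) \<in> carrier K"
    using augmentation_eq[of "c \<odot> \<one>"] c by auto
  show ?thesis
  proof (rule ccontr)
    assume "augmentation K A gr (c \<odot> \<one>) \<noteq> c"
    then have "augmentation K A gr (c \<odot> \<one>) \<ominus>\<^bsub>K\<^esub> c \<noteq> \<zero>\<^bsub>K\<^esub>" using c e(2) by simp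
    moreover have "(augmentation K A gr (c \<odot> \<one>) \<ominus>\<^bsub>K\<^esub> c) \<odot> \<one> = \<zero>"
      using c e by (simp add: a_minus_def smult_l_distr smult_l_minus M.r_neg)
    ultimately show False using scalar_mult_nonzero[of "augmentation K A gr (c \<odot> \<one>) \<ominus>\<^bsub>K\<^esub> c"] c e(2) by simp
  qed
qed

lemma Triv_simps [simp]: "carrier Triv = carrier K" "x \<oplus>\<^bsub>Triv\<^esub> y = x \<oplus>\<^bsub>K\<^esub> y" "a \<odot>\<^bsub>Triv\<^esub> x = augmentation K A gr a \<otimes>\<^bsub>K\<^esub> x"
  by (simp_all add: trivial_module_def)

lemma Reg_simps [simp]: "carrier Reg = carrier A" "x \<oplus>\<^bsub>Reg\<^esub> y = x \<oplus> y" "a \<odot>\<^bsub>Reg\<^esub> x = a \<otimes> x" "\<zero>\<^bsub>Reg\<^esub> = \<zero>"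
  "a_inv Reg = a_inv A" "finsum Reg = finsum A"
  by (simp_all add: regular_module_def a_inv_def[abs_def] finsum_def[abs_def] m_inv_def finprod_def fun_eq_iff)

lemma dom_iff: "(as, x) \<in> cochain_dom A Triv n \<longleftrightarrow> as \<in> lists n \<and> x \<in> carrier K"
  by (simp add: cochain_dom_def)

text \<open>The cochain on the trivial module whose values at \<open>1 \<in> K\<close> are given by \<open>\<chi>\<close>.\<close>

definition up :: "nat \<Rightarrow> ('a list \<Rightarrow> 'a) \<Rightarrow> 'a list \<times> 'k \<Rightarrow> 'a" where
  "up n \<chi> = (\<lambda>(as, x)\<in>cochain_dom A Triv n. x \<odot> \<chi> as)"

lemma up_apply: "as \<in> lists n \<Longrightarrow> x \<in> carrier K \<Longrightarrow> up n \<chi> (as, x) = x \<odot> \<chi> as"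
  by (simp add: up_def dom_iff)

lemma up_cong: "(\<And>l. l \<in> lists n \<Longrightarrow> \<chi> l = \<psi> l) \<Longrightarrow> up n \<chi> = up n \<psi>"
  by (auto simp: up_def dom_iff intro!: restrict_ext)

lemma up_eqD: "up n \<chi> = up n \<psi> \<Longrightarrow> closed_on n \<chi> \<Longrightarrow> closed_on n \<psi> \<Longrightarrow> l \<in> lists n \<Longrightarrow> \<chi> l = \<psi> l"
proof -
  assume a: "up n \<chi> = up n \<psi>" "closed_on n \<chi>" "closed_on n \<psi>" "l \<in> lists n"
  have "up n \<chi> (l, \<one>\<^bsub>K\<^esub>) = up n \<psi> (l, \<one>\<^bsub>K\<^esub>)" using a(1) by simp
  then show ?thesis using a(2-4) closed_onD by (simp add: up_apply)
qed

lemma multi_index: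
  "multi n \<chi> \<Longrightarrow> as \<in> lists n \<Longrightarrow> i < n \<Longrightarrow> b \<in> carrier A \<Longrightarrow>
    \<chi> (as[i := as ! i \<oplus> b]) = \<chi> as \<oplus> \<chi> (as[i := b])"
  "multi n \<chi> \<Longrightarrow> as \<in> lists n \<Longrightarrow> i < n \<Longrightarrow> z \<in> gr 0 \<Longrightarrow>
    \<chi> (as[i := z \<otimes> as ! i]) = z \<otimes> \<chi> as"
proof (induction n arbitrary: \<chi> as i)
  case (Suc n)
  {
    case 1
    then obtain a l where as: "as = a # l" "a \<in> carrier A" "l \<in> lists n" by (auto simp: length_Suc_conv)
    show ?case
    proof (cases i)
      case 0 then show ?thesis using multi_add[OF 1(1) as(2) 1(4) as(3)] as by simp
    next
      case (Suc k)
      then show ?thesis using Suc.IH(1)[OF multi_Cons[OF 1(1) as(2)] as(3), of k] 1 as by simp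
    qed
  next
    case 2
    then obtain a l where as: "as = a # l" "a \<in> carrier A" "l \<in> lists n" by (auto simp: length_Suc_conv)
    show ?case
    proof (cases i)
      case 0 then show ?thesis using multi_scal[OF 2(1) 2(4) as(2) as(3)] as by simp
    next
      case (Suc k)
      then show ?thesis using Suc.IH(2)[OF multi_Cons[OF 2(1) as(2)] as(3), of k] 2 as by simp
    qed
  }
qed simp_all

lemma multiI_index:
  assumes "\<And>as. as \<in> lists n \<Longrightarrow> \<chi> as \<in> carrier A"
    and "\<And>as i b. as \<in> lists n \<Longrightarrow> i < n \<Longrightarrow> b \<in> carrier A \<Longrightarrow> \<chi> (as[i := as ! i \<oplus> b]) = \<chi> as \<oplus> \<chi> (as[i := b])"
    and "\<And>as i z. as \<in> lists n \<Longrightarrow> i < n \<Longrightarrow> z \<in> gr 0 \<Longrightarrow> \<chi> (as[i := z \<otimes> as ! i]) = z \<otimes> \<chi> as"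
  shows "multi n \<chi>"
  using assms
proof (induction n arbitrary: \<chi>)
  case 0 then show ?case by simp
next
  case (Suc n)
  show ?case
  proof (rule multi_SucI)
    fix a assume a: "a \<in> carrier A"
    show "multi n (\<lambda>l. \<chi> (a # l))"
    proof (rule Suc.IH)
      fix as assume "as \<in> lists n" then show "\<chi> (a # as) \<in> carrier A" using Suc.prems(1)[of "a # as"] a by simp
    next
      fix as i b assume "as \<in> lists n" "i < n" "b \<in> carrier A"
      then show "\<chi> (a # as[i := as ! i \<oplus> b]) = \<chi> (a # as) \<oplus> \<chi> (a # as[i := b])"
        using Suc.prems(2)[of "a # as" "Suc i" b] a by simp
    next
      fix as i z assume "as \<in> lists n" "i < n" "z \<in> gr 0"
      then show "\<chi> (a # as[i := z \<otimes> as ! i]) = z \<otimes> \<chi> (a # as)"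
        using Suc.prems(3)[of "a # as" "Suc i" z] a by simp
    qed
  next
    fix a b l assume "a \<in> carrier A" "b \<in> carrier A" "l \<in> lists n"
    then show "\<chi> ((a \<oplus> b) # l) = \<chi> (a # l) \<oplus> \<chi> (b # l)" using Suc.prems(2)[of "a # l" 0 b] by simp
  next
    fix z a l assume "z \<in> gr 0" "a \<in> carrier A" "l \<in> lists n"
    then show "\<chi> ((z \<otimes> a) # l) = z \<otimes> \<chi> (a # l)" using Suc.prems(3)[of "a # l" 0 z] by simp
  qed
qed

text \<open>For cochains on the trivial module, which sits in the neutral degree. The grading \<open>V\<close> by \<open>\<Gamma>\<close> is a
  parameter because both \<open>\<int>\<close> and \<open>\<int> \<times> G\<close> occur.\<close>

definition has_degree :: "'d monoid \<Rightarrow> ('d \<Rightarrow> 'a set) \<Rightarrow> 'd \<Rightarrow> nat \<Rightarrow> ('a list \<Rightarrow> 'a) \<Rightarrow> bool" where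
  "has_degree \<Gamma> V \<gamma> n \<chi> \<longleftrightarrow> (\<forall>as \<alpha>s. length as = n \<and> set \<alpha>s \<subseteq> carrier \<Gamma> \<and> list_all2 (\<lambda>a \<alpha>. a \<in> V \<alpha>) as \<alpha>s \<longrightarrow>
     \<chi> as \<in> V (foldr (monoid.mult \<Gamma>) \<alpha>s \<one>\<^bsub>\<Gamma>\<^esub> \<otimes>\<^bsub>\<Gamma>\<^esub> \<gamma>))"

abbreviation cochain_space :: "'d monoid \<Rightarrow> ('d \<Rightarrow> 'a set) \<Rightarrow> 'd \<Rightarrow> nat \<Rightarrow> ('k, 'a list \<times> 'k \<Rightarrow> 'a) module" where
  "cochain_space \<Gamma> V \<gamma> n \<equiv> cochains K \<Gamma> A V Triv (trivial_grading K \<Gamma>) Reg V n \<gamma>"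

lemma lists_update: "as \<in> lists n \<Longrightarrow> b \<in> carrier A \<Longrightarrow> as[i := b] \<in> lists n"
  using set_update_subset_insert[of as i b] by auto

lemma up_in_cochain_space:
  assumes V: "\<And>\<delta>. submodule (V \<delta>) K A" and one: "\<one>\<^bsub>\<Gamma>\<^esub> \<in> carrier \<Gamma>"
    and m: "multi n \<chi>" and d: "has_degree \<Gamma> V \<gamma> n \<chi>"
  shows "up n \<chi> \<in> carrier (cochain_space \<Gamma> V \<gamma> n)"
proof -
  note c = multi_closed[OF m]
  have Vsub: "V \<delta> \<subseteq> carrier A" for \<delta> using V submoduleE(1) by blast
  have V0: "\<zero> \<in> V \<delta>" for \<delta> using submodule.axioms(1)[OF V, of \<delta>] subgroup.one_closed by fastforce
  have "multilinear_cochain K A Triv Reg n (up n \<chi>)"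
    unfolding multilinear_cochain_def
  proof (intro conjI ballI, goal_cases)
    case 1
    show ?case using c by (auto simp: up_def dom_iff)
  next
    case (2 p)
    obtain as x where p: "p = (as, x)" "as \<in> lists n" "x \<in> carrier K" using 2 by (cases p) (auto simp: dom_iff)
    have u: "as[i := b] \<in> lists n" if "b \<in> carrier A" for i b using lists_update[OF p(2) that] .
    have ai: "as ! i \<in> carrier A" if "i < n" for i using p(2) that nth_mem[of i as] by auto
    have "\<chi> (as[i := k \<odot> as ! i]) = (k \<odot> \<one>) \<otimes> \<chi> as" if "i < n" "k \<in> carrier K" for i k
      using multi_index(2)[OF m p(2) that(1), of "k \<odot> \<one>"] that ai scalar_eq[of k "as ! i"] unfolding gr_0 by auto
    moreover have "x \<odot> ((k \<odot> \<one>) \<otimes> \<chi> as) = (k \<odot> \<one>) \<otimes> (x \<odot> \<chi> as)" if "k \<in> carrier K" for k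
      using that c[OF p(2)] p(3) by (simp add: smult_mult_right)
    moreover have "(k \<otimes>\<^bsub>K\<^esub> x) \<odot> \<chi> as = (k \<odot> \<one>) \<otimes> (x \<odot> \<chi> as)" if "k \<in> carrier K" for k
      using that c[OF p(2)] p(3) by (simp add: smult_mult_left smult_assoc1)
    ultimately show ?case unfolding p(1)
      using p(2,3) u ai c[OF p(2)] c[OF u] multi_index(1)[OF m p(2)]
      by (auto simp: up_apply smult_r_distr smult_l_distr augmentation_scalar simp del: mem_Collect_eq)
  qed
  moreover have "cochain_degree \<Gamma> V (trivial_grading K \<Gamma>) V n \<gamma> (up n \<chi>)"
    unfolding cochain_degree_def
  proof (intro allI impI, elim conjE)
    fix as \<gamma>s x \<delta>
    assume h: "length as = n" "set \<gamma>s \<subseteq> carrier \<Gamma>" "\<delta> \<in> carrier \<Gamma>" "list_all2 (\<lambda>a \<alpha>. a \<in> V \<alpha>) as \<gamma>s"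
      "x \<in> trivial_grading K \<Gamma> \<delta>"
    have as: "as \<in> lists n"
      using h(1,4) Vsub by (auto simp: list_all2_conv_all_nth in_set_conv_nth) blast
    have xK: "x \<in> carrier K" using h(5) by (auto simp: trivial_grading_def split: if_splits)
    show "up n \<chi> (as, x) \<in> V (foldr (monoid.mult \<Gamma>) \<gamma>s \<delta> \<otimes>\<^bsub>\<Gamma>\<^esub> \<gamma>)"
    proof (cases "\<delta> = \<one>\<^bsub>\<Gamma>\<^esub>")
      case True
      then have "\<chi> as \<in> V (foldr (monoid.mult \<Gamma>) \<gamma>s \<delta> \<otimes>\<^bsub>\<Gamma>\<^esub> \<gamma>)" using d h unfolding has_degree_def by blast
      then show ?thesis using up_apply[OF as xK] submodule.smult_closed[OF V xK] by simp
    next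
      case False
      then have "x = \<zero>\<^bsub>K\<^esub>" using h(5) by (simp add: trivial_grading_def)
      then show ?thesis using up_apply[OF as xK] c[OF as] V0 by simp
    qed
  qed
  ultimately show ?thesis by (simp add: cochains_def)
qed

lemma cochain_space_down:
  assumes one: "\<one>\<^bsub>\<Gamma>\<^esub> \<in> carrier \<Gamma>" and \<phi>: "\<phi> \<in> carrier (cochain_space \<Gamma> V \<gamma> n)"
  obtains \<chi> where "\<phi> = up n \<chi>" "multi n \<chi>" "has_degree \<Gamma> V \<gamma> n \<chi>"
proof -
  let ?\<chi> = "\<lambda>as. \<phi> (as, \<one>\<^bsub>K\<^esub>)"
  have m: "multilinear_cochain K A Triv Reg n \<phi>" and d: "cochain_degree \<Gamma> V (trivial_grading K \<Gamma>) V n \<gamma> \<phi>"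
    using \<phi> by (auto simp: cochains_def)
  have ext: "\<phi> \<in> cochain_dom A Triv n \<rightarrow>\<^sub>E carrier A" using m by (simp add: multilinear_cochain_def)
  then have closed_on: "\<phi> (as, x) \<in> carrier A" if "as \<in> lists n" "x \<in> carrier K" for as x
    using that PiE_mem[OF ext, of "(as, x)"] dom_iff by blast
  have mm: "(\<forall>i<n. \<forall>b\<in>carrier A. \<phi> (as[i := as ! i \<oplus> b], x) = \<phi> (as, x) \<oplus> \<phi> (as[i := b], x)) \<and>
       (\<forall>i<n. \<forall>c\<in>carrier K. \<phi> (as[i := c \<odot> as ! i], x) = (c \<odot> \<one>) \<otimes> (\<phi> (as, x))) \<and>
       (\<forall>c\<in>carrier K. \<phi> (as, augmentation K A gr (c \<odot> \<one>) \<otimes>\<^bsub>K\<^esub> x) = (c \<odot> \<one>) \<otimes> (\<phi> (as, x)))"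
    if "as \<in> lists n" "x \<in> carrier K" for as x
    using m that dom_iff[of as x n] unfolding multilinear_cochain_def by auto
  have multi: "multi n ?\<chi>"
  proof (rule multiI_index)
    fix as i z assume h: "as \<in> lists n" "i < n" "z \<in> gr 0"
    then obtain c where c: "c \<in> carrier K" "z = c \<odot> \<one>" unfolding gr_0 by auto
    have "as ! i \<in> carrier A" using h nth_mem[of i as] by auto
    then have "z \<otimes> as ! i = c \<odot> as ! i" using c scalar_eq[OF c(1), of "as ! i"] by simp
    then show "\<phi> (as[i := z \<otimes> as ! i], \<one>\<^bsub>K\<^esub>) = z \<otimes> \<phi> (as, \<one>\<^bsub>K\<^esub>)" using mm[OF h(1)] h(2) c by simp
  qed (use closed_on mm in auto)
  have "\<phi> = up n ?\<chi>"
  proof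
    fix p
    show "\<phi> p = up n ?\<chi> p"
    proof (cases "p \<in> cochain_dom A Triv n")
      case True
      then obtain as x where p: "p = (as, x)" "as \<in> lists n" "x \<in> carrier K" by (cases p) (auto simp: dom_iff)
      have "\<phi> (as, augmentation K A gr (x \<odot> \<one>) \<otimes>\<^bsub>K\<^esub> \<one>\<^bsub>K\<^esub>) = (x \<odot> \<one>) \<otimes> \<phi> (as, \<one>\<^bsub>K\<^esub>)"
        using mm[OF p(2), of "\<one>\<^bsub>K\<^esub>"] p(3) by simp
      then show ?thesis unfolding p(1) up_apply[OF p(2,3)]
        using scalar_eq[OF p(3) closed_on[OF p(2) R.one_closed]] p(3) by (simp add: augmentation_scalar)
    next
      case False
      then show ?thesis using PiE_arb[OF ext] by (simp add: up_def)
    qed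
  qed
  moreover have "has_degree \<Gamma> V \<gamma> n ?\<chi>"
    unfolding has_degree_def
  proof (intro allI impI, elim conjE)
    fix as \<alpha>s assume "length as = n" "set \<alpha>s \<subseteq> carrier \<Gamma>" "list_all2 (\<lambda>a \<alpha>. a \<in> V \<alpha>) as \<alpha>s"
    moreover have "\<one>\<^bsub>K\<^esub> \<in> trivial_grading K \<Gamma> \<one>\<^bsub>\<Gamma>\<^esub>" by (simp add: trivial_grading_def)
    ultimately show "?\<chi> as \<in> V (foldr (monoid.mult \<Gamma>) \<alpha>s \<one>\<^bsub>\<Gamma>\<^esub> \<otimes>\<^bsub>\<Gamma>\<^esub> \<gamma>)"
      using d one unfolding cochain_degree_def by blast
  qed
  ultimately show ?thesis using that multi by blast
qed

lemma up_plus: "closed_on n \<chi> \<Longrightarrow> closed_on n \<psi> \<Longrightarrow> up n \<chi> \<oplus>\<^bsub>cochain_space \<Gamma> V \<gamma> n\<^esub> up n \<psi> = up n (\<lambda>l. \<chi> l \<oplus> \<psi> l)"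
  by (auto simp: cochains_def up_def dom_iff smult_r_distr closed_on_def intro!: restrict_ext)

lemma up_zero: "\<zero>\<^bsub>cochain_space \<Gamma> V \<gamma> n\<^esub> = up n (\<lambda>l. \<zero>)"
  by (auto simp: cochains_def up_def dom_iff intro!: restrict_ext)

lemma finsum_lessThan_Suc_shift:
  "u \<in> {..<Suc n} \<rightarrow> carrier A \<Longrightarrow> (\<Oplus>i\<in>{..<Suc n}. u i) = u 0 \<oplus> (\<Oplus>i\<in>{..<n}. u (Suc i))"
proof (induction n)
  case 0 then show ?case by (simp add: lessThan_Suc)
next
  case (Suc n)
  have c: "u i \<in> carrier A" if "i < Suc (Suc n)" for i using Suc.prems that by auto
  have c1: "u \<in> {..<Suc n} \<rightarrow> carrier A" "(\<lambda>i. u (Suc i)) \<in> {..<n} \<rightarrow> carrier A" using c by auto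
  have "(\<Oplus>i\<in>{..<Suc (Suc n)}. u i) = u (Suc n) \<oplus> (\<Oplus>i\<in>{..<Suc n}. u i)"
    unfolding lessThan_Suc[of "Suc n"] using c c1 by (subst M.finsum_insert) auto
  also have "\<dots> = u (Suc n) \<oplus> (u 0 \<oplus> (\<Oplus>i\<in>{..<n}. u (Suc i)))" using Suc.IH[OF c1(1)] by simp
  also have "\<dots> = u 0 \<oplus> (u (Suc n) \<oplus> (\<Oplus>i\<in>{..<n}. u (Suc i)))" using c c1 by (simp add: M.a_lcomm)
  also have "u (Suc n) \<oplus> (\<Oplus>i\<in>{..<n}. u (Suc i)) = (\<Oplus>i\<in>{..<Suc n}. u (Suc i))"
    unfolding lessThan_Suc[of n] using c c1 by (subst M.finsum_insert) auto
  finally show ?case .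
qed

lemma signed_Reg: "signed Reg i y = sgn i y"
  by (simp add: signed_def sgn_def)

lemma bdy_bar:
  "closed_on n \<chi> \<Longrightarrow> length as = Suc n \<Longrightarrow> set as \<subseteq> carrier A \<Longrightarrow>
   \<ominus> bdy \<chi> as = (\<Oplus>i\<in>{..<n}. sgn (Suc i) (\<chi> (take i as @ (as ! i \<otimes> as ! Suc i) # drop (Suc (Suc i)) as)))
      \<oplus> sgn (Suc n) (aug (last as) \<otimes> \<chi> (butlast as))"
proof (induction n arbitrary: \<chi> as)
  case 0
  then obtain a where "as = [a]" "a \<in> carrier A" by (auto simp: length_Suc_conv)
  then show ?case using closed_onD[OF 0(1), of "[]"] by (simp add: sgn_def)
next
  case (Suc n)
  then obtain a b l where as: "as = a # b # l" "a \<in> carrier A" "b \<in> carrier A" "l \<in> lists n"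
    by (auto simp: length_Suc_conv)
  let ?\<chi>a = "\<lambda>l. \<chi> (a # l)" and ?bl = "b # l"
  have ca: "closed_on n ?\<chi>a" using closed_on_Cons Suc.prems(1) as(2) .
  have bl: "?bl \<in> lists (Suc n)" using as by simp
  let ?m = "\<lambda>(as :: 'a list) i. take i as @ (as ! i \<otimes> as ! Suc i) # drop (Suc (Suc i)) as"
  have sub: "set (?m as i) \<subseteq> carrier A" "length (?m as i) = length as - 1" if "Suc i < length as" "set as \<subseteq> carrier A" for as i
  proof -
    have "as ! i \<in> carrier A" "as ! Suc i \<in> carrier A" using that nth_mem[of i as] nth_mem[of "Suc i" as] by auto
    then show "set (?m as i) \<subseteq> carrier A" using that by (auto dest: in_set_takeD in_set_dropD)
    show "length (?m as i) = length as - 1" using that by simp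
  qed
  have mS: "?m as (Suc i) = a # ?m ?bl i" for i using as(1) by simp
  have cm: "\<chi> (?m as i) \<in> carrier A" if "i < Suc n" for i
    using closed_onD[OF Suc.prems(1) _ sub(1)[of i as]] sub(2)[of i as] Suc.prems that by simp
  have cs: "?\<chi>a (?m ?bl i) \<in> carrier A" if "i < n" for i using cm[of "Suc i"] mS that by simp
  have fin: "(\<Oplus>i\<in>{..<n}. \<zero> \<ominus> sgn (Suc i) (?\<chi>a (?m ?bl i))) = \<ominus> (\<Oplus>i\<in>{..<n}. sgn (Suc i) (?\<chi>a (?m ?bl i)))"
    using finsum_minus[of "{..<n}" "\<lambda>_. \<zero>" "\<lambda>i. sgn (Suc i) (?\<chi>a (?m ?bl i))"] cs by (simp add: a_minus_def Pi_iff)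
  have "(\<Oplus>i\<in>{..<n}. sgn (Suc (Suc i)) (\<chi> (?m as (Suc i)))) = (\<Oplus>i\<in>{..<n}. \<zero> \<ominus> sgn (Suc i) (?\<chi>a (?m ?bl i)))"
  proof (rule M.add.finprod_cong')
    show "(\<lambda>i. \<zero> \<ominus> sgn (Suc i) (?\<chi>a (?m ?bl i))) \<in> {..<n} \<rightarrow> carrier A" using cs by simp
    fix i assume "i \<in> {..<n}"
    then have "?\<chi>a (?m ?bl i) \<in> carrier A" using cs by simp
    then show "sgn (Suc (Suc i)) (\<chi> (?m as (Suc i))) = \<zero> \<ominus> sgn (Suc i) (?\<chi>a (?m ?bl i))"
      unfolding mS sgn_Suc[OF \<open>?\<chi>a (?m ?bl i) \<in> carrier A\<close>, of "Suc i"] by (simp add: a_minus_def)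
  qed simp
  then have s1: "(\<Oplus>i\<in>{..<Suc n}. sgn (Suc i) (\<chi> (?m as i))) =
     \<ominus> \<chi> ((a \<otimes> b) # l) \<oplus> \<ominus> (\<Oplus>i\<in>{..<n}. sgn (Suc i) (?\<chi>a (?m ?bl i)))"
    using finsum_lessThan_Suc_shift[of "\<lambda>i. sgn (Suc i) (\<chi> (?m as i))" n] cm fin as(1) by (simp add: sgn_def)
  have cb: "\<chi> (butlast as) \<in> carrier A"
    using closed_onD[OF Suc.prems(1), of "butlast as"] Suc.prems by (auto dest: in_set_butlastD)
  have la: "last as \<in> carrier A" using Suc.prems as(1) last_in_set[of as] by auto
  have s2: "sgn (Suc (Suc n)) (aug (last as) \<otimes> \<chi> (butlast as)) = \<ominus> sgn (Suc n) (aug (last ?bl) \<otimes> ?\<chi>a (butlast ?bl))"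
    using cb la as(1) by (subst sgn_Suc) auto
  have B: "bdy ?\<chi>a ?bl \<in> carrier A" using bdy_closed[OF ca] bl by simp
  have X: "\<chi> ((a \<otimes> b) # l) \<in> carrier A" using closed_onD[OF Suc.prems(1), of "(a \<otimes> b) # l"] as by simp
  have S: "(\<Oplus>i\<in>{..<n}. sgn (Suc i) (?\<chi>a (?m ?bl i))) \<in> carrier A" using cs by simp
  have L: "sgn (Suc n) (aug (last ?bl) \<otimes> ?\<chi>a (butlast ?bl)) \<in> carrier A" using cb la as(1) by simp
  have IH: "\<ominus> bdy ?\<chi>a ?bl = (\<Oplus>i\<in>{..<n}. sgn (Suc i) (?\<chi>a (?m ?bl i))) \<oplus> sgn (Suc n) (aug (last ?bl) \<otimes> ?\<chi>a (butlast ?bl))"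
    by (rule Suc.IH[OF ca]) (use bl in auto)
  have "\<ominus> bdy \<chi> as = \<ominus> \<chi> ((a \<otimes> b) # l) \<oplus> bdy ?\<chi>a ?bl"
    using as(1) X B by (simp add: a_minus_def M.minus_add)
  also have "bdy ?\<chi>a ?bl = \<ominus> (\<ominus> bdy ?\<chi>a ?bl)" using B by simp
  also have "\<dots> = \<ominus> (\<Oplus>i\<in>{..<n}. sgn (Suc i) (?\<chi>a (?m ?bl i))) \<oplus> \<ominus> sgn (Suc n) (aug (last ?bl) \<otimes> ?\<chi>a (butlast ?bl))"
    unfolding IH using S L by (simp add: M.minus_add)
  finally show ?case unfolding s1 s2 using X S L by (simp add: M.a_assoc)
qed

lemma bar_diff_up:
  assumes m: "multi n \<chi>"
  shows "bar_diff A Triv Reg n (up n \<chi>) = up (Suc n) (dif \<chi>)"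
proof
  fix p :: "'a list \<times> 'k"
  show "bar_diff A Triv Reg n (up n \<chi>) p = up (Suc n) (dif \<chi>) p"
  proof (cases "p \<in> cochain_dom A Triv (Suc n)")
    case True
    then obtain as x where p: "p = (as, x)" "as \<in> lists (Suc n)" "x \<in> carrier K" by (cases p) (auto simp: dom_iff)
    let ?\<chi> = "\<lambda>l. (x \<odot> \<one>) \<otimes> \<chi> l"
    have x1: "x \<odot> \<one> \<in> carrier A" "x \<odot> \<one> \<in> gr 0" using p(3) unfolding gr_0 by auto
    have mx: "multi n ?\<chi>" by (rule multi_map[OF lin_mult_left[OF x1(1)] m])
    have up1: "up n \<chi> (l, x) = ?\<chi> l" if "l \<in> lists n" for l
      using up_apply[OF that p(3)] scalar_eq[OF p(3) multi_closed[OF m that]] by simp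
    have up2: "up n \<chi> (l, augmentation K A gr a \<otimes>\<^bsub>K\<^esub> x) = aug a \<otimes> ?\<chi> l" if "l \<in> lists n" "a \<in> carrier A" for l a
      using up_apply[OF that(1)] multi_closed[OF m that(1)] augmentation_eq[OF that(2)] p(3)
      by (simp add: smult_assoc1 smult_mult_left)
    have tl: "tl as \<in> lists n" "hd as \<in> carrier A" "butlast as \<in> lists n" "last as \<in> carrier A"
      using p(2) last_in_set[of as] by (cases as; auto dest: in_set_butlastD)+
    have mid: "take i as @ (as ! i \<otimes> as ! Suc i) # drop (Suc (Suc i)) as \<in> lists n" if "i < n" for i
    proof -
      have "as ! i \<in> carrier A" "as ! Suc i \<in> carrier A"
        using p(2) that nth_mem[of i as] nth_mem[of "Suc i" as] by auto
      then show ?thesis using p(2) that by (auto dest!: in_set_takeD in_set_dropD)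
    qed
    have "(\<Oplus>i\<in>{..<n}. sgn (Suc i) (up n \<chi> (take i as @ (as ! i \<otimes> as ! Suc i) # drop (Suc (Suc i)) as, x))) =
      (\<Oplus>i\<in>{..<n}. sgn (Suc i) (?\<chi> (take i as @ (as ! i \<otimes> as ! Suc i) # drop (Suc (Suc i)) as)))"
      by (rule M.add.finprod_cong') (use up1[OF mid] multi_closed[OF mx mid] in auto)
    then have "bar_diff A Triv Reg n (up n \<chi>) p = hd as \<otimes> ?\<chi> (tl as) \<oplus>
       (\<Oplus>i\<in>{..<n}. sgn (Suc i) (?\<chi> (take i as @ (as ! i \<otimes> as ! Suc i) # drop (Suc (Suc i)) as))) \<oplus>
       sgn (Suc n) (aug (last as) \<otimes> ?\<chi> (butlast as))"
      unfolding p(1) bar_diff_def using p(2,3) up1[OF tl(1)] up2[OF tl(3,4)]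
      by (simp add: dom_iff signed_Reg)
    also have "\<dots> = hd as \<otimes> ?\<chi> (tl as) \<oplus>
       ((\<Oplus>i\<in>{..<n}. sgn (Suc i) (?\<chi> (take i as @ (as ! i \<otimes> as ! Suc i) # drop (Suc (Suc i)) as))) \<oplus>
       sgn (Suc n) (aug (last as) \<otimes> ?\<chi> (butlast as)))"
      using multi_closed[OF mx] tl mid by (subst M.a_assoc) (auto intro!: M.finsum_closed)
    also have "\<dots> = dif ?\<chi> as"
      using bdy_bar[OF multi_closed_on[OF mx], of as] p(2) by (simp add: dif_def a_minus_def)
    also have "\<dots> = (x \<odot> \<one>) \<otimes> dif \<chi> as"
    proof (rule dif_map[OF lin_mult_left[OF x1(1)] multi_closed_on[OF m] p(2)])
      show "(x \<odot> \<one>) \<otimes> (hd as \<otimes> \<chi> (tl as)) = hd as \<otimes> ((x \<odot> \<one>) \<otimes> \<chi> (tl as))"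
        using linD(3)[OF lin_mult_left[OF tl(2)] x1(2) multi_closed[OF m tl(1)]] by simp
    qed
    also have "\<dots> = up (Suc n) (dif \<chi>) p"
      unfolding p(1) up_apply[OF p(2,3)] using scalar_eq[OF p(3) dif_closed[OF multi_closed_on[OF m] p(2)]] by simp
    finally show ?thesis .
  next
    case False then show ?thesis by (simp add: bar_diff_def up_def)
  qed
qed

definition lcocycle :: "'d monoid \<Rightarrow> ('d \<Rightarrow> 'a set) \<Rightarrow> 'd \<Rightarrow> nat \<Rightarrow> ('a list \<Rightarrow> 'a) \<Rightarrow> bool" where
  "lcocycle \<Gamma> V \<gamma> n \<chi> \<longleftrightarrow> multi n \<chi> \<and> has_degree \<Gamma> V \<gamma> n \<chi> \<and> (\<forall>l\<in>lists (Suc n). dif \<chi> l = \<zero>)"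

definition lbounds :: "'d monoid \<Rightarrow> ('d \<Rightarrow> 'a set) \<Rightarrow> 'd \<Rightarrow> nat \<Rightarrow> ('a list \<Rightarrow> 'a) \<Rightarrow> bool" where
  "lbounds \<Gamma> V \<gamma> n \<chi> \<longleftrightarrow> (case n of 0 \<Rightarrow> \<chi> [] = \<zero> | Suc k \<Rightarrow>
     \<exists>\<psi>. multi k \<psi> \<and> has_degree \<Gamma> V \<gamma> k \<psi> \<and> (\<forall>l\<in>lists n. \<chi> l = dif \<psi> l))"

definition coboundary_space :: "'d monoid \<Rightarrow> ('d \<Rightarrow> 'a set) \<Rightarrow> 'd \<Rightarrow> nat \<Rightarrow> ('a list \<times> 'k \<Rightarrow> 'a) set" where
  "coboundary_space \<Gamma> V \<gamma> n = (case n of 0 \<Rightarrow> {\<zero>\<^bsub>cochain_space \<Gamma> V \<gamma> 0\<^esub>} | Suc i \<Rightarrow> bar_diff A Triv Reg i ` carrier (cochain_space \<Gamma> V \<gamma> i))"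

lemma coboundary_space_eq:
  assumes V: "\<And>\<delta>. submodule (V \<delta>) K A" and one: "\<one>\<^bsub>\<Gamma>\<^esub> \<in> carrier \<Gamma>"
  shows "coboundary_space \<Gamma> V \<gamma> n = {up n \<theta> | \<theta>. multi n \<theta> \<and> lbounds \<Gamma> V \<gamma> n \<theta>}"
proof (cases n)
  case 0
  have z: "multi 0 (\<lambda>_. \<zero>)" "lbounds \<Gamma> V \<gamma> 0 (\<lambda>_. \<zero>)" by (simp_all add: lbounds_def)
  show ?thesis
  proof (intro Set.equalityI subsetI)
    fix b assume "b \<in> coboundary_space \<Gamma> V \<gamma> n"
    then have "b = up 0 (\<lambda>_. \<zero>)" using 0 by (simp add: coboundary_space_def up_zero)
    then show "b \<in> {up n \<theta> | \<theta>. multi n \<theta> \<and> lbounds \<Gamma> V \<gamma> n \<theta>}" using z 0 by blast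
  next
    fix b assume "b \<in> {up n \<theta> | \<theta>. multi n \<theta> \<and> lbounds \<Gamma> V \<gamma> n \<theta>}"
    then obtain \<theta> where t: "b = up 0 \<theta>" "\<theta> [] = \<zero>" using 0 by (auto simp: lbounds_def)
    have "up 0 \<theta> = up 0 (\<lambda>_. \<zero>)" by (rule up_cong) (use t(2) in simp)
    then show "b \<in> coboundary_space \<Gamma> V \<gamma> n" using t(1) 0 by (simp add: coboundary_space_def up_zero)
  qed
next
  case (Suc k)
  show ?thesis
  proof (intro Set.equalityI subsetI)
    fix b assume "b \<in> coboundary_space \<Gamma> V \<gamma> n"
    then obtain \<phi> where \<phi>: "\<phi> \<in> carrier (cochain_space \<Gamma> V \<gamma> k)" "b = bar_diff A Triv Reg k \<phi>" using Suc by (auto simp: coboundary_space_def)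
    obtain \<psi> where \<psi>: "\<phi> = up k \<psi>" "multi k \<psi>" "has_degree \<Gamma> V \<gamma> k \<psi>" using cochain_space_down[OF one \<phi>(1)] .
    then have "b = up n (dif \<psi>)" "multi n (dif \<psi>)" "lbounds \<Gamma> V \<gamma> n (dif \<psi>)"
      using \<phi>(2) bar_diff_up multi_dif Suc by (auto simp: lbounds_def)
    then show "b \<in> {up n \<theta> | \<theta>. multi n \<theta> \<and> lbounds \<Gamma> V \<gamma> n \<theta>}" by blast
  next
    fix b assume "b \<in> {up n \<theta> | \<theta>. multi n \<theta> \<and> lbounds \<Gamma> V \<gamma> n \<theta>}"
    then obtain \<theta> \<psi> where t: "b = up n \<theta>" "multi k \<psi>" "has_degree \<Gamma> V \<gamma> k \<psi>" "\<And>l. l \<in> lists n \<Longrightarrow> \<theta> l = dif \<psi> l"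
      using Suc by (auto simp: lbounds_def)
    then have "b = bar_diff A Triv Reg k (up k \<psi>)" using up_cong[OF t(4)] bar_diff_up[OF t(2)] Suc by simp
    then show "b \<in> coboundary_space \<Gamma> V \<gamma> n" using up_in_cochain_space[OF V one t(2,3)] Suc by (auto simp: coboundary_space_def)
  qed
qed

lemma has_degree_plus:
  assumes V: "\<And>\<delta>. submodule (V \<delta>) K A" and "has_degree \<Gamma> V \<gamma> n \<chi>" "has_degree \<Gamma> V \<gamma> n \<psi>"
  shows "has_degree \<Gamma> V \<gamma> n (\<lambda>l. \<chi> l \<oplus> \<psi> l)"
  using assms(2,3) subgroup.m_closed[OF submodule.axioms(1)[OF V]] unfolding has_degree_def by fastforce

lemma has_degree_neg:
  assumes V: "\<And>\<delta>. submodule (V \<delta>) K A" and "has_degree \<Gamma> V \<gamma> n \<chi>"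
  shows "has_degree \<Gamma> V \<gamma> n (\<lambda>l. \<ominus> \<chi> l)"
  using assms(2) subgroup.m_inv_closed[OF submodule.axioms(1)[OF V]] unfolding has_degree_def a_inv_def by fastforce

lemma lbounds_plus:
  assumes V: "\<And>\<delta>. submodule (V \<delta>) K A" and "lbounds \<Gamma> V \<gamma> n \<chi>" "lbounds \<Gamma> V \<gamma> n \<theta>"
  shows "lbounds \<Gamma> V \<gamma> n (\<lambda>l. \<chi> l \<oplus> \<theta> l)"
proof (cases n)
  case 0 then show ?thesis using assms(2,3) by (simp add: lbounds_def)
next
  case (Suc k)
  then obtain \<psi> \<psi>' where "multi k \<psi>" "has_degree \<Gamma> V \<gamma> k \<psi>" "\<forall>l\<in>lists n. \<chi> l = dif \<psi> l"
    "multi k \<psi>'" "has_degree \<Gamma> V \<gamma> k \<psi>'" "\<forall>l\<in>lists n. \<theta> l = dif \<psi>' l"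
    using assms(2,3) by (auto simp: lbounds_def)
  then have "multi k (\<lambda>l. \<psi> l \<oplus> \<psi>' l)" "has_degree \<Gamma> V \<gamma> k (\<lambda>l. \<psi> l \<oplus> \<psi>' l)"
    "\<forall>l\<in>lists n. \<chi> l \<oplus> \<theta> l = dif (\<lambda>l. \<psi> l \<oplus> \<psi>' l) l"
    using multi_plus has_degree_plus[OF V] dif_plus[OF multi_closed_on multi_closed_on] Suc by auto
  then show ?thesis using Suc unfolding lbounds_def by auto
qed

lemma lbounds_neg:
  assumes V: "\<And>\<delta>. submodule (V \<delta>) K A" and "lbounds \<Gamma> V \<gamma> n \<chi>"
  shows "lbounds \<Gamma> V \<gamma> n (\<lambda>l. \<ominus> \<chi> l)"
proof (cases n)
  case 0 then show ?thesis using assms(2) by (simp add: lbounds_def)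
next
  case (Suc k)
  then obtain \<psi> where "multi k \<psi>" "has_degree \<Gamma> V \<gamma> k \<psi>" "\<forall>l\<in>lists n. \<chi> l = dif \<psi> l"
    using assms(2) by (auto simp: lbounds_def)
  then have "multi k (\<lambda>l. \<ominus> \<psi> l)" "has_degree \<Gamma> V \<gamma> k (\<lambda>l. \<ominus> \<psi> l)"
    "\<forall>l\<in>lists n. \<ominus> \<chi> l = dif (\<lambda>l. \<ominus> \<psi> l) l"
    using multi_neg has_degree_neg[OF V] dif_neg[OF multi_closed_on] Suc by auto
  then show ?thesis using Suc unfolding lbounds_def by auto
qed

lemma lbounds_cong: "(\<And>l. l \<in> lists n \<Longrightarrow> \<chi> l = \<chi>' l) \<Longrightarrow> lbounds \<Gamma> V \<gamma> n \<chi> \<Longrightarrow> lbounds \<Gamma> V \<gamma> n \<chi>'"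
  unfolding lbounds_def by (cases n) auto

lemma Ext_eq: "Ext_triv_reg K \<Gamma> A gr V n \<gamma> =
    quotient ((cochain_space \<Gamma> V \<gamma> n)\<lparr>carrier := {\<phi> \<in> carrier (cochain_space \<Gamma> V \<gamma> n). bar_diff A Triv Reg n \<phi> = \<zero>\<^bsub>cochain_space \<Gamma> V \<gamma> (Suc n)\<^esub>}\<rparr>) (coboundary_space \<Gamma> V \<gamma> n)"
  unfolding Ext_triv_reg_def Ext_def Let_def coboundary_space_def ..

lemma Ext_carrier: "u \<in> carrier (Ext_triv_reg K \<Gamma> A gr V n \<gamma>) \<longleftrightarrow>
    (\<exists>\<phi>\<in>carrier (cochain_space \<Gamma> V \<gamma> n). bar_diff A Triv Reg n \<phi> = \<zero>\<^bsub>cochain_space \<Gamma> V \<gamma> (Suc n)\<^esub> \<and>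
       u = {b \<oplus>\<^bsub>cochain_space \<Gamma> V \<gamma> n\<^esub> \<phi> | b. b \<in> coboundary_space \<Gamma> V \<gamma> n})"
  unfolding Ext_eq quotient_def FactRing_def A_RCOSETS_def' a_r_coset_def' by auto

lemma Ext_zero: "\<zero>\<^bsub>Ext_triv_reg K \<Gamma> A gr V n \<gamma>\<^esub> = coboundary_space \<Gamma> V \<gamma> n"
  unfolding Ext_eq quotient_def FactRing_def by simp

lemma Ext_trivial_lbounds:
  assumes V: "\<And>\<delta>. submodule (V \<delta>) K A" and one: "\<one>\<^bsub>\<Gamma>\<^esub> \<in> carrier \<Gamma>"
    and triv: "carrier (Ext_triv_reg K \<Gamma> A gr V n \<gamma>) = {\<zero>\<^bsub>Ext_triv_reg K \<Gamma> A gr V n \<gamma>\<^esub>}"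
    and \<chi>: "lcocycle \<Gamma> V \<gamma> n \<chi>"
  shows "lbounds \<Gamma> V \<gamma> n \<chi>"
proof -
  have m: "multi n \<chi>" "has_degree \<Gamma> V \<gamma> n \<chi>" "\<And>l. l \<in> lists (Suc n) \<Longrightarrow> dif \<chi> l = \<zero>"
    using \<chi> by (auto simp: lcocycle_def)
  have "bar_diff A Triv Reg n (up n \<chi>) = \<zero>\<^bsub>cochain_space \<Gamma> V \<gamma> (Suc n)\<^esub>"
    using bar_diff_up[OF m(1)] up_cong[of "Suc n" "dif \<chi>" "\<lambda>l. \<zero>", OF m(3)] up_zero[of \<Gamma> V "Suc n" \<gamma>]
    by simp
  then have "{b \<oplus>\<^bsub>cochain_space \<Gamma> V \<gamma> n\<^esub> up n \<chi> | b. b \<in> coboundary_space \<Gamma> V \<gamma> n}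
      \<in> carrier (Ext_triv_reg K \<Gamma> A gr V n \<gamma>)"
    unfolding Ext_carrier by (intro bexI[OF _ up_in_cochain_space[OF V one m(1,2)]] conjI refl)
  then have "{b \<oplus>\<^bsub>cochain_space \<Gamma> V \<gamma> n\<^esub> up n \<chi> | b. b \<in> coboundary_space \<Gamma> V \<gamma> n} = coboundary_space \<Gamma> V \<gamma> n"
    unfolding triv Ext_zero by (rule singletonD)
  moreover have "up n (\<lambda>l. \<zero>) \<in> coboundary_space \<Gamma> V \<gamma> n"
  proof -
    have "has_degree \<Gamma> V \<gamma> k (\<lambda>l. \<zero>)" for k
      unfolding has_degree_def using subgroup.one_closed[OF submodule.axioms(1)[OF V]] by fastforce
    then have "lbounds \<Gamma> V \<gamma> n (\<lambda>l. \<zero>)"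
      unfolding lbounds_def using multi_zero dif_zero by (cases n) (auto intro!: exI[of _ "\<lambda>l. \<zero>"])
    then show ?thesis unfolding coboundary_space_eq[OF V one] using multi_zero by blast
  qed
  moreover have "up n (\<lambda>l. \<zero>) \<oplus>\<^bsub>cochain_space \<Gamma> V \<gamma> n\<^esub> up n \<chi> = up n \<chi>"
    unfolding up_plus[OF multi_closed_on[OF multi_zero] multi_closed_on[OF m(1)]]
    by (rule up_cong) (use multi_closed[OF m(1)] in simp)
  ultimately have "up n \<chi> \<in> coboundary_space \<Gamma> V \<gamma> n" by (metis (mono_tags, lifting) mem_Collect_eq)
  then obtain \<theta> where t: "up n \<chi> = up n \<theta>" "multi n \<theta>" "lbounds \<Gamma> V \<gamma> n \<theta>" unfolding coboundary_space_eq[OF V one] by blast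
  show ?thesis by (rule lbounds_cong[OF _ t(3)]) (use up_eqD[OF t(1) multi_closed_on[OF m(1)] multi_closed_on[OF t(2)]] in simp)
qed

text \<open>The coboundaries form a subgroup, so a coset other than the trivial one contains no coboundary.\<close>

lemma Ext_nonzero_lcocycle:
  assumes V: "\<And>\<delta>. submodule (V \<delta>) K A" and one: "\<one>\<^bsub>\<Gamma>\<^esub> \<in> carrier \<Gamma>"
    and u: "u \<in> carrier (Ext_triv_reg K \<Gamma> A gr V n \<gamma>)" "u \<noteq> \<zero>\<^bsub>Ext_triv_reg K \<Gamma> A gr V n \<gamma>\<^esub>"
  obtains \<chi> where "lcocycle \<Gamma> V \<gamma> n \<chi>" "\<not> lbounds \<Gamma> V \<gamma> n \<chi>"
proof -
  obtain \<phi> where \<phi>: "\<phi> \<in> carrier (cochain_space \<Gamma> V \<gamma> n)" "bar_diff A Triv Reg n \<phi> = \<zero>\<^bsub>cochain_space \<Gamma> V \<gamma> (Suc n)\<^esub>"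
    "u = {b \<oplus>\<^bsub>cochain_space \<Gamma> V \<gamma> n\<^esub> \<phi> | b. b \<in> coboundary_space \<Gamma> V \<gamma> n}"
    using u(1)[unfolded Ext_carrier] by (elim bexE conjE) (rule that; assumption)
  obtain \<chi> where \<chi>: "\<phi> = up n \<chi>" "multi n \<chi>" "has_degree \<Gamma> V \<gamma> n \<chi>" using cochain_space_down[OF one \<phi>(1)] .
  have "up (Suc n) (dif \<chi>) = up (Suc n) (\<lambda>l. \<zero>)" 
    using \<phi>(2) bar_diff_up[OF \<chi>(2)] up_zero[of \<Gamma> V "Suc n" \<gamma>] unfolding \<chi>(1) by simp
  then have "dif \<chi> l = \<zero>" if "l \<in> lists (Suc n)" for l
    using up_eqD[OF _ multi_closed_on[OF multi_dif[OF \<chi>(2)]] multi_closed_on[OF multi_zero] that] by simp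
  then have 1: "lcocycle \<Gamma> V \<gamma> n \<chi>" using \<chi> by (simp add: lcocycle_def)
  have 2: "\<not> lbounds \<Gamma> V \<gamma> n \<chi>"
  proof
    assume b: "lbounds \<Gamma> V \<gamma> n \<chi>"
    have "u = coboundary_space \<Gamma> V \<gamma> n"
    proof (intro Set.equalityI subsetI)
      fix v assume "v \<in> u"
      then obtain \<theta> where t: "multi n \<theta>" "lbounds \<Gamma> V \<gamma> n \<theta>" "v = up n \<theta> \<oplus>\<^bsub>cochain_space \<Gamma> V \<gamma> n\<^esub> up n \<chi>"
        unfolding \<phi>(3) \<chi>(1) coboundary_space_eq[OF V one] by blast
      then have "v = up n (\<lambda>l. \<theta> l \<oplus> \<chi> l)" 
        using up_plus[OF multi_closed_on[OF t(1)] multi_closed_on[OF \<chi>(2)]] t(3) by simp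
      then show "v \<in> coboundary_space \<Gamma> V \<gamma> n" unfolding coboundary_space_eq[OF V one]
        using multi_plus[OF t(1) \<chi>(2)] lbounds_plus[OF V t(2) b] by blast
    next
      fix v assume "v \<in> coboundary_space \<Gamma> V \<gamma> n"
      then obtain \<theta> where t: "multi n \<theta>" "lbounds \<Gamma> V \<gamma> n \<theta>" "v = up n \<theta>" unfolding coboundary_space_eq[OF V one] by blast
      let ?\<eta> = "\<lambda>l. \<theta> l \<oplus> \<ominus> \<chi> l"
      have e: "multi n ?\<eta>" "lbounds \<Gamma> V \<gamma> n ?\<eta>"
        using multi_plus[OF t(1) multi_neg[OF \<chi>(2)]] lbounds_plus[OF V t(2) lbounds_neg[OF V b]] by auto
      have "up n ?\<eta> \<oplus>\<^bsub>cochain_space \<Gamma> V \<gamma> n\<^esub> up n \<chi> = up n \<theta>"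
        unfolding up_plus[OF multi_closed_on[OF e(1)] multi_closed_on[OF \<chi>(2)]]
        by (rule up_cong) (use multi_closed[OF t(1)] multi_closed[OF \<chi>(2)] in \<open>simp add: M.a_assoc M.l_neg\<close>)
      then show "v \<in> u" unfolding \<phi>(3) \<chi>(1) coboundary_space_eq[OF V one] using t(3) e by force
    qed
    then show False using u(2) Ext_zero by metis
  qed
  show ?thesis using that 1 2 .
qed

end

section \<open>Cochains graded by \<open>\<int>\<close> and by \<open>\<int> \<times> G\<close>\<close>

context conn_graded
begin

lemma IG_submodule: "submodule (IG j) K A"
proof (cases "0 \<le> j")
  case True then show ?thesis using gr_submodule by (simp add: int_grading_def)
next
  case False
  have "submodule {\<zero>} K A" by (rule submoduleI) auto
  then show ?thesis using False by (simp add: int_grading_def)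
qed

lemma gdeg_iff_values:
  "multi n \<chi> \<Longrightarrow> gdeg n j \<chi> \<longleftrightarrow>
     (\<forall>as \<alpha>s. length as = n \<and> list_all2 (\<lambda>a \<alpha>. a \<in> IG \<alpha>) as \<alpha>s \<longrightarrow> \<chi> as \<in> IG (j + sum_list \<alpha>s))"
proof (induction n arbitrary: \<chi> j)
  case 0 then show ?case by auto
next
  case (Suc n)
  show ?case
  proof (intro iffI allI impI, elim conjE)
    fix as \<alpha>s assume g: "gdeg (Suc n) j \<chi>" and h: "length as = Suc n" "list_all2 (\<lambda>a \<alpha>. a \<in> IG \<alpha>) as \<alpha>s"
    obtain a l where as: "as = a # l" "length l = n" using h(1) by (auto simp: length_Suc_conv)
    then obtain \<alpha> \<beta>s where al: "\<alpha>s = \<alpha> # \<beta>s" "a \<in> IG \<alpha>" "list_all2 (\<lambda>a \<alpha>. a \<in> IG \<alpha>) l \<beta>s"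
      using h(2) by (auto simp: list_all2_Cons1)
    have lA: "set l \<subseteq> carrier A"
      using al(3) IG_closed by (induction rule: list_all2_induct) auto
    show "\<chi> as \<in> IG (j + sum_list \<alpha>s)"
    proof (cases "0 \<le> \<alpha>")
      case True
      then have a: "a \<in> gr (nat \<alpha>)" using al(2) by (simp add: int_grading_def)
      then have "gdeg n (j + \<alpha>) (\<lambda>l. \<chi> (a # l))" using g True by fastforce
      then show ?thesis
        using Suc.IH[OF multi_Cons[OF Suc.prems gr_closed[OF a]], of "j + \<alpha>"] as al by (simp add: ac_simps)
    next
      case False
      then have "a = \<zero>" using al(2) by (simp add: int_grading_def)
      then show ?thesis using multi_zero_head[OF Suc.prems, of l] as lA by simp
    qed
  next
    assume v: "\<forall>as \<alpha>s. length as = Suc n \<and> list_all2 (\<lambda>a \<alpha>. a \<in> IG \<alpha>) as \<alpha>s \<longrightarrow> \<chi> as \<in> IG (j + sum_list \<alpha>s)"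
    show "gdeg (Suc n) j \<chi>" unfolding gdeg.simps
    proof (intro allI ballI)
      fix i a assume a: "a \<in> gr i"
      have "\<chi> (a # as) \<in> IG (j + int i + sum_list \<alpha>s)"
        if "length as = n" "list_all2 (\<lambda>a \<alpha>. a \<in> IG \<alpha>) as \<alpha>s" for as \<alpha>s
        using v[rule_format, of "a # as" "int i # \<alpha>s"] that a by (simp add: IG_nat ac_simps)
      then show "gdeg n (j + int i) (\<lambda>l. \<chi> (a # l))"
        using Suc.IH[OF multi_Cons[OF Suc.prems gr_closed[OF a]], of "j + int i"] by blast
    qed
  qed
qed

lemma foldr_integer: "foldr (monoid.mult integer_group) \<alpha>s \<one>\<^bsub>integer_group\<^esub> = sum_list \<alpha>s"
  by (induction \<alpha>s) auto

lemma gdeg_iff_has_degree: "multi n \<chi> \<Longrightarrow> gdeg n j \<chi> \<longleftrightarrow> has_degree integer_group IG j n \<chi>"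
  unfolding gdeg_iff_values has_degree_def foldr_integer by (simp add: add.commute)

lemma Ext_trivial_bounds:
  assumes "carrier (Ext_triv_reg K integer_group A gr IG n j) = {\<zero>\<^bsub>Ext_triv_reg K integer_group A gr IG n j\<^esub>}"
    and c: "cocycle n j \<chi>"
  shows "bounds n j \<chi>"
proof -
  have "lcocycle integer_group IG j n \<chi>"
    using c gdeg_iff_has_degree[of n \<chi> j] by (simp add: cocycle_def lcocycle_def)
  then have "lbounds integer_group IG j n \<chi>"
    using Ext_trivial_lbounds[OF IG_submodule _ assms(1)] by simp
  then show ?thesis
    unfolding bounds_def lbounds_def using gdeg_iff_has_degree by (cases n) auto
qed

end

context coaction
begin

abbreviation VG :: "int \<times> 'g \<Rightarrow> 'a set" where "VG \<equiv> \<lambda>(i, g). IG i \<inter> AG g"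
abbreviation ZG where "ZG \<equiv> integer_group \<times>\<times> G"

lemma VG_submodule: "submodule (VG \<delta>) K A"
proof (cases \<delta>)
  case (Pair i g)
  have "submodule (AG g) K A"
  proof (rule submoduleI)
    show "AG g \<subseteq> carrier A" using AG_closed by blast
    have e: "AG g = proj g ` carrier A" by (simp add: G_component_def proj_def)
    show "\<zero> \<in> AG g" unfolding e by (rule image_eqI[of _ _ \<zero>]) simp_all
    show "\<ominus> a \<in> AG g" if "a \<in> AG g" for a using that unfolding e by (auto simp: proj_neg[symmetric])
    show "a \<oplus> b \<in> AG g" if "a \<in> AG g" "b \<in> AG g" for a b
      using that unfolding e by (auto simp: proj_add[symmetric])
    show "c \<odot> a \<in> AG g" if "c \<in> carrier K" "a \<in> AG g" for c a
      using that unfolding e by (auto simp: proj_smult[symmetric])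
  qed
  note s = IG_submodule[of i] this
  have "submodule (IG i \<inter> AG g) K A"
  proof (rule submoduleI)
    show "IG i \<inter> AG g \<subseteq> carrier A" using IG_closed by blast
    show "\<zero> \<in> IG i \<inter> AG g" using subgroup.one_closed[OF submodule.axioms(1)[OF s(2)]] by simp
    show "\<ominus> a \<in> IG i \<inter> AG g" if "a \<in> IG i \<inter> AG g" for a
      using that IG_neg subgroup.m_inv_closed[OF submodule.axioms(1)[OF s(2)], of a] by (simp add: a_inv_def)
    show "a \<oplus> b \<in> IG i \<inter> AG g" if "a \<in> IG i \<inter> AG g" "b \<in> IG i \<inter> AG g" for a b
      using that IG_add subgroup.m_closed[OF submodule.axioms(1)[OF s(2)], of a b] by simp
    show "c \<odot> a \<in> IG i \<inter> AG g" if "c \<in> carrier K" "a \<in> IG i \<inter> AG g" for c a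
      using that submodule.smult_closed[OF s(1)] submodule.smult_closed[OF s(2)] by simp
  qed
  then show ?thesis using Pair by simp
qed

text \<open>The degree \<open>(j, g)\<close> with \<open>k\<close> accumulating the \<open>G\<close>-degrees of the arguments passed so far, as \<open>G\<close> need not be
  commutative.\<close>

fun bdeg :: "'g \<Rightarrow> nat \<Rightarrow> int \<Rightarrow> 'g \<Rightarrow> ('a list \<Rightarrow> 'a) \<Rightarrow> bool" where
  "bdeg g 0 j k \<chi> \<longleftrightarrow> \<chi> [] \<in> IG j \<inter> AG (k \<cdot> g)"
| "bdeg g (Suc n) j k \<chi> \<longleftrightarrow> (\<forall>i. \<forall>h\<in>carrier G. \<forall>a\<in>gr i \<inter> AG h. bdeg g n (j + int i) (k \<cdot> h) (\<lambda>l. \<chi> (a # l)))"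

definition gprod :: "'g list \<Rightarrow> 'g" where "gprod hs = foldr (monoid.mult G) hs \<one>\<^bsub>G\<^esub>"

lemma gprod_closed: "set hs \<subseteq> carrier G \<Longrightarrow> gprod hs \<in> carrier G"
  unfolding gprod_def by (induction hs) auto

lemma gprod_Cons [simp]: "gprod (h # hs) = h \<cdot> gprod hs" by (simp add: gprod_def)
lemma gprod_Nil [simp]: "gprod [] = \<one>\<^bsub>G\<^esub>" by (simp add: gprod_def)

lemma foldr_ZG: "foldr (monoid.mult ZG) \<alpha>s \<one>\<^bsub>ZG\<^esub> = (sum_list (map fst \<alpha>s), gprod (map snd \<alpha>s))"
  by (induction \<alpha>s) (auto simp: gprod_def one_DirProd mult_DirProd')

lemma set_snd_ZG: "set \<alpha>s \<subseteq> carrier ZG \<Longrightarrow> set (map snd \<alpha>s) \<subseteq> carrier G"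
  by (auto simp: DirProd_def)

lemma bdeg_iff_values:
  "multi n \<chi> \<Longrightarrow> k \<in> carrier G \<Longrightarrow> g \<in> carrier G \<Longrightarrow> bdeg g n j k \<chi> \<longleftrightarrow>
     (\<forall>as \<alpha>s. length as = n \<and> set \<alpha>s \<subseteq> carrier ZG \<and> list_all2 (\<lambda>a \<alpha>. a \<in> VG \<alpha>) as \<alpha>s \<longrightarrow>
        \<chi> as \<in> IG (j + sum_list (map fst \<alpha>s)) \<inter> AG (k \<cdot> gprod (map snd \<alpha>s) \<cdot> g))"
proof (induction n arbitrary: \<chi> j k)
  case 0 then show ?case by auto
next
  case (Suc n)
  note m = Suc.prems(1) and k = Suc.prems(2) and g = Suc.prems(3)
  show ?case
  proof (intro iffI allI impI, elim conjE)
    fix as \<alpha>s assume b: "bdeg g (Suc n) j k \<chi>"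
      and h: "length as = Suc n" "set \<alpha>s \<subseteq> carrier ZG" "list_all2 (\<lambda>a \<alpha>. a \<in> VG \<alpha>) as \<alpha>s"
    obtain a l where as: "as = a # l" "length l = n" using h(1) by (auto simp: length_Suc_conv)
    then obtain i u \<beta>s where al: "\<alpha>s = (i, u) # \<beta>s" "a \<in> IG i" "a \<in> AG u" "list_all2 (\<lambda>a \<alpha>. a \<in> VG \<alpha>) l \<beta>s"
      using h(3) by (auto simp: list_all2_Cons1)
    have uG: "u \<in> carrier G" and bs: "set \<beta>s \<subseteq> carrier ZG" using h(2) al(1) by (auto simp: DirProd_def)
    have gp: "gprod (map snd \<beta>s) \<in> carrier G" using gprod_closed set_snd_ZG[OF bs] by blast
    have lA: "set l \<subseteq> carrier A"
      using al(4) IG_closed by (induction rule: list_all2_induct) auto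
    show "\<chi> as \<in> IG (j + sum_list (map fst \<alpha>s)) \<inter> AG (k \<cdot> gprod (map snd \<alpha>s) \<cdot> g)"
    proof (cases "0 \<le> i")
      case True
      then have a: "a \<in> gr (nat i)" using al(2) by (simp add: int_grading_def)
      have "bdeg g n (j + int (nat i)) (k \<cdot> u) (\<lambda>l. \<chi> (a # l))" using b a al(3) uG unfolding bdeg.simps by blast
      then have "\<chi> (a # l) \<in> IG (j + i + sum_list (map fst \<beta>s)) \<inter> AG (k \<cdot> u \<cdot> gprod (map snd \<beta>s) \<cdot> g)"
        using Suc.IH[OF multi_Cons[OF m gr_closed[OF a]] G.m_closed[OF k uG] g, of "j + i"] as al bs True by simp
      then show ?thesis using as(1) al(1) k uG gp g by (simp add: G.m_assoc ac_simps)
    next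
      case False
      then have "a = \<zero>" using al(2) by (simp add: int_grading_def)
      then show ?thesis using multi_zero_head[OF m, of l] as lA k uG gp g al(1) by simp
    qed
  next
    assume v: "\<forall>as \<alpha>s. length as = Suc n \<and> set \<alpha>s \<subseteq> carrier ZG \<and> list_all2 (\<lambda>a \<alpha>. a \<in> VG \<alpha>) as \<alpha>s \<longrightarrow>
        \<chi> as \<in> IG (j + sum_list (map fst \<alpha>s)) \<inter> AG (k \<cdot> gprod (map snd \<alpha>s) \<cdot> g)"
    show "bdeg g (Suc n) j k \<chi>" unfolding bdeg.simps
    proof (intro allI ballI)
      fix i h a assume h: "h \<in> carrier G" and a: "a \<in> gr i \<inter> AG h"
      have "\<chi> (a # as) \<in> IG (j + int i + sum_list (map fst \<alpha>s)) \<inter>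
          AG (k \<cdot> h \<cdot> gprod (map snd \<alpha>s) \<cdot> g)"
        if t: "length as = n" "set \<alpha>s \<subseteq> carrier ZG" "list_all2 (\<lambda>a \<alpha>. a \<in> VG \<alpha>) as \<alpha>s" for as \<alpha>s
      proof -
        have "gprod (map snd \<alpha>s) \<in> carrier G" using gprod_closed set_snd_ZG[OF t(2)] by blast
        moreover have "set ((int i, h) # \<alpha>s) \<subseteq> carrier ZG" using t(2) h by (simp add: DirProd_def)
        ultimately show ?thesis
          using v[rule_format, of "a # as" "(int i, h) # \<alpha>s"] t a h k g by (simp add: IG_nat G.m_assoc ac_simps)
      qed
      then show "bdeg g n (j + int i) (k \<cdot> h) (\<lambda>l. \<chi> (a # l))"
        using Suc.IH[OF multi_Cons[OF m] G.m_closed[OF k h] g, of a "j + int i"] a gr_closed by blast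
    qed
  qed
qed

lemma bdeg_iff_has_degree:
  assumes "multi n \<chi>" "g \<in> carrier G"
  shows "bdeg g n j \<one>\<^bsub>G\<^esub> \<chi> \<longleftrightarrow> has_degree ZG VG (j, g) n \<chi>"
proof -
  have "\<one>\<^bsub>G\<^esub> \<cdot> gprod (map snd \<alpha>s) = gprod (map snd \<alpha>s)" if "set \<alpha>s \<subseteq> carrier ZG" for \<alpha>s
    using gprod_closed[OF set_snd_ZG[OF that]] by simp
  then show ?thesis
    unfolding bdeg_iff_values[OF assms(1) G.one_closed assms(2)] has_degree_def foldr_ZG
    by (auto simp: mult_DirProd' add.commute)
qed

lemma bdeg_cong:
  "(\<And>l. l \<in> lists n \<Longrightarrow> \<chi> l = \<chi>' l) \<Longrightarrow> bdeg g n j k \<chi> \<Longrightarrow> bdeg g n j k \<chi>'"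
proof (induction n arbitrary: \<chi> \<chi>' j k)
  case (Suc n)
  show ?case unfolding bdeg.simps
  proof (intro allI ballI)
    fix i h a assume a: "h \<in> carrier G" "a \<in> gr i \<inter> AG h"
    show "bdeg g n (j + int i) (k \<cdot> h) (\<lambda>l. \<chi>' (a # l))"
      by (rule Suc.IH[of "\<lambda>l. \<chi> (a # l)"]) (use Suc.prems a gr_closed in auto)
  qed
qed simp

lemma bdeg_gdeg: "multi n \<chi> \<Longrightarrow> bdeg g n j k \<chi> \<Longrightarrow> gdeg n j \<chi>"
proof (induction n arbitrary: \<chi> j k)
  case (Suc n)
  show ?case unfolding gdeg.simps
  proof (intro allI ballI)
    fix i a assume a: "a \<in> gr i"
    have ac: "a \<in> carrier A" using a gr_closed by blast
    have "gdeg n (j + int i) (\<lambda>l. \<Oplus>h\<in>carrier G. \<chi> (proj h a # l))"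
    proof (rule gdeg_sum[OF finite_G])
      fix h assume h: "h \<in> carrier G"
      have "proj h a \<in> gr i \<inter> AG h" using proj_gr[OF a] proj_AG[OF ac] by blast
      then have "bdeg g n (j + int i) (k \<cdot> h) (\<lambda>l. \<chi> (proj h a # l))" using Suc.prems(2) h unfolding bdeg.simps by blast
      then show "gdeg n (j + int i) (\<lambda>l. \<chi> (proj h a # l))"
        using Suc.IH multi_Cons[OF Suc.prems(1) proj_closed[OF ac]] by blast
    qed
    then show "gdeg n (j + int i) (\<lambda>l. \<chi> (a # l))"
    proof (rule gdeg_cong[rotated])
      fix l assume l: "l \<in> lists n"
      show "(\<Oplus>h\<in>carrier G. \<chi> (proj h a # l)) = \<chi> (a # l)"
        using multi_finsum[OF Suc.prems(1) l finite_G, of "\<lambda>h. proj h a"] sum_proj[OF ac] ac by simp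
    qed
  qed
qed simp

abbreviation ghom :: "'a list \<Rightarrow> 'g list \<Rightarrow> bool" where
  "ghom \<equiv> list_all2 (\<lambda>a h. h \<in> carrier G \<and> a \<in> AG h)"

lemma ghom_closed: "ghom l hs \<Longrightarrow> set l \<subseteq> carrier A \<and> set hs \<subseteq> carrier G"
  by (induction rule: list_all2_induct) (auto simp: AG_closed)

lemma bdeg_ghom: "multi n \<chi> \<Longrightarrow> bdeg g n j k \<chi> \<Longrightarrow> g \<in> carrier G \<Longrightarrow> k \<in> carrier G \<Longrightarrow>
    ghom l hs \<Longrightarrow> length l = n \<Longrightarrow> \<chi> l \<in> AG (k \<cdot> gprod hs \<cdot> g)"
proof (induction n arbitrary: \<chi> j k l hs)
  case (Suc n)
  note g = Suc.prems(3) and k = Suc.prems(4)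
  obtain a l' where l: "l = a # l'" "length l' = n" using Suc.prems by (auto simp: length_Suc_conv)
  then obtain h hs' where hs: "hs = h # hs'" "h \<in> carrier G" "a \<in> AG h" "ghom l' hs'"
    using Suc.prems(5) by (auto simp: list_all2_Cons1)
  have c: "set l' \<subseteq> carrier A" "gprod hs' \<in> carrier G" using ghom_closed[OF hs(4)] gprod_closed by auto
  have ac: "a \<in> carrier A" using hs AG_closed by blast
  let ?t = "k \<cdot> h \<cdot> gprod hs' \<cdot> g"
  have t: "?t \<in> carrier G" using k hs c g by simp
  have "\<chi> (proj h a # l') \<in> AG ?t"
    using ac
  proof (induction rule: homogeneous_induct)
    case (homogeneous i y)
    have y: "proj h y \<in> gr i \<inter> AG h" using proj_gr[OF homogeneous] proj_AG gr_closed[OF homogeneous] by blast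
    then have "bdeg g n (j + int i) (k \<cdot> h) (\<lambda>l. \<chi> (proj h y # l))" using Suc.prems(2) hs(2) unfolding bdeg.simps by blast
    from Suc.IH[OF multi_Cons[OF Suc.prems(1)] this g G.m_closed[OF k hs(2)] hs(4) l(2)] y gr_closed
    show ?case by blast
  next
    case (add y z)
    then show ?case
      using multi_add[OF Suc.prems(1), of "proj h y" "proj h z" l'] l c AG_add[OF t] by (simp add: proj_add)
  qed
  then show ?case using AG_iff[OF hs(2)] hs l(1) k c g by (simp add: G.m_assoc)
qed (use AG_iff in auto)

text \<open>By this lemma, identities between cochains need to be checked on homogeneous arguments only, where \<open>gpart\<close>
  below is just a projection of the values.\<close>

lemma multi_ghom_ext:
  "multi n \<chi> \<Longrightarrow> multi n \<chi>' \<Longrightarrow> (\<And>l hs. ghom l hs \<Longrightarrow> length l = n \<Longrightarrow> \<chi> l = \<chi>' l) \<Longrightarrow> l \<in> lists n \<Longrightarrow> \<chi> l = \<chi>' l"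
proof (induction n arbitrary: \<chi> \<chi>' l)
  case (Suc n)
  obtain a l' where l: "l = a # l'" "a \<in> carrier A" "l' \<in> lists n" using Suc.prems(4) by (auto simp: length_Suc_conv)
  have pc: "proj h a \<in> carrier A" for h using l by simp
  have "\<chi> (proj h a # l') = \<chi>' (proj h a # l')" if h: "h \<in> carrier G" for h
  proof (rule Suc.IH[OF multi_Cons[OF Suc.prems(1) pc] multi_Cons[OF Suc.prems(2) pc] _ l(3)])
    fix k hs assume "ghom k hs" "length k = n"
    then show "\<chi> (proj h a # k) = \<chi>' (proj h a # k)" using Suc.prems(3)[of "proj h a # k" "h # hs"] h l(2) by simp
  qed
  moreover have "\<chi>' (proj h a # l') \<in> carrier A" for h using multi_closed[OF Suc.prems(2)] pc l(3) by simp
  ultimately have "(\<Oplus>h\<in>carrier G. \<chi> (proj h a # l')) = (\<Oplus>h\<in>carrier G. \<chi>' (proj h a # l'))"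
    by (intro M.add.finprod_cong') auto
  then show ?case
    using multi_finsum[OF Suc.prems(1) l(3) finite_G, of "\<lambda>h. proj h a"]
      multi_finsum[OF Suc.prems(2) l(3) finite_G, of "\<lambda>h. proj h a"] sum_proj[OF l(2)] pc l(1) by simp
qed simp

text \<open>The component of \<open>G\<close>-degree \<open>g\<close> of a cochain: every argument is decomposed into its homogeneous parts, and the
  value is projected to the degree that it should have; \<open>k\<close> is as in \<open>bdeg\<close>.\<close>

fun gpart :: "'g \<Rightarrow> 'g \<Rightarrow> ('a list \<Rightarrow> 'a) \<Rightarrow> 'a list \<Rightarrow> 'a" where
  "gpart g k \<chi> [] = proj (k \<cdot> g) (\<chi> [])"
| "gpart g k \<chi> (a # l) = (\<Oplus>h\<in>carrier G. gpart g (k \<cdot> h) (\<lambda>l. \<chi> (proj h a # l)) l)"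

lemma gpart_cong: "(\<And>l. l \<in> lists n \<Longrightarrow> \<chi> l = \<chi>' l) \<Longrightarrow> l \<in> lists n \<Longrightarrow> gpart g k \<chi> l = gpart g k \<chi>' l"
proof (induction n arbitrary: \<chi> \<chi>' l k)
  case (Suc n)
  obtain a l' where l: "l = a # l'" "a \<in> carrier A" "l' \<in> lists n" using Suc.prems(2) by (auto simp: length_Suc_conv)
  have "gpart g (k \<cdot> h) (\<lambda>l. \<chi> (proj h a # l)) l' = gpart g (k \<cdot> h) (\<lambda>l. \<chi>' (proj h a # l)) l'" for h
    by (rule Suc.IH) (use Suc.prems(1) l in auto)
  then show ?case using l(1) by simp
qed simp

lemma gpart_closed: "closed_on n \<chi> \<Longrightarrow> l \<in> lists n \<Longrightarrow> gpart g k \<chi> l \<in> carrier A"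
proof (induction n arbitrary: \<chi> l k)
  case (Suc n)
  obtain a l' where l: "l = a # l'" "a \<in> carrier A" "l' \<in> lists n" using Suc.prems(2) by (auto simp: length_Suc_conv)
  then show ?case using Suc.IH[OF closed_on_Cons[OF Suc.prems(1) proj_closed[OF l(2)]] l(3)] by (auto intro!: M.finsum_closed)
qed (simp add: closed_on_def)

lemma gpart_plus: "closed_on n \<chi> \<Longrightarrow> closed_on n \<psi> \<Longrightarrow> l \<in> lists n \<Longrightarrow>
    gpart g k (\<lambda>l. \<chi> l \<oplus> \<psi> l) l = gpart g k \<chi> l \<oplus> gpart g k \<psi> l"
proof (induction n arbitrary: \<chi> \<psi> l k)
  case (Suc n)
  obtain a l' where l: "l = a # l'" "a \<in> carrier A" "l' \<in> lists n" using Suc.prems(3) by (auto simp: length_Suc_conv)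
  note c = closed_on_Cons[OF Suc.prems(1) proj_closed[OF l(2)]] closed_on_Cons[OF Suc.prems(2) proj_closed[OF l(2)]]
  have p: "(\<lambda>h. gpart g (k \<cdot> h) (\<lambda>l. \<chi> (proj h a # l)) l') \<in> carrier G \<rightarrow> carrier A"
    "(\<lambda>h. gpart g (k \<cdot> h) (\<lambda>l. \<psi> (proj h a # l)) l') \<in> carrier G \<rightarrow> carrier A"
    using gpart_closed[OF c(1) l(3)] gpart_closed[OF c(2) l(3)] by auto
  show ?case using l(1) Suc.IH[OF c l(3)] M.finsum_addf[OF p] by simp
qed (auto simp: closed_on_def proj_add)

lemma gpart_scal: "closed_on n \<chi> \<Longrightarrow> l \<in> lists n \<Longrightarrow> z \<in> gr 0 \<Longrightarrow> k \<in> carrier G \<Longrightarrow> g \<in> carrier G \<Longrightarrow>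
    gpart g k (\<lambda>l. z \<otimes> \<chi> l) l = z \<otimes> gpart g k \<chi> l"
proof (induction n arbitrary: \<chi> l k)
  case 0
  then show ?case
    using proj_mult_left[of "\<one>\<^bsub>G\<^esub>" "k \<cdot> g" z "\<chi> []"] AG_gr_0[of z] R_eq by (simp add: closed_on_def)
next
  case (Suc n)
  obtain a l' where l: "l = a # l'" "a \<in> carrier A" "l' \<in> lists n" using Suc.prems(2) by (auto simp: length_Suc_conv)
  note c = closed_on_Cons[OF Suc.prems(1) proj_closed[OF l(2)]]
  have p: "(\<lambda>h. gpart g (k \<cdot> h) (\<lambda>l. \<chi> (proj h a # l)) l') \<in> carrier G \<rightarrow> carrier A"
    using gpart_closed[OF c l(3)] by auto
  have zc: "z \<in> carrier A" using Suc.prems gr_closed by blast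
  have "gpart g k (\<lambda>l. z \<otimes> \<chi> l) l = (\<Oplus>h\<in>carrier G. z \<otimes> gpart g (k \<cdot> h) (\<lambda>l. \<chi> (proj h a # l)) l')"
    unfolding l(1) gpart.simps
    by (rule M.add.finprod_cong') (use Suc.IH[OF c l(3) Suc.prems(3)] Suc.prems(4,5) p zc in auto)
  also have "\<dots> = z \<otimes> gpart g k \<chi> l" using A.finsum_rdistr[OF finite_G zc p] l(1) by simp
  finally show ?case .
qed

lemma gpart_zero: "l \<in> lists n \<Longrightarrow> gpart g k (\<lambda>l. \<zero>) l = \<zero>"
proof (induction n arbitrary: l k)
  case (Suc n)
  obtain a l' where l: "l = a # l'" "l' \<in> lists n" using Suc.prems by (auto simp: length_Suc_conv)
  then show ?case using Suc.IH[OF l(2)] by (simp add: M.add.finprod_one_eqI)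
qed simp

lemma multi_gpart: "multi n \<chi> \<Longrightarrow> k \<in> carrier G \<Longrightarrow> g \<in> carrier G \<Longrightarrow> multi n (gpart g k \<chi>)"
proof (induction n arbitrary: \<chi> k)
  case (Suc n)
  note m = Suc.prems(1) and kG = Suc.prems(2) and gG = Suc.prems(3)
  note c = multi_closed_on[OF multi_Cons[OF m proj_closed]]
  have p: "(\<lambda>h. gpart g (k \<cdot> h) (\<lambda>l. \<chi> (proj h a # l)) l) \<in> carrier G \<rightarrow> carrier A"
    if "a \<in> carrier A" "l \<in> lists n" for a l
    using gpart_closed[OF c[OF that(1)] that(2)] by auto
  show ?case
  proof (rule multi_SucI)
    fix a assume a: "a \<in> carrier A"
    show "multi n (\<lambda>l. gpart g k \<chi> (a # l))" unfolding gpart.simps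
      by (rule multi_sum[OF finite_G]) (use Suc.IH[OF multi_Cons[OF m proj_closed[OF a]]] kG gG in auto)
  next
    fix a b l assume h: "a \<in> carrier A" "b \<in> carrier A" "l \<in> lists n"
    have "gpart g (k \<cdot> u) (\<lambda>l. \<chi> (proj u (a \<oplus> b) # l)) l =
        gpart g (k \<cdot> u) (\<lambda>l. \<chi> (proj u a # l)) l \<oplus> gpart g (k \<cdot> u) (\<lambda>l. \<chi> (proj u b # l)) l" for u
    proof -
      have "gpart g (k \<cdot> u) (\<lambda>l. \<chi> (proj u (a \<oplus> b) # l)) l =
          gpart g (k \<cdot> u) (\<lambda>l. \<chi> (proj u a # l) \<oplus> \<chi> (proj u b # l)) l"
        by (rule gpart_cong[of n]) (use h multi_add[OF m, of "proj u a" "proj u b"] in \<open>auto simp: proj_add\<close>)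
      then show ?thesis using gpart_plus[OF c[OF h(1)] c[OF h(2)] h(3)] by simp
    qed
    then show "gpart g k \<chi> ((a \<oplus> b) # l) = gpart g k \<chi> (a # l) \<oplus> gpart g k \<chi> (b # l)"
      using M.finsum_addf[OF p[OF h(1,3)] p[OF h(2,3)]] by simp
  next
    fix z a l assume h: "z \<in> gr 0" "a \<in> carrier A" "l \<in> lists n"
    have zc: "z \<in> carrier A" using h gr_closed by blast
    have pz: "proj u (z \<otimes> a) = z \<otimes> proj u a" if "u \<in> carrier G" for u
      using proj_mult_left[of "\<one>\<^bsub>G\<^esub>" u z a] AG_gr_0[OF h(1)] R_eq h(2) that by simp
    have "gpart g (k \<cdot> u) (\<lambda>l. \<chi> (proj u (z \<otimes> a) # l)) l = z \<otimes> gpart g (k \<cdot> u) (\<lambda>l. \<chi> (proj u a # l)) l"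
      if u: "u \<in> carrier G" for u
    proof -
      have "gpart g (k \<cdot> u) (\<lambda>l. \<chi> (proj u (z \<otimes> a) # l)) l = gpart g (k \<cdot> u) (\<lambda>l. z \<otimes> \<chi> (proj u a # l)) l"
        by (rule gpart_cong[of n]) (use h pz[OF u] multi_scal[OF m h(1), of "proj u a"] in auto)
      then show ?thesis using gpart_scal[OF c[OF h(2)] h(3,1) G.m_closed[OF kG u] gG] by simp
    qed
    then have "gpart g k \<chi> ((z \<otimes> a) # l) = (\<Oplus>u\<in>carrier G. z \<otimes> gpart g (k \<cdot> u) (\<lambda>l. \<chi> (proj u a # l)) l)"
      unfolding gpart.simps by (intro M.add.finprod_cong') (use p[OF h(2,3)] zc in auto)
    then show "gpart g k \<chi> ((z \<otimes> a) # l) = z \<otimes> gpart g k \<chi> (a # l)"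
      using A.finsum_rdistr[OF finite_G zc p[OF h(2,3)]] by simp
  qed
qed simp

lemma gpart_Cons_AG:
  assumes m: "multi (Suc n) \<chi>" and h: "h \<in> carrier G" and a: "a \<in> AG h" and l: "l \<in> lists n"
  shows "gpart g k \<chi> (a # l) = gpart g (k \<cdot> h) (\<lambda>l. \<chi> (a # l)) l"
proof -
  have ac: "a \<in> carrier A" using a AG_closed by blast
  have c: "gpart g (k \<cdot> u) (\<lambda>l. \<chi> (a # l)) l \<in> carrier A" for u
    using gpart_closed[OF multi_closed_on[OF multi_Cons[OF m ac]] l] .
  have "gpart g (k \<cdot> u) (\<lambda>l. \<chi> (proj u a # l)) l = (if h = u then gpart g (k \<cdot> u) (\<lambda>l. \<chi> (a # l)) l else \<zero>)"
    if u: "u \<in> carrier G" for u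
  proof (cases "h = u")
    case True then show ?thesis using proj_of_AG[OF u h a] by simp
  next
    case False
    have "gpart g (k \<cdot> u) (\<lambda>l. \<chi> (\<zero> # l)) l = gpart g (k \<cdot> u) (\<lambda>l. \<zero>) l"
      by (rule gpart_cong[OF multi_zero_head[OF m] l])
    then show ?thesis using False proj_of_AG[OF u h a] gpart_zero[OF l] by simp
  qed
  then have "gpart g k \<chi> (a # l) = (\<Oplus>u\<in>carrier G. if h = u then gpart g (k \<cdot> u) (\<lambda>l. \<chi> (a # l)) l else \<zero>)"
    unfolding gpart.simps by (intro M.add.finprod_cong') (use c in auto)
  also have "\<dots> = gpart g (k \<cdot> h) (\<lambda>l. \<chi> (a # l)) l"
    by (rule M.add.finprod_singleton) (use h finite_G c in auto)
  finally show ?thesis .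
qed

lemma gpart_ghom: "multi n \<chi> \<Longrightarrow> k \<in> carrier G \<Longrightarrow> g \<in> carrier G \<Longrightarrow> ghom l hs \<Longrightarrow> length l = n \<Longrightarrow>
    gpart g k \<chi> l = proj (k \<cdot> gprod hs \<cdot> g) (\<chi> l)"
proof (induction n arbitrary: \<chi> k l hs)
  case (Suc n)
  obtain a l' where l: "l = a # l'" "length l' = n" using Suc.prems by (auto simp: length_Suc_conv)
  then obtain h hs' where hs: "hs = h # hs'" "h \<in> carrier G" "a \<in> AG h" "ghom l' hs'"
    using Suc.prems(4) by (auto simp: list_all2_Cons1)
  have c: "set l' \<subseteq> carrier A" "gprod hs' \<in> carrier G" using ghom_closed[OF hs(4)] gprod_closed by auto
  have "gpart g k \<chi> l = gpart g (k \<cdot> h) (\<lambda>l. \<chi> (a # l)) l'"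
    unfolding l(1) by (rule gpart_Cons_AG[OF Suc.prems(1) hs(2,3)]) (use l c in auto)
  also have "\<dots> = proj (k \<cdot> h \<cdot> gprod hs' \<cdot> g) (\<chi> (a # l'))"
    using Suc.IH[OF multi_Cons[OF Suc.prems(1) AG_closed[OF hs(3)]] G.m_closed[OF Suc.prems(2) hs(2)] Suc.prems(3) hs(4) l(2)] .
  finally show ?case using l(1) hs c Suc.prems(2,3) by (simp add: G.m_assoc)
qed simp

text \<open>On homogeneous arguments \<open>gpart\<close> is a projection of the values, and merging preserves homogeneity.\<close>

lemma bdy_gpart: "multi n \<chi> \<Longrightarrow> k \<in> carrier G \<Longrightarrow> g \<in> carrier G \<Longrightarrow> ghom l hs \<Longrightarrow> length l = Suc n \<Longrightarrow>
    bdy (gpart g k \<chi>) l = proj (k \<cdot> gprod hs \<cdot> g) (bdy \<chi> l)"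
proof (induction n arbitrary: \<chi> k l hs)
  case 0
  then obtain a h where l: "l = [a]" "hs = [h]" "h \<in> carrier G" "a \<in> AG h"
    by (auto simp: length_Suc_conv list_all2_Cons1)
  have ac: "a \<in> carrier A" using l AG_closed by blast
  have x: "\<chi> [] \<in> carrier A" using 0 by simp
  have z: "aug a \<in> AG \<one>\<^bsub>G\<^esub>" using AG_gr_0[OF aug_gr_0[OF ac]] R_eq by simp
  have pz: "proj (k \<cdot> h \<cdot> g) (aug a \<otimes> \<chi> []) = aug a \<otimes> proj (k \<cdot> h \<cdot> g) (\<chi> [])"
    using proj_mult_left[OF _ _ z x, of "k \<cdot> h \<cdot> g"] 0 l by simp
  show ?case
  proof (cases "h = \<one>\<^bsub>G\<^esub>")
    case True then show ?thesis using l pz 0 by simp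
  next
    case False
    have "aug a \<in> AG h" using AG_comp[OF l(3,4)] by (simp add: aug_def)
    then have "aug a = \<zero>" using proj_of_AG[OF l(3) G.one_closed z] AG_iff[OF l(3)] False by simp
    then show ?thesis using l x by simp
  qed
next
  case (Suc n)
  note m = Suc.prems(1) and kG = Suc.prems(2) and gG = Suc.prems(3)
  obtain a b l' where l: "l = a # b # l'" "length l' = n" using Suc.prems by (auto simp: length_Suc_conv)
  then obtain h u hs' where hs: "hs = h # u # hs'" "h \<in> carrier G" "a \<in> AG h" "u \<in> carrier G" "b \<in> AG u" "ghom l' hs'"
    using Suc.prems(4) by (auto simp: list_all2_Cons1)
  have c: "set l' \<subseteq> carrier A" "gprod hs' \<in> carrier G" using ghom_closed[OF hs(6)] gprod_closed by auto
  have ac: "a \<in> carrier A" "b \<in> carrier A" using hs AG_closed by blast+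
  let ?t = "k \<cdot> (h \<cdot> (u \<cdot> gprod hs')) \<cdot> g"
  have ma: "multi n (\<lambda>l. \<chi> (a # l))" using multi_Cons[OF m ac(1)] .
  have "ghom ((a \<otimes> b) # l') ((h \<cdot> u) # hs')" using hs AG_mult by simp
  from gpart_ghom[OF m kG gG this]
  have 1: "gpart g k \<chi> ((a \<otimes> b) # l') = proj ?t (\<chi> ((a \<otimes> b) # l'))" using l(2) hs c by (simp add: G.m_assoc)
  have "bdy (\<lambda>l. gpart g k \<chi> (a # l)) (b # l') = bdy (gpart g (k \<cdot> h) (\<lambda>l. \<chi> (a # l))) (b # l')"
    by (rule bdy_cong[of n]) (use gpart_Cons_AG[OF m hs(2,3)] ac l c in auto)
  also have "\<dots> = proj (k \<cdot> h \<cdot> gprod (u # hs') \<cdot> g) (bdy (\<lambda>l. \<chi> (a # l)) (b # l'))"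
    by (rule Suc.IH[OF ma G.m_closed[OF kG hs(2)] gG]) (use hs l in auto)
  also have "\<dots> = proj ?t (bdy (\<lambda>l. \<chi> (a # l)) (b # l'))" using kG gG hs c by (simp add: G.m_assoc)
  finally have 2: "bdy (\<lambda>l. gpart g k \<chi> (a # l)) (b # l') = proj ?t (bdy (\<lambda>l. \<chi> (a # l)) (b # l'))" .
  have "\<chi> ((a \<otimes> b) # l') \<in> carrier A" "bdy (\<lambda>l. \<chi> (a # l)) (b # l') \<in> carrier A"
    using multi_closed[OF m, of "(a \<otimes> b) # l'"] bdy_closed[OF multi_closed_on[OF ma], of "b # l'"] ac l c by auto
  then show ?case using 1 2 l(1) hs(1) by (simp add: proj_minus)
qed

lemma dif_gpart:
  assumes m: "multi n \<chi>" and g: "g \<in> carrier G" and l: "ghom l hs" "length l = Suc n"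
  shows "dif (gpart g \<one>\<^bsub>G\<^esub> \<chi>) l = proj (gprod hs \<cdot> g) (dif \<chi> l)"
proof -
  obtain a l' where as: "l = a # l'" "length l' = n" using l by (auto simp: length_Suc_conv)
  then obtain h hs' where hs: "hs = h # hs'" "h \<in> carrier G" "a \<in> AG h" "ghom l' hs'"
    using l(1) by (auto simp: list_all2_Cons1)
  have c: "set l' \<subseteq> carrier A" "gprod hs' \<in> carrier G" "gprod hs \<in> carrier G"
    using ghom_closed[OF hs(4)] ghom_closed[OF l(1)] gprod_closed by auto
  have ac: "a \<in> carrier A" using hs AG_closed by blast
  have x: "\<chi> l' \<in> carrier A" "bdy \<chi> l \<in> carrier A"
    using multi_closed[OF m] bdy_closed[OF multi_closed_on[OF m]] as c ac by auto
  have "bdy (gpart g \<one>\<^bsub>G\<^esub> \<chi>) l = proj (gprod hs \<cdot> g) (bdy \<chi> l)"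
    using bdy_gpart[OF m G.one_closed g l] c by simp
  moreover have "a \<otimes> gpart g \<one>\<^bsub>G\<^esub> \<chi> l' = proj (gprod hs \<cdot> g) (a \<otimes> \<chi> l')"
    using gpart_ghom[OF m G.one_closed g hs(4) as(2)]
      proj_mult_left[OF hs(2) _ hs(3) x(1), of "gprod hs \<cdot> g"] hs c g by (simp add: G.m_assoc[symmetric])
  ultimately show ?thesis using as(1) x ac by (simp add: proj_minus)
qed

lemma bdeg_gpart: "multi n \<chi> \<Longrightarrow> gdeg n j \<chi> \<Longrightarrow> k \<in> carrier G \<Longrightarrow> g \<in> carrier G \<Longrightarrow> bdeg g n j k (gpart g k \<chi>)"
proof (induction n arbitrary: \<chi> j k)
  case 0
  have "proj (k \<cdot> g) (\<chi> []) \<in> IG j"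
    using 0 proj_gr by (auto simp: int_grading_def)
  then show ?case using 0 by simp
next
  case (Suc n)
  show ?case unfolding bdeg.simps
  proof (intro allI ballI)
    fix i h a assume h: "h \<in> carrier G" and a: "a \<in> gr i \<inter> AG h"
    have ac: "a \<in> carrier A" using a gr_closed by blast
    have "gdeg n (j + int i) (\<lambda>l. \<chi> (a # l))" using a Suc.prems(2) by simp
    from Suc.IH[OF multi_Cons[OF Suc.prems(1) ac] this G.m_closed[OF Suc.prems(3) h] Suc.prems(4)]
    show "bdeg g n (j + int i) (k \<cdot> h) (\<lambda>l. gpart g k \<chi> (a # l))"
      by (rule bdeg_cong[rotated]) (use gpart_Cons_AG[OF Suc.prems(1) h] a in auto)
  qed
qed

text \<open>If \<open>\<chi>\<close> is homogeneous for \<open>\<int> \<times> G\<close> and \<open>\<chi> = dif \<psi>\<close> with \<open>\<psi>\<close> homogeneous for \<open>\<int>\<close> only, then \<open>\<psi>\<close> may be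
  replaced by its component of \<open>G\<close>-degree \<open>g\<close>.\<close>

theorem lbounds_if_bounds:
  assumes g: "g \<in> carrier G" and c: "lcocycle ZG VG (j, g) n \<chi>" and b: "bounds n j \<chi>"
  shows "lbounds ZG VG (j, g) n \<chi>"
proof (cases n)
  case 0 then show ?thesis using b by (simp add: bounds_def lbounds_def)
next
  case (Suc k)
  have m: "multi n \<chi>" and d: "bdeg g n j \<one>\<^bsub>G\<^esub> \<chi>" using c bdeg_iff_has_degree[OF _ g] by (auto simp: lcocycle_def)
  obtain \<psi> where \<psi>: "multi k \<psi>" "gdeg k j \<psi>" "\<And>l. l \<in> lists n \<Longrightarrow> \<chi> l = dif \<psi> l"
    using b Suc by (auto simp: bounds_def)
  let ?\<psi> = "gpart g \<one>\<^bsub>G\<^esub> \<psi>"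
  have mp: "multi k ?\<psi>" using multi_gpart[OF \<psi>(1) G.one_closed g] .
  have has_degree: "has_degree ZG VG (j, g) k ?\<psi>"
    using bdeg_iff_has_degree[OF mp g] bdeg_gpart[OF \<psi>(1,2) G.one_closed g] by blast
  have "\<chi> l = dif ?\<psi> l" if l: "l \<in> lists n" for l
  proof (rule multi_ghom_ext[OF m _ _ l])
    show "multi n (dif ?\<psi>)" using multi_dif[OF mp] Suc by simp
    fix l hs assume h: "ghom l hs" "length l = n"
    have gp: "gprod hs \<in> carrier G" using ghom_closed[OF h(1)] gprod_closed by blast
    have "\<chi> l \<in> AG (gprod hs \<cdot> g)" using bdeg_ghom[OF m d g G.one_closed h] gp by simp
    then have "proj (gprod hs \<cdot> g) (\<chi> l) = \<chi> l" using AG_iff[OF G.m_closed[OF gp g]] by simp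
    moreover have "\<chi> l = dif \<psi> l" using \<psi>(3) h ghom_closed[OF h(1)] by simp
    ultimately show "\<chi> l = dif ?\<psi> l" using dif_gpart[OF \<psi>(1) g h(1)] h(2) Suc by simp
  qed
  then show ?thesis using mp has_degree Suc by (auto simp: lbounds_def)
qed

end

context covariant_basis
begin

text \<open>Multiplying a cocycle that represents the class by \<open>f h\<close>, \<open>h = g\<^sup>-\<^sup>1 t \<noteq> e\<close>, raises its \<open>\<int>\<close>-degree and so makes it
  a coboundary, while \<open>f\<^sub>g f\<^sub>h\<close> is a nonzero multiple of \<open>f t\<close>. By \<open>bounds_if_product_bounds\<close> the cocycle
  itself would be a coboundary.\<close>

theorem Ext_degree_is_socle_degree:
  assumes gor: "\<And>i j. i \<noteq> d \<Longrightarrow> carrier (Ext_triv_reg K integer_group A gr IG i j) = {\<zero>\<^bsub>Ext_triv_reg K integer_group A gr IG i j\<^esub>}"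
    and conc: "\<And>j. j \<noteq> - l \<Longrightarrow> carrier (Ext_triv_reg K integer_group A gr IG d j) = {\<zero>\<^bsub>Ext_triv_reg K integer_group A gr IG d j\<^esub>}"
    and g: "g \<in> carrier G"
    and u: "u \<in> carrier (Ext_triv_reg K ZG A gr VG d (j, g))" "u \<noteq> \<zero>\<^bsub>Ext_triv_reg K ZG A gr VG d (j, g)\<^esub>"
    and t: "socle_degree t"
  shows "g = t"
proof (rule ccontr)
  assume ne: "g \<noteq> t"
  have one: "\<one>\<^bsub>ZG\<^esub> \<in> carrier ZG" by (simp add: DirProd_def)
  obtain \<chi> where \<chi>: "lcocycle ZG VG (j, g) d \<chi>" "\<not> lbounds ZG VG (j, g) d \<chi>"
    using Ext_nonzero_lcocycle[OF VG_submodule one u] .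
  have nb: "\<not> bounds d j \<chi>" using lbounds_if_bounds[OF g \<chi>(1)] \<chi>(2) by blast
  have m: "multi d \<chi>" and bd: "bdeg g d j \<one>\<^bsub>G\<^esub> \<chi>" and z: "\<And>l. l \<in> lists (Suc d) \<Longrightarrow> dif \<chi> l = \<zero>"
    using \<chi>(1) bdeg_iff_has_degree[OF _ g] by (auto simp: lcocycle_def)
  have coc: "cocycle d j \<chi>" using m z bdeg_gdeg[OF m bd] by (simp add: cocycle_def)
  have j: "j = - l" using Ext_trivial_bounds[OF conc coc] nb by blast
  have tG: "t \<in> carrier G" using t by (simp add: socle_degree_def)
  let ?h = "inv\<^bsub>G\<^esub> g \<cdot> t"
  have h: "?h \<in> carrier G" using g tG by simp
  have gh: "g \<cdot> ?h = t" using g tG by (simp flip: G.m_assoc)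
  then have h1: "?h \<noteq> \<one>\<^bsub>G\<^esub>" using ne g by auto
  obtain w where w: "w \<in> gr 0" "w \<noteq> \<zero>" "f g \<otimes> f ?h = w \<otimes> f t"
    using t g unfolding socle_degree_def by blast
  let ?\<chi>h = "\<lambda>l. \<chi> l \<otimes> f ?h"
  have "cocycle d (j + int (dg ?h)) ?\<chi>h"
    unfolding cocycle_def
  proof (intro conjI ballI)
    show "multi d ?\<chi>h" by (rule multi_map[OF lin_mult_right[OF f_closed[OF h]] m])
    show "gdeg d (j + int (dg ?h)) ?\<chi>h"
      by (rule gdeg_map[of "\<lambda>y. y \<otimes> f ?h"]) (use IG_mult_right[OF f_gr[OF h]] coc in \<open>auto simp: cocycle_def\<close>)
    fix l assume l: "l \<in> lists (Suc d)"
    have "tl l \<in> lists d" "hd l \<in> carrier A" using l by (cases l; auto)+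
    then have "dif ?\<chi>h l = dif \<chi> l \<otimes> f ?h"
      by (intro dif_map[OF lin_mult_right[OF f_closed[OF h]] multi_closed_on[OF m] l])
        (use multi_closed[OF m] h in \<open>simp add: A.m_assoc del: G.m_closed\<close>)
    then show "dif ?\<chi>h l = \<zero>" using z[OF l] h by simp
  qed
  moreover have "j + int (dg ?h) \<noteq> - l" using j dg_zero[OF h] h1 by simp
  ultimately have b: "bounds d (j + int (dg ?h)) ?\<chi>h" using Ext_trivial_bounds[OF conc] by blast
  have val: "\<chi> l \<in> AG g" if l: "length l = d" "set l \<subseteq> R" for l
  proof -
    have gl: "ghom l (replicate d \<one>\<^bsub>G\<^esub>)"
      using l R_eq by (auto simp: list_all2_conv_all_nth subset_iff)
    have "gprod (replicate n \<one>\<^bsub>G\<^esub>) = \<one>\<^bsub>G\<^esub>" for n by (induction n) auto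
    then show ?thesis using bdeg_ghom[OF m bd g G.one_closed gl l(1)] g by simp
  qed
  have "d = 0 \<or> acyclic_in (d - 1)"
    unfolding acyclic_in_def using Ext_trivial_bounds[OF gor] by (cases d) auto
  from bounds_if_product_bounds[OF this coc g h w(1,2) _ val b]
  show False using nb w(3) gh by simp
qed

end

section \<open>The Nakayama automorphism of the covariant ring\<close>

theorem theorem0p5:
  fixes K :: "'k ring" and A :: "('k, 'a) module" and gr :: "nat \<Rightarrow> 'a set"
    and G :: "'g monoid" and \<rho> :: "('g \<Rightarrow> 'k) \<Rightarrow> 'a \<Rightarrow> 'a"
    and f :: "'g \<Rightarrow> 'a" and D m :: 'g and \<mu> :: "'a set \<Rightarrow> 'a set" and \<beta> :: "'g \<Rightarrow> 'k"
  assumes "field K" and "char_zero K"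
    and "group G" and "finite (carrier G)"
    and "dual_reflection_group K G A gr \<rho>"
    and "homological_codeterminant K G A gr \<rho> D" and "m = inv\<^bsub>G\<^esub> D"
    and "\<And>g. g \<in> carrier G \<Longrightarrow> homogeneous gr (f g)"
    and "f \<one>\<^bsub>G\<^esub> = \<one>\<^bsub>A\<^esub>"
    and "\<And>g. g \<in> carrier G \<Longrightarrow>
           G_component K G A \<rho> g = (\<lambda>a. f g \<otimes>\<^bsub>A\<^esub> a) ` fixed_set K G A \<rho>"
    and "\<And>g. g \<in> carrier G \<Longrightarrow>
           G_component K G A \<rho> g = (\<lambda>a. a \<otimes>\<^bsub>A\<^esub> f g) ` fixed_set K G A \<rho>"
    and "graded_nakayama K (covariant_ring K G A gr \<rho>) (covariant_grading K G A gr \<rho>) \<mu>"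
    and "\<And>g. g \<in> carrier G \<Longrightarrow> \<beta> g \<in> carrier K - {\<zero>\<^bsub>K\<^esub>}"
    and "\<And>g. g \<in> carrier G \<Longrightarrow> \<mu> (to_covariant K G A gr \<rho> (f g)) =
           \<beta> g \<odot>\<^bsub>covariant_ring K G A gr \<rho>\<^esub>
             to_covariant K G A gr \<rho> (f (m \<otimes>\<^bsub>G\<^esub> g \<otimes>\<^bsub>G\<^esub> inv\<^bsub>G\<^esub> m))"
  shows "(homogeneous gr (f m) \<and> normal_element A (f m)) \<and>
     (f m \<noteq> \<zero>\<^bsub>A\<^esub> \<and> conj_by A (f m) \<in> algebra_auts K A \<and>
       (\<forall>g\<in>carrier G. conj_by A (f m) (f g) =
          \<beta> g \<odot>\<^bsub>A\<^esub> f (m \<otimes>\<^bsub>G\<^esub> g \<otimes>\<^bsub>G\<^esub> inv\<^bsub>G\<^esub> m)) \<and>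
       (\<forall>a\<in>carrier A. \<mu> (to_covariant K G A gr \<rho> a) =
          to_covariant K G A gr \<rho> (conj_by A (f m) a))) \<and>
     (\<forall>\<sigma>\<in>graded_auts K (covariant_ring K G A gr \<rho>) (covariant_grading K G A gr \<rho>).
       \<forall>c\<in>carrier (covariant_ring K G A gr \<rho>). \<sigma> (\<mu> c) = \<mu> (\<sigma> c)) \<and>
     conj_by A (f m) ` fixed_set K G A \<rho> = fixed_set K G A \<rho>"
proof -
  have reg: "AS_regular K A gr" "is_domain A" "homogeneous_action K G A gr \<rho>" "inner_faithful K G A \<rho>"
    using assms(5) by (auto simp: dual_reflection_group_def)
  then have gor: "AS_Gorenstein K A gr" by (simp add: AS_regular_def)
  then have "connected_graded K A gr" by (simp add: AS_Gorenstein_def)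
  then interpret conn_graded K A gr by unfold_locales
  interpret G: group G by (rule assms(3))
  interpret covariant_basis K A gr G \<rho> f
    by unfold_locales (use assms(4,8,9,10,11) reg in auto)
  obtain d l where "one_sided_Gorenstein K A gr d l" using gor by (auto simp: AS_Gorenstein_def)
  then have d: "has_inj_dim A (regular_module A) d"
    and ext: "\<And>i j. i \<noteq> d \<Longrightarrow> carrier (Ext_triv_reg K integer_group A gr IG i j) =
        {\<zero>\<^bsub>Ext_triv_reg K integer_group A gr IG i j\<^esub>}"
      "\<And>j. j \<noteq> - l \<Longrightarrow> carrier (Ext_triv_reg K integer_group A gr IG d j) =
        {\<zero>\<^bsub>Ext_triv_reg K integer_group A gr IG d j\<^esub>}"
    by (simp_all add: one_sided_Gorenstein_def Let_def)
  obtain d' j u where d': "has_inj_dim A (regular_module A) d'" and D: "D \<in> carrier G"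
    and u: "u \<in> carrier (Ext_triv_reg K ZG A gr VG d' (j, m))"
      "u \<noteq> \<zero>\<^bsub>Ext_triv_reg K ZG A gr VG d' (j, m)\<^esub>"
    using assms(6,7) by (auto simp: homological_codeterminant_def Let_def)
  have "d' = d" using d d' unfolding has_inj_dim_def by (meson linorder_neqE_nat)
  have mG: "m \<in> carrier G" using D assms(7) by simp
  obtain B where \<mu>: "\<mu> \<in> graded_auts K C grC" and B: "frobenius_form K C grC B"
    and nak: "\<And>a b. a \<in> carrier C \<Longrightarrow> b \<in> carrier C \<Longrightarrow> B a b = B (\<mu> b) a"
    using assms(12) unfolding graded_nakayama_def by blast
  obtain k where F: "frobenius_functional (\<lambda>a. B (to \<one>\<^bsub>A\<^esub>) (to a)) k"
    and B_mult: "\<And>a b. a \<in> carrier A \<Longrightarrow> b \<in> carrier A \<Longrightarrow>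
      B (to a) (to b) = B (to \<one>\<^bsub>A\<^esub>) (to (a \<otimes>\<^bsub>A\<^esub> b))"
    using frobenius_form_functional[OF B] by blast
  obtain t where t: "socle_degree t" "B (to \<one>\<^bsub>A\<^esub>) (to (f t)) \<noteq> \<zero>\<^bsub>K\<^esub>" "dg t = k"
    "\<And>g. g \<in> carrier G \<Longrightarrow> g \<noteq> t \<Longrightarrow> dg g \<noteq> k"
    using frobenius_functional_socle[OF F] by blast
  have "m = t"
    using Ext_degree_is_socle_degree[OF ext mG u[unfolded \<open>d' = d\<close>] t(1)] .
  then have soc: "socle_degree m" and Fm: "B (to \<one>\<^bsub>A\<^esub>) (to (f m)) \<noteq> \<zero>\<^bsub>K\<^esub>" and dgm: "dg m = k"
    and uniq: "\<And>g. g \<in> carrier G \<Longrightarrow> g \<noteq> m \<Longrightarrow> dg g \<noteq> k" using t by auto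
  have \<beta>: "\<And>g. g \<in> carrier G \<Longrightarrow> \<beta> g \<in> carrier K" using assms(13) by blast
  note nakayama = socle_conjugation_nakayama[OF soc \<mu> B F Fm dgm uniq B_mult nak \<beta> assms(14)]
  note normal = socle_element_normal(1)[OF soc]
  show ?thesis
    using f_homogeneous[OF mG] normal f_nonzero[OF mG] conj_by_automorphism[OF normal f_nonzero[OF mG]]
      nakayama socle_element_conj(1)[OF soc]
    by blast
qed

end
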